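(* Let $n$ range over even positive integers and let $d_2=d_2(n)$ satisfy $d_2=\omega(1)$ and $d_2=O(n^{1/10})$. Let $d_1=d_1(n)$ and $d_1'=d_1'(n)$ be integers with $\min\{d_1,d_1',d_2-d_1,d_2-d_1'\}=\omega(1)$. Then there exists a coupling of $G_\oplus\sim G(n,d_1)\oplus G(n,d_2-d_1)$ and $G_\oplus'\sim G(n,d_1')\oplus G(n,d_2-d_1')$ such that $\mathbb{P}(G_\oplus=G_\oplus')=1-o(1)$ as $n\to\infty$.
   Context: $G(n,d)$ denotes a uniformly random $d$-regular graph on the vertex set $[n]$. For integers $a,b\ge1$ with $a+b\le n-1$, $G(n,a)\oplus G(n,b)$ denotes the random $(a+b)$-regular graph obtained by sampling independent $G_1\sim G(n,a)$ and $G_2\sim G(n,b)$ on the same vertex set $[n]$, conditioned on $G_1$ and $G_2$ being edge-disjoint, and taking their union. Asymptotic notation refers to $n\to\infty$. *)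

theory Defs
  imports "HOL-Probability.Probability" "HOL-Library.Landau_Symbols"
begin

text \<open>A simple graph on the vertex set \<open>{1..n}\<close> is identified with its set of edges.\<close>

definition complete_edges :: "nat \<Rightarrow> nat set set" where
  "complete_edges n = {e. e \<subseteq> {1..n} \<and> card e = 2}"

definition degree :: "nat set set \<Rightarrow> nat \<Rightarrow> nat" where
  "degree G v = card {e \<in> G. v \<in> e}"

definition regular_graphs :: "nat \<Rightarrow> nat \<Rightarrow> nat set set set" where
  "regular_graphs n d = {G. G \<subseteq> complete_edges n \<and> (\<forall>v\<in>{1..n}. degree G v = d)}"

text \<open>The uniform distribution is meaningful only if a \<open>d\<close>-regular graph on \<open>{1..n}\<close> exists;
  for even \<open>n > 0\<close> this is the case whenever \<open>d < n\<close>.\<close>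

definition random_regular :: "nat \<Rightarrow> nat \<Rightarrow> nat set set pmf" where
  "random_regular n d = pmf_of_set (regular_graphs n d)"

text \<open>The law of \<open>G(n,a) \<oplus> G(n,b)\<close>. For even \<open>n > 0\<close> and \<open>a + b < n\<close> the conditioning event has
  positive probability, because the complete graph on \<open>{1..n}\<close> decomposes into perfect matchings.
  Outside this range the value is an unspecified probability mass function.\<close>

definition random_regular_sum :: "nat \<Rightarrow> nat \<Rightarrow> nat \<Rightarrow> nat set set pmf" where
  "random_regular_sum n a b =
     map_pmf (\<lambda>(G1, G2). G1 \<union> G2)
       (cond_pmf (pair_pmf (random_regular n a) (random_regular n b))
          {(G1, G2). G1 \<inter> G2 = {}})"

definition is_coupling :: "('a \<times> 'b) pmf \<Rightarrow> 'a pmf \<Rightarrow> 'b pmf \<Rightarrow> bool" where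
  "is_coupling c p q \<longleftrightarrow> map_pmf fst c = p \<and> map_pmf snd c = q"

text \<open>The limit \<open>n \<longlongrightarrow> \<infinity>\<close> along even positive integers.\<close>

definition even_at_top :: "nat filter" where
  "even_at_top = inf at_top (principal {n. even n \<and> n > 0})"

end

theory Submission
  imports Defs "HOL-Real_Asymp.Real_Asymp"
begin

text \<open>The law of \<open>G(n,a) \<oplus> G(n,b)\<close> gives a \<open>d\<close>-regular graph \<open>H\<close>, \<open>d = a + b\<close>, a probability proportional to
  the number \<open>X H\<close> of \<open>a\<close>-regular spanning subgraphs of \<open>H\<close>. By Cauchy--Schwarz its \<open>L\<^sup>1\<close> distance to the uniform
  law on \<open>d\<close>-regular graphs is at most \<open>sqrt (E X\<^sup>2 / (E X)\<^sup>2 - 1)\<close>, so it suffices to show that the second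
  moment is asymptotic to the square of the first, whatever \<open>a\<close> is; a maximal coupling then gives the theorem.

  In the configuration model \<open>1\<close>, \<open>X\<close> and \<open>X\<^sup>2\<close> count simple perfect matchings of \<open>n * d\<close> points whose pairs
  respect a colouring with one, two and four colours. Switchings show that such a matching is simple with
  probability about \<open>exp (- \<lambda>)\<close>, \<open>\<lambda>\<close> the mean number of loops and double edges; here \<open>4 * \<lambda>\<close> is
  \<open>d\<^sup>2 - 1\<close>, \<open>d\<^sup>2 - 2\<close> and, for typical pairs of selections, \<open>d\<^sup>2 - 4 + 1\<close>, so the exponents cancel.
  The numbers of all coloured matchings contribute an average of \<open>config_ratio\<close> over the total overlap
  of two random selections, a sum of independent hypergeometric variables. Near its mean the ratio is
  \<open>sqrt 2 * exp (\<tau>\<^sup>2 / 4)\<close> for even and \<open>0\<close> for odd overlaps, \<open>\<tau>\<close> the standardised overlap, and the Gaussian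
  average of this is \<open>sqrt 2 * (1 / 2) * sqrt 2 = 1\<close>.\<close>

section \<open>Switchings in coloured matchings\<close>

text \<open>The difficulty lies far from the mean overlap, where \<open>config_ratio\<close> can be
  exponentially large and neither Stirling's formula nor a Chernoff bound controls its product with
  the overlap probability. An exact recurrence shows that this product, up to a polynomial factor,
  does not grow when the overlap moves away from the mean in steps of two. The outside of a window
  of \<open>Y\<close> standard deviations is thus governed by its edge, where the product is at most
  about \<open>exp (- Y\<^sup>2 / 4)\<close>. This has to beat the crude factor
  \<open>exp (2 * d\<^sup>2)\<close> left by the simplicity estimates, so \<open>Y\<close> must
  exceed \<open>d\<close> in order of magnitude; inside the window the cubic Taylor errors
  \<open>Y ^ 3 * sqrt (d / n)\<close> must vanish. For \<open>d\<close> of order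
  \<open>n powr (1/10)\<close> the choice \<open>Y = n powr (1/8)\<close> meets both demands. That
  \<open>d\<close> tends to infinity enters through the variance of the overlap, which exceeds the
  value suggested by Stirling's formula by the factor \<open>d / (d - 1)\<close>.\<close>

text \<open>A matching is encoded as a fixed-point-free involution of \<open>P\<close>, extended by the identity outside \<open>P\<close>.\<close>

definition cmatch :: "'p set \<Rightarrow> ('p \<Rightarrow> 'c) \<Rightarrow> ('p \<Rightarrow> 'p) set" where
  "cmatch P \<kappa> = {f. (\<forall>x. x \<notin> P \<longrightarrow> f x = x) \<and>
     (\<forall>x\<in>P. f x \<in> P \<and> f x \<noteq> x \<and> f (f x) = x \<and> \<kappa> (f x) = \<kappa> x)}"

text \<open>In terms of pairs, {x, f x} and {p, f p} are replaced by {x, f p} and {p, f x}; the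
  colouring is respected when \<open>x\<close> and \<open>p\<close> have the same colour.\<close>

definition switch :: "('p \<Rightarrow> 'p) \<Rightarrow> 'p \<Rightarrow> 'p \<Rightarrow> 'p \<Rightarrow> 'p" where
  "switch f x p = f(x := f p, f p := x, f x := p, p := f x)"

lemma cmatchD:
  assumes "f \<in> cmatch P \<kappa>" "x \<in> P"
  shows "f x \<in> P" "f x \<noteq> x" "f (f x) = x" "\<kappa> (f x) = \<kappa> x"
  using assms by (auto simp: cmatch_def)

lemma cmatch_eq_iff:
  assumes "f \<in> cmatch P \<kappa>" "x \<in> P" "y \<in> P"
  shows "f x = f y \<longleftrightarrow> x = y" "f x = y \<longleftrightarrow> x = f y"
  using cmatchD[OF assms(1,2)] cmatchD[OF assms(1,3)] by metis+

lemma finite_cmatch: "finite P \<Longrightarrow> finite (cmatch P \<kappa>)"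
proof -
  assume P: "finite P"
  have "inj_on (\<lambda>f. restrict f P) (cmatch P \<kappa>)"
    by (rule inj_onI, rule ext) (auto simp: cmatch_def restrict_def fun_eq_iff, metis)
  moreover have "(\<lambda>f. restrict f P) ` cmatch P \<kappa> \<subseteq> (P \<rightarrow>\<^sub>E P)"
    by (auto simp: cmatch_def)
  ultimately show ?thesis using P
    by (meson finite_PiE finite_imageD finite_subset)
qed

lemma switch_apply:
  assumes "f \<in> cmatch P \<kappa>" "x \<in> P" "p \<in> P" "p \<noteq> x" "p \<noteq> f x"
  shows "switch f x p x = f p" "switch f x p (f p) = x" "switch f x p (f x) = p" "switch f x p p = f x"
    "r \<notin> {x, p, f x, f p} \<Longrightarrow> switch f x p r = f r"
  using assms cmatch_eq_iff[OF assms(1)] cmatchD[OF assms(1)] by (auto simp: switch_def)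

lemma switch_cmatch:
  assumes f: "f \<in> cmatch P \<kappa>" and x: "x \<in> P" "p \<in> P" "\<kappa> x = \<kappa> p" "p \<noteq> x" "p \<noteq> f x"
  shows "switch f x p \<in> cmatch P \<kappa>"
proof -
  note s = switch_apply[OF f x(1,2,4,5)]
  note D = cmatchD[OF f] note e = cmatch_eq_iff[OF f]
  have ne: "f p \<noteq> x" using x e(2) by metis
  have "switch f x p r = r" if "r \<notin> P" for r
    using that s(5)[of r] x D(1) f by (force simp: cmatch_def)
  moreover have "switch f x p r \<in> P \<and> switch f x p r \<noteq> r \<and> switch f x p (switch f x p r) = r
      \<and> \<kappa> (switch f x p r) = \<kappa> r" if r: "r \<in> P" for r
  proof (cases "r \<in> {x, p, f x, f p}")
    case True
    then show ?thesis using s x D ne by auto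
  next
    case False
    then have "f r \<notin> {x, p, f x, f p}" using r x D e by auto
    then show ?thesis using s(5)[OF False] s(5)[of "f r"] r D by auto
  qed
  ultimately show ?thesis by (auto simp: cmatch_def)
qed

text \<open>A second switching with the same points exchanges the partners of \<open>x\<close> and
  \<open>p\<close> back. Counting maps built from switchings are therefore injective as soon as the
  switched points can be read off from the image.\<close>

lemma switch_switch:
  assumes f: "f \<in> cmatch P \<kappa>" and x: "x \<in> P" "p \<in> P" "\<kappa> x = \<kappa> p" "p \<noteq> x" "p \<noteq> f x"
  shows "switch (switch f x p) x p = f"
proof -
  note s = switch_apply[OF f x(1,2,4,5)]
  note D = cmatchD[OF f] note e = cmatch_eq_iff[OF f]
  have g: "switch f x p \<in> cmatch P \<kappa>" by (rule switch_cmatch[OF f x])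
  have ne2: "p \<noteq> switch f x p x" using s D x by metis
  note t = switch_apply[OF g x(1,2,4) ne2]
  show ?thesis
  proof (rule ext)
    fix r show "switch (switch f x p) x p r = f r"
    proof (cases "r \<in> {x, p, f x, f p}")
      case True
      then show ?thesis using s t D x by auto
    next
      case False
      then show ?thesis using s t by auto
    qed
  qed
qed

text \<open>A point \<open>(v, i)\<close> lies at the vertex \<open>v\<close>. The inequalities select one representative of each loop and of
  each double edge.\<close>

definition loops :: "(nat \<times> nat) set \<Rightarrow> (nat \<times> nat \<Rightarrow> 'c) \<Rightarrow> ((nat \<times> nat) \<times> (nat \<times> nat)) set" where
  "loops P \<kappa> = {(x, y). x \<in> P \<and> y \<in> P \<and> \<kappa> x = \<kappa> y \<and> fst x = fst y \<and> snd x < snd y}"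

definition doubles :: "(nat \<times> nat) set \<Rightarrow> (nat \<times> nat \<Rightarrow> 'c) \<Rightarrow>
    ((nat \<times> nat) \<times> (nat \<times> nat) \<times> (nat \<times> nat) \<times> (nat \<times> nat)) set" where
  "doubles P \<kappa> = {(x, y, x', y'). x \<in> P \<and> y \<in> P \<and> x' \<in> P \<and> y' \<in> P \<and> \<kappa> x = \<kappa> y \<and> \<kappa> x' = \<kappa> y' \<and>
     fst x = fst x' \<and> fst y = fst y' \<and> fst x < fst y \<and> snd x < snd x' \<and> y \<noteq> y'}"

definition avoids where
  "avoids L D f \<longleftrightarrow> (\<forall>(x, y)\<in>L. f x \<noteq> y) \<and> (\<forall>(x, y, x', y')\<in>D. \<not> (f x = y \<and> f x' = y'))"

text \<open>Only the pairs {x, f p} and {f x, p} are new. A newly created loop must be one of them,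
  and a newly created double edge must consist of one of them and a parallel pair at some
  \<open>r\<close>; the hypotheses list all orientations of these cases. The guards
  \<open>D \<noteq> {}\<close> spare the phase in which only loops are forbidden, where parallel
  pairs cannot be excluded but do no harm.\<close>

lemma switch_avoids:
  assumes f: "f \<in> cmatch P \<kappa>" and x: "x \<in> P" "p \<in> P" "\<kappa> x = \<kappa> p" "p \<noteq> x" "p \<noteq> f x"
    and a: "avoids L D f" and LD: "L \<subseteq> loops P \<kappa>" "D \<subseteq> doubles P \<kappa>"
    and L: "(x, f p) \<notin> L" "(f p, x) \<notin> L" "(f x, p) \<notin> L" "(p, f x) \<notin> L"
    and D: "\<And>r. D \<noteq> {} \<Longrightarrow> r \<in> P \<Longrightarrow> r \<noteq> x \<Longrightarrow> fst r = fst x \<Longrightarrow> fst (switch f x p r) = fst (f p) \<Longrightarrow>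
        {(x, f p, r, switch f x p r), (f p, x, switch f x p r, r),
         (r, switch f x p r, x, f p), (switch f x p r, r, f p, x)} \<inter> D = {}"
    and D': "\<And>r. D \<noteq> {} \<Longrightarrow> r \<in> P \<Longrightarrow> r \<noteq> f x \<Longrightarrow> fst r = fst (f x) \<Longrightarrow> fst (switch f x p r) = fst p \<Longrightarrow>
        {(f x, p, r, switch f x p r), (p, f x, switch f x p r, r),
         (r, switch f x p r, f x, p), (switch f x p r, r, p, f x)} \<inter> D = {}"
  shows "avoids L D (switch f x p)"
proof -
  define g where "g = switch f x p"
  have g: "g \<in> cmatch P \<kappa>" unfolding g_def by (rule switch_cmatch[OF f x])
  note s = switch_apply[OF f x(1,2,4,5), folded g_def]
  have 1: "g u \<noteq> v" if uv: "(u, v) \<in> L" for u v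
  proof
    assume "g u = v"
    then show False using uv L s a by (cases "u \<in> {x, p, f x, f p}") (auto simp: avoids_def)
  qed
  have 2: "\<not> (g u = v \<and> g u' = v')" if uv: "(u, v, u', v') \<in> D" for u v u' v'
  proof
    assume gu: "g u = v \<and> g u' = v'"
    have du: "u \<in> P" "v \<in> P" "u' \<in> P" "v' \<in> P" "fst u = fst u'" "fst v = fst v'" "u \<noteq> u'" "v \<noteq> v'"
      using uv LD(2) by (auto simp: doubles_def)
    have gv: "g v = u" "g v' = u'" using gu cmatchD(3)[OF g du(1)] cmatchD(3)[OF g du(3)] by auto
    have Dne: "D \<noteq> {}" using uv by auto
    note DD = D[OF Dne, folded g_def] note DD' = D'[OF Dne, folded g_def]
    consider "u \<in> {x, p, f x, f p}" | "u' \<in> {x, p, f x, f p}" 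
      | "u \<notin> {x, p, f x, f p}" "u' \<notin> {x, p, f x, f p}" by blast
    then show False
    proof cases
      case 1
      then consider "u = x" "v = f p" | "u = f p" "v = x" | "u = f x" "v = p" | "u = p" "v = f x"
        using s gu by auto
      then show False
        using DD[of u'] DD[of v'] DD'[of u'] DD'[of v'] uv du gu gv s by cases auto
    next
      case 2
      then consider "u' = x" "v' = f p" | "u' = f p" "v' = x" | "u' = f x" "v' = p" | "u' = p" "v' = f x"
        using s gu by auto
      then show False
        using DD[of u] DD[of v] DD'[of u] DD'[of v] uv du gu gv s by cases auto
    next
      case 3
      then show False using s gu a uv by (auto simp: avoids_def)
    qed
  qed
  show ?thesis using 1 2 by (auto simp: avoids_def g_def)
qed

section \<open>Counting matchings with forbidden and forced pairs\<close>

locale coloured_points =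
  fixes P :: "(nat \<times> nat) set" and \<kappa> :: "nat \<times> nat \<Rightarrow> 'c" and d m :: nat
  assumes finite_P: "finite P"
    and vertex_le: "card {x\<in>P. fst x = v} \<le> d"
    and class_ge: "x \<in> P \<Longrightarrow> m \<le> card {z\<in>P. \<kappa> z = \<kappa> x}"
    and m_ge: "32 * d\<^sup>2 \<le> m" and d_pos: "0 < d"
begin

definition class_size :: "'c \<Rightarrow> nat" where "class_size c = card {z\<in>P. \<kappa> z = c}"

definition good where
  "good L D F = {f \<in> cmatch P \<kappa>. avoids L D f \<and> (\<forall>(x, y)\<in>F. f x = y)}"

text \<open>Loops are forbidden before double edges.\<close>

definition phase where
  "phase L D \<longleftrightarrow> L \<subseteq> loops P \<kappa> \<and> D \<subseteq> doubles P \<kappa> \<and> (D = {} \<or> L = loops P \<kappa>)"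

text \<open>When a double edge \<open>(x, y, x', y')\<close> is forced, \<open>F\<close> is first empty and then holds the pair already forced.\<close>

definition beside where
  "beside x y F \<longleftrightarrow> card F \<le> 1 \<and> (\<forall>(x', y')\<in>F. x' \<in> P \<and> y' \<in> P \<and> fst x' = fst x \<and> fst y' = fst y
      \<and> x' \<noteq> x \<and> x' \<noteq> y \<and> y' \<noteq> x \<and> y' \<noteq> y)"

lemma finite_good: "finite (good L D F)"
  using finite_cmatch[OF finite_P, of \<kappa>] by (simp add: good_def)

text \<open>Switching \<open>x\<close> with a point \<open>p\<close> that is far from the vertices of \<open>x\<close> and \<open>y\<close> creates no new double edge.\<close>

definition hood :: "(nat \<times> nat \<Rightarrow> nat \<times> nat) \<Rightarrow> nat set \<Rightarrow> nat set" where
  "hood f V = V \<union> (\<lambda>r. fst (f r)) ` {r\<in>P. fst r \<in> V}"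

definition far where
  "far f V = {p\<in>P. fst p \<notin> hood f V \<and> fst (f p) \<notin> hood f V}"

lemma card_fst_in: "finite V \<Longrightarrow> card {r\<in>P. fst r \<in> V} \<le> d * card V"
proof -
  assume V: "finite V"
  have "{r\<in>P. fst r \<in> V} = (\<Union>v\<in>V. {r\<in>P. fst r = v})" by auto
  then have "card {r\<in>P. fst r \<in> V} \<le> (\<Sum>v\<in>V. card {r\<in>P. fst r = v})"
    using card_UN_le[OF V, of "\<lambda>v. {r\<in>P. fst r = v}"] by simp
  also have "\<dots> \<le> (\<Sum>v\<in>V. d)" by (intro sum_mono vertex_le)
  finally show ?thesis by (simp add: mult.commute)
qed

text \<open>The neighbourhood has at most \<open>4 + 4 * d\<close> vertices with at most
  \<open>d\<close> points each, and a point is also lost when its partner lies there: at most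
  \<open>2 * d * (4 + 4 * d)\<close> points in all. The assumption \<open>m_ge\<close> asks for
  twice the resulting bound, so at least half of every colour class remains usable.\<close>

lemma card_not_far:
  assumes f: "f \<in> cmatch P \<kappa>" and V: "finite V" "card V \<le> 4"
  shows "card (P - far f V) \<le> 16 * d\<^sup>2"
proof -
  let ?H = "hood f V"
  have fH: "finite ?H" using V finite_P by (simp add: hood_def)
  have "card ?H \<le> card V + card ((\<lambda>r. fst (f r)) ` {r\<in>P. fst r \<in> V})"
    unfolding hood_def by (rule card_Un_le)
  also have "\<dots> \<le> card V + card {r\<in>P. fst r \<in> V}"
    using finite_P by (intro add_left_mono card_image_le) auto
  also have "\<dots> \<le> 4 + d * 4" using V(2) by (intro add_mono order.trans[OF card_fst_in[OF V(1)]] mult_le_mono2)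
  finally have H: "card ?H \<le> 4 + 4 * d" by simp
  have "P - far f V \<subseteq> {r\<in>P. fst r \<in> ?H} \<union> f ` {r\<in>P. fst r \<in> ?H}"
  proof
    fix p assume "p \<in> P - far f V"
    then have p: "p \<in> P" "fst p \<in> ?H \<or> fst (f p) \<in> ?H" by (auto simp: far_def)
    have "p \<in> f ` {r\<in>P. fst r \<in> ?H}" if "fst (f p) \<in> ?H"
      using cmatchD[OF f p(1)] that by (intro image_eqI[of _ _ "f p"]) auto
    then show "p \<in> {r\<in>P. fst r \<in> ?H} \<union> f ` {r\<in>P. fst r \<in> ?H}" using p by auto
  qed
  then have "card (P - far f V) \<le> card ({r\<in>P. fst r \<in> ?H} \<union> f ` {r\<in>P. fst r \<in> ?H})"
    using finite_P by (intro card_mono) auto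
  also have "\<dots> \<le> card {r\<in>P. fst r \<in> ?H} + card (f ` {r\<in>P. fst r \<in> ?H})" by (rule card_Un_le)
  also have "\<dots> \<le> 2 * card {r\<in>P. fst r \<in> ?H}"
    using card_image_le[of "{r\<in>P. fst r \<in> ?H}" f] finite_P by simp
  also have "\<dots> \<le> 2 * (d * (4 + 4 * d))" using H by (intro mult_le_mono2 order.trans[OF card_fst_in[OF fH]])
  also have "\<dots> \<le> 16 * d\<^sup>2" using d_pos by (simp add: power2_eq_square algebra_simps)
  finally show ?thesis .
qed

lemma card_far_ge:
  assumes f: "f \<in> cmatch P \<kappa>" and V: "finite V" "card V \<le> 4"
  shows "class_size c \<le> card {z\<in>far f V. \<kappa> z = c} + 16 * d\<^sup>2"
proof -
  have "{z\<in>P. \<kappa> z = c} \<subseteq> {z\<in>far f V. \<kappa> z = c} \<union> (P - far f V)" by auto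
  then have "class_size c \<le> card ({z\<in>far f V. \<kappa> z = c} \<union> (P - far f V))"
    unfolding class_size_def using finite_P by (intro card_mono) (auto simp: far_def)
  also have "\<dots> \<le> card {z\<in>far f V. \<kappa> z = c} + card (P - far f V)" by (rule card_Un_le)
  finally show ?thesis using card_not_far[OF assms] by simp
qed

lemma farD:
  assumes f: "f \<in> cmatch P \<kappa>" and p: "p \<in> far f V" and r: "r \<in> P" "fst r \<in> V"
  shows "p \<in> P" "f p \<in> P" "fst p \<notin> V" "fst (f p) \<notin> V" "fst p \<noteq> fst (f r)" "fst (f p) \<noteq> fst (f r)"
  using p r cmatchD[OF f, of p] by (auto simp: far_def hood_def)

text \<open>This is the reason for the order of the phases: as soon as some double edge is
  forbidden, all loops are. Otherwise \<open>x\<close> and \<open>f x\<close> could share a vertex,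
  and a switching could create parallel pairs among the four switched points themselves.\<close>

lemma no_loop:
  assumes "phase L D" "D \<noteq> {}" "f \<in> cmatch P \<kappa>" "avoids L D f" "r \<in> P"
  shows "fst (f r) \<noteq> fst r"
proof
  assume "fst (f r) = fst r"
  note D = cmatchD[OF assms(3,5)]
  have L: "L = loops P \<kappa>" using assms by (auto simp: phase_def)
  have "snd (f r) \<noteq> snd r" using D \<open>fst (f r) = fst r\<close> by (metis prod.expand)
  then have "(r, f r) \<in> L \<or> (f r, r) \<in> L" using D \<open>fst (f r) = fst r\<close> assms(5) L
    by (auto simp: loops_def) 
  then show False using assms(4) D by (auto simp: avoids_def)
qed

lemma good_switch_far:
  assumes ph: "phase L D" and f: "f \<in> cmatch P \<kappa>" "avoids L D f" and x: "x \<in> P" "\<kappa> p = \<kappa> x"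
    and V: "fst x \<in> V" "fst (f x) \<in> V" and p: "p \<in> far f V"
  shows "switch f x p \<in> cmatch P \<kappa>" "avoids L D (switch f x p)" "p \<noteq> x" "p \<noteq> f x"
proof -
  note D = cmatchD[OF f(1)]
  note F = farD[OF f(1) p]
  note Fx = F[OF x(1) V(1)] and Fy = F[OF D(1)[OF x(1)] V(2)]
  show px: "p \<noteq> x" "p \<noteq> f x" using Fx V by auto
  note s = switch_apply[OF f(1) x(1) Fx(1) px]
  show "switch f x p \<in> cmatch P \<kappa>" using switch_cmatch[OF f(1) x(1) Fx(1) _ px] x by simp
  have LD: "L \<subseteq> loops P \<kappa>" "D \<subseteq> doubles P \<kappa>" using ph by (auto simp: phase_def)
  have fst_ne: "fst x \<noteq> fst (f p)" "fst (f x) \<noteq> fst p" using Fx V by auto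
  show "avoids L D (switch f x p)"
  proof (rule switch_avoids[OF f(1) x(1) Fx(1) x(2)[symmetric] px f(2) LD])
    show "(x, f p) \<notin> L" "(f p, x) \<notin> L" "(f x, p) \<notin> L" "(p, f x) \<notin> L"
      using LD fst_ne by (auto simp: loops_def)
  next
    fix r assume "D \<noteq> {}" and r: "r \<in> P" "r \<noteq> x" "fst r = fst x" "fst (switch f x p r) = fst (f p)"
    have "fst (f x) \<noteq> fst x" using no_loop[OF ph \<open>D \<noteq> {}\<close> f x(1)] .
    then have "r \<notin> {x, p, f x, f p}" using r Fx V Fy by auto
    then have "fst (f r) = fst (f p)" using r s by auto
    \<comment> \<open>The old pair at \<open>r\<close> would join the vertex of \<open>x\<close> to
      that of \<open>f p\<close>, which would then belong to the neighbourhood of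
      \<open>V\<close>.\<close>
    then have False using F[OF r(1)] r V by auto
    then show "{(x, f p, r, switch f x p r), (f p, x, switch f x p r, r),
         (r, switch f x p r, x, f p), (switch f x p r, r, f p, x)} \<inter> D = {}" ..
  next
    fix r assume "D \<noteq> {}" and r: "r \<in> P" "r \<noteq> f x" "fst r = fst (f x)" "fst (switch f x p r) = fst p"
    have "fst (f x) \<noteq> fst x" using no_loop[OF ph \<open>D \<noteq> {}\<close> f x(1)] .
    then have "r \<notin> {x, p, f x, f p}" using r Fx V Fy by auto
    then have "fst (f r) = fst p" using r s by auto
    then have False using F[OF r(1)] r V by auto
    then show "{(f x, p, r, switch f x p r), (p, f x, switch f x p r, r),
         (r, switch f x p r, f x, p), (switch f x p r, r, p, f x)} \<inter> D = {}" ..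
  qed
qed

text \<open>Double counting of the switchings that break the pair {x, y}. Every far point
  \<open>z\<close> of the right colour yields an admissible matching, and distinct choices yield
  distinct matchings because \<open>z\<close> becomes the partner of \<open>y\<close>, which
  identifies it.\<close>

lemma good_insert_upper:
  assumes ph: "phase L D" and xy: "x \<in> P" "y \<in> P" "\<kappa> x = \<kappa> y" and F: "beside x y F"
  shows "card (good L D (insert (x, y) F)) * (class_size (\<kappa> x) - 16 * d\<^sup>2) \<le> card (good L D F)"
proof -
  define V where "V = {fst x, fst y}"
  have V: "finite V" "card V \<le> 4" by (auto simp: V_def card_insert_if)
  define Z where "Z f = {z\<in>far f V. \<kappa> z = \<kappa> x}" for f
  have fZ: "finite (Z f)" for f using finite_P by (auto simp: Z_def far_def)
  define A where "A = (SIGMA f:good L D (insert (x, y) F). Z f)"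
  have "inj_on (\<lambda>(f, z). switch f x z) A"
  proof (rule inj_onI, clarify)
    fix f z f' z'
    assume A: "(f, z) \<in> A" "(f', z') \<in> A" and eq: "switch f x z = switch f' x z'"
    have *: "switch h x w y = w \<and> switch (switch h x w) x w = h" if "(h, w) \<in> A" for h w
    proof -
      have h: "h \<in> cmatch P \<kappa>" "avoids L D h" "h x = y" "w \<in> far h V" "\<kappa> w = \<kappa> x"
        using that by (auto simp: A_def good_def Z_def)
      have w: "w \<noteq> x" "w \<noteq> h x" using good_switch_far[OF ph h(1,2) xy(1) h(5) _ _ h(4)] h V_def by auto
      have "w \<in> P" using h by (auto simp: far_def)
      then show ?thesis using switch_apply(3)[OF h(1) xy(1) _ w] switch_switch[OF h(1) xy(1) _ _ w] h by auto
    qed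
    from *[OF A(1)] *[OF A(2)] eq show "f = f' \<and> z = z'" by metis
  qed
  moreover have "(\<lambda>(f, z). switch f x z) ` A \<subseteq> good L D F"
  proof clarify
    fix f z assume fz: "(f, z) \<in> A"
    have h: "f \<in> cmatch P \<kappa>" "avoids L D f" "f x = y" "z \<in> far f V" "\<kappa> z = \<kappa> x" "\<forall>(x', y')\<in>F. f x' = y'"
      using fz by (auto simp: A_def good_def Z_def)
    note g = good_switch_far[OF ph h(1,2) xy(1) h(5) _ _ h(4)]
    have zP: "z \<in> P" using h by (auto simp: far_def)
    have "switch f x z x' = y'" if "(x', y') \<in> F" for x' y'
    proof -
      have xy': "x' \<in> P" "y' \<in> P" "fst x' = fst x" "fst y' = fst y" "x' \<noteq> x" "x' \<noteq> y" "y' \<noteq> x" "y' \<noteq> y" "f x' = y'"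
        using F that h by (auto simp: beside_def)
      \<comment> \<open>The pairs of \<open>F\<close> sit at the vertices of \<open>x\<close> and
        \<open>y\<close>, whereas \<open>z\<close> and its partner avoid both vertices; so forced
        pairs survive the switching.\<close>
      have "fst z \<notin> V" "fst (f z) \<notin> V" using h by (auto simp: far_def hood_def)
      then have "x' \<noteq> z" "x' \<noteq> f z" using xy' by (auto simp: V_def)
      then show ?thesis using switch_apply(5)[OF h(1) xy(1) zP, of x'] g(3,4) xy' h V_def by auto
    qed
    then show "switch f x z \<in> good L D F" using g h by (auto simp: good_def V_def)
  qed
  ultimately have "card A \<le> card (good L D F)"
    using card_inj_on_le finite_good by blast
  moreover have "card A = (\<Sum>f\<in>good L D (insert (x, y) F). card (Z f))"
    unfolding A_def using fZ finite_good by (intro card_SigmaI) auto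
  moreover have "(\<Sum>f\<in>good L D (insert (x, y) F). class_size (\<kappa> x) - 16 * d\<^sup>2) \<le> \<dots>"
  proof (intro sum_mono)
    fix f assume "f \<in> good L D (insert (x, y) F)"
    then have "f \<in> cmatch P \<kappa>" by (auto simp: good_def)
    from card_far_ge[OF this V, of "\<kappa> x"] show "class_size (\<kappa> x) - 16 * d\<^sup>2 \<le> card (Z f)"
      by (auto simp: Z_def)
  qed
  ultimately show ?thesis by simp
qed

text \<open>Matchings in which forcing \<open>x y\<close> would complete a double edge with a pair outside \<open>F\<close>.\<close>

definition clash where
  "clash L D x y F = {f\<in>good L D F. D \<noteq> {} \<and>
     (\<exists>r\<in>P. r \<noteq> x \<and> r \<notin> fst ` F \<and> fst r = fst x \<and> fst (f r) = fst y)}"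

text \<open>A union bound: the clashing pair is one of at most \<open>d\<^sup>2\<close> pairs
  between the two vertices, and by \<open>good_insert_upper\<close> each of these is present in at
  most a fraction \<open>1 / (m - 16 * d\<^sup>2)\<close> of the matchings.\<close>

lemma card_clash:
  assumes ph: "phase L D" and F: "beside x y F" and xy: "D \<noteq> {} \<Longrightarrow> fst x \<noteq> fst y"
  shows "card (clash L D x y F) * (m - 16 * d\<^sup>2) \<le> d\<^sup>2 * card (good L D F)"
proof (cases "D = {}")
  case True
  then show ?thesis by (simp add: clash_def)
next
  case False
  define R where "R = {(r, s). r \<in> P \<and> s \<in> P \<and> \<kappa> r = \<kappa> s \<and> fst r = fst x \<and> fst s = fst y
    \<and> r \<notin> fst ` F \<and> s \<notin> snd ` F}"
  have Rsub: "R \<subseteq> {r\<in>P. fst r = fst x} \<times> {s\<in>P. fst s = fst y}" by (auto simp: R_def)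
  then have fR: "finite R" using finite_P by (auto intro: finite_subset)
  have "card R \<le> card {r\<in>P. fst r = fst x} * card {s\<in>P. fst s = fst y}"
    using card_mono[OF _ Rsub] finite_P by (simp add: card_cartesian_product)
  also have "\<dots> \<le> d * d" by (intro mult_mono vertex_le) auto
  finally have cR: "card R \<le> d\<^sup>2" by (simp add: power2_eq_square)
  have "clash L D x y F \<subseteq> (\<Union>(r, s)\<in>R. good L D (insert (r, s) F))"
  proof
    fix f assume "f \<in> clash L D x y F"
    then obtain r where f: "f \<in> good L D F" and r: "r \<in> P" "r \<notin> fst ` F" "fst r = fst x" "fst (f r) = fst y"
      by (auto simp: clash_def)
    have fc: "f \<in> cmatch P \<kappa>" using f by (auto simp: good_def)
    note Df = cmatchD[OF fc r(1)]
    have "f r \<notin> snd ` F"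
    proof
      assume "f r \<in> snd ` F"
      then obtain x' where x': "(x', f r) \<in> F" by auto
      then have "x' \<in> P" "f x' = f r" using F f by (auto simp: beside_def good_def)
      then have "x' = r" using cmatch_eq_iff(1)[OF fc] r by auto
      then show False using r(2) x' by force
    qed
    then have "(r, f r) \<in> R" using r Df by (auto simp: R_def)
    moreover have "f \<in> good L D (insert (r, f r) F)" using f by (auto simp: good_def)
    ultimately show "f \<in> (\<Union>(r, s)\<in>R. good L D (insert (r, s) F))" by blast
  qed
  then have "card (clash L D x y F) \<le> card (\<Union>(r, s)\<in>R. good L D (insert (r, s) F))"
    using fR finite_good by (intro card_mono) auto
  also have "\<dots> \<le> (\<Sum>rs\<in>R. card (case rs of (r, s) \<Rightarrow> good L D (insert (r, s) F)))"
    by (rule card_UN_le[OF fR])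
  finally have "card (clash L D x y F) * (m - 16 * d\<^sup>2)
      \<le> (\<Sum>rs\<in>R. card (case rs of (r, s) \<Rightarrow> good L D (insert (r, s) F)) * (m - 16 * d\<^sup>2))"
    by (simp flip: sum_distrib_right)
  also have "\<dots> \<le> (\<Sum>rs\<in>R. card (good L D F))"
  proof (intro sum_mono, clarify)
    fix r1 r2 s1 s2 assume rs: "((r1, r2), (s1, s2)) \<in> R"
    define r s where "r = (r1, r2)" and "s = (s1, s2)"
    have rs: "r \<in> P" "s \<in> P" "\<kappa> r = \<kappa> s" "fst r = fst x" "fst s = fst y" "r \<notin> fst ` F" "s \<notin> snd ` F"
      using rs by (auto simp: R_def r_def s_def)
    have "x' \<noteq> r \<and> y' \<noteq> s \<and> x' \<noteq> s \<and> y' \<noteq> r" if "(x', y') \<in> F" for x' y'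
    proof -
      have "x' \<in> fst ` F" "y' \<in> snd ` F" using that by force+
      moreover have "fst x' = fst x" "fst y' = fst y" using that F by (auto simp: beside_def)
      ultimately show ?thesis using rs xy[OF False] by metis
    qed
    then have "beside r s F" using F rs by (auto simp: beside_def)
    from good_insert_upper[OF ph rs(1,2,3) this] 
    have "card (good L D (insert (r, s) F)) * (class_size (\<kappa> r) - 16 * d\<^sup>2) \<le> card (good L D F)" .
    moreover have "m \<le> class_size (\<kappa> r)" using class_ge[OF rs(1)] by (simp add: class_size_def)
    then have "card (good L D (insert (r, s) F)) * (m - 16 * d\<^sup>2)
        \<le> card (good L D (insert (r, s) F)) * (class_size (\<kappa> r) - 16 * d\<^sup>2)"
      by (intro mult_le_mono2 diff_le_mono)
    ultimately show "card (good L D (insert ((r1, r2), (s1, s2)) F)) * (m - 16 * d\<^sup>2) \<le> card (good L D F)"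
      unfolding r_def s_def by linarith
  qed
  also have "\<dots> \<le> d\<^sup>2 * card (good L D F)" using cR by simp
  finally show ?thesis .
qed

text \<open>Switching \<open>x\<close> with \<open>f y\<close> directly would create the pair {f x,
  f y}, which may be forbidden. A detour through a far point \<open>p\<close> replaces {x, f x}, {y,
  f y}, {p, f p} by {x, y}, {f x, p}, {f p, f y}, where the last two pairs are harmless. The result
  together with \<open>p\<close> and \<open>f p\<close> determines \<open>f\<close>; hence the
  square of the class size on the right.\<close>

lemma good_insert_lower:
  assumes ph: "phase L D" and xy: "x \<in> P" "y \<in> P" "\<kappa> x = \<kappa> y" "x \<noteq> y" and F: "beside x y F"
    and nl: "D \<noteq> {} \<Longrightarrow> fst x \<noteq> fst y" and L: "(x, y) \<notin> L" "(y, x) \<notin> L"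
    and DF: "\<And>x' y'. (x', y') \<in> F \<Longrightarrow> {(x,y,x',y'),(y,x,y',x'),(x',y',x,y),(y',x',y,x)} \<inter> D = {}"
  shows "(card (good L D F) - card (good L D (insert (x, y) F)) - card (clash L D x y F)) * (class_size (\<kappa> x) - 16 * d\<^sup>2)
     \<le> card (good L D (insert (x, y) F)) * (class_size (\<kappa> x))\<^sup>2"
proof -
  \<comment> \<open>The new pairs also end at the old partners of \<open>x\<close> and
    \<open>y\<close>, so \<open>p\<close> has to be far from four vertices; this is the 4 in
    \<open>card_not_far\<close>.\<close>
  define V where "V f = {fst x, fst y, fst (f x), fst (f y)}" for f :: "nat \<times> nat \<Rightarrow> nat \<times> nat"
  have V: "finite (V f)" "card (V f) \<le> 4" for f by (auto simp: V_def card_insert_if)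
  define Z where "Z f = {z\<in>far f (V f). \<kappa> z = \<kappa> x}" for f
  have fZ: "finite (Z f)" for f using finite_P by (auto simp: Z_def far_def)
  define S where "S = good L D F - good L D (insert (x, y) F) - clash L D x y F"
  define A where "A = (SIGMA f:S. Z f)"
  define C where "C = {z\<in>P. \<kappa> z = \<kappa> x}"
  define h where "h f p = switch (switch f x p) x (f y)" for f p
  have key: "h f p \<in> good L D (insert (x, y) F) \<and> p \<in> C \<and> f p \<in> C \<and>
      h f p (f p) = f y \<and> f = switch (switch (h f p) x (f y)) x p" if fp: "(f, p) \<in> A" for f p
  proof -
    have f: "f \<in> cmatch P \<kappa>" "avoids L D f" "f x \<noteq> y" "\<forall>(x', y')\<in>F. f x' = y'" "f \<notin> clash L D x y F" "f \<in> good L D F"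
      and p: "p \<in> far f (V f)" "\<kappa> p = \<kappa> x"
      using fp by (auto simp: A_def S_def good_def Z_def)
    note Dx = cmatchD[OF f(1) xy(1)] and Dy = cmatchD[OF f(1) xy(2)]
    note e = cmatch_eq_iff[OF f(1)]
    have Vm: "fst x \<in> V f" "fst y \<in> V f" "fst (f x) \<in> V f" "fst (f y) \<in> V f" by (auto simp: V_def)
    note FF = farD[OF f(1) p(1)]
    note Fx = FF[OF xy(1) Vm(1)] and Fy = FF[OF xy(2) Vm(2)]
    note Fu = FF[OF Dx(1) Vm(3)] and Fw = FF[OF Dy(1) Vm(4)]
    define g1 where "g1 = switch f x p"
    note G = good_switch_far[OF ph f(1,2) xy(1) p(2) Vm(1,3) p(1), folded g1_def]
    note s1 = switch_apply[OF f(1) xy(1) Fx(1) G(3,4), folded g1_def]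
    have yn: "y \<notin> {x, p, f x, f p}" using xy(4) Fx(3,4) Vm f(3) by auto
    have wx: "f y \<noteq> x" using f(3) e(2)[OF xy(1,2)] by auto
    have uw: "f x \<noteq> f y" using e(1)[OF xy(1,2)] xy(4) by auto
    have fy_n: "f y \<notin> {x, p, f x, f p}" using wx uw Fx Vm by auto
    have g1w: "g1 (f y) = y" using s1(5)[OF fy_n] Dy by auto
    define g2 where "g2 = switch g1 x (f y)"
    have g2h: "g2 = h f p" by (simp add: g2_def g1_def h_def)
    have c: "\<kappa> x = \<kappa> (f y)" using xy Dy by simp
    have wg: "f y \<noteq> g1 x" using s1(1) fy_n by auto
    note s2 = switch_apply[OF G(1) xy(1) Dy(1) wx wg, folded g2_def]
    have g2c: "g2 \<in> cmatch P \<kappa>" using switch_cmatch[OF G(1) xy(1) Dy(1) c wx wg] by (simp add: g2_def)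
    have g2: "g2 x = y" "g2 y = x" "g2 (f p) = f y" "g2 (f y) = f p"
      using s2 s1 g1w by auto
    have g2': "g2 r = g1 r" if "r \<notin> {x, f y, f p, y}" for r using s2(5)[of r] that s1 g1w by auto
    have "f x \<noteq> f p" using Fx(6) by metis
    then have g2u: "g2 (f x) = p" using g2'[of "f x"] s1(3) Dx uw f(3) by simp
    have g2o: "g2 r = f r" if "r \<notin> {x, y, p, f x, f p, f y}" for r
      using g2'[of r] s1(5)[of r] that by auto
    have LD: "L \<subseteq> loops P \<kappa>" "D \<subseteq> doubles P \<kappa>" using ph by (auto simp: phase_def)
    have av: "avoids L D g2" unfolding g2_def
    proof (rule switch_avoids[OF G(1) xy(1) Dy(1) c wx wg G(2) LD], unfold g1w s1(1), fold g2_def)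
      show "(x, y) \<notin> L" "(y, x) \<notin> L" by (fact L)+
      show "(f p, f y) \<notin> L" "(f y, f p) \<notin> L" using Fx(4) Vm LD by (auto simp: loops_def)
    next
      fix r assume Dne: "D \<noteq> {}" and r: "r \<in> P" "r \<noteq> x" "fst r = fst x" "fst (g2 r) = fst y"
      have r1: "r \<notin> {y, p, f p}" using r nl[OF Dne] Fx Vm by auto
      have r2: "r \<noteq> f y" using r(4) g2(4) Fx(4) Vm by auto
      have r3: "r \<noteq> f x" using r(4) g2u Fx(3) Vm by auto
      have "g2 r = f r" using g2o r r1 r2 r3 by auto
      \<comment> \<open>Since \<open>f\<close> does not clash, a pair parallel to {x, y} is one of
        the forced pairs, and \<open>DF\<close> says that it forms no forbidden double edge with {x,
        y}.\<close>
      then have "r \<in> fst ` F" using f(5,6) r Dne by (auto simp: clash_def)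
      then obtain y' where y': "(r, y') \<in> F" by auto
      then have "f r = y'" using f(4) by auto
      then show "{(x, y, r, g2 r), (y, x, g2 r, r), (r, g2 r, x, y), (g2 r, r, y, x)} \<inter> D = {}"
        using DF[OF y'] \<open>g2 r = f r\<close> by simp
    next
      fix r assume Dne: "D \<noteq> {}" and r: "r \<in> P" "r \<noteq> f p" "fst r = fst (f p)" "fst (g2 r) = fst (f y)"
      have r1: "r \<notin> {x, y, f x, f y}" using r Fx Vm by auto
      have "fst (f p) \<noteq> fst p" using no_loop[OF ph Dne f(1,2) Fx(1)] .
      then have "r \<noteq> p" using r by auto
      then have *: "g2 r = f r" using g2o r r1 by auto
      note Dr = cmatchD[OF f(1) r(1)]
      have "fst (f r) \<in> V f" using r(4) * by (simp add: V_def)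
      then have False using FF(6)[OF Dr(1)] Dr r by auto
      then show "{(f p, f y, r, g2 r), (f y, f p, g2 r, r), (r, g2 r, f p, f y), (g2 r, r, f y, f p)} \<inter> D = {}" ..
    qed
    have "g2 x' = y'" if "(x', y') \<in> F" for x' y'
    proof -
      have xy': "x' \<in> P" "y' \<in> P" "fst x' = fst x" "fst y' = fst y" "x' \<noteq> x" "x' \<noteq> y" "y' \<noteq> x" "y' \<noteq> y" "f x' = y'"
        using F that f by (auto simp: beside_def)
      have "x' \<noteq> f x" "x' \<noteq> f y" using xy' Dx Dy by auto
      moreover have "x' \<noteq> p" "x' \<noteq> f p" using xy' Fx Vm by auto
      ultimately show ?thesis using g2o[of x'] xy' by auto
    qed
    then have "g2 \<in> good L D (insert (x, y) F)" using g2c av g2 by (auto simp: good_def)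
    moreover have "p \<in> C" "f p \<in> C" using Fx p cmatchD(4)[OF f(1) Fx(1)] by (auto simp: C_def)
    moreover have "switch g2 x (f y) = g1" unfolding g2_def
      by (rule switch_switch[OF G(1) xy(1) Dy(1) c wx wg])
    moreover have "switch g1 x p = f" unfolding g1_def
      by (rule switch_switch[OF f(1) xy(1) Fx(1) p(2)[symmetric] G(3,4)])
    ultimately show ?thesis using g2(3) unfolding g2h by simp
  qed
  \<comment> \<open>From the image, \<open>f y\<close> is recovered as the new partner of
    \<open>f p\<close>; then both switchings can be undone.\<close>
  define \<Psi> where "\<Psi> = (\<lambda>(f, p). (h f p, p, f p :: nat \<times> nat))"
  have "inj_on \<Psi> A"
  proof (rule inj_onI)
    fix a a' assume a: "a \<in> A" "a' \<in> A" and eq: "\<Psi> a = \<Psi> a'"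
    obtain f p where fp: "a = (f, p)" by (cases a)
    obtain f' p' where fp': "a' = (f', p')" by (cases a')
    have "h f p = h f' p'" "p = p'" "f p = f' p'" using eq by (auto simp: \<Psi>_def fp fp')
    then show "a = a'" using key[of f p] key[of f' p'] a unfolding fp fp' by metis
  qed
  moreover have "\<Psi> ` A \<subseteq> good L D (insert (x, y) F) \<times> C \<times> C" using key by (auto simp: \<Psi>_def)
  moreover have "finite C" using finite_P by (simp add: C_def)
  ultimately have "card A \<le> card (good L D (insert (x, y) F) \<times> C \<times> C)"
    using finite_good by (intro card_inj_on_le[of \<Psi>]) auto
  then have 1: "card A \<le> card (good L D (insert (x, y) F)) * (class_size (\<kappa> x))\<^sup>2"
    by (simp add: card_cartesian_product C_def class_size_def power2_eq_square)
  have fS: "finite S" using finite_good by (simp add: S_def)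
  have "card A = (\<Sum>f\<in>S. card (Z f))"
    unfolding A_def using fZ fS by (intro card_SigmaI) auto
  moreover have "(\<Sum>f\<in>S. class_size (\<kappa> x) - 16 * d\<^sup>2) \<le> (\<Sum>f\<in>S. card (Z f))"
  proof (intro sum_mono)
    fix f assume "f \<in> S"
    then have "f \<in> cmatch P \<kappa>" by (auto simp: S_def good_def)
    from card_far_ge[OF this V[of f], of "\<kappa> x"] show "class_size (\<kappa> x) - 16 * d\<^sup>2 \<le> card (Z f)"
      by (auto simp: Z_def)
  qed
  ultimately have 2: "card S * (class_size (\<kappa> x) - 16 * d\<^sup>2) \<le> card A" by simp
  have "card (good L D F) - card (good L D (insert (x, y) F)) - card (clash L D x y F) \<le> card S"
  proof -
    have fc: "finite (clash L D x y F)" unfolding clash_def using finite_good by simp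
    show ?thesis
      using diff_card_le_card_Diff[OF finite_good, of "good L D F" L D "insert (x, y) F"]
        diff_card_le_card_Diff[OF fc, of "good L D F - good L D (insert (x, y) F)"]
      unfolding S_def by linarith
  qed
  then have "(card (good L D F) - card (good L D (insert (x, y) F)) - card (clash L D x y F)) * (class_size (\<kappa> x) - 16 * d\<^sup>2)
     \<le> card S * (class_size (\<kappa> x) - 16 * d\<^sup>2)" by (rule mult_le_mono1)
  also note 2
  also note 1
  finally show ?thesis .
qed

end

section \<open>From relative counts to exponential bounds\<close>

context coloured_points
begin

lemma delta_le: "real (d\<^sup>2) / real m \<le> 1 / 32" "0 < m"
proof -
  show m: "0 < m" using m_ge d_pos by (metis bot_nat_0.extremum_strict bot_nat_0.not_eq_extremum
    le_0_eq mult_eq_0_iff power_not_zero zero_neq_numeral)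
  have "real (32 * d\<^sup>2) \<le> real m" using m_ge by (simp only: of_nat_le_iff)
  then show "real (d\<^sup>2) / real m \<le> 1 / 32" using m by (simp add: field_simps)
qed

lemma cls_ge: "x \<in> P \<Longrightarrow> m \<le> class_size (\<kappa> x)"
  using class_ge by (simp add: class_size_def)

lemma inverse_cls_le: "x \<in> P \<Longrightarrow> 1 / real (class_size (\<kappa> x)) \<le> real (d\<^sup>2) / real m"
proof -
  assume "x \<in> P"
  then have "real m \<le> class_size (\<kappa> x)" using cls_ge by simp
  moreover have "(1::real) \<le> real (d\<^sup>2)" using d_pos by (metis One_nat_def Suc_leI of_nat_1 of_nat_le_iff pos2 zero_less_power)
  ultimately show ?thesis using delta_le(2) by (intro frac_le) auto
qed

lemma good_insert_upper_real:
  assumes ph: "phase L D" and xy: "x \<in> P" "y \<in> P" "\<kappa> x = \<kappa> y" and F: "beside x y F"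
  shows "real (card (good L D (insert (x, y) F))) 
    \<le> real (card (good L D F)) * (1 / class_size (\<kappa> x)) * (1 + 32 * (real (d\<^sup>2) / real m))"
proof -
  define \<delta> N h g where "\<delta> = real (d\<^sup>2) / real m" and "N = real (class_size (\<kappa> x))"
    and "h = real (card (good L D (insert (x, y) F)))" and "g = real (card (good L D F))"
  have \<delta>: "0 \<le> \<delta>" "\<delta> \<le> 1/32" using delta_le by (auto simp: \<delta>_def)
  have N: "real m \<le> N" "0 < N" using cls_ge[OF xy(1)] delta_le(2) by (auto simp: N_def)
  have "\<delta> * N \<ge> real (d\<^sup>2)" using N(1) delta_le(2) by (simp add: \<delta>_def field_simps mult_right_mono)
  then have a: "N * (1 - 16 * \<delta>) \<le> N - 16 * real (d\<^sup>2)" by (simp add: algebra_simps)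
  have "16 * d\<^sup>2 \<le> class_size (\<kappa> x)" using m_ge cls_ge[OF xy(1)] by linarith
  then have "real (class_size (\<kappa> x) - 16 * d\<^sup>2) = N - 16 * real (d\<^sup>2)" by (simp add: N_def of_nat_diff)
  moreover have "real (card (good L D (insert (x, y) F)) * (class_size (\<kappa> x) - 16 * d\<^sup>2)) \<le> g"
    using good_insert_upper[OF assms] unfolding g_def by (simp only: of_nat_le_iff)
  ultimately have "h * (N - 16 * real (d\<^sup>2)) \<le> g" by (simp add: h_def)
  then have 1: "h * (N * (1 - 16 * \<delta>)) \<le> g" using a mult_left_mono[OF a, of h] by (simp add: h_def)
  \<comment> \<open>For \<open>\<delta> \<le> 1/32\<close> the inverse of
    \<open>1 - 16 * \<delta>\<close> is at most \<open>1 + 32 * \<delta>\<close>.\<close>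
  have "h * N \<le> (h * N) * ((1 - 16 * \<delta>) * (1 + 32 * \<delta>))"
  proof -
    have "\<delta> * \<delta> \<le> \<delta> * (1/32)" using \<delta> by (intro mult_left_mono)
    then have "1 \<le> (1 - 16 * \<delta>) * (1 + 32 * \<delta>)" by (simp add: algebra_simps)
    moreover have "0 \<le> h * N" using N by (simp add: h_def)
    ultimately show ?thesis by (metis mult.right_neutral mult_left_mono)
  qed
  also have "\<dots> = h * (N * (1 - 16 * \<delta>)) * (1 + 32 * \<delta>)" by (simp add: algebra_simps)
  also have "\<dots> \<le> g * (1 + 32 * \<delta>)" using 1 \<delta> by (intro mult_right_mono) auto
  finally show ?thesis using N unfolding h_def[symmetric] g_def[symmetric] N_def[symmetric] \<delta>_def[symmetric]
    by (simp add: field_simps)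
qed

text \<open>The relative loss of 20 \<delta> consists of 16 \<delta> for points that are not far, 2
  \<delta> for matchings that already contain the pair, and 2 \<delta> for clashes.\<close>

lemma good_insert_lower_real:
  assumes ph: "phase L D" and xy: "x \<in> P" "y \<in> P" "\<kappa> x = \<kappa> y" "x \<noteq> y" and F: "beside x y F"
    and nl: "D \<noteq> {} \<Longrightarrow> fst x \<noteq> fst y" and L: "(x, y) \<notin> L" "(y, x) \<notin> L"
    and DF: "\<And>x' y'. (x', y') \<in> F \<Longrightarrow> {(x,y,x',y'),(y,x,y',x'),(x',y',x,y),(y',x',y,x)} \<inter> D = {}"
  shows "real (card (good L D (insert (x, y) F))) 
    \<ge> real (card (good L D F)) * (1 / class_size (\<kappa> x)) * (1 - 20 * (real (d\<^sup>2) / real m))"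
proof -
  define \<delta> N h g c where "\<delta> = real (d\<^sup>2) / real m" and "N = real (class_size (\<kappa> x))"
    and "h = real (card (good L D (insert (x, y) F)))" and "g = real (card (good L D F))"
    and "c = real (card (clash L D x y F))"
  have \<delta>: "0 \<le> \<delta>" "\<delta> \<le> 1/32" using delta_le by (auto simp: \<delta>_def)
  have N: "real m \<le> N" "0 < N" using cls_ge[OF xy(1)] delta_le(2) by (auto simp: N_def)
  have nn: "0 \<le> h" "0 \<le> g" "0 \<le> c" by (auto simp: h_def g_def c_def)
  have "\<delta> * N \<ge> real (d\<^sup>2)" using N(1) delta_le(2) by (simp add: \<delta>_def field_simps mult_right_mono)
  then have a: "N * (1 - 16 * \<delta>) \<le> N - 16 * real (d\<^sup>2)" by (simp add: algebra_simps)
  have le: "16 * d\<^sup>2 \<le> class_size (\<kappa> x)" "16 * d\<^sup>2 \<le> m" using m_ge cls_ge[OF xy(1)] by linarith+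
  have hb: "h \<le> 2 * \<delta> * g"
  proof -
    have "h \<le> g * (1 / N) * (1 + 32 * \<delta>)"
      using good_insert_upper_real[OF ph xy(1,2,3) F] by (simp add: h_def g_def N_def \<delta>_def)
    also have "\<dots> \<le> g * \<delta> * 2"
    proof -
      have "1 / N \<le> \<delta>" using inverse_cls_le[OF xy(1)] by (simp add: N_def \<delta>_def)
      then show ?thesis using nn \<delta> N by (intro mult_mono) auto
    qed
    finally show ?thesis by (simp add: mult_ac)
  qed
  have cb: "c \<le> 2 * \<delta> * g"
  proof -
    have "card (clash L D x y F) * (m - 16 * d\<^sup>2) \<le> d\<^sup>2 * card (good L D F)"
      by (rule card_clash[OF ph F]) (rule nl)
    then have "real (card (clash L D x y F) * (m - 16 * d\<^sup>2)) \<le> real (d\<^sup>2 * card (good L D F))"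
      by (simp only: of_nat_le_iff)
    then have "c * (real m - 16 * real (d\<^sup>2)) \<le> real (d\<^sup>2) * g"
      using le by (simp add: c_def g_def of_nat_diff)
    moreover have "real m / 2 \<le> real m - 16 * real (d\<^sup>2)" using \<delta>(2) delta_le(2) by (simp add: \<delta>_def field_simps)
    ultimately have "c * (real m / 2) \<le> real (d\<^sup>2) * g" using nn mult_left_mono[of "real m / 2" _ c] by fastforce
    then show ?thesis using delta_le(2) by (simp add: \<delta>_def field_simps)
  qed
  have "real ((card (good L D F) - card (good L D (insert (x, y) F)) - card (clash L D x y F)) * (class_size (\<kappa> x) - 16 * d\<^sup>2))
     \<le> h * N\<^sup>2"
    using good_insert_lower[OF assms] unfolding h_def N_def by (metis of_nat_le_iff of_nat_mult of_nat_power)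
  moreover have "real (class_size (\<kappa> x) - 16 * d\<^sup>2) = N - 16 * real (d\<^sup>2)" using le by (simp add: N_def of_nat_diff)
  moreover have "g - h - c \<le> real (card (good L D F) - card (good L D (insert (x, y) F)) - card (clash L D x y F))"
    unfolding g_def h_def c_def by linarith
  moreover have "real (16 * d\<^sup>2) \<le> N" using le(1) unfolding N_def by (simp only: of_nat_le_iff)
  then have "0 \<le> N - 16 * real (d\<^sup>2)" by simp
  ultimately have "(g - h - c) * (N - 16 * real (d\<^sup>2)) \<le> h * N\<^sup>2"
    by (smt (verit) mult_right_mono of_nat_mult)
  moreover have "4 * \<delta> * g \<le> 1 * g" using nn \<delta> by (intro mult_right_mono) auto
  then have "0 \<le> g * (1 - 4 * \<delta>)" "g * (1 - 4 * \<delta>) \<le> g - h - c" using hb cb nn \<delta> by (auto simp: algebra_simps)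
  moreover have "0 \<le> N * (1 - 16 * \<delta>)" using N \<delta> by auto
  ultimately have "g * (1 - 4 * \<delta>) * (N * (1 - 16 * \<delta>)) \<le> h * N\<^sup>2" using a
    by (smt (verit) mult_mono)
  then have "(g * ((1 - 4 * \<delta>) * (1 - 16 * \<delta>))) * N \<le> (h * N) * N" by (simp add: power2_eq_square mult_ac)
  then have "g * ((1 - 4 * \<delta>) * (1 - 16 * \<delta>)) \<le> h * N" using N(2) by (rule mult_right_le_imp_le)
  moreover have "1 - 20 * \<delta> \<le> (1 - 4 * \<delta>) * (1 - 16 * \<delta>)" using \<delta> by (simp add: algebra_simps)
  ultimately have "g * (1 - 20 * \<delta>) \<le> h * N" using nn by (meson mult_left_mono order.trans)
  then show ?thesis using N unfolding h_def[symmetric] g_def[symmetric] N_def[symmetric] \<delta>_def[symmetric]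
    by (simp add: field_simps)
qed

text \<open>The 96 leaves room for two forced pairs, since
  \<open>(1 + 32 * \<delta>)\<^sup>2 \<le> 1 + 96 * \<delta>\<close>. Replacing \<open>1 - q\<close>
  by an exponential costs a further \<open>2 * q\<^sup>2\<close>, and \<open>q \<le> 4 * x\<close>
  together with \<open>q \<le> 4 * \<delta>\<close> bounds this by \<open>32 * \<delta> * x\<close>;
  hence 128.\<close>

lemma exp_step:
  fixes x \<delta> g h :: real
  assumes x: "0 \<le> x" "x \<le> \<delta>" and \<delta>: "\<delta> \<le> 1/32" and g: "0 \<le> g"
    and h: "g * (x * (1 - 96 * \<delta>)) \<le> h" "h \<le> g * (x * (1 + 96 * \<delta>))"
  shows "g * exp (- ((1 + 128 * \<delta>) * x)) \<le> g - h" "g - h \<le> g * exp (- ((1 - 128 * \<delta>) * x))"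
proof -
  have "g - h \<le> g * (1 - x * (1 - 96 * \<delta>))" using h by (simp add: algebra_simps)
  also have "\<dots> \<le> g * exp (- ((1 - 96 * \<delta>) * x))"
    using exp_ge_add_one_self[of "- ((1 - 96 * \<delta>) * x)"] g by (intro mult_left_mono) (auto simp: mult.commute)
  also have "\<dots> \<le> g * exp (- ((1 - 128 * \<delta>) * x))"
    using g x by (intro mult_left_mono iffD2[OF exp_le_cancel_iff]) (auto simp: algebra_simps mult_mono)
  finally show "g - h \<le> g * exp (- ((1 - 128 * \<delta>) * x))" .
  define q where "q = x * (1 + 96 * \<delta>)"
  have "q \<le> x * 4" unfolding q_def using x \<delta> by (intro mult_left_mono) auto
  then have q: "0 \<le> q" "q \<le> 4 * \<delta>" "q \<le> 4 * x" using x by (auto simp: q_def)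
  have "- q - 2 * q\<^sup>2 \<le> ln (1 - q)" using q \<delta> by (intro ln_one_minus_pos_lower_bound) auto
  then have "exp (- q - 2 * q\<^sup>2) \<le> exp (ln (1 - q))" by simp
  then have "exp (- q - 2 * q\<^sup>2) \<le> 1 - q" using q \<delta> by simp
  moreover have "q\<^sup>2 \<le> (4 * x) * (4 * \<delta>)" unfolding power2_eq_square using q x by (intro mult_mono) auto
  then have "- ((1 + 128 * \<delta>) * x) \<le> - q - 2 * q\<^sup>2" unfolding q_def[symmetric] 
    by (simp add: q_def algebra_simps)
  ultimately have "exp (- ((1 + 128 * \<delta>) * x)) \<le> 1 - q" by (smt (verit) exp_le_cancel_iff)
  then have "g * exp (- ((1 + 128 * \<delta>) * x)) \<le> g * (1 - q)" using g by (intro mult_left_mono)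
  also have "\<dots> \<le> g - h" using h by (simp add: q_def algebra_simps)
  finally show "g * exp (- ((1 + 128 * \<delta>) * x)) \<le> g - h" .
qed

text \<open>The expected number of loops and double edges in a random coloured matching, with the
  probability of a single pair simplified to \<open>1 / class_size\<close>.\<close>

definition bad_mean :: real where
  "bad_mean = (\<Sum>(x, y)\<in>loops P \<kappa>. 1 / class_size (\<kappa> x)) +
     (\<Sum>(x, y, x', y')\<in>doubles P \<kappa>. 1 / (real (class_size (\<kappa> x)) * real (class_size (\<kappa> x'))))"

lemma finite_loops: "finite (loops P \<kappa>)" and finite_doubles: "finite (doubles P \<kappa>)"
proof -
  show "finite (loops P \<kappa>)" by (rule finite_subset[of _ "P \<times> P"]) (auto simp: loops_def finite_P)
  show "finite (doubles P \<kappa>)" by (rule finite_subset[of _ "P \<times> P \<times> P \<times> P"]) (auto simp: doubles_def finite_P)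
qed

text \<open>Each forbidden pair, given the ones before it, is present with probability \<open>(1 + O(d\<^sup>2 / m)) / class_size\<close>;
  multiplying the conditional probabilities of absence gives the exponential.\<close>

lemma card_good_loops:
  assumes "T \<subseteq> loops P \<kappa>"
  defines "\<delta> \<equiv> real (d\<^sup>2) / real m" and "s \<equiv> \<Sum>(x, y)\<in>T. 1 / class_size (\<kappa> x)"
  shows "card (good {} {} {}) * exp (- ((1 + 128 * \<delta>) * s)) \<le> card (good T {} {})"
    "card (good T {} {}) \<le> card (good {} {} {}) * exp (- ((1 - 128 * \<delta>) * s))"
proof -
  have fT: "finite T" using assms finite_loops finite_subset by blast
  let ?G = "real (card (good {} {} {}))" let ?s = "\<lambda>T. \<Sum>(x, y)\<in>T. 1 / real (class_size (\<kappa> x))"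
  have "?G * exp (- ((1 + 128 * \<delta>) * ?s T)) \<le> card (good T {} {}) \<and>
    card (good T {} {}) \<le> ?G * exp (- ((1 - 128 * \<delta>) * ?s T))"
    using fT assms(1)
  proof (induction T rule: finite_induct)
    case empty
    then show ?case by simp
  next
    case (insert e T)
    obtain x y where e: "e = (x, y)" by (cases e)
    have xy: "x \<in> P" "y \<in> P" "\<kappa> x = \<kappa> y" "x \<noteq> y" "(x, y) \<notin> T" "(y, x) \<notin> T"
      using insert.prems insert.hyps unfolding e by (auto simp: loops_def)
    have ph: "phase T {}" using insert.prems by (simp add: phase_def)
    have b: "beside x y {}" by (simp add: beside_def)
    define g h where "g = real (card (good T {} {}))" and "h = real (card (good T {} {(x, y)}))"
    define w where "w = 1 / real (class_size (\<kappa> x))"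
    have w: "0 \<le> w" "w \<le> \<delta>" using inverse_cls_le[OF xy(1)] by (auto simp: w_def \<delta>_def)
    have \<delta>: "\<delta> \<le> 1/32" using delta_le by (simp add: \<delta>_def)
    have "good (insert e T) {} {} = good T {} {} - good T {} {(x, y)}"
      by (auto simp: good_def avoids_def e)
    moreover have "good T {} {(x, y)} \<subseteq> good T {} {}" by (auto simp: good_def)
    ultimately have "card (good (insert e T) {} {}) = card (good T {} {}) - card (good T {} {(x, y)})"
      using card_Diff_subset[OF finite_good] by metis
    moreover have "card (good T {} {(x, y)}) \<le> card (good T {} {})"
      by (intro card_mono finite_good) (auto simp: good_def)
    ultimately have eq: "real (card (good (insert e T) {} {})) = g - h" by (simp add: g_def h_def of_nat_diff)
    have "h \<le> g * w * (1 + 32 * \<delta>)" "g * w * (1 - 20 * \<delta>) \<le> h"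
      using good_insert_upper_real[OF ph xy(1-3) b] good_insert_lower_real[OF ph xy(1-4) b _ xy(5,6)]
      by (simp_all add: g_def h_def w_def \<delta>_def)
    moreover have "0 \<le> g" "0 \<le> \<delta>" "0 \<le> g * w" using w by (auto simp: g_def)
    then have "g * w * (1 + 32 * \<delta>) \<le> g * w * (1 + 96 * \<delta>)" "g * w * (1 - 96 * \<delta>) \<le> g * w * (1 - 20 * \<delta>)"
      by (auto intro!: mult_left_mono)
    ultimately have "g * (w * (1 - 96 * \<delta>)) \<le> h" "h \<le> g * (w * (1 + 96 * \<delta>))" by (auto simp: mult.assoc)
    from exp_step[OF w \<delta> \<open>0 \<le> g\<close> this] 
    have st: "g * exp (- ((1 + 128 * \<delta>) * w)) \<le> g - h" "g - h \<le> g * exp (- ((1 - 128 * \<delta>) * w))" .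
    have IH: "?G * exp (- ((1 + 128 * \<delta>) * ?s T)) \<le> g" "g \<le> ?G * exp (- ((1 - 128 * \<delta>) * ?s T))"
      using insert by (auto simp: g_def)
    have s: "?s (insert e T) = w + ?s T" using insert by (simp add: e w_def)
    have ex: "?G * exp (- (c * (w + ?s T))) = ?G * exp (- (c * ?s T)) * exp (- (c * w))" for c
      by (simp add: distrib_left exp_add[symmetric])
    have "?G * exp (- ((1 + 128 * \<delta>) * ?s T)) * exp (- ((1 + 128 * \<delta>) * w)) \<le> g - h"
      by (rule order.trans[OF mult_right_mono[OF IH(1)] st(1)]) simp
    moreover have "g - h \<le> ?G * exp (- ((1 - 128 * \<delta>) * ?s T)) * exp (- ((1 - 128 * \<delta>) * w))"
      by (rule order.trans[OF st(2) mult_right_mono[OF IH(2)]]) simp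
    ultimately show ?case unfolding eq s ex by (rule conjI)
  qed
  then show "card (good {} {} {}) * exp (- ((1 + 128 * \<delta>) * s)) \<le> card (good T {} {})"
    "card (good T {} {}) \<le> card (good {} {} {}) * exp (- ((1 - 128 * \<delta>) * s))" by (auto simp: s_def)
qed

text \<open>A double edge is handled by forcing its pairs one after the other, first {x', y'} and
  then {x, y} beside it, so that two single-pair estimates are multiplied. All loops stay forbidden
  throughout, as \<open>phase\<close> demands.\<close>

lemma card_good_doubles:
  assumes "T \<subseteq> doubles P \<kappa>"
  defines "\<delta> \<equiv> real (d\<^sup>2) / real m" and "L \<equiv> loops P \<kappa>"
    and "s \<equiv> \<Sum>(x, y, x', y')\<in>T. 1 / (real (class_size (\<kappa> x)) * real (class_size (\<kappa> x')))"
  shows "card (good L {} {}) * exp (- ((1 + 128 * \<delta>) * s)) \<le> card (good L T {})"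
    "card (good L T {}) \<le> card (good L {} {}) * exp (- ((1 - 128 * \<delta>) * s))"
proof -
  have fT: "finite T" using assms finite_doubles finite_subset by blast
  let ?G = "real (card (good L {} {}))"
  let ?s = "\<lambda>T. \<Sum>(x, y, x', y')\<in>T. 1 / (real (class_size (\<kappa> x)) * real (class_size (\<kappa> x')))"
  have "?G * exp (- ((1 + 128 * \<delta>) * ?s T)) \<le> card (good L T {}) \<and>
    card (good L T {}) \<le> ?G * exp (- ((1 - 128 * \<delta>) * ?s T))"
    using fT assms(1)
  proof (induction T rule: finite_induct)
    case empty
    then show ?case by simp
  next
    case (insert e T)
    obtain x y x' y' where e: "e = (x, y, x', y')" by (cases e)
    have xy: "x \<in> P" "y \<in> P" "\<kappa> x = \<kappa> y" "x' \<in> P" "y' \<in> P" "\<kappa> x' = \<kappa> y'" "fst x = fst x'" "fst y = fst y'"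
      "fst x < fst y" "snd x < snd x'" "y \<noteq> y'" "(x, y, x', y') \<notin> T"
      using insert.prems insert.hyps unfolding e by (auto simp: doubles_def)
    have ne: "x \<noteq> y" "x' \<noteq> y'" "x \<noteq> x'" "x' \<noteq> y" "y' \<noteq> x" using xy by auto
    have Td: "T \<subseteq> doubles P \<kappa>" using insert.prems by auto
    have ph: "phase L T" using Td by (simp add: phase_def L_def)
    have b: "beside x' y' {}" "beside x y {(x', y')}" using xy ne by (auto simp: beside_def)
    have nL: "(x, y) \<notin> L" "(y, x) \<notin> L" "(x', y') \<notin> L" "(y', x') \<notin> L" using xy by (auto simp: L_def loops_def)
    \<comment> \<open>The inequalities in \<open>doubles\<close> admit only one of the four
      orientations of a double edge, and that one is the quadruple being added, which is not yet in
      \<open>T\<close>.\<close>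
    have DF: "{(x,y,x',y'),(y,x,y',x'),(x',y',x,y),(y',x',y,x)} \<inter> T = {}"
      using xy Td by (auto simp: doubles_def)
    define g g1 h where "g = real (card (good L T {}))" and "g1 = real (card (good L T {(x', y')}))"
      and "h = real (card (good L T {(x, y), (x', y')}))"
    define w w' where "w = 1 / real (class_size (\<kappa> x))" and "w' = 1 / real (class_size (\<kappa> x'))"
    have \<delta>: "\<delta> \<le> 1/32" "0 \<le> \<delta>" using delta_le by (auto simp: \<delta>_def)
    have w: "0 \<le> w" "w \<le> \<delta>" "0 \<le> w'" "w' \<le> \<delta>"
      using inverse_cls_le[OF xy(1)] inverse_cls_le[OF xy(4)] by (auto simp: w_def w'_def \<delta>_def)
    have ww: "0 \<le> w * w'" "w * w' \<le> \<delta>"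
    proof -
      show "0 \<le> w * w'" using w by simp
      have "w * w' \<le> \<delta> * 1" using w \<delta> by (intro mult_mono) auto
      then show "w * w' \<le> \<delta>" by simp
    qed
    have "good L (insert e T) {} = good L T {} - good L T {(x, y), (x', y')}"
      by (auto simp: good_def avoids_def e)
    moreover have "good L T {(x, y), (x', y')} \<subseteq> good L T {}" by (auto simp: good_def)
    ultimately have "card (good L (insert e T) {}) = card (good L T {}) - card (good L T {(x, y), (x', y')})"
      using card_Diff_subset[OF finite_good] by metis
    moreover have "card (good L T {(x, y), (x', y')}) \<le> card (good L T {})"
      by (intro card_mono finite_good) (auto simp: good_def)
    ultimately have eq: "real (card (good L (insert e T) {})) = g - h" by (simp add: g_def h_def of_nat_diff)
    have u: "h \<le> g1 * w * (1 + 32 * \<delta>)" "g1 \<le> g * w' * (1 + 32 * \<delta>)"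
      using good_insert_upper_real[OF ph xy(1-3) b(2)] good_insert_upper_real[OF ph xy(4-6) b(1)]
      by (simp_all add: g_def g1_def h_def w_def w'_def \<delta>_def)
    have l1: "g1 * w * (1 - 20 * \<delta>) \<le> h"
      unfolding g1_def h_def w_def \<delta>_def
      by (rule good_insert_lower_real[OF ph xy(1-3) ne(1) b(2) _ nL(1,2)]) (use xy DF in auto)
    have l2: "g * w' * (1 - 20 * \<delta>) \<le> g1"
      unfolding g1_def g_def w'_def \<delta>_def
      by (rule good_insert_lower_real[OF ph xy(4-6) ne(2) b(1) _ nL(3,4)]) (use xy in auto)
    have g0: "0 \<le> g" "0 \<le> g1" by (auto simp: g_def g1_def)
    have "g * w' * (1 - 20 * \<delta>) * (w * (1 - 20 * \<delta>)) \<le> g1 * (w * (1 - 20 * \<delta>))"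
      using w \<delta> by (intro mult_right_mono[OF l2]) auto
    then have "g * w' * (1 - 20 * \<delta>) * w * (1 - 20 * \<delta>) \<le> h" using l1 by (simp add: mult.assoc)
    moreover have "g * (w * w' * (1 - 96 * \<delta>)) \<le> g * w' * (1 - 20 * \<delta>) * w * (1 - 20 * \<delta>)"
    proof -
      have "1 - 96 * \<delta> \<le> (1 - 20 * \<delta>) * (1 - 20 * \<delta>)" using \<delta> by (simp add: algebra_simps)
      then have "(g * (w * w')) * (1 - 96 * \<delta>) \<le> (g * (w * w')) * ((1 - 20 * \<delta>) * (1 - 20 * \<delta>))"
        using g0 ww by (intro mult_left_mono) auto
      then show ?thesis by (simp add: mult_ac)
    qed
    ultimately have lo: "g * (w * w' * (1 - 96 * \<delta>)) \<le> h" by simp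
    have "g1 * (w * (1 + 32 * \<delta>)) \<le> g * w' * (1 + 32 * \<delta>) * (w * (1 + 32 * \<delta>))"
      using w \<delta> by (intro mult_right_mono[OF u(2)]) auto
    then have "h \<le> (g * w' * (1 + 32 * \<delta>)) * w * (1 + 32 * \<delta>)" using u(1) by (simp add: mult.assoc)
    also have "\<dots> = (g * (w * w')) * ((1 + 32 * \<delta>) * (1 + 32 * \<delta>))" by (simp add: mult_ac)
    also have "\<dots> \<le> (g * (w * w')) * (1 + 96 * \<delta>)"
    proof -
      have "\<delta> * \<delta> \<le> \<delta> * (1/32)" using \<delta> by (intro mult_left_mono)
      then have "(1 + 32 * \<delta>) * (1 + 32 * \<delta>) \<le> 1 + 96 * \<delta>" by (simp add: algebra_simps)
      then show ?thesis using g0 ww by (intro mult_left_mono) auto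
    qed
    finally have hi: "h \<le> g * (w * w' * (1 + 96 * \<delta>))" by (simp add: mult_ac)
    from exp_step[OF ww \<delta>(1) \<open>0 \<le> g\<close> lo hi] 
    have st: "g * exp (- ((1 + 128 * \<delta>) * (w * w'))) \<le> g - h" "g - h \<le> g * exp (- ((1 - 128 * \<delta>) * (w * w')))" .
    have IH: "?G * exp (- ((1 + 128 * \<delta>) * ?s T)) \<le> g" "g \<le> ?G * exp (- ((1 - 128 * \<delta>) * ?s T))"
      using insert.IH[OF Td] by (auto simp: g_def)
    have s: "?s (insert e T) = w * w' + ?s T" using insert by (simp add: e w_def w'_def)
    have ex: "?G * exp (- (c * (w * w' + ?s T))) = ?G * exp (- (c * ?s T)) * exp (- (c * (w * w')))" for c
      by (simp add: distrib_left exp_add[symmetric])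
    have "?G * exp (- ((1 + 128 * \<delta>) * ?s T)) * exp (- ((1 + 128 * \<delta>) * (w * w'))) \<le> g - h"
      by (rule order.trans[OF mult_right_mono[OF IH(1)] st(1)]) simp
    moreover have "g - h \<le> ?G * exp (- ((1 - 128 * \<delta>) * ?s T)) * exp (- ((1 - 128 * \<delta>) * (w * w')))"
      by (rule order.trans[OF st(2) mult_right_mono[OF IH(2)]]) simp
    ultimately show ?case unfolding eq s ex by (rule conjI)
  qed
  then show "card (good L {} {}) * exp (- ((1 + 128 * \<delta>) * s)) \<le> card (good L T {})"
    "card (good L T {}) \<le> card (good L {} {}) * exp (- ((1 - 128 * \<delta>) * s))" by (auto simp: s_def)
qed

definition simple where
  "simple = {f \<in> cmatch P \<kappa>. avoids (loops P \<kappa>) (doubles P \<kappa>) f}"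

theorem simple_bounds:
  defines "\<delta> \<equiv> real (d\<^sup>2) / real m"
  shows "card (cmatch P \<kappa>) * exp (- ((1 + 128 * \<delta>) * bad_mean)) \<le> card simple"
    "card simple \<le> card (cmatch P \<kappa>) * exp (- ((1 - 128 * \<delta>) * bad_mean))"
proof -
  have g: "good {} {} {} = cmatch P \<kappa>" "good (loops P \<kappa>) (doubles P \<kappa>) {} = simple"
    by (auto simp: good_def simple_def avoids_def)
  note l = card_good_loops[OF order.refl, folded \<delta>_def, unfolded g]
  note d = card_good_doubles[OF order.refl, folded \<delta>_def, unfolded g]
  have ex: "exp (- (c * bad_mean)) = exp (- (c * (\<Sum>(x, y)\<in>loops P \<kappa>. 1 / class_size (\<kappa> x)))) *
      exp (- (c * (\<Sum>(x, y, x', y')\<in>doubles P \<kappa>. 1 / (real (class_size (\<kappa> x)) * real (class_size (\<kappa> x'))))))" for c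
    by (simp add: bad_mean_def distrib_left exp_add[symmetric])
  show "card (cmatch P \<kappa>) * exp (- ((1 + 128 * \<delta>) * bad_mean)) \<le> card simple"
    unfolding ex mult.assoc[symmetric] by (rule order.trans[OF mult_right_mono[OF l(1)] d(1)]) simp
  show "card simple \<le> card (cmatch P \<kappa>) * exp (- ((1 - 128 * \<delta>) * bad_mean))"
    unfolding ex mult.assoc[symmetric] by (rule order.trans[OF d(2) mult_right_mono[OF l(2)]]) simp
qed

end

section \<open>The mean number of loops and double edges\<close>

lemma sum_involution_half:
  fixes w :: "'a \<Rightarrow> real"
  assumes A: "finite A" and i: "\<And>a. a \<in> A \<Longrightarrow> i a \<in> A" "\<And>a. a \<in> A \<Longrightarrow> i (i a) = a"
    "\<And>a. a \<in> A \<Longrightarrow> w (i a) = w a" "\<And>a. a \<in> A \<Longrightarrow> Q (i a) \<longleftrightarrow> \<not> Q a"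
  shows "sum w A = 2 * sum w {a\<in>A. Q a}"
proof -
  have "sum w {a\<in>A. \<not> Q a} = sum w {a\<in>A. Q a}"
    by (rule sum.reindex_bij_witness[of _ i i]) (use i in auto)
  moreover have "sum w A = sum w {a\<in>A. Q a} + sum w {a\<in>A. \<not> Q a}"
    using A by (subst sum.union_disjoint[symmetric]) (auto intro: sum.cong)
  ultimately show ?thesis by simp
qed

context coloured_points
begin

definition vertex_pairs :: "'c \<Rightarrow> 'c \<Rightarrow> real" where
  "vertex_pairs c c' = card {(x, x'). x \<in> P \<and> x' \<in> P \<and> fst x = fst x' \<and> \<kappa> x = c \<and> \<kappa> x' = c'}"

lemma cls_pos: "c \<in> \<kappa> ` P \<Longrightarrow> 0 < class_size c"
  using cls_ge delta_le(2) by (metis imageE order_less_le_trans)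

lemma card_pairs_ne:
  "real (card {(x, x'). x \<in> P \<and> x' \<in> P \<and> fst x = fst x' \<and> x \<noteq> x' \<and> \<kappa> x = c \<and> \<kappa> x' = c'})
    = vertex_pairs c c' - (if c = c' then real (class_size c) else 0)"
proof -
  let ?A = "{(x, x'). x \<in> P \<and> x' \<in> P \<and> fst x = fst x' \<and> \<kappa> x = c \<and> \<kappa> x' = c'}"
  let ?B = "{(x, x'). x \<in> P \<and> x' \<in> P \<and> fst x = fst x' \<and> x \<noteq> x' \<and> \<kappa> x = c \<and> \<kappa> x' = c'}"
  let ?D = "(\<lambda>x. (x, x)) ` {x\<in>P. \<kappa> x = c \<and> c = c'}"
  have fA: "finite ?A" by (rule finite_subset[of _ "P \<times> P"]) (auto simp: finite_P)
  have "?A = ?B \<union> ?D" "?B \<inter> ?D = {}" by auto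
  then have "card ?A = card ?B + card ?D"
    using card_Un_disjoint[of ?B ?D] fA by (metis (no_types, lifting) finite_Un)
  moreover have "card ?D = (if c = c' then class_size c else 0)"
    by (subst card_image) (auto simp: inj_on_def class_size_def)
  ultimately show ?thesis by (auto simp: vertex_pairs_def)
qed

lemma sum_loops:
  "(\<Sum>(x, y)\<in>loops P \<kappa>. 1 / class_size (\<kappa> x)) = (\<Sum>c\<in>\<kappa> ` P. (vertex_pairs c c / class_size c - 1) / 2)"
proof -
  define A where "A = {(x, y). x \<in> P \<and> y \<in> P \<and> \<kappa> x = \<kappa> y \<and> fst x = fst y \<and> x \<noteq> y}"
  define w where "w = (\<lambda>(x, y :: nat \<times> nat). 1 / real (class_size (\<kappa> x)))"
  have fA: "finite A" by (rule finite_subset[of _ "P \<times> P"]) (auto simp: finite_P A_def)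
  have "sum w A = 2 * sum w {a\<in>A. case a of (x, y) \<Rightarrow> snd x < snd y}"
    by (rule sum_involution_half[OF fA, where i = "\<lambda>(x, y). (y, x)"])
       (auto simp: A_def w_def prod_eq_iff)
  moreover have "{a\<in>A. case a of (x, y) \<Rightarrow> snd x < snd y} = loops P \<kappa>"
    by (auto simp: A_def loops_def)
  ultimately have "2 * sum w (loops P \<kappa>) = sum w A" by simp
  also have "\<dots> = (\<Sum>c\<in>\<kappa> ` P. sum w {a\<in>A. \<kappa> (fst a) = c})"
    by (rule sum.group[symmetric]) (use fA finite_P in \<open>auto simp: A_def\<close>)
  also have "\<dots> = (\<Sum>c\<in>\<kappa> ` P. vertex_pairs c c / class_size c - 1)"
  proof (rule sum.cong[OF refl])
    fix c assume c: "c \<in> \<kappa> ` P"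
    have "sum w {a\<in>A. \<kappa> (fst a) = c} = (\<Sum>a\<in>{a\<in>A. \<kappa> (fst a) = c}. 1 / real (class_size c))"
      by (rule sum.cong) (auto simp: w_def)
    also have "\<dots> = real (card {a\<in>A. \<kappa> (fst a) = c}) / real (class_size c)" by simp
    moreover have E: "{a\<in>A. \<kappa> (fst a) = c}
        = {(x, x'). x \<in> P \<and> x' \<in> P \<and> fst x = fst x' \<and> x \<noteq> x' \<and> \<kappa> x = c \<and> \<kappa> x' = c}"
      by (auto simp: A_def)
    have "real (card {a\<in>A. \<kappa> (fst a) = c}) / real (class_size c) = vertex_pairs c c / class_size c - 1"
      using cls_pos[OF c] unfolding E card_pairs_ne by (simp add: diff_divide_distrib)
    ultimately show "sum w {a\<in>A. \<kappa> (fst a) = c} = vertex_pairs c c / class_size c - 1" by simp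
  qed
  finally show ?thesis by (simp add: w_def case_prod_beta sum_divide_distrib[symmetric])
qed

text \<open>The sum over all ordered quadruples factorises over the two ends and gives
  \<open>T\<close>. A double edge occurs in it four times, by exchanging its ends and its two pairs.
  The surplus comes from quadruples with all four points at one vertex: at most \<open>d ^ 3\<close>
  for each \<open>x\<close>, with second weight at most \<open>1 / m\<close>, and the weights of
  \<open>x\<close> add up to the number of colours.\<close>

lemma sum_doubles:
  defines "T \<equiv> \<Sum>c\<in>\<kappa> ` P. \<Sum>c'\<in>\<kappa> ` P. (vertex_pairs c c' - (if c = c' then real (class_size c) else 0))\<^sup>2 / (real (class_size c) * real (class_size c'))"
    and "S \<equiv> \<Sum>(x, y, x', y')\<in>doubles P \<kappa>. 1 / (real (class_size (\<kappa> x)) * real (class_size (\<kappa> x')))"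
  shows "4 * S \<le> T" "T - card (\<kappa> ` P) * real d ^ 3 / real m \<le> 4 * S"
proof -
  define A where "A = {(x, y, x', y'). x \<in> P \<and> y \<in> P \<and> x' \<in> P \<and> y' \<in> P \<and> \<kappa> x = \<kappa> y \<and> \<kappa> x' = \<kappa> y' \<and>
     fst x = fst x' \<and> fst y = fst y' \<and> x \<noteq> x' \<and> y \<noteq> y'}"
  define w where "w = (\<lambda>(x, y :: nat \<times> nat, x', y' :: nat \<times> nat). 1 / (real (class_size (\<kappa> x)) * real (class_size (\<kappa> x'))))"
  have fA: "finite A" by (rule finite_subset[of _ "P \<times> P \<times> P \<times> P"]) (auto simp: finite_P A_def)
  define B where "B = {a\<in>A. case a of (x, y, x', y') \<Rightarrow> fst x \<noteq> fst y}"
  define B' where "B' = {a\<in>B. case a of (x, y, x', y') \<Rightarrow> fst x < fst y}"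
  have fB: "finite B" "finite B'" using fA by (auto simp: B_def B'_def)
  have "sum w B = 2 * sum w B'" unfolding B'_def
    by (rule sum_involution_half[OF fB(1), where i = "\<lambda>(x, y, x', y'). (y, x, y', x')"])
       (auto simp: A_def B_def w_def)
  moreover have "sum w B' = 2 * sum w {a\<in>B'. case a of (x, y, x', y') \<Rightarrow> snd x < snd x'}"
    by (rule sum_involution_half[OF fB(2), where i = "\<lambda>(x, y, x', y'). (x', y', x, y)"])
       (auto simp: A_def B_def B'_def w_def prod_eq_iff mult.commute)
  moreover have "{a\<in>B'. case a of (x, y, x', y') \<Rightarrow> snd x < snd x'} = doubles P \<kappa>"
    by (auto simp: A_def B_def B'_def doubles_def)
  ultimately have SB: "4 * S = sum w B" by (simp add: S_def w_def)
  have "sum w A = (\<Sum>c\<in>\<kappa> ` P \<times> \<kappa> ` P. sum w {a\<in>A. (case a of (x, y, x', y') \<Rightarrow> (\<kappa> x, \<kappa> x')) = c})"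
    by (rule sum.group[symmetric]) (use fA finite_P in \<open>auto simp: A_def\<close>)
  also have "\<dots> = (\<Sum>(c, c')\<in>\<kappa> ` P \<times> \<kappa> ` P. (vertex_pairs c c' - (if c = c' then real (class_size c) else 0))\<^sup>2 / (real (class_size c) * real (class_size c')))"
  proof (rule sum.cong[OF refl], clarify)
    fix p q :: "nat \<times> nat" define c c' where "c = \<kappa> p" and "c' = \<kappa> q"
    let ?E = "{(x, x'). x \<in> P \<and> x' \<in> P \<and> fst x = fst x' \<and> x \<noteq> x' \<and> \<kappa> x = c \<and> \<kappa> x' = c'}"
    let ?F = "{a\<in>A. (case a of (x, y, x', y') \<Rightarrow> (\<kappa> x, \<kappa> x')) = (c, c')}"
    have F: "?F = (\<lambda>((x, x'), (y, y')). (x, y, x', y')) ` (?E \<times> ?E)"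
      by (auto simp: A_def image_iff)
    have "sum w ?F = (\<Sum>a\<in>?F. 1 / (real (class_size c) * real (class_size c')))"
      by (rule sum.cong) (auto simp: w_def)
    also have "\<dots> = real (card ?F) / (real (class_size c) * real (class_size c'))" by simp
    also have "card ?F = card ?E * card ?E"
      unfolding F by (subst card_image) (auto simp: inj_on_def card_cartesian_product)
    finally show "sum w ?F = (vertex_pairs c c' - (if c = c' then real (class_size c) else 0))\<^sup>2 / (real (class_size c) * real (class_size c'))"
      by (simp add: card_pairs_ne power2_eq_square)
  qed
  finally have TA: "sum w A = T" by (simp add: T_def sum.cartesian_product)
  have nn: "0 \<le> w a" for a by (auto simp: w_def split: prod.split)
  have "sum w A = sum w B + sum w (A - B)"
    using fA by (subst sum.subset_diff[of B A]) (auto simp: B_def)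
  moreover have "0 \<le> sum w (A - B)" using nn by (simp add: sum_nonneg)
  moreover have "sum w (A - B) \<le> card (\<kappa> ` P) * real d ^ 3 / real m"
  proof -
    define Y where "Y x = {y\<in>P. fst y = fst x}" for x :: "nat \<times> nat"
    have fY: "finite (Y x)" "card (Y x) \<le> d" for x using finite_P vertex_le by (auto simp: Y_def)
    define E where "E = (SIGMA x:P. Y x \<times> Y x \<times> Y x)"
    have fE: "finite E" unfolding E_def using finite_P fY by auto
    have "A - B \<subseteq> E" by (auto simp: A_def B_def E_def Y_def)
    then have "sum w (A - B) \<le> (\<Sum>a\<in>A - B. case a of (x, _) \<Rightarrow> 1 / (real (class_size (\<kappa> x)) * real m))"
    proof (intro sum_mono)
      fix a assume "a \<in> A - B"
      then obtain x y x' y' where a: "a = (x, y, x', y')" "x \<in> P" "x' \<in> P" by (auto simp: A_def)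
      have "real m \<le> class_size (\<kappa> x')" "0 < class_size (\<kappa> x)" using cls_ge[OF a(3)] cls_pos a(2) by auto
      then show "w a \<le> (case a of (x, _) \<Rightarrow> 1 / (real (class_size (\<kappa> x)) * real m))"
        using delta_le(2) unfolding w_def a by (auto intro!: divide_left_mono mult_left_mono mult_pos_pos)
    qed
    also have "\<dots> \<le> (\<Sum>a\<in>E. case a of (x, _) \<Rightarrow> 1 / (real (class_size (\<kappa> x)) * real m))"
      using \<open>A - B \<subseteq> E\<close> fE by (intro sum_mono2) auto
    also have "\<dots> = (\<Sum>x\<in>P. \<Sum>_\<in>Y x \<times> Y x \<times> Y x. 1 / (real (class_size (\<kappa> x)) * real m))"
      unfolding E_def using finite_P fY by (subst sum.Sigma) (auto intro!: sum.cong)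
    also have "\<dots> = (\<Sum>x\<in>P. real (card (Y x)) ^ 3 * (1 / (real (class_size (\<kappa> x)) * real m)))"
      by (simp add: card_cartesian_product power3_eq_cube mult.assoc)
    also have "\<dots> \<le> (\<Sum>x\<in>P. real d ^ 3 * (1 / (real (class_size (\<kappa> x)) * real m)))"
      using fY by (intro sum_mono mult_right_mono power_mono) auto
    also have "\<dots> = real d ^ 3 / real m * (\<Sum>x\<in>P. 1 / real (class_size (\<kappa> x)))"
      by (simp add: sum_distrib_left mult.commute)
    also have "(\<Sum>x\<in>P. 1 / real (class_size (\<kappa> x))) = (\<Sum>c\<in>\<kappa> ` P. \<Sum>x\<in>{x\<in>P. \<kappa> x = c}. 1 / real (class_size (\<kappa> x)))"
      by (rule sum.group[symmetric]) (use finite_P in auto)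
    also have "\<dots> = (\<Sum>c\<in>\<kappa> ` P. 1)"
    proof (rule sum.cong[OF refl])
      fix c assume c: "c \<in> \<kappa> ` P"
      have "(\<Sum>x\<in>{x\<in>P. \<kappa> x = c}. 1 / real (class_size (\<kappa> x))) = (\<Sum>x\<in>{x\<in>P. \<kappa> x = c}. 1 / real (class_size c))"
        by (rule sum.cong) auto
      then show "(\<Sum>x\<in>{x\<in>P. \<kappa> x = c}. 1 / real (class_size (\<kappa> x))) = 1" using cls_pos[OF c] by (simp add: class_size_def)
    qed
    finally show ?thesis by (simp add: mult.commute)
  qed
  ultimately show "4 * S \<le> T" "T - card (\<kappa> ` P) * real d ^ 3 / real m \<le> 4 * S" using SB TA by auto
qed

text \<open>The diagonal terms in the double edge sum cancel against the loops, and what remains of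
  the corrections is \<open>- 1 / 4\<close> per colour. This is the origin of
  \<open>d\<^sup>2 - 1\<close>, \<open>d\<^sup>2 - 2\<close> and \<open>d\<^sup>2 - 4\<close> for
  one, two and four colours.\<close>

lemma bad_mean_bounds:
  fixes T :: real
  defines "T \<equiv> \<Sum>c\<in>\<kappa> ` P. \<Sum>c'\<in>\<kappa> ` P. (vertex_pairs c c')\<^sup>2 / (real (class_size c) * real (class_size c'))"
  shows "bad_mean \<le> (T - card (\<kappa> ` P)) / 4"
    "(T - card (\<kappa> ` P)) / 4 - card (\<kappa> ` P) * real d ^ 3 / (4 * real m) \<le> bad_mean"
proof -
  have fC: "finite (\<kappa> ` P)" using finite_P by simp
  have "(\<Sum>c\<in>\<kappa> ` P. \<Sum>c'\<in>\<kappa> ` P. (vertex_pairs c c' - (if c = c' then real (class_size c) else 0))\<^sup>2 / (real (class_size c) * real (class_size c')))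
     = (\<Sum>c\<in>\<kappa> ` P. \<Sum>c'\<in>\<kappa> ` P. (vertex_pairs c c')\<^sup>2 / (real (class_size c) * real (class_size c')) - (if c = c' then 2 * vertex_pairs c c / class_size c - 1 else 0))"
    using cls_pos by (intro sum.cong refl) (auto simp: power2_eq_square field_simps)
  also have "\<dots> = T - 2 * (\<Sum>c\<in>\<kappa> ` P. vertex_pairs c c / class_size c) + card (\<kappa> ` P)"
    using fC by (simp add: T_def sum_subtractf sum.delta sum_distrib_left)
  finally have eq: "(\<Sum>c\<in>\<kappa> ` P. \<Sum>c'\<in>\<kappa> ` P. (vertex_pairs c c' - (if c = c' then real (class_size c) else 0))\<^sup>2 / (real (class_size c) * real (class_size c')))
     = T - 2 * (\<Sum>c\<in>\<kappa> ` P. vertex_pairs c c / class_size c) + card (\<kappa> ` P)" .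
  have l: "(\<Sum>(x, y)\<in>loops P \<kappa>. 1 / class_size (\<kappa> x)) = ((\<Sum>c\<in>\<kappa> ` P. vertex_pairs c c / class_size c) - card (\<kappa> ` P)) / 2"
    unfolding sum_loops by (simp add: sum_subtractf sum_divide_distrib[symmetric])
  show "bad_mean \<le> (T - card (\<kappa> ` P)) / 4"
    "(T - card (\<kappa> ` P)) / 4 - card (\<kappa> ` P) * real d ^ 3 / (4 * real m) \<le> bad_mean"
    using sum_doubles[unfolded eq] unfolding bad_mean_def l by (simp_all add: field_simps)
qed

end

section \<open>The configuration model\<close>

text \<open>\<open>pairings k\<close> is \<open>(k - 1)!!\<close> for even \<open>k\<close> and \<open>0\<close> for odd \<open>k\<close>.\<close>

fun pairings :: "nat \<Rightarrow> nat" where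
  "pairings 0 = 1"
| "pairings (Suc 0) = 0"
| "pairings (Suc (Suc k)) = Suc k * pairings k"

lemma card_cmatch_fixed:
  assumes P: "finite P" and x: "x \<in> P" "y \<in> P" "x \<noteq> y" "\<kappa> x = \<kappa> y"
  shows "card {f \<in> cmatch P \<kappa>. f x = y} = card (cmatch (P - {x, y}) \<kappa>)"
proof (rule bij_betw_same_card[of "\<lambda>f. f(x := x, y := y)"], rule bij_betw_byWitness[where f' = "\<lambda>g. g(x := y, y := x)"])
  show "\<forall>f\<in>{f \<in> cmatch P \<kappa>. f x = y}. (f(x := x, y := y))(x := y, y := x) = f"
    using x by (auto simp: fun_eq_iff cmatch_def)
  show "\<forall>g\<in>cmatch (P - {x, y}) \<kappa>. (g(x := y, y := x))(x := x, y := y) = g"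
    using x by (auto simp: fun_eq_iff cmatch_def)
  show "(\<lambda>g. g(x := y, y := x)) ` cmatch (P - {x, y}) \<kappa> \<subseteq> {f \<in> cmatch P \<kappa>. f x = y}"
  proof clarify
    fix g assume g: "g \<in> cmatch (P - {x, y}) \<kappa>"
    have "g r = r" if "r \<notin> P" for r using g that by (simp add: cmatch_def)
    moreover have "g r \<in> P \<and> g r \<noteq> x \<and> g r \<noteq> y \<and> g r \<noteq> r \<and> g (g r) = r \<and> \<kappa> (g r) = \<kappa> r"
      if "r \<in> P" "r \<noteq> x" "r \<noteq> y" for r
      using cmatchD[OF g, of r] that by auto
    ultimately show "g(x := y, y := x) \<in> cmatch P \<kappa> \<and> (g(x := y, y := x)) x = y"
      using x unfolding cmatch_def by simp
  qed
  show "(\<lambda>f. f(x := x, y := y)) ` {f \<in> cmatch P \<kappa>. f x = y} \<subseteq> cmatch (P - {x, y}) \<kappa>"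
  proof clarify
    fix f assume f: "f \<in> cmatch P \<kappa>" "y = f x"
    note D = cmatchD[OF f(1)] note e = cmatch_eq_iff[OF f(1)]
    have "f r \<noteq> x \<and> f r \<noteq> f x" if "r \<in> P" "r \<noteq> x" "r \<noteq> f x" for r
      using that e[OF that(1) x(1)] by auto
    moreover have "f r = r" if "r \<notin> P" for r using f(1) that by (simp add: cmatch_def)
    ultimately show "f(x := x, f x := f x) \<in> cmatch (P - {x, f x}) \<kappa>"
      using D unfolding cmatch_def by simp
  qed
qed

text \<open>Removing a point together with its partner lowers the size of its class by two, and the
  number of possible partners is the class size minus one: this is the recurrence of
  \<open>pairings\<close>.\<close>

theorem card_cmatch:
  assumes "finite P" "finite C" "\<kappa> ` P \<subseteq> C"
  shows "card (cmatch P \<kappa>) = (\<Prod>c\<in>C. pairings (card {x\<in>P. \<kappa> x = c}))"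
  using assms(1,3)
proof (induction "card P" arbitrary: P rule: less_induct)
  case less
  show ?case
  proof (cases "P = {}")
    case True
    then have "cmatch P \<kappa> = {\<lambda>x. x}" by (auto simp: cmatch_def)
    then show ?thesis using True by simp
  next
    case False
    then obtain x where x: "x \<in> P" by auto
    define c where "c = \<kappa> x"
    define Y where "Y = {y\<in>P. \<kappa> y = c} - {x}"
    define n where "n c = card {x\<in>P. \<kappa> x = c}" for c
    have fY: "finite Y" using less.prems by (simp add: Y_def)
    have cY: "n c = Suc (card Y)"
      unfolding n_def Y_def using less.prems x by (subst card_Suc_Diff1) (auto simp: c_def)
    have cC: "c \<in> C" using x less.prems by (auto simp: c_def)
    have "cmatch P \<kappa> = (\<Union>y\<in>Y. {f \<in> cmatch P \<kappa>. f x = y})"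
      using x cmatchD[of _ P \<kappa> x] by (auto simp: Y_def c_def)
    also have "card \<dots> = (\<Sum>y\<in>Y. card {f \<in> cmatch P \<kappa>. f x = y})"
      using fY finite_cmatch[OF less.prems(1), of \<kappa>] by (intro card_UN_disjoint) auto
    finally have "card (cmatch P \<kappa>) = (\<Sum>y\<in>Y. card {f \<in> cmatch P \<kappa>. f x = y})" .
    also have "\<dots> = (\<Sum>y\<in>Y. pairings (card Y - 1) * (\<Prod>c\<in>C - {c}. pairings (n c)))"
    proof (rule sum.cong[OF refl])
      fix y assume y: "y \<in> Y"
      then have yP: "y \<in> P" "x \<noteq> y" "\<kappa> x = \<kappa> y" by (auto simp: Y_def c_def)
      have "card (P - {x, y}) < card P" using less.prems x by (intro psubset_card_mono) auto
      then have "card (cmatch (P - {x, y}) \<kappa>) = (\<Prod>c\<in>C. pairings (card {z\<in>P - {x, y}. \<kappa> z = c}))"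
        using less.prems by (intro less.hyps) auto
      also have "\<dots> = pairings (card {z\<in>P - {x, y}. \<kappa> z = c}) * (\<Prod>c\<in>C - {c}. pairings (card {z\<in>P - {x, y}. \<kappa> z = c}))"
        using cC assms(2) by (rule prod.remove[rotated])
      also have "{z\<in>P - {x, y}. \<kappa> z = c} = Y - {y}" using yP by (auto simp: Y_def)
      also have "card (Y - {y}) = card Y - 1" using y by simp
      also have "(\<Prod>c\<in>C - {c}. pairings (card {z\<in>P - {x, y}. \<kappa> z = c})) = (\<Prod>c\<in>C - {c}. pairings (n c))"
        using yP unfolding n_def c_def by (intro prod.cong refl arg_cong[of _ _ pairings] arg_cong[of _ _ card]) auto
      finally show "card {f \<in> cmatch P \<kappa>. f x = y} = pairings (card Y - 1) * (\<Prod>c\<in>C - {c}. pairings (n c))"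
        using card_cmatch_fixed[OF less.prems(1) x yP(1,2,3)] by simp
    qed
    also have "\<dots> = (card Y * pairings (card Y - 1)) * (\<Prod>c\<in>C - {c}. pairings (n c))" by simp
    also have "card Y * pairings (card Y - 1) = pairings (n c)" unfolding cY by (cases "card Y") auto
    also have "pairings (n c) * (\<Prod>c\<in>C - {c}. pairings (n c)) = (\<Prod>c\<in>C. pairings (n c))"
      using cC assms(2) by (rule prod.remove[rotated, symmetric])
    finally show ?thesis by (simp add: n_def)
  qed
qed

section \<open>Simple matchings and the graphs they define\<close>

definition pts :: "nat \<Rightarrow> nat \<Rightarrow> (nat \<times> nat) set" where
  "pts n d = {1..n} \<times> {..<d}"

definition simple_matchings :: "nat \<Rightarrow> nat \<Rightarrow> (nat \<times> nat \<Rightarrow> nat \<times> nat) set" where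
  "simple_matchings n d = {f \<in> cmatch (pts n d) (\<lambda>_. ()). (\<forall>x\<in>pts n d. fst (f x) \<noteq> fst x) \<and>
     (\<forall>x\<in>pts n d. \<forall>x'\<in>pts n d. x \<noteq> x' \<longrightarrow> fst x = fst x' \<longrightarrow> fst (f x) \<noteq> fst (f x'))}"

lemma finite_pts [simp]: "finite (pts n d)" and card_pts: "card (pts n d) = n * d"
  by (auto simp: pts_def card_cartesian_product)

lemma pts_vertex: "v \<in> {1..n} \<Longrightarrow> {x\<in>pts n d. fst x = v} = Pair v ` {..<d}"
  by (auto simp: pts_def)

lemma card_pts_vertex: "card {x\<in>pts n d. fst x = v} \<le> d"
proof (cases "v \<in> {1..n}")
  case True
  show ?thesis unfolding pts_vertex[OF True] by (subst card_image) (auto simp: inj_on_def)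
next
  case False
  then have "{x\<in>pts n d. fst x = v} = {}" by (auto simp: pts_def)
  then show ?thesis by (simp only: card.empty le0)
qed

text \<open>Every loop of \<open>f\<close> has two orientations and every double edge four; one of
  them always satisfies the inequalities in \<open>loops\<close> or \<open>doubles\<close>, so
  nothing is missed by keeping one representative.\<close>

lemma coloured_simple_eq:
  "{f \<in> cmatch (pts n d) \<kappa>. avoids (loops (pts n d) \<kappa>) (doubles (pts n d) \<kappa>) f} =
   {f \<in> simple_matchings n d. \<forall>x\<in>pts n d. \<kappa> (f x) = \<kappa> x}" (is "?L = ?R")
proof (intro equalityI subsetI)
  fix f assume "f \<in> ?L"
  then have f: "f \<in> cmatch (pts n d) \<kappa>" and a: "avoids (loops (pts n d) \<kappa>) (doubles (pts n d) \<kappa>) f" by auto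
  note D = cmatchD[OF f]
  have 1: "fst (f x) \<noteq> fst x" if x: "x \<in> pts n d" for x
  proof
    assume eq: "fst (f x) = fst x"
    then have "snd (f x) \<noteq> snd x" using D[OF x] by (metis prod.expand)
    then have "(x, f x) \<in> loops (pts n d) \<kappa> \<or> (f x, x) \<in> loops (pts n d) \<kappa>"
      using D[OF x] x eq by (auto simp: loops_def)
    then show False using a D[OF x] by (auto simp: avoids_def)
  qed
  have 2: False if x: "x \<in> pts n d" "x' \<in> pts n d" "x \<noteq> x'" "fst x = fst x'" "fst (f x) = fst (f x')" for x x'
  proof -
    have ff: "f x \<noteq> f x'" using cmatch_eq_iff(1)[OF f x(1,2)] x(3) by simp
    have s: "snd x \<noteq> snd x'" "snd (f x) \<noteq> snd (f x')" using x(3-5) ff by (metis prod.expand)+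
    note Dx = D[OF x(1)] D[OF x(2)] 1[OF x(1)]
    have "(x, f x, x', f x') \<in> doubles (pts n d) \<kappa> \<or> (x', f x', x, f x) \<in> doubles (pts n d) \<kappa> \<or>
       (f x, x, f x', x') \<in> doubles (pts n d) \<kappa> \<or> (f x', x', f x, x) \<in> doubles (pts n d) \<kappa>"
      using Dx x s ff unfolding doubles_def mem_Collect_eq prod.case by (metis linorder_neqE_nat)
    then show False using a Dx by (auto simp: avoids_def)
  qed
  have "f \<in> cmatch (pts n d) (\<lambda>_. ())" using f by (auto simp: cmatch_def)
  moreover have "\<forall>x\<in>pts n d. fst (f x) \<noteq> fst x" using 1 by blast
  moreover have "\<forall>x\<in>pts n d. \<forall>x'\<in>pts n d. x \<noteq> x' \<longrightarrow> fst x = fst x' \<longrightarrow> fst (f x) \<noteq> fst (f x')"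
    using 2 by blast
  ultimately show "f \<in> ?R" using D(4) unfolding simple_matchings_def by simp
next
  fix f assume f: "f \<in> ?R"
  then have "f \<in> simple_matchings n d" and \<kappa>: "\<forall>x\<in>pts n d. \<kappa> (f x) = \<kappa> x" by simp_all
  then have "f \<in> cmatch (pts n d) (\<lambda>_. ())" by (simp add: simple_matchings_def)
  with \<kappa> have "f \<in> cmatch (pts n d) \<kappa>" unfolding cmatch_def by simp
  moreover have "f x \<noteq> y" if "(x, y) \<in> loops (pts n d) \<kappa>" for x y
  proof
    assume "f x = y"
    then have "x \<in> pts n d" "fst (f x) = fst x" using that by (simp_all add: loops_def)
    then show False using \<open>f \<in> simple_matchings n d\<close> unfolding simple_matchings_def by blast
  qed
  moreover have "\<not> (f x = y \<and> f x' = y')" if "(x, y, x', y') \<in> doubles (pts n d) \<kappa>" for x y x' y'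
  proof
    assume "f x = y \<and> f x' = y'"
    then have "x \<in> pts n d" "x' \<in> pts n d" "x \<noteq> x'" "fst x = fst x'" "fst (f x) = fst (f x')"
      using that by (auto simp: doubles_def)
    then show False using \<open>f \<in> simple_matchings n d\<close> unfolding simple_matchings_def by blast
  qed
  ultimately have "avoids (loops (pts n d) \<kappa>) (doubles (pts n d) \<kappa>) f" "f \<in> cmatch (pts n d) \<kappa>"
    unfolding avoids_def by blast+
  then show "f \<in> ?L" by auto
qed

definition edge_at :: "(nat \<times> nat \<Rightarrow> nat \<times> nat) \<Rightarrow> nat \<times> nat \<Rightarrow> nat set" where
  "edge_at f x = {fst x, fst (f x)}"

definition graph_of :: "nat \<Rightarrow> nat \<Rightarrow> (nat \<times> nat \<Rightarrow> nat \<times> nat) \<Rightarrow> nat set set" where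
  "graph_of n d f = edge_at f ` pts n d"

lemma simple_matchingsD:
  assumes "f \<in> simple_matchings n d" "x \<in> pts n d"
  shows "f x \<in> pts n d" "f (f x) = x" "fst (f x) \<noteq> fst x" "edge_at f (f x) = edge_at f x"
proof -
  have "f \<in> cmatch (pts n d) (\<lambda>_. ())" using assms(1) by (simp add: simple_matchings_def)
  from cmatchD[OF this assms(2)] show "f x \<in> pts n d" "f (f x) = x" by auto
  then show "edge_at f (f x) = edge_at f x" by (auto simp: edge_at_def)
  show "fst (f x) \<noteq> fst x" using assms unfolding simple_matchings_def by blast
qed

lemma edge_at_inj:
  assumes f: "f \<in> simple_matchings n d" and x: "x \<in> pts n d" "y \<in> pts n d"
    and v: "fst x = fst y" and e: "edge_at f x = edge_at f y"
  shows "x = y"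
proof -
  have "fst (f x) = fst (f y)" using e v by (auto simp: edge_at_def doubleton_eq_iff)
  then show ?thesis using f x v unfolding simple_matchings_def by blast
qed

lemma edge_at_eq_iff:
  assumes f: "f \<in> simple_matchings n d" and x: "x \<in> pts n d" "y \<in> pts n d"
  shows "edge_at f x = edge_at f y \<longleftrightarrow> y = x \<or> y = f x"
proof
  assume e: "edge_at f x = edge_at f y"
  then have "fst y = fst x \<or> fst y = fst (f x)" by (auto simp: edge_at_def)
  then show "y = x \<or> y = f x"
    using edge_at_inj[OF f x(2,1)] edge_at_inj[OF f x(2), of "f x"] simple_matchingsD[OF f x(1)] e by metis
next
  assume "y = x \<or> y = f x"
  then show "edge_at f x = edge_at f y" using simple_matchingsD(4)[OF f x(1)] by auto
qed

lemma edge_at_regular: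
  assumes f: "f \<in> simple_matchings n d" and S: "S \<subseteq> pts n d" "\<And>x. x \<in> S \<Longrightarrow> f x \<in> S"
  shows "edge_at f ` S \<subseteq> complete_edges n" "degree (edge_at f ` S) v = card {x\<in>S. fst x = v}"
proof -
  show "edge_at f ` S \<subseteq> complete_edges n"
  proof clarify
    fix a b assume "(a, b) \<in> S"
    then have ab: "(a, b) \<in> pts n d" using S by auto
    note D = simple_matchingsD[OF f ab]
    show "edge_at f (a, b) \<in> complete_edges n"
      using D ab by (auto simp: complete_edges_def edge_at_def pts_def card_insert_if)
  qed
  have "{e \<in> edge_at f ` S. v \<in> e} = edge_at f ` {x\<in>S. fst x = v}"
  proof (intro equalityI subsetI)
    fix e assume "e \<in> {e \<in> edge_at f ` S. v \<in> e}"
    then obtain x where x: "x \<in> S" "e = edge_at f x" "v = fst x \<or> v = fst (f x)" by (auto simp: edge_at_def)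
    then show "e \<in> edge_at f ` {x\<in>S. fst x = v}"
      using simple_matchingsD(4)[OF f, of x] S by (metis (mono_tags, lifting) image_eqI mem_Collect_eq subsetD)
  qed (auto simp: edge_at_def)
  moreover have "inj_on (edge_at f) {x\<in>S. fst x = v}"
    using edge_at_inj[OF f] S(1) by (intro inj_onI) blast
  ultimately show "degree (edge_at f ` S) v = card {x\<in>S. fst x = v}"
    unfolding degree_def by (simp add: card_image)
qed

lemma card_pts_vertex_eq: "v \<in> {1..n} \<Longrightarrow> card {x\<in>pts n d. fst x = v} = d"
  by (simp only: pts_vertex) (subst card_image, auto simp: inj_on_def)

lemma graph_of_regular: "f \<in> simple_matchings n d \<Longrightarrow> graph_of n d f \<in> regular_graphs n d"
  using edge_at_regular[of f n d "pts n d"] simple_matchingsD(1)[of f n d] card_pts_vertex_eq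
  by (auto simp: regular_graphs_def graph_of_def)

section \<open>Factors of a graph as invariant sets of points\<close>

definition selections :: "nat \<Rightarrow> nat \<Rightarrow> nat \<Rightarrow> (nat \<times> nat) set set" where
  "selections n d a = {T. T \<subseteq> pts n d \<and> (\<forall>v\<in>{1..n}. card {x\<in>T. fst x = v} = a)}"

definition factor_pairs :: "nat \<Rightarrow> nat \<Rightarrow> nat \<Rightarrow> nat set set \<Rightarrow> (nat set set \<times> nat set set) set" where
  "factor_pairs n a b H = {(G, G'). G \<in> regular_graphs n a \<and> G' \<in> regular_graphs n b \<and> G \<inter> G' = {} \<and> G \<union> G' = H}"

lemma card_compl_selection:
  assumes T: "T \<in> selections n d a" and v: "v \<in> {1..n}"
  shows "card {x\<in>pts n d - T. fst x = v} = d - a"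
proof -
  have "{x\<in>pts n d - T. fst x = v} = {x\<in>pts n d. fst x = v} - {x\<in>T. fst x = v}" by auto
  moreover have "{x\<in>T. fst x = v} \<subseteq> {x\<in>pts n d. fst x = v}" using T by (auto simp: selections_def)
  ultimately show ?thesis using T v card_pts_vertex_eq[OF v, of d]
    by (simp add: card_Diff_subset finite_subset selections_def)
qed

text \<open>The fibres of \<open>edge_at f\<close> are the matched pairs, so sets of edges
  correspond to sets of points invariant under \<open>f\<close>, and the degree of a vertex is the
  number of its selected points.\<close>

lemma card_factor_pairs:
  assumes f: "f \<in> simple_matchings n d"
  shows "card (factor_pairs n a (d - a) (graph_of n d f)) =
    card {T\<in>selections n d a. \<forall>x\<in>pts n d. f x \<in> T \<longleftrightarrow> x \<in> T}"
proof (rule bij_betw_same_card[symmetric], 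
    rule bij_betw_byWitness[where f = "\<lambda>T. (edge_at f ` T, edge_at f ` (pts n d - T))"
      and f' = "\<lambda>(G, G'). {x\<in>pts n d. edge_at f x \<in> G}"])
  let ?T = "{T\<in>selections n d a. \<forall>x\<in>pts n d. f x \<in> T \<longleftrightarrow> x \<in> T}"
  let ?F = "factor_pairs n a (d - a) (graph_of n d f)"
  have mem: "edge_at f x \<in> edge_at f ` T \<longleftrightarrow> x \<in> T" if "T \<subseteq> pts n d" "\<forall>x\<in>pts n d. f x \<in> T \<longleftrightarrow> x \<in> T" "x \<in> pts n d" for T x
  proof
    assume "edge_at f x \<in> edge_at f ` T"
    then obtain y where y: "y \<in> T" "edge_at f x = edge_at f y" by auto
    then have "y = x \<or> y = f x" using edge_at_eq_iff[OF f that(3), of y] that(1) by blast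
    then show "x \<in> T" using y that by auto
  qed auto
  show "\<forall>T\<in>?T. (\<lambda>(G, G'). {x\<in>pts n d. edge_at f x \<in> G}) (edge_at f ` T, edge_at f ` (pts n d - T)) = T"
  proof
    fix T assume T: "T \<in> ?T"
    then have "T \<subseteq> pts n d" by (auto simp: selections_def)
    then show "(\<lambda>(G, G'). {x\<in>pts n d. edge_at f x \<in> G}) (edge_at f ` T, edge_at f ` (pts n d - T)) = T"
      using mem[of T] T by auto
  qed
  show "(\<lambda>T. (edge_at f ` T, edge_at f ` (pts n d - T))) ` ?T \<subseteq> ?F"
  proof (rule image_subsetI)
    fix T assume T: "T \<in> ?T"
    then have TP: "T \<subseteq> pts n d" by (auto simp: selections_def)
    let ?S = "pts n d - T"
    have ST: "\<And>x. x \<in> ?S \<Longrightarrow> f x \<in> ?S" "\<And>x. x \<in> T \<Longrightarrow> f x \<in> T"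
      using T TP simple_matchingsD(1)[OF f] by auto
    have 1: "edge_at f ` T \<in> regular_graphs n a"
      using edge_at_regular[OF f TP ST(2)] T by (auto simp: regular_graphs_def selections_def)
    have 2: "edge_at f ` ?S \<in> regular_graphs n (d - a)"
      using edge_at_regular[OF f _ ST(1)] card_compl_selection[of T n d a] T by (auto simp: regular_graphs_def)
    have 3: "edge_at f ` T \<inter> edge_at f ` ?S = {}"
    proof -
      have "edge_at f x \<notin> edge_at f ` T" if "x \<in> ?S" for x using mem[OF TP _, of x] T that by simp
      then show ?thesis by blast
    qed
    have 4: "edge_at f ` T \<union> edge_at f ` ?S = graph_of n d f" using TP by (auto simp: graph_of_def)
    show "(edge_at f ` T, edge_at f ` ?S) \<in> ?F" using 1 2 3 4 by (simp add: factor_pairs_def)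
  qed
  have key: "{x\<in>pts n d. edge_at f x \<in> G} \<in> ?T \<and> edge_at f ` {x\<in>pts n d. edge_at f x \<in> G} = G \<and>
      edge_at f ` (pts n d - {x\<in>pts n d. edge_at f x \<in> G}) = G'" if GG: "(G, G') \<in> ?F" for G G'
  proof -
    let ?S = "{x\<in>pts n d. edge_at f x \<in> G}"
    have G: "G \<in> regular_graphs n a" "G \<inter> G' = {}" "G \<union> G' = edge_at f ` pts n d"
      using GG by (auto simp: factor_pairs_def graph_of_def)
    have inv: "f x \<in> ?S \<longleftrightarrow> x \<in> ?S" if "x \<in> pts n d" for x
      using simple_matchingsD[OF f that] that by auto
    have im: "edge_at f ` ?S = G" "edge_at f ` (pts n d - ?S) = G'"
    proof -
      have "edge_at f ` ?S = edge_at f ` pts n d \<inter> G" "edge_at f ` (pts n d - ?S) = edge_at f ` pts n d - G"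
        by auto
      then show "edge_at f ` ?S = G" "edge_at f ` (pts n d - ?S) = G'" unfolding G(3)[symmetric] using G(2) by auto
    qed
    have "card {x\<in>?S. fst x = v} = a" if "v \<in> {1..n}" for v
      using edge_at_regular(2)[OF f, of ?S v] inv G(1) that unfolding im by (auto simp: regular_graphs_def)
    then show ?thesis using inv im by (auto simp: selections_def)
  qed
  show "\<forall>p\<in>?F. (\<lambda>T. (edge_at f ` T, edge_at f ` (pts n d - T))) ((\<lambda>(G, G'). {x\<in>pts n d. edge_at f x \<in> G}) p) = p"
    using key by auto
  show "(\<lambda>(G, G'). {x\<in>pts n d. edge_at f x \<in> G}) ` ?F \<subseteq> ?T"
  proof (rule image_subsetI)
    fix p assume "p \<in> ?F"
    then show "(\<lambda>(G, G'). {x\<in>pts n d. edge_at f x \<in> G}) p \<in> ?T" using key[of "fst p" "snd p"] by (simp add: case_prod_beta)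
  qed
qed

text \<open>This is \<open>fact d\<close>, in the form in which injections are counted.\<close>

definition slot_orders :: "nat \<Rightarrow> nat" where
  "slot_orders d = prod ((-) d) {0..<d}"

lemma slot_orders_pos: "0 < slot_orders d"
  by (auto simp: slot_orders_def)

text \<open>A matching with graph \<open>H\<close> amounts to a labelling, at every vertex, of the
  \<open>d\<close> slots by the \<open>d\<close> incident edges; an edge then pairs the two slots
  that carry it. The labellings at different vertices are independent, so the fibre size is the same
  for all \<open>H\<close> and uniform matchings induce uniform graphs.\<close>

theorem card_fibre:
  assumes H: "H \<in> regular_graphs n d"
  shows "card {f\<in>simple_matchings n d. graph_of n d f = H} = slot_orders d ^ n"
proof -
  define E where "E v = {e\<in>H. v \<in> e}" for v
  have HE: "H \<subseteq> complete_edges n" using H by (simp add: regular_graphs_def)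
  have "finite (complete_edges n)" by (rule finite_subset[of _ "Pow {1..n}"]) (auto simp: complete_edges_def)
  then have "finite H" using HE finite_subset by blast
  then have fE: "finite (E v)" for v by (simp add: E_def)
  have cE: "card (E v) = d" if "v \<in> {1..n}" for v using H that by (simp add: regular_graphs_def degree_def E_def)
  define B where "B v = {\<beta> \<in> {..<d} \<rightarrow>\<^sub>E E v. inj_on \<beta> {..<d}}" for v
  have cB: "card (B v) = slot_orders d" if "v \<in> {1..n}" for v
    unfolding B_def slot_orders_def using card_inj_on_subset_funcset[of "{..<d}" "E v" "{..<d}"] fE cE[OF that] by simp
  define \<Phi> where "\<Phi> f = (\<lambda>v\<in>{1..n}. \<lambda>i\<in>{..<d}. edge_at f (v, i))" for f
  let ?F = "{f\<in>simple_matchings n d. graph_of n d f = H}"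
  have "bij_betw \<Phi> ?F (PiE {1..n} B)"
    unfolding bij_betw_def
  proof
    show "inj_on \<Phi> ?F"
    proof (rule inj_onI, rule ext)
      fix f g x assume f: "f \<in> ?F" and g: "g \<in> ?F" and eq: "\<Phi> f = \<Phi> g"
      have ee: "edge_at f x = edge_at g x" if "x \<in> pts n d" for x
        using fun_cong[OF fun_cong[OF eq], of "fst x" "snd x"] that by (auto simp: \<Phi>_def pts_def split: if_splits)
      show "f x = g x"
      proof (cases "x \<in> pts n d")
        case True
        note Df = simple_matchingsD[of f n d x] simple_matchingsD[of g n d x]
        have "edge_at f (g x) = edge_at f x" using ee Df True g by auto
        then have "g x = x \<or> g x = f x" using edge_at_eq_iff[of f n d x "g x"] f g Df True by auto
        then show ?thesis using Df True g by auto
      next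
        case False
        then have "f x = x" "g x = x" using f g unfolding simple_matchings_def cmatch_def by blast+
        then show ?thesis by simp
      qed
    qed
    show "\<Phi> ` ?F = PiE {1..n} B"
    proof (intro equalityI subsetI)
      fix \<beta> assume "\<beta> \<in> \<Phi> ` ?F"
      then obtain f where f: "f \<in> simple_matchings n d" "H = graph_of n d f" "\<beta> = \<Phi> f" by auto
      have "edge_at f (v, i) \<in> E v" if "v \<in> {1..n}" "i < d" for v i
        using that imageI[of "(v, i)" "pts n d" "edge_at f"] by (auto simp: E_def f(2) graph_of_def pts_def edge_at_def)
      moreover have "inj_on (\<lambda>i\<in>{..<d}. edge_at f (v, i)) {..<d}" if "v \<in> {1..n}" for v
        using edge_at_inj[OF f(1)] that by (intro inj_onI) (force simp: pts_def)
      ultimately show "\<beta> \<in> PiE {1..n} B" unfolding f(3) \<Phi>_def B_def by auto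
    next
      fix \<beta> assume \<beta>: "\<beta> \<in> PiE {1..n} B"
      define b where "b x = \<beta> (fst x) (snd x)" for x
      have bE: "b x \<in> H" "fst x \<in> b x" if "x \<in> pts n d" for x
        using \<beta> that by (force simp: b_def pts_def B_def E_def PiE_iff)+
      have binj: "x = y" if "x \<in> pts n d" "y \<in> pts n d" "fst x = fst y" "b x = b y" for x y
      proof -
        have "inj_on (\<beta> (fst x)) {..<d}" using \<beta> that(1) by (force simp: pts_def B_def PiE_iff)
        then have "snd x = snd y" using that by (auto simp: b_def pts_def inj_on_def)
        then show ?thesis using that(3) by (simp add: prod_eq_iff)
      qed
      have bsurj: "\<exists>x\<in>pts n d. fst x = v \<and> b x = e" if "v \<in> {1..n}" "e \<in> H" "v \<in> e" for v e
      proof -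
        have bv: "\<beta> v \<in> {..<d} \<rightarrow> E v" "inj_on (\<beta> v) {..<d}" using \<beta> that by (auto simp: B_def PiE_iff)
        have "\<beta> v ` {..<d} = E v"
          using bv cE[OF that(1)] fE by (intro card_subset_eq) (auto simp: card_image)
        then have "e \<in> \<beta> v ` {..<d}" using that by (simp add: E_def)
        then obtain i where "i < d" "\<beta> v i = e" by auto
        then show ?thesis using that by (intro bexI[of _ "(v, i)"]) (auto simp: b_def pts_def)
      qed
      \<comment> \<open>\<open>y\<close> is the slot that carries the same edge at its other
        end.\<close>
      define R where "R x y \<longleftrightarrow> y \<in> pts n d \<and> fst y \<noteq> fst x \<and> b y = b x" for x y
      have ends: "b x = {fst x, fst y}" if "x \<in> pts n d" "R x y" for x y
      proof -
        have "card (b x) = 2" "fst x \<in> b x" "fst y \<in> b x" "fst x \<noteq> fst y"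
          using that bE[of x] bE[of y] HE by (auto simp: R_def complete_edges_def)
        then show ?thesis by (auto simp: card_2_iff doubleton_eq_iff)
      qed
      have ex: "\<exists>y. R x y" if xP: "x \<in> pts n d" for x
      proof -
        have "card (b x) = 2" "b x \<subseteq> {1..n}" using bE[OF xP] HE by (auto simp: complete_edges_def)
        then obtain u where u: "u \<in> b x" "u \<noteq> fst x" "u \<in> {1..n}"
          using bE(2)[OF xP] by (auto simp: card_2_iff)
        then obtain y where "y \<in> pts n d" "fst y = u" "b y = b x" using bsurj[OF u(3) bE(1)[OF xP] u(1)] by blast
        then show ?thesis using u(2) unfolding R_def by blast
      qed
      have uniq: "y = y'" if "x \<in> pts n d" "R x y" "R x y'" for x y y'
      proof -
        have "{fst x, fst y} = {fst x, fst y'}" using ends[OF that(1,2)] ends[OF that(1,3)] by simp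
        then have "fst y = fst y'" by (auto simp: doubleton_eq_iff)
        then show ?thesis using binj that by (auto simp: R_def)
      qed
      define f where "f x = (if x \<in> pts n d then SOME y. R x y else x)" for x
      have fR: "R x (f x)" if "x \<in> pts n d" for x using someI_ex[OF ex[OF that]] that by (simp add: f_def)
      have feq: "f x = y" if "x \<in> pts n d" "R x y" for x y using uniq[OF that(1) fR[OF that(1)] that(2)] .
      have e: "edge_at f x = b x" if "x \<in> pts n d" for x using ends[OF that fR[OF that]] by (simp add: edge_at_def)
      have "f \<in> cmatch (pts n d) (\<lambda>_. ())"
        unfolding cmatch_def
      proof (intro CollectI conjI allI impI ballI)
        fix x assume x: "x \<in> pts n d"
        show "f x \<in> pts n d" "f x \<noteq> x" using fR[OF x] by (auto simp: R_def)
        have "f x \<in> pts n d" "R (f x) x" using fR[OF x] x by (auto simp: R_def)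
        then show "f (f x) = x" by (rule feq)
      qed (auto simp: f_def)
      moreover have "\<forall>x\<in>pts n d. fst (f x) \<noteq> fst x" using fR by (auto simp: R_def)
      moreover have "x = x'" if x: "x \<in> pts n d" "x' \<in> pts n d" "fst x = fst x'" "fst (f x) = fst (f x')" for x x'
      proof -
        have "b x = b x'" using e[OF x(1)] e[OF x(2)] x(3,4) by (simp add: edge_at_def)
        then show ?thesis using binj x by blast
      qed
      ultimately have fs: "f \<in> simple_matchings n d" unfolding simple_matchings_def by blast
      have "graph_of n d f = b ` pts n d" unfolding graph_of_def using e by (intro image_cong) auto
      also have "\<dots> = H"
      proof (intro equalityI subsetI)
        fix h assume h: "h \<in> H"
        then have "card h = 2" "h \<subseteq> {1..n}" using HE by (auto simp: complete_edges_def)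
        moreover from this have "h \<noteq> {}" by auto
        ultimately obtain v where "v \<in> h" "v \<in> {1..n}" by blast
        then show "h \<in> b ` pts n d" using bsurj[of v h] h by auto
      qed (use bE in auto)
      finally have gf: "graph_of n d f = H" .
      have "\<Phi> f = \<beta>"
      proof (rule ext)
        fix v show "\<Phi> f v = \<beta> v"
        proof (cases "v \<in> {1..n}")
          case True
          then have "\<beta> v \<in> extensional {..<d}" using \<beta> by (auto simp: B_def PiE_iff)
          moreover have "edge_at f (v, i) = \<beta> v i" if "i < d" for i
            using e[of "(v, i)"] True that by (auto simp: b_def pts_def)
          ultimately show ?thesis using True by (auto simp: \<Phi>_def fun_eq_iff extensional_def)
        next
          case False
          then show ?thesis using \<beta> by (auto simp: \<Phi>_def PiE_iff extensional_def)
        qed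
      qed
      then show "\<beta> \<in> \<Phi> ` ?F" using fs gf by blast
    qed
  qed
  then have "card ?F = card (PiE {1..n} B)" by (rule bij_betw_same_card)
  also have "\<dots> = (\<Prod>v\<in>{1..n}. card (B v))" by (simp add: card_PiE)
  also have "\<dots> = (\<Prod>v\<in>{1..n}. slot_orders d)" by (rule prod.cong) (auto simp: cB)
  finally show ?thesis by simp
qed

section \<open>The second moment of the number of factors\<close>

definition factor_count :: "nat \<Rightarrow> nat \<Rightarrow> nat \<Rightarrow> nat set set \<Rightarrow> nat" where
  "factor_count n a b H = card (factor_pairs n a b H)"

definition coloured_matchings :: "nat \<Rightarrow> nat \<Rightarrow> (nat \<times> nat \<Rightarrow> 'c) \<Rightarrow> (nat \<times> nat \<Rightarrow> nat \<times> nat) set" where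
  "coloured_matchings n d \<kappa> = {f \<in> simple_matchings n d. \<forall>x\<in>pts n d. \<kappa> (f x) = \<kappa> x}"

lemma finite_simple_matchings: "finite (simple_matchings n d)"
  using finite_cmatch[of "pts n d" "\<lambda>_. ()"] by (simp add: simple_matchings_def)

lemma finite_complete_edges: "finite (complete_edges n)"
  by (rule finite_subset[of _ "Pow {1..n}"]) (auto simp: complete_edges_def)

lemma finite_regular_graphs: "finite (regular_graphs n d)"
  by (rule finite_subset[of _ "Pow (complete_edges n)"]) (auto simp: regular_graphs_def finite_complete_edges)

lemma finite_selections: "finite (selections n d a)"
  by (rule finite_subset[of _ "Pow (pts n d)"]) (auto simp: selections_def)

lemma sum_over_fibres:
  "slot_orders d ^ n * (\<Sum>H\<in>regular_graphs n d. F H) = (\<Sum>f\<in>simple_matchings n d. F (graph_of n d f))" for F :: "_ \<Rightarrow> nat"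
proof -
  have "(\<Sum>f\<in>simple_matchings n d. F (graph_of n d f)) =
     (\<Sum>H\<in>regular_graphs n d. \<Sum>f\<in>{f\<in>simple_matchings n d. graph_of n d f = H}. F (graph_of n d f))"
    by (rule sum.group[symmetric]) (auto simp: finite_simple_matchings finite_regular_graphs graph_of_regular)
  also have "\<dots> = (\<Sum>H\<in>regular_graphs n d. slot_orders d ^ n * F H)"
  proof (rule sum.cong[OF refl])
    fix H assume H: "H \<in> regular_graphs n d"
    have "(\<Sum>f\<in>{f\<in>simple_matchings n d. graph_of n d f = H}. F (graph_of n d f)) =
       (\<Sum>f\<in>{f\<in>simple_matchings n d. graph_of n d f = H}. F H)" by (rule sum.cong) auto
    then show "(\<Sum>f\<in>{f\<in>simple_matchings n d. graph_of n d f = H}. F (graph_of n d f)) = slot_orders d ^ n * F H"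
      using card_fibre[OF H] by simp
  qed
  finally show ?thesis by (simp add: sum_distrib_left)
qed

lemma factor_count_graph_of:
  assumes f: "f \<in> simple_matchings n d"
  shows "factor_count n a (d - a) (graph_of n d f) =
    (\<Sum>T\<in>selections n d a. if f \<in> coloured_matchings n d (\<lambda>x. x \<in> T) then 1 else 0)"
proof -
  have "(\<Sum>T\<in>selections n d a. if f \<in> coloured_matchings n d (\<lambda>x. x \<in> T) then 1 else 0) =
     card {T\<in>selections n d a. f \<in> coloured_matchings n d (\<lambda>x. x \<in> T)}"
    using finite_selections by (simp add: sum.If_cases Int_def)
  also have "{T\<in>selections n d a. f \<in> coloured_matchings n d (\<lambda>x. x \<in> T)} =
     {T\<in>selections n d a. \<forall>x\<in>pts n d. f x \<in> T \<longleftrightarrow> x \<in> T}"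
    using f by (simp add: coloured_matchings_def)
  finally show ?thesis using card_factor_pairs[OF f, of a] by (simp add: factor_count_def)
qed

lemma sum_factor_count:
  "slot_orders d ^ n * (\<Sum>H\<in>regular_graphs n d. factor_count n a (d - a) H) =
    (\<Sum>T\<in>selections n d a. card (coloured_matchings n d (\<lambda>x. x \<in> T)))"
proof -
  have "slot_orders d ^ n * (\<Sum>H\<in>regular_graphs n d. factor_count n a (d - a) H) =
    (\<Sum>f\<in>simple_matchings n d. \<Sum>T\<in>selections n d a. if f \<in> coloured_matchings n d (\<lambda>x. x \<in> T) then 1 else 0)"
    unfolding sum_over_fibres by (rule sum.cong) (auto simp: factor_count_graph_of)
  also have "\<dots> = (\<Sum>T\<in>selections n d a. \<Sum>f\<in>simple_matchings n d. if f \<in> coloured_matchings n d (\<lambda>x. x \<in> T) then 1 else 0)"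
    by (rule sum.swap)
  also have "\<dots> = (\<Sum>T\<in>selections n d a. card (coloured_matchings n d (\<lambda>x. x \<in> T)))"
    by (intro sum.cong refl) (simp add: sum.If_cases finite_simple_matchings coloured_matchings_def Int_def conj_commute)
  finally show ?thesis .
qed

lemma sum_factor_count_sq:
  "slot_orders d ^ n * (\<Sum>H\<in>regular_graphs n d. (factor_count n a (d - a) H)\<^sup>2) =
    (\<Sum>T\<in>selections n d a. \<Sum>T'\<in>selections n d a. card (coloured_matchings n d (\<lambda>x. (x \<in> T, x \<in> T'))))"
proof -
  let ?i = "\<lambda>f T. if f \<in> coloured_matchings n d (\<lambda>x. x \<in> T) then 1 else 0 :: nat"
  have "slot_orders d ^ n * (\<Sum>H\<in>regular_graphs n d. (factor_count n a (d - a) H)\<^sup>2) =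
    (\<Sum>f\<in>simple_matchings n d. (\<Sum>T\<in>selections n d a. ?i f T)\<^sup>2)"
    unfolding sum_over_fibres by (rule sum.cong) (auto simp: factor_count_graph_of)
  also have "\<dots> = (\<Sum>f\<in>simple_matchings n d. \<Sum>T\<in>selections n d a. \<Sum>T'\<in>selections n d a. ?i f T * ?i f T')"
    by (simp add: power2_eq_square sum_product)
  also have "\<dots> = (\<Sum>T\<in>selections n d a. \<Sum>f\<in>simple_matchings n d. \<Sum>T'\<in>selections n d a. ?i f T * ?i f T')"
    by (rule sum.swap)
  also have "\<dots> = (\<Sum>T\<in>selections n d a. \<Sum>T'\<in>selections n d a. \<Sum>f\<in>simple_matchings n d. ?i f T * ?i f T')"
    by (intro sum.cong refl sum.swap)
  also have "\<dots> = (\<Sum>T\<in>selections n d a. \<Sum>T'\<in>selections n d a. card (coloured_matchings n d (\<lambda>x. (x \<in> T, x \<in> T'))))"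
  proof (intro sum.cong refl)
    fix T T'
    have "(\<Sum>f\<in>simple_matchings n d. ?i f T * ?i f T') =
       (\<Sum>f\<in>simple_matchings n d. if f \<in> coloured_matchings n d (\<lambda>x. (x \<in> T, x \<in> T')) then 1 else 0)"
      by (rule sum.cong) (auto simp: coloured_matchings_def)
    then show "(\<Sum>f\<in>simple_matchings n d. ?i f T * ?i f T') = card (coloured_matchings n d (\<lambda>x. (x \<in> T, x \<in> T')))"
      by (simp add: sum.If_cases finite_simple_matchings coloured_matchings_def Int_def conj_commute)
  qed
  finally show ?thesis .
qed

section \<open>The overlap of two random selections\<close>

definition hypergeom :: "nat \<Rightarrow> nat \<Rightarrow> nat \<Rightarrow> real" where
  "hypergeom a b k = real ((a choose k) * (b choose (a - k))) / real ((a + b) choose a)"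

text \<open>The expectation of \<open>F\<close> over \<open>n\<close> independent hypergeometric
  variables, written as a finite weighted sum so that it can be reindexed and interchanged with
  integrals.\<close>

definition hyp_mean :: "nat \<Rightarrow> nat \<Rightarrow> nat \<Rightarrow> ((nat \<Rightarrow> nat) \<Rightarrow> real) \<Rightarrow> real" where
  "hyp_mean n a b F = (\<Sum>k\<in>PiE {1..n} (\<lambda>_. {..a}). (\<Prod>v\<in>{1..n}. hypergeom a b (k v)) * F k)"

lemma card_subsets_inter:
  assumes D: "finite D" "S \<subseteq> D" and k: "k \<le> a"
  shows "card {A. A \<subseteq> D \<and> card A = a \<and> card (A \<inter> S) = k} = (card S choose k) * (card (D - S) choose (a - k))"
proof -
  have fin: "finite A" if "A \<subseteq> D" for A using that D finite_subset by blast
  have "bij_betw (\<lambda>A. (A \<inter> S, A - S)) {A. A \<subseteq> D \<and> card A = a \<and> card (A \<inter> S) = k}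
     ({B. B \<subseteq> S \<and> card B = k} \<times> {C. C \<subseteq> D - S \<and> card C = a - k})"
  proof (rule bij_betw_byWitness[where f' = "\<lambda>(B, C). B \<union> C"])
    show "(\<lambda>A. (A \<inter> S, A - S)) ` {A. A \<subseteq> D \<and> card A = a \<and> card (A \<inter> S) = k}
       \<subseteq> {B. B \<subseteq> S \<and> card B = k} \<times> {C. C \<subseteq> D - S \<and> card C = a - k}"
      using fin by (auto simp: card_Diff_subset_Int)
    show "(\<lambda>(B, C). B \<union> C) ` ({B. B \<subseteq> S \<and> card B = k} \<times> {C. C \<subseteq> D - S \<and> card C = a - k})
       \<subseteq> {A. A \<subseteq> D \<and> card A = a \<and> card (A \<inter> S) = k}"
    proof clarify
      fix B C assume BC: "B \<subseteq> S" "C \<subseteq> D - S" "k = card B" "card C = a - card B"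
      have "finite B" "finite C" using fin[of B] fin[of C] BC D by auto
      moreover have "B \<inter> C = {}" "(B \<union> C) \<inter> S = B" using BC by auto
      ultimately show "B \<union> C \<subseteq> D \<and> card (B \<union> C) = a \<and> card ((B \<union> C) \<inter> S) = card B"
        using BC D k by (auto simp: card_Un_disjoint)
    qed
  qed auto
  then have "card {A. A \<subseteq> D \<and> card A = a \<and> card (A \<inter> S) = k} =
     card ({B. B \<subseteq> S \<and> card B = k} \<times> {C. C \<subseteq> D - S \<and> card C = a - k})" by (rule bij_betw_same_card)
  then show ?thesis using D finite_subset[OF D(2,1)] by (simp add: card_cartesian_product n_subsets)
qed

definition overlap :: "nat \<Rightarrow> (nat \<times> nat) set \<Rightarrow> (nat \<times> nat) set \<Rightarrow> nat \<Rightarrow> nat" where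
  "overlap n T T' = (\<lambda>v\<in>{1..n}. card {x\<in>T \<inter> T'. fst x = v})"

lemma card_slice: "card {x\<in>T. fst x = v} = card {i. (v, i) \<in> T}"
proof -
  have "{x\<in>T. fst x = v} = Pair v ` {i. (v, i) \<in> T}" by auto
  then show ?thesis by (simp add: card_image inj_on_def)
qed

text \<open>For fixed \<open>T\<close> the slices of \<open>T'\<close> at different vertices are
  chosen independently, and a uniform \<open>a\<close>-subset of the \<open>d\<close> slots meets
  the slice of \<open>T\<close> in a hypergeometric number of slots.\<close>

lemma sum_selections_overlap:
  assumes T: "T \<in> selections n d a" and a: "a \<le> d"
  shows "(\<Sum>T'\<in>selections n d a. F (overlap n T T')) = real (d choose a) ^ n * hyp_mean n a (d - a) F"
proof -
  let ?K = "PiE {1..n} (\<lambda>_. {..a})"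
  define Tv where "Tv v = {i. (v, i) \<in> T}" for v
  have Tv: "Tv v \<subseteq> {..<d}" "card (Tv v) = a" if "v \<in> {1..n}" for v
    using T that card_slice[of T v] by (auto simp: selections_def pts_def Tv_def)
  have ov: "overlap n T T' \<in> ?K" if "T' \<in> selections n d a" for T'
  proof -
    have "card {x\<in>T \<inter> T'. fst x = v} \<le> a" if v: "v \<in> {1..n}" for v
    proof -
      have "card {x\<in>T \<inter> T'. fst x = v} \<le> card {x\<in>T. fst x = v}"
        using T by (intro card_mono) (auto simp: selections_def intro: finite_subset[OF _ finite_pts])
      then show ?thesis using T v by (auto simp: selections_def)
    qed
    then show ?thesis by (auto simp: overlap_def)
  qed
  have fK: "finite ?K" by (intro finite_PiE) auto
  have "(\<Sum>T'\<in>selections n d a. F (overlap n T T')) =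
     (\<Sum>k\<in>?K. \<Sum>T'\<in>{T'\<in>selections n d a. overlap n T T' = k}. F (overlap n T T'))"
    using ov by (intro sum.group[symmetric] finite_selections fK) auto
  also have "\<dots> = (\<Sum>k\<in>?K. real (d choose a) ^ n * ((\<Prod>v\<in>{1..n}. hypergeom a (d - a) (k v)) * F k))"
  proof (rule sum.cong[OF refl])
    fix k assume k: "k \<in> ?K"
    define B where "B v = {A. A \<subseteq> {..<d} \<and> card A = a \<and> card (A \<inter> Tv v) = k v}" for v
    have cB: "card (B v) = (a choose k v) * ((d - a) choose (a - k v))" if v: "v \<in> {1..n}" for v
    proof -
      have "card ({..<d} - Tv v) = d - a" using Tv[OF v] by (simp add: card_Diff_subset finite_subset)
      moreover have "k v \<le> a" using k v by (auto simp: PiE_iff)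
      ultimately show ?thesis unfolding B_def
        using card_subsets_inter[OF finite_lessThan Tv(1)[OF v], of "k v" a] Tv(2)[OF v] by simp
    qed
    have "bij_betw (\<lambda>T'. \<lambda>v\<in>{1..n}. {i. (v, i) \<in> T'}) {T'\<in>selections n d a. overlap n T T' = k} (PiE {1..n} B)"
    proof (rule bij_betw_byWitness[where f' = "\<lambda>A. {(v, i). v \<in> {1..n} \<and> i \<in> A v}"])
      show "\<forall>T'\<in>{T'\<in>selections n d a. overlap n T T' = k}.
          {(v, i). v \<in> {1..n} \<and> i \<in> (\<lambda>v\<in>{1..n}. {i. (v, i) \<in> T'}) v} = T'"
        by (auto simp: selections_def pts_def)
      show "\<forall>A\<in>PiE {1..n} B. (\<lambda>v\<in>{1..n}. {i. (v, i) \<in> {(v, i). v \<in> {1..n} \<and> i \<in> A v}}) = A"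
        by (auto simp: fun_eq_iff PiE_iff extensional_def)
      show "(\<lambda>T'. \<lambda>v\<in>{1..n}. {i. (v, i) \<in> T'}) ` {T'\<in>selections n d a. overlap n T T' = k} \<subseteq> PiE {1..n} B"
      proof (rule image_subsetI)
        fix T' assume T': "T' \<in> {T'\<in>selections n d a. overlap n T T' = k}"
        have "{i. (v, i) \<in> T'} \<in> B v" if v: "v \<in> {1..n}" for v
        proof -
          have "card {i. (v, i) \<in> T'} = a" "{i. (v, i) \<in> T'} \<subseteq> {..<d}"
            using T' v card_slice[of T' v] by (auto simp: selections_def pts_def)
          moreover have "card ({i. (v, i) \<in> T'} \<inter> Tv v) = overlap n T T' v"
            using v card_slice[of "T \<inter> T'" v] by (simp add: overlap_def Tv_def Int_def conj_commute)
          ultimately show ?thesis using T' by (simp add: B_def)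
        qed
        then show "(\<lambda>v\<in>{1..n}. {i. (v, i) \<in> T'}) \<in> PiE {1..n} B" by auto
      qed
      show "(\<lambda>A. {(v, i). v \<in> {1..n} \<and> i \<in> A v}) ` PiE {1..n} B \<subseteq> {T'\<in>selections n d a. overlap n T T' = k}"
      proof (rule image_subsetI)
        fix A assume A: "A \<in> PiE {1..n} B"
        let ?T = "{(v, i). v \<in> {1..n} \<and> i \<in> A v}"
        have Av: "A v \<subseteq> {..<d} \<and> card (A v) = a \<and> card (A v \<inter> Tv v) = k v" if "v \<in> {1..n}" for v
          using A that by (auto simp: PiE_iff B_def)
        have "?T \<subseteq> pts n d" using Av by (auto simp: pts_def)
        moreover have "card {x\<in>?T. fst x = v} = a" if "v \<in> {1..n}" for v
          unfolding card_slice using Av[OF that] that by simp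
        moreover have "overlap n T ?T = k"
        proof (rule ext)
          fix v show "overlap n T ?T v = k v"
          proof (cases "v \<in> {1..n}")
            case True
            then have "{i. (v, i) \<in> T \<inter> ?T} = A v \<inter> Tv v" by (auto simp: Tv_def)
            moreover have "overlap n T ?T v = card {i. (v, i) \<in> T \<inter> ?T}"
              using True unfolding overlap_def card_slice by simp
            ultimately show ?thesis using Av[OF True] by simp
          next
            case False
            then show ?thesis using k by (auto simp: overlap_def PiE_iff extensional_def)
          qed
        qed
        ultimately show "?T \<in> {T'\<in>selections n d a. overlap n T T' = k}" by (auto simp: selections_def)
      qed
    qed
    then have "card {T'\<in>selections n d a. overlap n T T' = k} = card (PiE {1..n} B)" by (rule bij_betw_same_card)
    also have "\<dots> = (\<Prod>v\<in>{1..n}. card (B v))" by (simp add: card_PiE)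
    also have "\<dots> = (\<Prod>v\<in>{1..n}. (a choose k v) * ((d - a) choose (a - k v)))" by (rule prod.cong) (auto simp: cB)
    finally have "real (card {T'\<in>selections n d a. overlap n T T' = k}) = (\<Prod>v\<in>{1..n}. real ((a choose k v) * ((d - a) choose (a - k v))))"
      by simp
    also have "\<dots> = (\<Prod>v\<in>{1..n}. real (d choose a) * hypergeom a (d - a) (k v))"
      using a by (intro prod.cong refl) (simp add: hypergeom_def)
    finally have c: "real (card {T'\<in>selections n d a. overlap n T T' = k}) = real (d choose a) ^ n * (\<Prod>v\<in>{1..n}. hypergeom a (d - a) (k v))"
      by (simp add: prod.distrib)
    have "(\<Sum>T'\<in>{T'\<in>selections n d a. overlap n T T' = k}. F (overlap n T T')) = 
       (\<Sum>T'\<in>{T'\<in>selections n d a. overlap n T T' = k}. F k)" by (rule sum.cong) auto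
    also have "\<dots> = real (card {T'\<in>selections n d a. overlap n T T' = k}) * F k" by simp
    finally show "(\<Sum>T'\<in>{T'\<in>selections n d a. overlap n T T' = k}. F (overlap n T T')) = 
       real (d choose a) ^ n * ((\<Prod>v\<in>{1..n}. hypergeom a (d - a) (k v)) * F k)" unfolding c by (simp add: mult.assoc)
  qed
  finally show ?thesis by (simp add: hyp_mean_def sum_distrib_left)
qed

lemma sum_hyp: "a \<le> b \<Longrightarrow> (\<Sum>k\<le>a. hypergeom a b k) = 1"
proof -
  have "(\<Sum>k\<le>a. (a choose k) * (b choose (a - k))) = (a + b) choose a" by (rule vandermonde)
  then have "(\<Sum>k\<le>a. real ((a choose k) * (b choose (a - k)))) = real ((a + b) choose a)" by (metis of_nat_sum)
  then show ?thesis unfolding hypergeom_def sum_divide_distrib[symmetric] by simp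
qed

lemma hyp_mean_prod: "hyp_mean n a b (\<lambda>k. \<Prod>v\<in>{1..n}. \<phi> v (k v)) = (\<Prod>v\<in>{1..n}. \<Sum>k\<le>a. hypergeom a b k * \<phi> v k)"
  unfolding hyp_mean_def by (subst prod_sum_PiE) (auto simp: prod.distrib)

lemma hyp_mean_1: "a \<le> b \<Longrightarrow> hyp_mean n a b (\<lambda>_. 1) = 1"
  using hyp_mean_prod[of n a b "\<lambda>_ _. 1"] sum_hyp[of a b] by simp

lemma card_selections: "selections n d a \<noteq> {} \<Longrightarrow> 2 * a \<le> d \<Longrightarrow> card (selections n d a) = (d choose a) ^ n"
proof -
  assume "selections n d a \<noteq> {}" and a: "2 * a \<le> d"
  then obtain T where "T \<in> selections n d a" by auto
  from sum_selections_overlap[OF this, of "\<lambda>_. 1"] a show ?thesis by (simp add: hyp_mean_1 flip: of_nat_power)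
qed

lemma selections_nonempty: "a \<le> d \<Longrightarrow> selections n d a \<noteq> {}"
proof -
  assume "a \<le> d"
  then have "{1..n} \<times> {..<a} \<in> selections n d a" by (auto simp: selections_def pts_def card_slice)
  then show ?thesis by auto
qed

section \<open>Simple matchings with one, two and four colours\<close>

lemma coloured_matchings_bounds:
  assumes cp: "coloured_points (pts n d) \<kappa> d m"
  defines "\<delta> \<equiv> real (d\<^sup>2) / real m" and "\<mu> \<equiv> coloured_points.bad_mean (pts n d) \<kappa>"
  shows "card (cmatch (pts n d) \<kappa>) * exp (- ((1 + 128 * \<delta>) * \<mu>)) \<le> card (coloured_matchings n d \<kappa>)"
    "card (coloured_matchings n d \<kappa>) \<le> card (cmatch (pts n d) \<kappa>) * exp (- ((1 - 128 * \<delta>) * \<mu>))"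
  using coloured_points.simple_bounds[OF cp] coloured_simple_eq[of n d \<kappa>]
  unfolding coloured_points.simple_def[OF cp] coloured_matchings_def \<delta>_def \<mu>_def by simp_all

lemma coloured_vertex_pairs:
  assumes cp: "coloured_points (pts n d) \<kappa> d m"
    and k: "\<And>v c. v \<in> {1..n} \<Longrightarrow> card {x\<in>pts n d. fst x = v \<and> \<kappa> x = c} = k v c"
  shows "coloured_points.vertex_pairs (pts n d) \<kappa> c c' = (\<Sum>v\<in>{1..n}. real (k v c) * real (k v c'))"
    "coloured_points.class_size (pts n d) \<kappa> c = (\<Sum>v\<in>{1..n}. k v c)"
proof -
  let ?P = "pts n d"
  let ?E = "\<lambda>v c. {x\<in>?P. fst x = v \<and> \<kappa> x = c}"
  have "{(x, x'). x \<in> ?P \<and> x' \<in> ?P \<and> fst x = fst x' \<and> \<kappa> x = c \<and> \<kappa> x' = c'}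
      = (\<Union>v\<in>{1..n}. ?E v c \<times> ?E v c')" by (auto simp: pts_def)
  moreover have "card (\<Union>v\<in>{1..n}. ?E v c \<times> ?E v c') = (\<Sum>v\<in>{1..n}. card (?E v c \<times> ?E v c'))"
    by (intro card_UN_disjoint) auto
  ultimately show "coloured_points.vertex_pairs ?P \<kappa> c c' = (\<Sum>v\<in>{1..n}. real (k v c) * real (k v c'))"
    unfolding coloured_points.vertex_pairs_def[OF cp] by (simp add: card_cartesian_product k)
  have "{x\<in>?P. \<kappa> x = c} = (\<Union>v\<in>{1..n}. ?E v c)" by (auto simp: pts_def)
  moreover have "card (\<Union>v\<in>{1..n}. ?E v c) = (\<Sum>v\<in>{1..n}. card (?E v c))"
    by (intro card_UN_disjoint) auto
  ultimately show "coloured_points.class_size ?P \<kappa> c = (\<Sum>v\<in>{1..n}. k v c)"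
    unfolding coloured_points.class_size_def[OF cp] by (simp add: k)
qed

text \<open>The only class has \<open>n * d\<close> points, so the relative error is governed by
  \<open>d / n\<close>. The 33 is 32, from \<open>128 * (d / n)\<close> times
  \<open>d\<^sup>2 / 4\<close>, plus 1 for the error term of \<open>bad_mean_bounds\<close>.\<close>

lemma card_simple_matchings_le:
  assumes d: "0 < d" "32 * d \<le> n"
  shows "card (simple_matchings n d) \<le> pairings (n * d) * exp (- (real d ^ 2 - 1) / 4 + 33 * real d ^ 3 / real n)"
proof -
  let ?\<kappa> = "\<lambda>_. 0 :: nat"
  have n: "0 < n" using d by linarith
  have cp: "coloured_points (pts n d) ?\<kappa> d (n * d)"
  proof
    show "32 * d\<^sup>2 \<le> n * d" using mult_le_mono1[OF d(2), of d] by (simp add: power2_eq_square)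
    show "finite (pts n d)" by simp
    show "card {x\<in>pts n d. fst x = v} \<le> d" for v by (rule card_pts_vertex)
    show "n * d \<le> card {z\<in>pts n d. 0 = 0}" by (simp add: card_pts)
  qed (rule d(1))
  have im: "?\<kappa> ` pts n d = {0}"
  proof -
    have "(1, 0) \<in> pts n d" using d n by (simp add: pts_def)
    then show ?thesis by auto
  qed
  have vertex_pairs: "coloured_points.vertex_pairs (pts n d) ?\<kappa> 0 0 = real n * real d ^ 2" "coloured_points.class_size (pts n d) ?\<kappa> 0 = n * d"
  proof -
    have k: "card {x\<in>pts n d. fst x = v \<and> 0 = c} = (if c = 0 then d else 0)" if "v \<in> {1..n}" for v c :: nat
      using card_pts_vertex_eq[OF that, of d] by simp
    show "coloured_points.vertex_pairs (pts n d) ?\<kappa> 0 0 = real n * real d ^ 2" "coloured_points.class_size (pts n d) ?\<kappa> 0 = n * d"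
      using coloured_vertex_pairs(1)[OF cp, of "\<lambda>_ c. if c = 0 then d else 0" "0" "0", OF k] coloured_vertex_pairs(2)[OF cp, of "\<lambda>_ c. if c = 0 then d else 0" "0", OF k]
      by (simp_all add: power2_eq_square)
  qed
  have T: "(real n * real d ^ 2)\<^sup>2 / (real (n * d) * real (n * d)) = real d ^ 2"
    using n d by (simp add: field_simps power2_eq_square)
  define \<mu> where "\<mu> = coloured_points.bad_mean (pts n d) ?\<kappa>"
  have \<mu>: "\<mu> \<le> (real d ^ 2 - 1) / 4" "(real d ^ 2 - 1) / 4 - real d ^ 3 / (4 * real (n * d)) \<le> \<mu>"
    using coloured_points.bad_mean_bounds[OF cp] by (simp_all add: im vertex_pairs T \<mu>_def del: of_nat_mult)
  have card: "card (cmatch (pts n d) ?\<kappa>) = pairings (n * d)"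
    using card_cmatch[of "pts n d" "{0}" ?\<kappa>] by (simp add: card_pts image_subset_iff)
  have \<delta>: "real (d\<^sup>2) / real (n * d) = real d / real n" using d by (simp add: power2_eq_square)
  have "coloured_matchings n d ?\<kappa> = simple_matchings n d" by (auto simp: coloured_matchings_def)
  then have "card (simple_matchings n d) \<le> pairings (n * d) * exp (- ((1 - 128 * (real d / real n)) * \<mu>))"
    using coloured_matchings_bounds(2)[OF cp] by (simp only: card \<mu>_def \<delta>)
  also have "\<dots> \<le> pairings (n * d) * exp (- (real d ^ 2 - 1) / 4 + 33 * real d ^ 3 / real n)"
  proof (intro mult_left_mono iffD2[OF exp_le_cancel_iff])
    have "128 * (real d / real n) * \<mu> \<le> 128 * (real d / real n) * (real d ^ 2 / 4)"
      using \<mu>(1) by (intro mult_left_mono) auto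
    also have "\<dots> = 32 * (real d ^ 3 / real n)" by (simp add: power3_eq_cube power2_eq_square)
    finally have 1: "128 * (real d / real n) * \<mu> \<le> 32 * (real d ^ 3 / real n)" .
    have "real d ^ 3 / (4 * real (n * d)) \<le> real d ^ 3 / real n"
      using n d by (intro divide_left_mono) auto
    show "- ((1 - 128 * (real d / real n)) * \<mu>) \<le> - (real d ^ 2 - 1) / 4 + 33 * real d ^ 3 / real n"
    proof -
      have "(1 - 128 * (real d / real n)) * \<mu> = \<mu> - 128 * (real d / real n) * \<mu>" by (simp add: algebra_simps)
      moreover have "33 * real d ^ 3 / real n = 33 * (real d ^ 3 / real n)" by simp
      ultimately show ?thesis using 1 \<mu>(2) \<open>real d ^ 3 / (4 * real (n * d)) \<le> real d ^ 3 / real n\<close> by argo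
    qed
  qed auto
  finally show ?thesis .
qed

lemma card_selection_cell:
  assumes T: "T \<in> selections n d a" and v: "v \<in> {1..n}"
  shows "card {x\<in>pts n d. fst x = v \<and> x \<in> T} = a" "card {x\<in>pts n d. fst x = v \<and> x \<notin> T} = d - a"
proof -
  have "{x\<in>pts n d. fst x = v \<and> x \<in> T} = {x\<in>T. fst x = v}" using T by (auto simp: selections_def)
  then show "card {x\<in>pts n d. fst x = v \<and> x \<in> T} = a" using T v by (simp add: selections_def)
  have "{x\<in>pts n d. fst x = v \<and> x \<notin> T} = {x\<in>pts n d - T. fst x = v}" by auto
  then show "card {x\<in>pts n d. fst x = v \<and> x \<notin> T} = d - a" using card_compl_selection[OF T v] by simp
qed

text \<open>Every vertex has exactly \<open>a\<close> points of one colour and \<open>d - a\<close>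
  of the other, so \<open>vertex_pairs\<close> has rank one and the main sum in
  \<open>bad_mean_bounds\<close> is exactly the square of \<open>a + (d - a)\<close>.\<close>

lemma card_two_coloured_ge:
  assumes T: "T \<in> selections n d a" and a: "0 < a" "2 * a \<le> d" "32 * d\<^sup>2 \<le> n * a"
  shows "real (pairings (n * a)) * real (pairings (n * (d - a))) * exp (- (real d ^ 2 - 2) / 4 - 32 * real d ^ 4 / (real n * real a))
    \<le> card (coloured_matchings n d (\<lambda>x. x \<in> T))"
proof -
  let ?\<kappa> = "\<lambda>x. x \<in> T"
  define s where "s c = (if c then a else d - a)" for c :: bool
  have n: "0 < n" using a by (cases n) auto
  have k: "card {x\<in>pts n d. fst x = v \<and> (x \<in> T) = c} = s c" if "v \<in> {1..n}" for v c
    using card_selection_cell[OF T that] by (cases c) (simp_all add: s_def)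
  have tot: "card {x\<in>pts n d. (x \<in> T) = c} = n * s c" for c
  proof -
    have "{x\<in>pts n d. (x \<in> T) = c} = (\<Union>v\<in>{1..n}. {x\<in>pts n d. fst x = v \<and> (x \<in> T) = c})" by (auto simp: pts_def)
    moreover have "card (\<Union>v\<in>{1..n}. {x\<in>pts n d. fst x = v \<and> (x \<in> T) = c}) = (\<Sum>v\<in>{1..n}. s c)"
      by (subst card_UN_disjoint) (auto simp: k)
    ultimately show ?thesis by simp
  qed
  have cp: "coloured_points (pts n d) ?\<kappa> d (n * a)"
    by unfold_locales (use a card_pts_vertex tot in \<open>auto simp: s_def\<close>)
  have im: "?\<kappa> ` pts n d = {True, False}"
  proof -
    have "{x\<in>pts n d. (x \<in> T) = c} \<noteq> {}" for c
    proof
      assume "{x\<in>pts n d. (x \<in> T) = c} = {}"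
      then have "n * s c = 0" using tot[of c] by (metis card.empty)
      then show False using n a by (auto simp: s_def split: if_splits)
    qed
    from this[of True] this[of False] show ?thesis by (auto simp: image_iff)
  qed
  have vertex_pairs: "coloured_points.vertex_pairs (pts n d) ?\<kappa> c c' = real n * (real (s c) * real (s c'))" 
    "coloured_points.class_size (pts n d) ?\<kappa> c = n * s c" for c c'
    using coloured_vertex_pairs(1)[OF cp, of "\<lambda>_. s" c c'] coloured_vertex_pairs(2)[OF cp, of "\<lambda>_. s" c] k by auto
  define \<mu> where "\<mu> = coloured_points.bad_mean (pts n d) ?\<kappa>"
  have q: "(real n * (x * y))\<^sup>2 / ((real n * x) * (real n * y)) = x * y" for x y :: real
    using n by (cases "x = 0"; cases "y = 0") (auto simp: field_simps power2_eq_square)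
  have "\<mu> \<le> ((\<Sum>c\<in>{True, False}. \<Sum>c'\<in>{True, False}. real (s c) * real (s c')) - 2) / 4"
    using coloured_points.bad_mean_bounds(1)[OF cp] by (simp add: im vertex_pairs q \<mu>_def)
  also have "(\<Sum>c\<in>{True, False}. \<Sum>c'\<in>{True, False}. real (s c) * real (s c')) = real d ^ 2"
    using a by (simp add: s_def of_nat_diff power2_eq_square algebra_simps)
  finally have \<mu>: "\<mu> \<le> (real d ^ 2 - 2) / 4" .
  have card: "card (cmatch (pts n d) ?\<kappa>) = pairings (n * a) * pairings (n * (d - a))"
  proof -
    have sub: "?\<kappa> ` pts n d \<subseteq> {True, False}" unfolding im by simp
    show ?thesis using card_cmatch[OF finite_pts _ sub] tot[of True] tot[of False] by (simp add: s_def)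
  qed
  define \<delta> where "\<delta> = real (d\<^sup>2) / real (n * a)"
  have \<delta>: "0 \<le> \<delta>" by (simp add: \<delta>_def)
  have "real (pairings (n * a)) * real (pairings (n * (d - a))) * exp (- (real d ^ 2 - 2) / 4 - 32 * real d ^ 4 / (real n * real a))
     \<le> real (pairings (n * a)) * real (pairings (n * (d - a))) * exp (- ((1 + 128 * \<delta>) * \<mu>))"
  proof (intro mult_left_mono iffD2[OF exp_le_cancel_iff])
    have "(1 + 128 * \<delta>) * \<mu> \<le> (1 + 128 * \<delta>) * ((real d ^ 2 - 2) / 4)" using \<mu> \<delta> by (intro mult_left_mono) auto
    also have "\<dots> \<le> (real d ^ 2 - 2) / 4 + 128 * \<delta> * (real d ^ 2 / 4)" 
    proof -
      have "128 * \<delta> * ((real d ^ 2 - 2) / 4) \<le> 128 * \<delta> * (real d ^ 2 / 4)" using \<delta> by (intro mult_left_mono) auto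
      then show ?thesis by (simp only: distrib_right mult_1)
    qed
    also have "128 * \<delta> * (real d ^ 2 / 4) = 32 * real d ^ 4 / (real n * real a)"
      by (simp add: \<delta>_def power4_eq_xxxx power2_eq_square mult_ac)
    finally show "- (real d ^ 2 - 2) / 4 - 32 * real d ^ 4 / (real n * real a) \<le> - ((1 + 128 * \<delta>) * \<mu>)" by linarith
  qed auto
  also have "\<dots> \<le> card (coloured_matchings n d ?\<kappa>)"
    using coloured_matchings_bounds(1)[OF cp] by (simp add: card \<mu>_def \<delta>_def)
  finally show ?thesis .
qed

text \<open>With \<open>x\<^sub>c\<close> the sizes of the four colour classes, the last factor is the sum of the \<open>1 / x\<^sub>c\<close>, and
  \<open>(d\<^sup>2 - 4 + overlap_defect\<^sup>2) / 4\<close> is the mean number of loops and double edges up to \<open>O(d\<^sup>4 / min x\<^sub>c)\<close>.\<close>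

definition overlap_defect :: "nat \<Rightarrow> nat \<Rightarrow> nat \<Rightarrow> (nat \<Rightarrow> nat) \<Rightarrow> real" where
  "overlap_defect n d a k = (let S = real (\<Sum>v\<in>{1..n}. k v); Q = real (\<Sum>v\<in>{1..n}. (k v)\<^sup>2) in
     (Q - S\<^sup>2 / n) * (1 / S + 2 / (real (n * a) - S) + 1 / (real (n * (d - 2 * a)) + S)))"

text \<open>\<open>m\<close> is the size of the smallest colour class; below
  \<open>128 * d\<^sup>2\<close> the switching estimate is void and the trivial bound 1 replaces it.
  Capping the squared defect at 1, near which it typically lies, keeps the leading exponent below
  \<open>d\<^sup>2 / 4\<close> and hence its relative error under control.\<close>

definition simple_bound :: "nat \<Rightarrow> nat \<Rightarrow> nat \<Rightarrow> (nat \<Rightarrow> nat) \<Rightarrow> real" where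
  "simple_bound n d a k = (let S = (\<Sum>v\<in>{1..n}. k v); m = min S (n * a - S) in
     if 128 * d\<^sup>2 \<le> m then exp (- (real d ^ 2 - 4 + min 1 ((overlap_defect n d a k)\<^sup>2)) / 4 + 33 * real d ^ 4 / real m)
     else 1)"

text \<open>After expanding the square and dividing, the mixed terms carry the square of
  \<open>sum \<sigma> C\<close>, which vanishes, and the other two parts are squares of single
  sums.\<close>

lemma rank_one_perturbation_sum:
  fixes p u :: "'c \<Rightarrow> real"
  assumes C: "finite C" and u: "\<And>c. c \<in> C \<Longrightarrow> u c \<noteq> 0" and n: "n \<noteq> 0" and \<sigma>: "sum \<sigma> C = 0" 
    "\<And>c. c \<in> C \<Longrightarrow> (\<sigma> c)\<^sup>2 = 1" and s: "sum u C = n * D"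
  shows "(\<Sum>c\<in>C. \<Sum>c'\<in>C. (u c * u c' / n + \<sigma> c * \<sigma> c' * W)\<^sup>2 / (u c * u c')) = D\<^sup>2 + (W * (\<Sum>c\<in>C. 1 / u c))\<^sup>2"
proof -
  have pr: "(\<Sum>c\<in>C. \<Sum>c'\<in>C. f c * f c') = sum f C * sum f C" for f :: "'c \<Rightarrow> real"
    by (simp add: sum_product)
  have pr2: "(\<Sum>c\<in>C. \<Sum>c'\<in>C. K * (f c * f c')) = K * (sum f C * sum f C)" for f :: "'c \<Rightarrow> real" and K
    unfolding pr[symmetric] by (simp add: sum_distrib_left)
  have "(\<Sum>c\<in>C. \<Sum>c'\<in>C. (u c * u c' / n + \<sigma> c * \<sigma> c' * W)\<^sup>2 / (u c * u c')) =
     (\<Sum>c\<in>C. \<Sum>c'\<in>C. (u c / n) * (u c' / n) + (2 * W / n) * (\<sigma> c * \<sigma> c') + W\<^sup>2 * ((1 / u c) * (1 / u c')))"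
  proof (intro sum.cong refl)
    fix c c' assume c: "c \<in> C" "c' \<in> C"
    have "(u c * u c' / n + \<sigma> c * \<sigma> c' * W)\<^sup>2 = (u c * u c')\<^sup>2 / n\<^sup>2 + 2 * (u c * u c' / n) * (\<sigma> c * \<sigma> c' * W) + (\<sigma> c)\<^sup>2 * (\<sigma> c')\<^sup>2 * W\<^sup>2"
      by (simp add: power2_sum power_mult_distrib power_divide)
    also have "\<dots> = (u c * u c')\<^sup>2 / n\<^sup>2 + 2 * (u c * u c' / n) * (\<sigma> c * \<sigma> c' * W) + W\<^sup>2" using c \<sigma>(2) by simp
    finally show "(u c * u c' / n + \<sigma> c * \<sigma> c' * W)\<^sup>2 / (u c * u c') =
        (u c / n) * (u c' / n) + (2 * W / n) * (\<sigma> c * \<sigma> c') + W\<^sup>2 * ((1 / u c) * (1 / u c'))"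
      using u[OF c(1)] u[OF c(2)] n by (simp add: field_simps power2_eq_square)
  qed
  also have "\<dots> = (\<Sum>c\<in>C. u c / n) * (\<Sum>c\<in>C. u c / n) + (2 * W / n) * (sum \<sigma> C * sum \<sigma> C) + W\<^sup>2 * ((\<Sum>c\<in>C. 1 / u c) * (\<Sum>c\<in>C. 1 / u c))"
    by (simp only: sum.distrib pr[of "\<lambda>c. u c / n"] pr2[of _ \<sigma>] pr2[of _ "\<lambda>c. 1 / u c"])
  also have "(\<Sum>c\<in>C. u c / n) = D" using s n by (simp add: sum_divide_distrib[symmetric])
  finally show ?thesis using \<sigma>(1) by (simp add: power2_eq_square algebra_simps)
qed

lemma card_four_coloured_le:
  assumes T: "T \<in> selections n d a" "T' \<in> selections n d a" and a: "0 < a" "2 * a \<le> d"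
  defines "S \<equiv> (\<Sum>v\<in>{1..n}. overlap n T T' v)"
  shows "card (coloured_matchings n d (\<lambda>x. (x \<in> T, x \<in> T'))) \<le>
    real (pairings S) * real (pairings (n * a - S)) ^ 2 * real (pairings (n * (d - 2 * a) + S)) * simple_bound n d a (overlap n T T')"
proof -
  let ?\<kappa> = "\<lambda>x. (x \<in> T, x \<in> T')"
  let ?C = "{(True, True), (True, False), (False, True), (False, False)}"
  define k where "k = overlap n T T'"
  define s where "s v c = (case c of (True, True) \<Rightarrow> k v | (True, False) \<Rightarrow> a - k v | (False, True) \<Rightarrow> a - k v | (False, False) \<Rightarrow> d - 2 * a + k v)" for v c
  have TP: "T \<subseteq> pts n d" "T' \<subseteq> pts n d" using T by (auto simp: selections_def)
  have fin: "finite {x\<in>A. fst x = v}" if "A \<subseteq> pts n d" for A v using finite_subset[OF that finite_pts] by simp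
  have cells: "card {x\<in>pts n d. fst x = v \<and> ?\<kappa> x = c} = s v c \<and> k v \<le> a" if v: "v \<in> {1..n}" for v c
  proof -
    have TT: "card {x\<in>T. fst x = v} = a" "card {x\<in>T'. fst x = v} = a" using T v by (auto simp: selections_def)
    have kk: "card {x\<in>T \<inter> T'. fst x = v} = k v" using v by (simp add: k_def overlap_def)
    have ka: "k v \<le> a" using card_mono[OF fin[OF TP(1)], of "{x\<in>T \<inter> T'. fst x = v}" v] TT kk by auto
    have sub: "{x\<in>T \<inter> T'. fst x = v} \<subseteq> {x\<in>T. fst x = v}" "{x\<in>T \<inter> T'. fst x = v} \<subseteq> {x\<in>T'. fst x = v}"
      by auto
    have e1: "{x\<in>pts n d. fst x = v \<and> ?\<kappa> x = (True, True)} = {x\<in>T \<inter> T'. fst x = v}" using TP by auto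
    have "{x\<in>pts n d. fst x = v \<and> ?\<kappa> x = (True, False)} = {x\<in>T. fst x = v} - {x\<in>T \<inter> T'. fst x = v}" using TP by auto
    then have e2: "card {x\<in>pts n d. fst x = v \<and> ?\<kappa> x = (True, False)} = a - k v"
      using card_Diff_subset[OF finite_subset[OF sub(1) fin[OF TP(1)]] sub(1)] TT kk by simp
    have "{x\<in>pts n d. fst x = v \<and> ?\<kappa> x = (False, True)} = {x\<in>T'. fst x = v} - {x\<in>T \<inter> T'. fst x = v}" using TP by auto
    then have e3: "card {x\<in>pts n d. fst x = v \<and> ?\<kappa> x = (False, True)} = a - k v"
      using card_Diff_subset[OF finite_subset[OF sub(2) fin[OF TP(2)]] sub(2)] TT kk by simp
    have "{x\<in>pts n d. fst x = v \<and> ?\<kappa> x = (False, False)} = {x\<in>pts n d. fst x = v \<and> x \<notin> T} - {x\<in>pts n d. fst x = v \<and> ?\<kappa> x = (False, True)}"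
      by auto
    then have e4: "card {x\<in>pts n d. fst x = v \<and> ?\<kappa> x = (False, False)} = d - a - (a - k v)"
      using card_selection_cell(2)[OF T(1) v] e3 by (simp add: card_Diff_subset subset_iff)
    obtain c1 c2 where c: "c = (c1, c2)" by (cases c)
    show ?thesis
      using e1 kk e2 e3 e4 ka a unfolding c s_def by (cases c1; cases c2) auto
  qed
  have ka: "k v \<le> a" if "v \<in> {1..n}" for v using cells[OF that] by auto
  define u where "u c = (\<Sum>v\<in>{1..n}. s v c)" for c
  have tot: "card {x\<in>pts n d. ?\<kappa> x = c} = u c" for c
  proof -
    have "{x\<in>pts n d. ?\<kappa> x = c} = (\<Union>v\<in>{1..n}. {x\<in>pts n d. fst x = v \<and> ?\<kappa> x = c})" by (auto simp: pts_def)
    moreover have "card (\<Union>v\<in>{1..n}. {x\<in>pts n d. fst x = v \<and> ?\<kappa> x = c}) = (\<Sum>v\<in>{1..n}. s v c)"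
      by (subst card_UN_disjoint) (use cells in auto)
    ultimately show ?thesis by (simp add: u_def)
  qed
  have S: "S = (\<Sum>v\<in>{1..n}. k v)" by (simp add: S_def k_def)
  have "(\<Sum>v\<in>{1..n}. a - k v) = n * a - S" unfolding S using ka by (subst sum_subtractf_nat) auto
  then have u: "u (True, True) = S" "u (True, False) = n * a - S" "u (False, True) = n * a - S" "u (False, False) = n * (d - 2 * a) + S"
    by (simp_all add: u_def s_def S sum.distrib)
  have Sle: "S \<le> n * a" unfolding S using sum_mono[of "{1..n}" k "\<lambda>_. a"] ka by simp
  have card: "card (cmatch (pts n d) ?\<kappa>) = pairings S * (pairings (n * a - S) ^ 2 * pairings (n * (d - 2 * a) + S))"
  proof -
    have sub: "?\<kappa> ` pts n d \<subseteq> ?C" by (auto simp: split_beta)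
    show ?thesis using card_cmatch[OF finite_pts _ sub] unfolding tot by (simp add: u power2_eq_square)
  qed
  have cm: "coloured_matchings n d ?\<kappa> \<subseteq> cmatch (pts n d) ?\<kappa>"
    using coloured_simple_eq[of n d ?\<kappa>] by (auto simp: coloured_matchings_def)
  define m where "m = min S (n * a - S)"
  show ?thesis
  proof (cases "128 * d\<^sup>2 \<le> m")
    case False
    then have "simple_bound n d a k = 1" unfolding simple_bound_def Let_def S[symmetric] m_def[symmetric] by simp
    moreover have "card (coloured_matchings n d ?\<kappa>) \<le> card (cmatch (pts n d) ?\<kappa>)"
      by (intro card_mono cm finite_cmatch) simp
    then have "real (card (coloured_matchings n d ?\<kappa>)) \<le> real (card (cmatch (pts n d) ?\<kappa>))" by simp
    ultimately show ?thesis unfolding card k_def by (simp add: mult.assoc)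
  next
    case True
    have m: "m \<le> u c" for c using u Sle by (cases c) (auto simp: m_def, (metis (full_types) min.cobounded1 min.cobounded2 trans_le_add2)+)
    have d0: "0 < d" using a by simp
    then have m0: "0 < m" using True by (metis gr0I mult_is_0 not_numeral_le_zero le_zero_eq power_eq_0_iff zero_neq_numeral)
    have n0: "0 < n" using m0 Sle by (cases n) (auto simp: m_def)
    have cp: "coloured_points (pts n d) ?\<kappa> d m"
    proof
      show "m \<le> card {z \<in> pts n d. ?\<kappa> z = ?\<kappa> x}" for x unfolding tot by (rule m)
    qed (use True d0 card_pts_vertex in auto)
    have im: "?\<kappa> ` pts n d = ?C"
    proof -
      have "c \<in> ?\<kappa> ` pts n d" for c
      proof (rule ccontr)
        assume "c \<notin> ?\<kappa> ` pts n d"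
        then have "{x\<in>pts n d. ?\<kappa> x = c} = {}" by (auto simp: image_iff)
        then have "u c = 0" using tot[of c] by (metis card.empty)
        then show False using m[of c] m0 by simp
      qed
      then have "?\<kappa> ` pts n d = UNIV" by (simp add: set_eq_iff)
      also have "UNIV = ?C" by (auto simp: split_paired_all)
      finally show ?thesis .
    qed
    have vertex_pairs: "coloured_points.vertex_pairs (pts n d) ?\<kappa> c c' = (\<Sum>v\<in>{1..n}. real (s v c) * real (s v c'))" 
      "coloured_points.class_size (pts n d) ?\<kappa> c = u c" for c c'
      using coloured_vertex_pairs(1)[OF cp, of s c c'] coloured_vertex_pairs(2)[OF cp, of s c] cells by (auto simp: u_def)
    \<comment> \<open>At each vertex the four class sizes are affine functions of the overlap with
      slopes 1, -1, -1, 1. The matrix of vertex pairs is therefore a rank one matrix perturbed by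
      \<open>W\<close>, which is \<open>n\<close> times the empirical variance of the
      overlaps.\<close>
    define \<sigma> :: "bool \<times> bool \<Rightarrow> real" where "\<sigma> c = (if fst c = snd c then 1 else -1)" for c
    define p :: "bool \<times> bool \<Rightarrow> real" where "p c = (case c of (True, True) \<Rightarrow> 0 | (False, False) \<Rightarrow> real (d - 2 * a) | _ \<Rightarrow> real a)" for c
    have sp: "real (s v c) = p c + \<sigma> c * real (k v)" if "v \<in> {1..n}" for v c
      using ka[OF that] by (cases c; cases "fst c"; cases "snd c") (auto simp: s_def p_def \<sigma>_def of_nat_diff)
    define Q where "Q = real (\<Sum>v\<in>{1..n}. (k v)\<^sup>2)"
    define W where "W = Q - (real S)\<^sup>2 / real n"
    have up: "real (u c) = real n * p c + \<sigma> c * real S" for c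
      unfolding u_def S by (simp add: sp sum.distrib sum_distrib_left)
    have ZW: "(\<Sum>v\<in>{1..n}. real (s v c) * real (s v c')) = real (u c) * real (u c') / real n + \<sigma> c * \<sigma> c' * W" for c c'
    proof -
      have "(\<Sum>v\<in>{1..n}. real (s v c) * real (s v c')) = 
          (\<Sum>v\<in>{1..n}. p c * p c' + (p c * \<sigma> c' + p c' * \<sigma> c) * real (k v) + \<sigma> c * \<sigma> c' * (real (k v))\<^sup>2)"
        by (intro sum.cong refl) (simp add: sp power2_eq_square algebra_simps)
      also have "\<dots> = real n * (p c * p c') + (p c * \<sigma> c' + p c' * \<sigma> c) * real S + \<sigma> c * \<sigma> c' * Q"
        by (simp add: sum.distrib sum_distrib_left[symmetric] S Q_def)
      also have "\<dots> = real (u c) * real (u c') / real n + \<sigma> c * \<sigma> c' * W"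
        unfolding up W_def using n0 by (simp add: field_simps power2_eq_square)
      finally show ?thesis .
    qed
    define B where "B = (\<Sum>c\<in>?C. 1 / real (u c))"
    have sumC: "(\<Sum>c\<in>?C. \<Sum>c'\<in>?C. (real (u c) * real (u c') / real n + \<sigma> c * \<sigma> c' * W)\<^sup>2 / (real (u c) * real (u c'))) = (real d)\<^sup>2 + (W * B)\<^sup>2"
      unfolding B_def
    proof (rule rank_one_perturbation_sum)
      show "real (u c) \<noteq> 0" for c using m[of c] m0 by simp
      show "sum \<sigma> ?C = 0" by (simp add: \<sigma>_def)
      show "(\<sigma> c)\<^sup>2 = 1" for c by (simp add: \<sigma>_def)
      show "(\<Sum>c\<in>?C. real (u c)) = real n * real d" using a by (simp add: up p_def \<sigma>_def of_nat_diff algebra_simps)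
    qed (use n0 in auto)
    have WB: "W * B = overlap_defect n d a k"
      unfolding overlap_defect_def Let_def S[symmetric] W_def B_def Q_def using Sle by (simp add: u of_nat_diff)
    define \<mu> where "\<mu> = coloured_points.bad_mean (pts n d) ?\<kappa>"
    have \<mu>: "(real d ^ 2 + (W * B)\<^sup>2 - 4) / 4 - 4 * real d ^ 3 / (4 * real m) \<le> \<mu>"
      using coloured_points.bad_mean_bounds(2)[OF cp] unfolding im vertex_pairs ZW sumC \<mu>_def by simp
    define \<delta> where "\<delta> = real (d\<^sup>2) / real m"
    \<comment> \<open>The threshold in \<open>simple_bound\<close> makes
      \<open>1 - 128 * \<delta>\<close> nonnegative, so the lower bound on the mean may be
      multiplied by it.\<close>
    have "real (128 * d\<^sup>2) \<le> real m" using True by (simp only: of_nat_le_iff)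
    then have \<delta>: "0 \<le> \<delta>" "128 * \<delta> \<le> 1" using m0 by (auto simp: \<delta>_def field_simps)
    define L where "L = (real d ^ 2 - 4 + min 1 ((W * B)\<^sup>2)) / 4"
    have "min 1 ((W * B)\<^sup>2) \<le> (W * B)\<^sup>2" "min 1 ((W * B)\<^sup>2) \<le> 4" by auto
    moreover have "(real d ^ 2 + (W * B)\<^sup>2 - 4) / 4 - real d ^ 3 / real m \<le> \<mu>" using \<mu> by simp
    ultimately have L: "L - real d ^ 3 / real m \<le> \<mu>" "L \<le> real d ^ 2 / 4"
      unfolding L_def by argo+
    have "(1 - 128 * \<delta>) * (L - real d ^ 3 / real m) \<le> (1 - 128 * \<delta>) * \<mu>" using L \<delta> by (intro mult_left_mono) auto
    moreover have "(1 - 128 * \<delta>) * (L - real d ^ 3 / real m) = L - 128 * \<delta> * L - real d ^ 3 / real m + 128 * \<delta> * (real d ^ 3 / real m)"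
      by (simp add: algebra_simps)
    moreover have "128 * \<delta> * L \<le> 128 * \<delta> * (real d ^ 2 / 4)" using L \<delta> by (intro mult_left_mono) auto
    moreover have "128 * \<delta> * (real d ^ 2 / 4) = 32 * (real d ^ 4 / real m)"
      by (simp add: \<delta>_def power4_eq_xxxx power2_eq_square)
    moreover have "real d ^ 3 / real m \<le> real d ^ 4 / real m"
      using d0 m0 by (intro divide_right_mono power_increasing) auto
    moreover have "0 \<le> 128 * \<delta> * (real d ^ 3 / real m)" using \<delta> by simp
    ultimately have ex: "- ((1 - 128 * \<delta>) * \<mu>) \<le> - L + 33 * (real d ^ 4 / real m)" by linarith
    have "card (coloured_matchings n d ?\<kappa>) \<le> card (cmatch (pts n d) ?\<kappa>) * exp (- ((1 - 128 * \<delta>) * \<mu>))"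
      using coloured_matchings_bounds(2)[OF cp] by (simp add: \<mu>_def \<delta>_def)
    also have "\<dots> \<le> card (cmatch (pts n d) ?\<kappa>) * exp (- L + 33 * (real d ^ 4 / real m))"
      using ex by (intro mult_left_mono) auto
    also have "exp (- L + 33 * (real d ^ 4 / real m)) = simple_bound n d a k"
      using True unfolding simple_bound_def Let_def S[symmetric] m_def[symmetric] L_def WB
      by (simp only: minus_divide_left times_divide_eq_right if_True)
    finally show ?thesis unfolding card k_def by (simp add: mult.assoc)
  qed
qed

section \<open>Assembling the second moment\<close>

lemma pairings_pos: "even k \<Longrightarrow> 0 < pairings k"
  by (induction k rule: pairings.induct) auto

lemma pairings_odd: "odd k \<Longrightarrow> pairings k = 0"
  by (induction k rule: pairings.induct) auto

text \<open>Numbers of all coloured matchings, simple or not: four colours times one colour over the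
  square of two colours, at total overlap \<open>s\<close>. It vanishes for odd \<open>s\<close>,
  since a class of odd size has no perfect matching.\<close>

definition config_ratio :: "nat \<Rightarrow> nat \<Rightarrow> nat \<Rightarrow> nat \<Rightarrow> real" where
  "config_ratio n d a s = real (pairings s) * real (pairings (n * a - s)) ^ 2 * real (pairings (n * (d - 2 * a) + s))
     * real (pairings (n * d)) / (real (pairings (n * a)) * real (pairings (n * (d - a))))\<^sup>2"

lemma hyp_mean_cmult: "hyp_mean n a b (\<lambda>k. c * F k) = c * hyp_mean n a b F"
  by (simp add: hyp_mean_def sum_distrib_left mult_ac)

lemma hyp_nonneg: "0 \<le> hypergeom a b k"
  by (simp add: hypergeom_def)

lemma hyp_mean_mono: 
  "(\<And>k. k \<in> PiE {1..n} (\<lambda>_. {..a}) \<Longrightarrow> F k \<le> G k) \<Longrightarrow> hyp_mean n a b F \<le> hyp_mean n a b G"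
  unfolding hyp_mean_def by (intro sum_mono mult_left_mono prod_nonneg) (auto simp: hyp_nonneg)

text \<open>The fibre size \<open>K\<close> and the number \<open>C\<close> of selections enter both
  sides squared and cancel. The exponents of the one- and two-coloured counts combine to \<open>-
  (d\<^sup>2 - 1) / 4 + 2 * (d\<^sup>2 - 2) / 4 = (d\<^sup>2 - 3) / 4\<close>, and their errors to
  33 + 2 * 32 = 97.\<close>

theorem second_moment_bound:
  assumes a: "0 < a" "2 * a \<le> d" and n: "even n" "32 * d \<le> n" "32 * d\<^sup>2 \<le> n * a"
  defines "N1 \<equiv> real (card (regular_graphs n d))"
    and "N2 \<equiv> real (\<Sum>H\<in>regular_graphs n d. factor_count n a (d - a) H)"
    and "N4 \<equiv> real (\<Sum>H\<in>regular_graphs n d. (factor_count n a (d - a) H)\<^sup>2)"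
  shows "N4 * N1 \<le> N2\<^sup>2 * (exp ((real d ^ 2 - 3) / 4 + 97 * real d ^ 4 / real n) *
      hyp_mean n a (d - a) (\<lambda>k. config_ratio n d a (\<Sum>v\<in>{1..n}. k v) * simple_bound n d a k))"
    and "0 < N2"
proof -
  define K where "K = real (slot_orders d ^ n)"
  define b where "b = d - a"
  have d0: "0 < d" and n0: "0 < n" using a n(2) by auto
  have K: "0 < K" using slot_orders_pos[of d] by (simp add: K_def)
  define C where "C = real (d choose a) ^ n"
  have C: "0 < C" using a by (simp add: C_def)
  have ad: "a \<le> d" using a by simp
  have cs: "real (card (selections n d a)) = C" using card_selections[OF selections_nonempty[OF ad] a(2)] by (simp add: C_def)
  define M where "M = real (pairings (n * a)) * real (pairings (n * (d - a)))"
  have M: "0 < M" using n(1) by (simp add: M_def pairings_pos)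
  define A1 A2 where "A1 = - (real d ^ 2 - 1) / 4 + 33 * real d ^ 3 / real n"
    and "A2 = - (real d ^ 2 - 2) / 4 - 32 * real d ^ 4 / (real n * real a)"
  have "slot_orders d ^ n * card (regular_graphs n d) = card (simple_matchings n d)"
    using sum_over_fibres[of d n "\<lambda>_. 1"] by simp
  then have KN1: "K * N1 \<le> real (pairings (n * d)) * exp A1"
    using card_simple_matchings_le[OF d0 n(2)] unfolding K_def N1_def A1_def by (metis of_nat_mult)
  have "K * N2 = (\<Sum>T\<in>selections n d a. real (card (coloured_matchings n d (\<lambda>x. x \<in> T))))"
    using arg_cong[OF sum_factor_count[of d n a], of real] unfolding K_def N2_def by (simp add: of_nat_sum)
  also have "\<dots> \<ge> (\<Sum>T\<in>selections n d a. M * exp A2)"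
    unfolding M_def A2_def by (intro sum_mono card_two_coloured_ge a n(3))
  finally have KN2: "C * (M * exp A2) \<le> K * N2" by (simp add: cs)
  then have "0 < K * N2" using C M by (smt (verit) exp_gt_zero mult_pos_pos)
  then show N2: "0 < N2" using K by (simp add: zero_less_mult_iff)
  define F where "F k = real (pairings (\<Sum>v\<in>{1..n}. k v)) * real (pairings (n * a - (\<Sum>v\<in>{1..n}. k v))) ^ 2 *
      real (pairings (n * (d - 2 * a) + (\<Sum>v\<in>{1..n}. k v))) * simple_bound n d a k" for k
  have "K * N4 = (\<Sum>T\<in>selections n d a. \<Sum>T'\<in>selections n d a. real (card (coloured_matchings n d (\<lambda>x. (x \<in> T, x \<in> T')))))"
    using arg_cong[OF sum_factor_count_sq[of d n a], of real] unfolding K_def N4_def by (simp add: of_nat_sum)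
  also have "\<dots> \<le> (\<Sum>T\<in>selections n d a. \<Sum>T'\<in>selections n d a. F (overlap n T T'))"
    unfolding F_def by (intro sum_mono card_four_coloured_le a)
  also have "\<dots> = (\<Sum>T\<in>selections n d a. C * hyp_mean n a (d - a) F)"
    by (rule sum.cong) (auto simp: sum_selections_overlap ad C_def)
  finally have KN4: "K * N4 \<le> C\<^sup>2 * hyp_mean n a (d - a) F" by (simp add: cs power2_eq_square)
  define m where "m = real (pairings (n * d))"
  have m: "0 < m" using n(1) by (simp add: m_def pairings_pos)
  have "(\<lambda>k. config_ratio n d a (\<Sum>v\<in>{1..n}. k v) * simple_bound n d a k) = (\<lambda>k. (m / M\<^sup>2) * F k)"
    by (simp add: config_ratio_def F_def m_def M_def mult_ac)
  then have hm: "hyp_mean n a (d - a) (\<lambda>k. config_ratio n d a (\<Sum>v\<in>{1..n}. k v) * simple_bound n d a k) =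
      m / M\<^sup>2 * hyp_mean n a (d - a) F" by (simp only: hyp_mean_cmult)
  have "0 \<le> F k" for k by (simp add: F_def simple_bound_def Let_def)
  then have hF: "0 \<le> hyp_mean n a (d - a) F" unfolding hyp_mean_def by (intro sum_nonneg mult_nonneg_nonneg prod_nonneg) (auto simp: hyp_nonneg)
  have "(K * N4) * (K * N1) \<le> (C\<^sup>2 * hyp_mean n a (d - a) F) * (m * exp A1)"
    using KN1 hF K by (intro mult_mono[OF KN4]) (auto simp: m_def N1_def)
  also have "\<dots> = (C * (M * exp A2))\<^sup>2 * (exp (A1 - 2 * A2) * (m / M\<^sup>2 * hyp_mean n a (d - a) F))"
    using M by (simp add: power_mult_distrib exp_diff exp_double[symmetric] field_simps)
  also have "\<dots> \<le> (K * N2)\<^sup>2 * (exp ((real d ^ 2 - 3) / 4 + 97 * real d ^ 4 / real n) * (m / M\<^sup>2 * hyp_mean n a (d - a) F))"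
  proof (rule mult_mono[OF power_mono[OF KN2] mult_right_mono])
    have "real d ^ 3 / real n \<le> real d ^ 4 / real n" using d0 n0 by (intro divide_right_mono power_increasing) auto
    moreover have "real d ^ 4 / (real n * real a) \<le> real d ^ 4 / real n" using a n0 by (intro divide_left_mono) auto
    moreover have "A1 - 2 * A2 = (real d ^ 2 - 3) / 4 + 33 * (real d ^ 3 / real n) + 64 * (real d ^ 4 / (real n * real a))"
      by (simp add: A1_def A2_def field_simps)
    ultimately have "A1 - 2 * A2 \<le> (real d ^ 2 - 3) / 4 + 97 * (real d ^ 4 / real n)" by linarith
    then show "exp (A1 - 2 * A2) \<le> exp ((real d ^ 2 - 3) / 4 + 97 * real d ^ 4 / real n)" by simp
  qed (use C M hF m in auto)
  finally have "K\<^sup>2 * (N4 * N1) \<le> K\<^sup>2 * (N2\<^sup>2 * (exp ((real d ^ 2 - 3) / 4 + 97 * real d ^ 4 / real n) * (m / M\<^sup>2 * hyp_mean n a (d - a) F)))"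
    by (simp add: power2_eq_square mult_ac)
  then show "N4 * N1 \<le> N2\<^sup>2 * (exp ((real d ^ 2 - 3) / 4 + 97 * real d ^ 4 / real n) *
      hyp_mean n a (d - a) (\<lambda>k. config_ratio n d a (\<Sum>v\<in>{1..n}. k v) * simple_bound n d a k))"
    unfolding hm by (rule mult_left_le_imp_le) (use K in simp)
qed

section \<open>Stirling estimates for the ratio of matching numbers\<close>

text \<open>The difference of the two sides has derivative \<open>y ^ 3 / (1 + y)\<close>, which has
  the sign of \<open>y\<close>, so its minimum is at 0; this covers negative arguments as
  well.\<close>

lemma ln_add_one_le_cubic:
  fixes x :: real
  assumes "- 1 < x"
  shows "ln (1 + x) \<le> x - x\<^sup>2 / 2 + x ^ 3 / 3"
proof -
  define g where "g x = x - x\<^sup>2 / 2 + x ^ 3 / 3 - ln (1 + x)" for x :: real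
  have D: "(g has_real_derivative y ^ 3 / (1 + y)) (at y)" if "- 1 < y" for y
    unfolding g_def using that
    by (auto intro!: derivative_eq_intros simp: field_simps power2_eq_square power3_eq_cube)
  have "g 0 \<le> g x"
  proof (cases "0 \<le> x")
    case True
    show ?thesis by (rule DERIV_nonneg_imp_nondecreasing[OF True]) (use D in \<open>force intro!: exI\<close>)
  next
    case False
    then have "x \<le> 0" by simp
    moreover have "\<exists>y. (g has_real_derivative y) (at z) \<and> y \<le> 0" if "x \<le> z" "z \<le> 0" for z
    proof (intro exI conjI)
      show "(g has_real_derivative z ^ 3 / (1 + z)) (at z)" using that assms by (intro D) auto
      have "z ^ 3 \<le> 0" using that(2) by (simp add: power_le_zero_eq)
      then show "z ^ 3 / (1 + z) \<le> 0" using that assms by (intro divide_nonpos_pos) auto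
    qed
    ultimately show ?thesis by (rule DERIV_nonpos_imp_nonincreasing)
  qed
  then show ?thesis by (simp add: g_def)
qed

text \<open>The Pade approximant is just strong enough: at \<open>x = 1 / k\<close> it gives
  \<open>(k + 1/2) * ln (1 + 1 / k) \<ge> 1\<close>, which makes \<open>fact_defect\<close>
  decreasing.\<close>

lemma ln_add_one_ge_pade:
  fixes x :: real
  assumes "0 \<le> x"
  shows "2 * x / (2 + x) \<le> ln (1 + x)"
proof -
  define g where "g x = ln (1 + x) - 2 * x / (2 + x)" for x :: real
  have "\<exists>z. (g has_real_derivative z) (at y) \<and> 0 \<le> z" if "0 \<le> y" for y
  proof (intro exI conjI)
    show "(g has_real_derivative (1 / (1 + y) - 4 / (2 + y)\<^sup>2)) (at y)"
      unfolding g_def using that by (auto intro!: derivative_eq_intros simp: field_simps power2_eq_square)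
    have "1 / (1 + y) - 4 / (2 + y)\<^sup>2 = y\<^sup>2 / ((1 + y) * (2 + y)\<^sup>2)"
    proof -
      define w where "w = 2 + y"
      have w: "y = w - 2" "w \<noteq> 0" "w - 1 \<noteq> 0" using that by (auto simp: w_def)
      have "1 / (w - 1) - 4 / w\<^sup>2 = (w - 2)\<^sup>2 / ((w - 1) * w\<^sup>2)"
        using w(2,3) by (simp add: field_simps power2_eq_square)
      then show ?thesis unfolding w(1) by (simp add: algebra_simps)
    qed
    then show "0 \<le> 1 / (1 + y) - 4 / (2 + y)\<^sup>2" using that by simp
  qed
  from DERIV_nonneg_imp_nondecreasing[OF assms this] have "g 0 \<le> g x" by simp
  then show ?thesis by (simp add: g_def)
qed

text \<open>Since \<open>pairings (2 * m) = (2 * m)! / (2 ^ m * m!)\<close>, only differences of this remainder matter, and the constant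
  in Stirling's formula is not needed.\<close>

definition fact_defect :: "nat \<Rightarrow> real" where
  "fact_defect m = ln (fact m) - (real m + 1/2) * ln m + m"

text \<open>The decrease equals \<open>(k + 1/2) * ln (1 + 1 / k) - 1\<close>. Its upper bound is
  put in telescoping form, so that going from \<open>m\<close> to \<open>2 * m\<close> accumulates
  only \<open>1 / (4 * m)\<close>.\<close>

lemma fact_defect_step:
  assumes k: "0 < k"
  shows "fact_defect (Suc k) \<le> fact_defect k" 
    "fact_defect k - fact_defect (Suc k) \<le> (1 / real k - 1 / real (Suc k)) / 2"
proof -
  have "real (Suc k) = real k * (1 + 1 / real k)" using k by (simp add: field_simps)
  then have "ln (real (Suc k)) = ln (real k * (1 + 1 / real k))" by (simp only:)
  also have "\<dots> = ln (real k) + ln (1 + 1 / real k)" 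
  proof -
    have "0 < 1 + 1 / real k" by (simp add: add_pos_nonneg)
    then show ?thesis using k by (simp add: ln_mult)
  qed
  finally have l: "ln (real (Suc k)) = ln (real k) + ln (1 + 1 / real k)" .
  have "ln (fact (Suc k)) = ln (real (Suc k)) + ln (fact k)" using k by (simp add: ln_mult)
  then have eq: "fact_defect k - fact_defect (Suc k) = (real k + 1/2) * ln (1 + 1 / real k) - 1"
    unfolding fact_defect_def l by (simp add: algebra_simps)
  have "2 * (1 / real k) / (2 + 1 / real k) \<le> ln (1 + 1 / real k)" by (rule ln_add_one_ge_pade) simp
  then have "(real k + 1/2) * (2 * (1 / real k) / (2 + 1 / real k)) \<le> (real k + 1/2) * ln (1 + 1 / real k)"
    by (intro mult_left_mono) auto
  moreover have "(real k + 1/2) * (2 * (1 / real k) / (2 + 1 / real k)) = 1" using k by (simp add: field_simps)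
  ultimately show "fact_defect (Suc k) \<le> fact_defect k" using eq by simp
  have "ln (1 + 1 / real k) \<le> 1 / k - (1 / k)\<^sup>2 / 2 + (1 / k) ^ 3 / 3" by (rule ln_add_one_le_cubic) (simp add: add_pos_pos order.strict_trans2[of "-1" 0])
  then have "(real k + 1/2) * ln (1 + 1 / real k) \<le> (real k + 1/2) * (1 / k - (1 / k)\<^sup>2 / 2 + (1 / k) ^ 3 / 3)"
    by (intro mult_left_mono) auto
  also have "\<dots> = 1 + 1 / (12 * real k ^ 2) + 1 / (6 * real k ^ 3)"
    using k by (simp add: field_simps power2_eq_square power3_eq_cube)
  also have "1 / (6 * real k ^ 3) \<le> 1 / (6 * real k ^ 2)"
    using k by (intro divide_left_mono mult_left_mono power_increasing) auto
  also have "1 + 1 / (12 * real k ^ 2) + 1 / (6 * real k ^ 2) = 1 + 1 / (4 * real k ^ 2)" by (simp add: field_simps)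
  also have "1 / (4 * real k ^ 2) \<le> 1 / (2 * (real k * real (Suc k)))"
    using k by (intro divide_left_mono) (auto simp: power2_eq_square)
  also have "1 / (2 * (real k * real (Suc k))) = (1 / real k - 1 / real (Suc k)) / 2"
    using k by (simp add: field_simps)
  finally show "fact_defect k - fact_defect (Suc k) \<le> (1 / real k - 1 / real (Suc k)) / 2" using eq by linarith
qed

lemma fact_defect_double:
  assumes m: "0 < m"
  shows "fact_defect (2 * m) \<le> fact_defect m" "fact_defect m - fact_defect (2 * m) \<le> 1 / (4 * real m)"
proof -
  have "fact_defect (m + j) \<le> fact_defect m \<and> fact_defect m - fact_defect (m + j) \<le> (1 / real m - 1 / real (m + j)) / 2" for j
  proof (induction j)
    case (Suc j)
    then show ?case using fact_defect_step[of "m + j"] m by (auto simp: diff_divide_distrib)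
  qed simp
  from this[of m] have "fact_defect (m + m) \<le> fact_defect m \<and>
      fact_defect m - fact_defect (m + m) \<le> (1 / real m - 1 / real (m + m)) / 2" .
  moreover have mm: "m + m = 2 * m" by simp
  moreover have "(1 / real m - 1 / real (2 * m)) / 2 = 1 / (4 * real m)" using m by (simp add: field_simps)
  ultimately show "fact_defect (2 * m) \<le> fact_defect m" "fact_defect m - fact_defect (2 * m) \<le> 1 / (4 * real m)"
    by (simp_all only: mm)
qed

lemma pairings_fact: "pairings (2 * m) * (2 ^ m * fact m) = fact (2 * m)"
proof (induction m)
  case (Suc m)
  have "pairings (2 * Suc m) * (2 ^ Suc m * fact (Suc m)) = (2 * m + 1) * (2 * (m + 1)) * (pairings (2 * m) * (2 ^ m * fact m))"
    by (simp add: algebra_simps)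
  also have "\<dots> = (2 * m + 1) * (2 * (m + 1)) * fact (2 * m)" using Suc by simp
  also have "\<dots> = fact (2 * Suc m)" by (simp add: algebra_simps)
  finally show ?case .
qed simp

text \<open>In \<open>fact (2 * m) / (2 ^ m * fact m)\<close> the constants of Stirling's formula
  cancel, and the half logarithms of \<open>2 * m\<close> and \<open>m\<close> leave
  \<open>ln 2 / 2\<close>.\<close>

lemma ln_pairings:
  assumes N: "even N" "0 < N"
  shows "ln (real (pairings N)) \<le> ln 2 / 2 + real N / 2 * (ln (real N) - 1)"
    "ln 2 / 2 + real N / 2 * (ln (real N) - 1) - 1 / (2 * real N) \<le> ln (real (pairings N))"
proof -
  obtain m where m: "N = 2 * m" "0 < m" using N by (auto elim: evenE)
  have "real (pairings N) * (2 ^ m * fact m) = fact (2 * m)"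
    unfolding m using arg_cong[OF pairings_fact[of m], of real] by simp
  then have "ln (fact (2 * m)) = ln (real (pairings N) * (2 ^ m * fact m))" by simp
  also have "\<dots> = ln (real (pairings N)) + (m * ln 2 + ln (fact m))"
    using pairings_pos[OF N(1)] by (simp add: ln_mult ln_realpow)
  finally have "ln (real (pairings N)) = ln (fact (2 * m)) - m * ln 2 - ln (fact m)" by simp
  also have "ln (fact (2 * m)) = fact_defect (2 * m) + (2 * real m + 1 / 2) * ln (2 * m) - 2 * m" by (simp add: fact_defect_def)
  also have "ln (fact m) = fact_defect m + (real m + 1 / 2) * ln m - m" by (simp add: fact_defect_def)
  also have "ln (real (2 * m)) = ln 2 + ln m" using m by (simp add: ln_mult)
  finally have eq: "ln (real (pairings N)) = ln 2 / 2 + real N / 2 * (ln (real N) - 1) + (fact_defect (2 * m) - fact_defect m)"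
    unfolding m using m(2) by (simp add: ln_mult algebra_simps)
  show "ln (real (pairings N)) \<le> ln 2 / 2 + real N / 2 * (ln (real N) - 1)"
    "ln 2 / 2 + real N / 2 * (ln (real N) - 1) - 1 / (2 * real N) \<le> ln (real (pairings N))"
    using fact_defect_double[OF m(2)] unfolding eq by (auto simp: m)
qed

section \<open>Entropy expansion around the mean overlap\<close>

lemma xlnx_le:
  fixes m t :: real
  assumes m: "0 < m" and t: "\<bar>t\<bar> < m"
  shows "(m + t) * ln (m + t) \<le> (m + t) * ln m + t + t\<^sup>2 / (2 * m) + \<bar>t\<bar> ^ 3 / (2 * m\<^sup>2)"
proof -
  define x where "x = t / m"
  have x: "\<bar>x\<bar> < 1" "t = m * x" using assms by (auto simp: x_def)
  have "m + t = m * (1 + x)" using x(2) by (simp add: algebra_simps)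
  then have "ln (m + t) = ln m + ln (1 + x)" using m x by (simp add: ln_mult)
  then have "(m + t) * ln (m + t) = (m + t) * ln m + m * ((1 + x) * ln (1 + x))"
    using \<open>m + t = m * (1 + x)\<close> by (simp add: algebra_simps)
  moreover have "(1 + x) * ln (1 + x) \<le> x + x\<^sup>2 / 2 + \<bar>x\<bar> ^ 3 / 2"
  proof -
    have "(1 + x) * ln (1 + x) \<le> (1 + x) * (x - x\<^sup>2 / 2 + x ^ 3 / 3)"
      using x by (intro mult_left_mono ln_add_one_le_cubic) auto
    also have "\<dots> = x + x\<^sup>2 / 2 + (- (x ^ 3) / 6 + x ^ 4 / 3)"
      by (simp add: field_simps power2_eq_square power3_eq_cube power4_eq_xxxx)
    also have "- (x ^ 3) / 6 + x ^ 4 / 3 \<le> \<bar>x\<bar> ^ 3 / 6 + \<bar>x\<bar> ^ 3 / 3"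
    proof -
      have "- (x ^ 3) \<le> \<bar>x\<bar> ^ 3" by (metis abs_ge_minus_self power_abs)
      moreover have "x ^ 4 \<le> \<bar>x\<bar> ^ 3"
        using power_decreasing[of 3 4 "\<bar>x\<bar>"] x by (simp add: power_even_abs)
      ultimately show ?thesis by simp
    qed
    finally show ?thesis by simp
  qed
  then have "m * ((1 + x) * ln (1 + x)) \<le> m * (x + x\<^sup>2 / 2 + \<bar>x\<bar> ^ 3 / 2)" using m by (intro mult_left_mono) auto
  moreover have "m * (x + x\<^sup>2 / 2 + \<bar>x\<bar> ^ 3 / 2) = t + t\<^sup>2 / (2 * m) + \<bar>t\<bar> ^ 3 / (2 * m\<^sup>2)"
    using m by (simp add: x_def power_divide abs_divide field_simps power2_eq_square power3_eq_cube)
  ultimately show ?thesis by linarith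
qed

text \<open>Separates the linear bookkeeping from the nonlinear terms, which become atoms: the
  first-order terms \<open>t\<close>, \<open>- 2 * t\<close>, \<open>t\<close> cancel, and the cubic
  remainders are all replaced by the largest one.\<close>

lemma config_entropy_combine:
  fixes X1 X2 X4 Y1 Y2 Y4 t T1 T2 T4 C1 C2 C4 R1 R2 R3 T C :: real
  assumes "X1 \<le> Y1 + t + T1 + C1" "X2 \<le> Y2 + - t + T2 + C2" "X4 \<le> Y4 + t + T4 + C4" "C2 \<le> C1" "C4 \<le> C1"
    "T1 + 2 * T2 + T4 = T" "Y1 + 2 * Y2 + Y4 + R1 - R2 - R3 = 0" "4 * C1 = C"
  shows "X1 + 2 * X2 + X4 + R1 - R2 - R3 \<le> T + C"
  using assms by linarith

text \<open>The mean class sizes are \<open>a\<^sup>2\<close>, twice \<open>a * b\<close>, and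
  \<open>b\<^sup>2\<close>, each times \<open>n / d\<close>. Their logarithms are thus linear in
  those of \<open>a\<close>, \<open>b\<close> and \<open>n / d\<close>, and the zeroth-order terms
  cancel. The reciprocals of the means, with multiplicity, add up to \<open>1 / v\<close>, and the
  cubic remainders are dominated by that of the smallest class, of mean size
  \<open>\<mu>\<close>.\<close>

lemma config_entropy_le:
  fixes n a b t :: real
  assumes pos: "0 < n" "0 < a" "a \<le> b"
  defines "d \<equiv> a + b"
  defines "\<mu> \<equiv> a\<^sup>2 * n / d" and "v \<equiv> n * a\<^sup>2 * b\<^sup>2 / d ^ 3"
  assumes t: "\<bar>t\<bar> < \<mu>"
  shows "(\<mu> + t) * ln (\<mu> + t) + 2 * ((n * a - (\<mu> + t)) * ln (n * a - (\<mu> + t)))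
     + (n * (b - a) + (\<mu> + t)) * ln (n * (b - a) + (\<mu> + t)) + n * d * ln (n * d)
     - 2 * (n * a * ln (n * a)) - 2 * (n * b * ln (n * b))
     \<le> t\<^sup>2 / (2 * v) + 2 * \<bar>t\<bar> ^ 3 / \<mu>\<^sup>2"
proof -
  have b: "0 < b" and d: "0 < d" using pos by (auto simp: d_def)
  define \<mu>2 \<mu>4 where "\<mu>2 = a * b * n / d" and "\<mu>4 = b\<^sup>2 * n / d"
  have le: "\<mu> \<le> \<mu>2" "\<mu> \<le> \<mu>4" "0 < \<mu>"
    using pos b d by (auto simp: \<mu>_def \<mu>2_def \<mu>4_def power2_eq_square intro!: divide_right_mono mult_right_mono mult_mono)
  have \<mu>2: "\<mu>2 = n * a - \<mu>" and \<mu>4: "\<mu>4 = n * (b - a) + \<mu>"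
    using d by (simp_all add: \<mu>2_def \<mu>4_def \<mu>_def field_simps) (simp_all add: d_def power2_eq_square algebra_simps)
  define L where "L = ln n - ln d"
  have lns: "ln \<mu> = 2 * ln a + L" "ln \<mu>2 = ln a + ln b + L" "ln \<mu>4 = 2 * ln b + L"
    using pos b d by (simp_all add: \<mu>_def \<mu>2_def \<mu>4_def L_def ln_div ln_mult ln_realpow)
  have 1: "(\<mu> + t) * ln (\<mu> + t) \<le> (\<mu> + t) * ln \<mu> + t + t\<^sup>2 / (2 * \<mu>) + \<bar>t\<bar> ^ 3 / (2 * \<mu>\<^sup>2)"
    using le t by (intro xlnx_le) auto
  have 2: "(\<mu>2 + (- t)) * ln (\<mu>2 + (- t)) \<le> (\<mu>2 + (- t)) * ln \<mu>2 + (- t) + (- t)\<^sup>2 / (2 * \<mu>2) + \<bar>- t\<bar> ^ 3 / (2 * \<mu>2\<^sup>2)"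
    using le t by (intro xlnx_le) auto
  have 4: "(\<mu>4 + t) * ln (\<mu>4 + t) \<le> (\<mu>4 + t) * ln \<mu>4 + t + t\<^sup>2 / (2 * \<mu>4) + \<bar>t\<bar> ^ 3 / (2 * \<mu>4\<^sup>2)"
    using le t by (intro xlnx_le) auto
  have c: "\<bar>t\<bar> ^ 3 / (2 * \<mu>2\<^sup>2) \<le> \<bar>t\<bar> ^ 3 / (2 * \<mu>\<^sup>2)" "\<bar>t\<bar> ^ 3 / (2 * \<mu>4\<^sup>2) \<le> \<bar>t\<bar> ^ 3 / (2 * \<mu>\<^sup>2)"
    using le by (auto intro!: divide_left_mono mult_left_mono power_mono mult_pos_pos)
  have q: "t\<^sup>2 / (2 * \<mu>) + 2 * (t\<^sup>2 / (2 * \<mu>2)) + t\<^sup>2 / (2 * \<mu>4) = t\<^sup>2 / (2 * v)"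
  proof -
    have "1 / \<mu> + 2 / \<mu>2 + 1 / \<mu>4 = 1 / v"
    proof -
      have "1 / \<mu> + 2 / \<mu>2 + 1 / \<mu>4 = d * (b\<^sup>2 + 2 * a * b + a\<^sup>2) / (n * a\<^sup>2 * b\<^sup>2)"
        using pos b d by (simp add: \<mu>_def \<mu>2_def \<mu>4_def field_simps power2_eq_square)
      also have "b\<^sup>2 + 2 * a * b + a\<^sup>2 = d\<^sup>2" by (simp add: d_def power2_eq_square algebra_simps)
      finally show ?thesis by (simp add: v_def power2_eq_square power3_eq_cube mult_ac)
    qed
    then have "t\<^sup>2 / 2 * (1 / \<mu> + 2 / \<mu>2 + 1 / \<mu>4) = t\<^sup>2 / 2 * (1 / v)" by simp
    then show ?thesis by (simp add: algebra_simps add_divide_distrib)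
  qed
  have e2: "n * a - (\<mu> + t) = \<mu>2 + (- t)" "n * (b - a) + (\<mu> + t) = \<mu>4 + t" by (simp_all add: \<mu>2 \<mu>4)
  have lnd: "ln (n * d) = L + 2 * ln d" "ln (n * a) = L + ln d + ln a" "ln (n * b) = L + ln d + ln b"
    using pos b d by (simp_all add: ln_mult L_def)
  have lin: "(\<mu> + t) * (2 * ln a + L) + 2 * ((\<mu>2 + - t) * (ln a + ln b + L)) + (\<mu>4 + t) * (2 * ln b + L)
      + n * d * (L + 2 * ln d) - 2 * (n * a * (L + ln d + ln a)) - 2 * (n * b * (L + ln d + ln b)) = 0"
    unfolding \<mu>2 \<mu>4 d_def by (simp add: algebra_simps)
  have "(- t)\<^sup>2 = t\<^sup>2" "\<bar>- t\<bar> = \<bar>t\<bar>" by simp_all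
  note 2 = 2[unfolded this]
  have c3: "4 * (\<bar>t\<bar> ^ 3 / (2 * \<mu>\<^sup>2)) = 2 * \<bar>t\<bar> ^ 3 / \<mu>\<^sup>2" by simp
  show ?thesis unfolding e2 lnd
    by (rule config_entropy_combine[OF 1[unfolded lns] 2[unfolded lns] 4[unfolded lns] c q lin c3])
qed

lemma stirling_combine:
  fixes X U W A B D l lx lu lw ld la lb :: real
  assumes "U = A - X" "W = B - A + X" "D = A + B" 
  shows "(l / 2 + X / 2 * (lx - 1)) + 2 * (l / 2 + U / 2 * (lu - 1)) + (l / 2 + W / 2 * (lw - 1)) + (l / 2 + D / 2 * (ld - 1))
      - 2 * ((l / 2 + A / 2 * (la - 1) - 1 / (2 * A)) + (l / 2 + B / 2 * (lb - 1) - 1 / (2 * B)))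
    = l / 2 + (X * lx + 2 * (U * lu) + W * lw + D * ld - 2 * (A * la) - 2 * (B * lb)) / 2 + 1 / A + 1 / B"
  unfolding assms by (simp add: algebra_simps add_divide_distrib diff_divide_distrib)

text \<open>Five pairing numbers above the line against four below leave a single factor
  \<open>sqrt 2\<close> from \<open>ln_pairings\<close>. The entropy enters halved, as
  \<open>ln (pairings N)\<close> is about half of \<open>N * ln N\<close>; hence
  \<open>4 * v\<close> in place of \<open>2 * v\<close>.\<close>

lemma config_ratio_le:
  assumes a: "0 < a" "2 * a \<le> d" and n: "even n" "0 < n"
  defines "\<mu> \<equiv> (real a)\<^sup>2 * n / d" and "v \<equiv> real n * (real a)\<^sup>2 * (real (d - a))\<^sup>2 / real d ^ 3"
  assumes t: "\<bar>real s - \<mu>\<bar> < \<mu>"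
  shows "config_ratio n d a s \<le> sqrt 2 * exp ((real s - \<mu>)\<^sup>2 / (4 * v) + \<bar>real s - \<mu>\<bar> ^ 3 / \<mu>\<^sup>2 + 2 / (real n * real a))"
proof (cases "even s")
  case False
  then show ?thesis by (simp add: config_ratio_def pairings_odd)
next
  case True
  define b where "b = d - a"
  define \<tau> where "\<tau> = real s - \<mu>"
  have b: "0 < b" "a \<le> b" "real d = real a + real b" using a by (auto simp: b_def)
  have s: "real s = \<mu> + \<tau>" by (simp add: \<tau>_def)
  have "2 * \<mu> \<le> real n * real a"
  proof -
    have "2 * \<mu> = (2 * real a / real d) * (real n * real a)" by (simp add: \<mu>_def power2_eq_square)
    also have "\<dots> \<le> 1 * (real n * real a)" using a by (intro mult_right_mono) (auto simp: field_simps)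
    finally show ?thesis by simp
  qed
  then have "real s < real n * real a" "0 < real s" using t by auto
  then have s0: "0 < s" "s < n * a" by (auto simp flip: of_nat_mult)
  have ev: "even (n * a - s)" "even (n * (d - 2 * a) + s)" "even (n * d)" "even (n * a)" "even (n * b)"
    using n True s0 by auto
  have p: "0 < real (pairings s)" "0 < real (pairings (n * a - s))" "0 < real (pairings (n * (d - 2 * a) + s))"
     "0 < real (pairings (n * d))" "0 < real (pairings (n * a))" "0 < real (pairings (n * b))"
    using True ev by (simp_all add: pairings_pos)
  define X U W D A B where "X = real s" and "U = real (n * a - s)" and "W = real (n * (d - 2 * a) + s)"
    and "D = real (n * d)" and "A = real (n * a)" and "B = real (n * b)"
  have eqs: "X = \<mu> + \<tau>" "U = real n * real a - (\<mu> + \<tau>)" "W = real n * (real b - real a) + (\<mu> + \<tau>)"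
      "D = real n * real d" "A = real n * real a" "B = real n * real b"
    using s0 a s by (simp_all add: X_def U_def W_def D_def A_def B_def of_nat_diff b_def)
  have rel: "U = A - X" "W = B - A + X" "D = A + B" unfolding eqs b(3) by (simp_all add: algebra_simps)
  have pos: "0 < n * a - s" "0 < n * (d - 2 * a) + s" "0 < n * d" "0 < n * a" "0 < n * b"
    using s0 a n b by simp_all
  have up: "ln (pairings s) \<le> ln 2 / 2 + X / 2 * (ln X - 1)" "ln (pairings (n * a - s)) \<le> ln 2 / 2 + U / 2 * (ln U - 1)"
      "ln (pairings (n * (d - 2 * a) + s)) \<le> ln 2 / 2 + W / 2 * (ln W - 1)" "ln (pairings (n * d)) \<le> ln 2 / 2 + D / 2 * (ln D - 1)"
    unfolding X_def U_def W_def D_def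
    using ln_pairings(1)[OF True s0(1)] ln_pairings(1)[OF ev(1) pos(1)] ln_pairings(1)[OF ev(2) pos(2)] ln_pairings(1)[OF ev(3) pos(3)]
    by blast+
  have lo: "ln 2 / 2 + A / 2 * (ln A - 1) - 1 / (2 * A) \<le> ln (pairings (n * a))"
     "ln 2 / 2 + B / 2 * (ln B - 1) - 1 / (2 * B) \<le> ln (pairings (n * b))"
    unfolding A_def B_def using ln_pairings(2)[OF ev(4) pos(4)] ln_pairings(2)[OF ev(5) pos(5)] by blast+
  have ent: "X * ln X + 2 * (U * ln U) + W * ln W + D * ln D - 2 * (A * ln A) - 2 * (B * ln B) \<le> \<tau>\<^sup>2 / (2 * v) + 2 * \<bar>\<tau>\<bar> ^ 3 / \<mu>\<^sup>2"
    unfolding eqs using config_entropy_le[of "real n" "real a" "real b" \<tau>, folded b(3)] n a b t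
    unfolding \<mu>_def[symmetric] v_def[folded b_def, symmetric] \<tau>_def by simp
  have "1 / (real n * real b) \<le> 1 / (real n * real a)" using a b n by (intro divide_left_mono mult_left_mono) auto
  moreover have "2 / (real n * real a) = 1 / (real n * real a) + 1 / (real n * real a)" by simp
  ultimately have AB: "1 / A + 1 / B \<le> 2 / (real n * real a)" unfolding eqs by argo
  have "ln (config_ratio n d a s) = ln (pairings s) + 2 * ln (pairings (n * a - s)) + ln (pairings (n * (d - 2 * a) + s))
      + ln (pairings (n * d)) - 2 * (ln (pairings (n * a)) + ln (pairings (n * b)))"
    unfolding config_ratio_def b_def[symmetric] using p
    by (simp add: ln_div ln_mult ln_realpow)
  also have "\<dots> \<le> (ln 2 / 2 + X / 2 * (ln X - 1)) + 2 * (ln 2 / 2 + U / 2 * (ln U - 1)) + (ln 2 / 2 + W / 2 * (ln W - 1))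
      + (ln 2 / 2 + D / 2 * (ln D - 1))
      - 2 * ((ln 2 / 2 + A / 2 * (ln A - 1) - 1 / (2 * A)) + (ln 2 / 2 + B / 2 * (ln B - 1) - 1 / (2 * B)))"
    by (rule diff_mono[OF add_mono[OF add_mono[OF add_mono[OF up(1) mult_left_mono[OF up(2)]] up(3)] up(4)] mult_left_mono[OF add_mono[OF lo]]]) simp_all
  also have "\<dots> = ln 2 / 2 + (X * ln X + 2 * (U * ln U) + W * ln W + D * ln D - 2 * (A * ln A) - 2 * (B * ln B)) / 2 + 1 / A + 1 / B"
    by (rule stirling_combine[OF rel])
  also have "\<dots> \<le> ln 2 / 2 + (\<tau>\<^sup>2 / (2 * v) + 2 * \<bar>\<tau>\<bar> ^ 3 / \<mu>\<^sup>2) / 2 + 2 / (real n * real a)"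
    using divide_right_mono[OF ent, of 2] AB by linarith
  also have "\<dots> = ln 2 / 2 + (\<tau>\<^sup>2 / (4 * v) + \<bar>\<tau>\<bar> ^ 3 / \<mu>\<^sup>2 + 2 / (real n * real a))"
    by (simp add: add_divide_distrib)
  finally have "ln (config_ratio n d a s) \<le> \<dots>" .
  moreover have "0 < config_ratio n d a s" unfolding config_ratio_def b_def[symmetric] using p by simp
  ultimately have "config_ratio n d a s \<le> exp (ln 2 / 2 + (\<tau>\<^sup>2 / (4 * v) + \<bar>\<tau>\<bar> ^ 3 / \<mu>\<^sup>2 + 2 / (real n * real a)))"
    by (metis exp_le_cancel_iff exp_ln)
  also have "\<dots> = sqrt 2 * exp (\<tau>\<^sup>2 / (4 * v) + \<bar>\<tau>\<bar> ^ 3 / \<mu>\<^sup>2 + 2 / (real n * real a))"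
    by (simp add: exp_add ln_sqrt[symmetric])
  finally show ?thesis by (simp add: \<tau>_def)
qed

lemma pairings_real_step: "real (pairings (x + 2)) = (real x + 1) * real (pairings x)"
  by (simp add: algebra_simps)

lemma config_ratio_step:
  assumes "s + 2 \<le> n * a"
  shows "config_ratio n d a (s + 2) * (real (n * a) - real s - 1)\<^sup>2 = config_ratio n d a s * ((real s + 1) * (real (n * (d - 2 * a)) + real s + 1))"
proof -
  have "n * a - s = Suc (Suc (n * a - (s + 2)))" using assms by simp
  then have "pairings (n * a - s) = Suc (n * a - (s + 2)) * pairings (n * a - (s + 2))" by (metis pairings.simps(3))
  then have "real (pairings (n * a - s)) = real (Suc (n * a - (s + 2))) * real (pairings (n * a - (s + 2)))"
    by (metis of_nat_mult)
  also have "real (Suc (n * a - (s + 2))) = real (n * a) - real s - 1" using assms by (simp add: of_nat_diff)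
  finally have 1: "real (pairings (n * a - s)) = (real (n * a) - real s - 1) * real (pairings (n * a - (s + 2)))" .
  note 2 = pairings_real_step[of s]
  have 3: "real (pairings (n * (d - 2 * a) + (s + 2))) = (real (n * (d - 2 * a)) + real s + 1) * real (pairings (n * (d - 2 * a) + s))"
    using pairings_real_step[of "n * (d - 2 * a) + s"] by (simp only: add.assoc[symmetric] of_nat_add)
  show ?thesis unfolding config_ratio_def 1 2 3 by (simp only: power_mult_distrib times_divide_eq_left times_divide_eq_right mult_ac)
qed

section \<open>Hypergeometric overlaps\<close>

lemma hyp_step:
  assumes "k < a" "a \<le> b"
  shows "hypergeom a b (Suc k) * (real (Suc k) * (real (b - a) + real (Suc k))) = hypergeom a b k * (real a - real k)\<^sup>2"
proof -
  define j where "j = a - Suc k"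
  have j: "a - k = Suc j" "a - Suc k = j" "b - j = b - a + Suc k" using assms by (auto simp: j_def)
  have 1: "Suc k * (a choose Suc k) = (a - k) * (a choose k)"
    using binomial_absorption[of k a] binomial_absorb_comp[of a k] by simp
  have 2: "Suc j * (b choose Suc j) = (b - j) * (b choose j)"
    using binomial_absorption[of j b] binomial_absorb_comp[of b j] by simp
  have "(a choose Suc k) * (b choose j) * (Suc k * (b - a + Suc k)) = (Suc k * (a choose Suc k)) * ((b - j) * (b choose j))"
    unfolding j(3) by (simp only: mult_ac)
  also have "\<dots> = ((a choose k) * (b choose (Suc j))) * (a - k)\<^sup>2"
    unfolding 1 2[symmetric] j(1) by (simp only: mult_ac power2_eq_square)
  finally have "real ((a choose Suc k) * (b choose j)) * real (Suc k * (b - a + Suc k)) = real ((a choose k) * (b choose (Suc j))) * real ((a - k)\<^sup>2)"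
    by (metis of_nat_mult)
  moreover have "real (Suc k * (b - a + Suc k)) = real (Suc k) * (real (b - a) + real (Suc k))" by (simp only: of_nat_mult of_nat_add)
  moreover have "real ((a - k)\<^sup>2) = (real a - real k)\<^sup>2" using assms by (simp add: of_nat_diff)
  ultimately have e: "real ((a choose Suc k) * (b choose j)) * (real (Suc k) * (real (b - a) + real (Suc k)))
      = real ((a choose k) * (b choose (Suc j))) * (real a - real k)\<^sup>2"
    by (simp only:)
  show ?thesis unfolding hypergeom_def j(1,2) times_divide_eq_left e ..
qed

text \<open>A Stein-type identity obtained by summing \<open>hyp_step\<close>. With constant
  \<open>F\<close> the second moments on the two sides cancel and the mean remains; with
  \<open>F = real\<close> the third moments cancel and the second moment remains.\<close>

lemma hyp_shift_sum:
  assumes "a \<le> b"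
  shows "(\<Sum>k\<le>a. hypergeom a b k * (real k * (real (b - a) + real k)) * F k) = (\<Sum>k\<le>a. hypergeom a b k * (real a - real k)\<^sup>2 * F (Suc k))"
proof -
  have "(\<Sum>k\<le>a. hypergeom a b k * (real k * (real (b - a) + real k)) * F k) =
     (\<Sum>k<a. hypergeom a b (Suc k) * (real (Suc k) * (real (b - a) + real (Suc k))) * F (Suc k))"
    by (subst sum.atMost_shift) simp
  also have "\<dots> = (\<Sum>k<a. hypergeom a b k * (real a - real k)\<^sup>2 * F (Suc k))"
    by (rule sum.cong[OF refl]) (simp only: hyp_step assms lessThan_iff)
  also have "\<dots> = (\<Sum>k\<le>a. hypergeom a b k * (real a - real k)\<^sup>2 * F (Suc k))"
    by (simp add: lessThan_Suc_atMost[symmetric])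
  finally show ?thesis .
qed

lemma hyp_first_moment:
  assumes "0 < a" "a \<le> b"
  shows "(\<Sum>k\<le>a. hypergeom a b k * real k) = (real a)\<^sup>2 / real (a + b)"
proof -
  define m q where "m = (\<Sum>k\<le>a. hypergeom a b k * real k)" and "q = (\<Sum>k\<le>a. hypergeom a b k * (real k)\<^sup>2)"
  have "(\<Sum>k\<le>a. hypergeom a b k * (real k * (real (b - a) + real k)) * 1) = (\<Sum>k\<le>a. real (b - a) * (hypergeom a b k * real k) + hypergeom a b k * (real k)\<^sup>2)"
    by (rule sum.cong[OF refl]) (simp add: algebra_simps power2_eq_square)
  also have "\<dots> = real (b - a) * m + q" by (simp add: sum.distrib sum_distrib_left m_def q_def)
  finally have 1: "(\<Sum>k\<le>a. hypergeom a b k * (real k * (real (b - a) + real k)) * 1) = real (b - a) * m + q" .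
  have "(\<Sum>k\<le>a. hypergeom a b k * (real a - real k)\<^sup>2 * 1) = (\<Sum>k\<le>a. (real a)\<^sup>2 * hypergeom a b k - 2 * real a * (hypergeom a b k * real k) + hypergeom a b k * (real k)\<^sup>2)"
    by (rule sum.cong[OF refl]) (simp add: algebra_simps power2_eq_square)
  also have "\<dots> = (real a)\<^sup>2 - 2 * real a * m + q"
    using sum_hyp[OF assms(2)] by (simp add: sum.distrib sum_subtractf sum_distrib_left[symmetric] m_def q_def)
  finally have "real (b - a) * m + q = (real a)\<^sup>2 - 2 * real a * m + q"
    using 1 hyp_shift_sum[OF assms(2), of "\<lambda>_. 1"] by simp
  then have "real (a + b) * m = (real a)\<^sup>2" using assms by (simp add: of_nat_diff algebra_simps)
  then show ?thesis using assms by (simp add: m_def field_simps)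
qed

lemma hyp_second_moment:
  assumes "0 < a" "a \<le> b"
  defines "m \<equiv> (real a)\<^sup>2 / real (a + b)"
  shows "(\<Sum>k\<le>a. hypergeom a b k * (real k)\<^sup>2) = m\<^sup>2 + (real a)\<^sup>2 * (real b)\<^sup>2 / ((real (a + b))\<^sup>2 * (real (a + b) - 1))"
proof -
  define q r where "q = (\<Sum>k\<le>a. hypergeom a b k * (real k)\<^sup>2)" and "r = (\<Sum>k\<le>a. hypergeom a b k * (real k) ^ 3)"
  have m: "(\<Sum>k\<le>a. hypergeom a b k * real k) = m" using hyp_first_moment[OF assms(1,2)] by (simp add: m_def)
  have "(\<Sum>k\<le>a. hypergeom a b k * (real k * (real (b - a) + real k)) * real k) = (\<Sum>k\<le>a. real (b - a) * (hypergeom a b k * (real k)\<^sup>2) + hypergeom a b k * (real k) ^ 3)"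
    by (rule sum.cong[OF refl]) (simp add: algebra_simps power2_eq_square power3_eq_cube)
  also have "\<dots> = real (b - a) * q + r" by (simp add: sum.distrib sum_distrib_left r_def q_def)
  finally have 1: "(\<Sum>k\<le>a. hypergeom a b k * (real k * (real (b - a) + real k)) * real k) = real (b - a) * q + r" .
  have "(\<Sum>k\<le>a. hypergeom a b k * (real a - real k)\<^sup>2 * real (Suc k)) = 
     (\<Sum>k\<le>a. (real a)\<^sup>2 * (hypergeom a b k * real k) - 2 * real a * (hypergeom a b k * (real k)\<^sup>2) + hypergeom a b k * (real k) ^ 3
       + (real a)\<^sup>2 * hypergeom a b k - 2 * real a * (hypergeom a b k * real k) + hypergeom a b k * (real k)\<^sup>2)"
    by (rule sum.cong[OF refl]) (simp add: algebra_simps power2_eq_square power3_eq_cube)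
  also have "\<dots> = (real a)\<^sup>2 * m - 2 * real a * q + r + (real a)\<^sup>2 - 2 * real a * m + q"
    using sum_hyp[OF assms(2)] m by (simp add: sum.distrib sum_subtractf sum_distrib_left[symmetric] r_def q_def)
  finally have "real (b - a) * q + r = (real a)\<^sup>2 * m - 2 * real a * q + r + (real a)\<^sup>2 - 2 * real a * m + q"
    using 1 hyp_shift_sum[OF assms(2), of real] by simp
  then have *: "(real (a + b) - 1) * q = (real a)\<^sup>2 * (m + 1) - 2 * real a * m"
    using assms by (simp add: of_nat_diff algebra_simps)
  define A B where "A = real a" and "B = real b"
  have AB: "0 < A" "A \<le> B" "A + B - 1 \<noteq> 0" "A + B \<noteq> 0" using assms by (auto simp: A_def B_def)
  have "(A + B - 1) * q = A\<^sup>2 * (A\<^sup>2 / (A + B) + 1) - 2 * A * (A\<^sup>2 / (A + B))"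
    using * by (simp add: m_def A_def B_def)
  also have "\<dots> = (A + B - 1) * ((A\<^sup>2 / (A + B))\<^sup>2 + A\<^sup>2 * B\<^sup>2 / ((A + B)\<^sup>2 * (A + B - 1)))"
  proof -
    define D where "D = A + B"
    have B: "D - A = B" by (simp add: D_def)
    have D: "D \<noteq> 0" "D - 1 \<noteq> 0" using AB by (auto simp: D_def)
    have "A\<^sup>2 * (A\<^sup>2 / D + 1) - 2 * A * (A\<^sup>2 / D) = (D - 1) * ((A\<^sup>2 / D)\<^sup>2 + A\<^sup>2 * (D - A)\<^sup>2 / (D\<^sup>2 * (D - 1)))"
      using D by (simp add: field_simps power2_eq_square)
    then show ?thesis unfolding B unfolding D_def .
  qed
  finally have "q = (A\<^sup>2 / (A + B))\<^sup>2 + A\<^sup>2 * B\<^sup>2 / ((A + B)\<^sup>2 * (A + B - 1))" using AB(3) by (simp only: mult_cancel_left) simp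
  then show ?thesis by (simp add: q_def A_def B_def m_def)
qed

section \<open>Moment generating functions of the overlap\<close>

lemma exp_le_quadratic_neg: "x \<le> 0 \<Longrightarrow> exp x \<le> 1 + x + x\<^sup>2 / 2" for x :: real
proof -
  assume x: "x \<le> 0"
  define w where "w x = 1 + x + x\<^sup>2 / 2 - exp x" for x :: real
  have "\<exists>y. (w has_real_derivative y) (at z) \<and> y \<le> 0" for z
  proof (intro exI[of _ "1 + z - exp z"] conjI)
    show "(w has_real_derivative 1 + z - exp z) (at z)" unfolding w_def by (auto intro!: derivative_eq_intros)
    show "1 + z - exp z \<le> 0" using exp_ge_add_one_self[of z] by simp
  qed
  then have "w 0 \<le> w x" by (rule DERIV_nonpos_imp_nonincreasing[OF x])
  then show ?thesis by (simp add: w_def)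
qed

lemma exp_le_cubic: "\<bar>x\<bar> \<le> 1 \<Longrightarrow> exp x \<le> 1 + x + x\<^sup>2 / 2 + \<bar>x\<bar> ^ 3" for x :: real
proof (cases "0 \<le> x")
  case False
  then show ?thesis using exp_le_quadratic_neg[of x] zero_le_power_abs[of x 3] by linarith
next
  case True
  assume x: "\<bar>x\<bar> \<le> 1"
  define w where "w x = 1 + x + x\<^sup>2 / 2 + x ^ 3 - exp x" for x :: real
  have "\<exists>y. (w has_real_derivative y) (at z) \<and> 0 \<le> y" if "0 \<le> z" "z \<le> x" for z
  proof (intro exI[of _ "1 + z + 3 * z\<^sup>2 - exp z"] conjI)
    show "(w has_real_derivative 1 + z + 3 * z\<^sup>2 - exp z) (at z)"
      unfolding w_def by (auto intro!: derivative_eq_intros)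
    have "exp z \<le> 1 + z + z\<^sup>2" using that x by (intro exp_bound) auto
    then show "0 \<le> 1 + z + 3 * z\<^sup>2 - exp z" using zero_le_power2[of z] by linarith
  qed
  then have "w 0 \<le> w x" by (rule DERIV_nonneg_imp_nondecreasing[OF True])
  then show ?thesis using True by (simp add: w_def)
qed

text \<open>In the third-order Taylor bound the linear term averages to 0, and the cubic term is at
  most \<open>a\<close> times the square because deviations from the mean do not exceed
  \<open>a\<close>; so only multiples of the variance \<open>V\<close> remain.\<close>

lemma hyp_mgf:
  assumes ab: "0 < a" "a \<le> b" and \<theta>: "\<bar>\<theta>\<bar> * real a \<le> 1"
  defines "m \<equiv> (real a)\<^sup>2 / real (a + b)" and "V \<equiv> (real a)\<^sup>2 * (real b)\<^sup>2 / ((real (a + b))\<^sup>2 * (real (a + b) - 1))"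
  shows "(\<Sum>k\<le>a. hypergeom a b k * exp (\<theta> * (real k - m))) \<le> exp (\<theta>\<^sup>2 * V / 2 + \<bar>\<theta>\<bar> ^ 3 * real a * V)"
proof -
  have m: "0 \<le> m" "m \<le> real a"
    using ab by (auto simp: m_def field_simps power2_eq_square)
  have M1: "(\<Sum>k\<le>a. hypergeom a b k * real k) = m" and M2: "(\<Sum>k\<le>a. hypergeom a b k * (real k)\<^sup>2) = m\<^sup>2 + V"
    using hyp_first_moment[OF ab] hyp_second_moment[OF ab] by (simp_all add: m_def V_def)
  have c1: "(\<Sum>k\<le>a. hypergeom a b k * (real k - m)) = 0"
    using M1 sum_hyp[OF ab(2)] by (simp add: right_diff_distrib sum_subtractf sum_distrib_right[symmetric])
  have "(\<Sum>k\<le>a. hypergeom a b k * (real k - m)\<^sup>2) = (\<Sum>k\<le>a. hypergeom a b k * (real k)\<^sup>2 - 2 * m * (hypergeom a b k * real k) + m\<^sup>2 * hypergeom a b k)"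
    by (rule sum.cong[OF refl]) (simp add: algebra_simps power2_eq_square)
  also have "\<dots> = V" using M1 M2 sum_hyp[OF ab(2)]
    by (simp add: sum.distrib sum_subtractf sum_distrib_left[symmetric] power2_eq_square)
  finally have c2: "(\<Sum>k\<le>a. hypergeom a b k * (real k - m)\<^sup>2) = V" .
  have "(\<Sum>k\<le>a. hypergeom a b k * exp (\<theta> * (real k - m))) \<le>
     (\<Sum>k\<le>a. hypergeom a b k * (1 + \<theta> * (real k - m) + (\<theta>\<^sup>2 / 2 + \<bar>\<theta>\<bar> ^ 3 * real a) * (real k - m)\<^sup>2))"
  proof (intro sum_mono mult_left_mono hyp_nonneg)
    fix k assume "k \<in> {..a}"
    then have k: "\<bar>real k - m\<bar> \<le> real a" using m by auto
    have "\<bar>\<theta> * (real k - m)\<bar> \<le> \<bar>\<theta>\<bar> * real a" using k by (simp add: abs_mult mult_left_mono)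
    then have "exp (\<theta> * (real k - m)) \<le> 1 + \<theta> * (real k - m) + (\<theta> * (real k - m))\<^sup>2 / 2 + \<bar>\<theta> * (real k - m)\<bar> ^ 3"
      using \<theta> by (intro exp_le_cubic) auto
    also have "\<bar>\<theta> * (real k - m)\<bar> ^ 3 = \<bar>\<theta>\<bar> ^ 3 * (\<bar>real k - m\<bar> * (real k - m)\<^sup>2)"
    proof -
      have "\<bar>y\<bar> ^ 3 = \<bar>y\<bar> * \<bar>y\<bar>\<^sup>2" for y :: real by (simp only: power3_eq_cube power2_eq_square mult.assoc)
      then show ?thesis by (simp add: abs_mult power_mult_distrib)
    qed
    also have "\<dots> \<le> \<bar>\<theta>\<bar> ^ 3 * (real a * (real k - m)\<^sup>2)"
      using k by (intro mult_left_mono mult_right_mono) auto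
    finally show "exp (\<theta> * (real k - m)) \<le> 1 + \<theta> * (real k - m) + (\<theta>\<^sup>2 / 2 + \<bar>\<theta>\<bar> ^ 3 * real a) * (real k - m)\<^sup>2"
      by (simp add: distrib_right power_mult_distrib mult.assoc)
  qed
  also have "\<dots> = (\<Sum>k\<le>a. hypergeom a b k + \<theta> * (hypergeom a b k * (real k - m)) + (\<theta>\<^sup>2 / 2 + \<bar>\<theta>\<bar> ^ 3 * real a) * (hypergeom a b k * (real k - m)\<^sup>2))"
    by (rule sum.cong[OF refl]) (simp only: distrib_left mult_1_right mult_ac)
  also have "\<dots> = 1 + (\<theta>\<^sup>2 / 2 + \<bar>\<theta>\<bar> ^ 3 * real a) * V"
    unfolding sum.distrib sum_distrib_left[symmetric] c1 c2 sum_hyp[OF ab(2)] by simp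
  also have "\<dots> \<le> exp ((\<theta>\<^sup>2 / 2 + \<bar>\<theta>\<bar> ^ 3 * real a) * V)" by (rule exp_ge_add_one_self)
  finally show ?thesis by (simp add: algebra_simps)
qed

section \<open>Parity of the total overlap\<close>

lemma hyp_step_ge:
  assumes "k < a" "a \<le> b"
  shows "hypergeom a b k \<le> real (a * b) * hypergeom a b (Suc k)"
proof -
  have "hypergeom a b k * 1 \<le> hypergeom a b k * (real a - real k)\<^sup>2"
    using assms hyp_nonneg by (intro mult_left_mono) (auto simp: one_le_power)
  also have "\<dots> = hypergeom a b (Suc k) * (real (Suc k) * (real (b - a) + real (Suc k)))" using hyp_step[OF assms] by simp
  also have "\<dots> \<le> hypergeom a b (Suc k) * (real a * real b)"
    using assms hyp_nonneg by (intro mult_left_mono mult_mono) (auto simp: of_nat_diff)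
  finally show ?thesis by (simp add: mult.commute)
qed

text \<open>Raising \<open>k\<close> by one changes its parity and lowers the tilted weight at most
  by the factor \<open>1 / (a + b)\<^sup>2\<close>, so neither parity class can carry almost all the
  mass. The gain per vertex is small, but its \<open>n\<close>-th power makes the signed mean
  negligible when \<open>n\<close> is much larger than \<open>(a + b)\<^sup>2\<close>.\<close>

lemma hyp_parity:
  assumes ab: "0 < a" "a \<le> b" and \<theta>: "\<bar>\<theta>\<bar> * real a \<le> 1"
  shows "\<bar>\<Sum>k\<le>a. hypergeom a b k * ((-1) ^ k * exp (\<theta> * (real k - m)))\<bar>
    \<le> (1 - 1 / (2 * (real (a + b))\<^sup>2)) * (\<Sum>k\<le>a. hypergeom a b k * exp (\<theta> * (real k - m)))"
proof -
  define w where "w k = hypergeom a b k * exp (\<theta> * (real k - m))" for k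
  define c where "c = 1 / (real (a + b))\<^sup>2"
  define P where "P r = (\<Sum>k\<le>a. if even k = r then w k else 0)" for r
  have w0: "0 \<le> w k" for k by (simp add: w_def hyp_nonneg)
  have P0: "0 \<le> P r" for r by (auto simp: P_def w0 intro: sum_nonneg)
  have "2 \<le> real (a + b)" using ab by simp
  then have "2\<^sup>2 \<le> (real (a + b))\<^sup>2" by (intro power_mono) auto
  then have c: "0 < c" "c \<le> 1 / 4" using ab by (auto simp: c_def field_simps)
  have "\<bar>\<theta>\<bar> * 1 \<le> \<bar>\<theta>\<bar> * real a" using ab by (intro mult_left_mono) auto
  then have \<theta>1: "\<bar>\<theta>\<bar> \<le> 1" using \<theta> by simp
  have ex: "exp \<theta> \<le> 3" "1 / 3 \<le> exp \<theta>"
  proof -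
    have "exp \<theta> \<le> exp 1" using \<theta>1 by simp
    then show "exp \<theta> \<le> 3" using e_less_272 by linarith
    have "exp (- \<theta>) \<le> exp 1" using \<theta>1 by simp
    then have "exp (- \<theta>) \<le> 3" using e_less_272 by linarith
    then show "1 / 3 \<le> exp \<theta>" by (simp add: exp_minus field_simps)
  qed
  have wS: "w (Suc k) = hypergeom a b (Suc k) * (exp (\<theta> * (real k - m)) * exp \<theta>)" for k
    by (simp add: w_def exp_add[symmetric] algebra_simps)
  have step: "c * w k \<le> w (Suc k)" if k: "k < a" for k
  proof -
    have "4 * (real a * real b) \<le> (real (a + b))\<^sup>2"
      using zero_le_power2[of "real a - real b"] by (simp add: power2_eq_square algebra_simps)
    then have "real (a * b) \<le> 1 / (4 * c)" by (simp add: c_def)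
    then have "hypergeom a b k \<le> 1 / (4 * c) * hypergeom a b (Suc k)"
      using hyp_step_ge[OF k ab(2)] hyp_nonneg[of a b "Suc k"] by (meson mult_right_mono order.trans)
    then have "c * hypergeom a b k \<le> hypergeom a b (Suc k) * (1 / 4)" using c by (simp add: field_simps)
    also have "\<dots> \<le> hypergeom a b (Suc k) * exp \<theta>" using ex hyp_nonneg by (intro mult_left_mono) auto
    finally have "c * hypergeom a b k * exp (\<theta> * (real k - m)) \<le> hypergeom a b (Suc k) * exp \<theta> * exp (\<theta> * (real k - m))"
      by (intro mult_right_mono) auto
    then show ?thesis unfolding wS by (simp add: w_def mult_ac)
  qed
  \<comment> \<open>The shift from \<open>k\<close> to \<open>Suc k\<close> does not cover
    \<open>k = a\<close>, which is compared with its predecessor instead.\<close>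
  have top: "w a \<le> 3 * w (a - 1)"
  proof -
    have "hypergeom a b (Suc (a - 1)) * (real (Suc (a - 1)) * (real (b - a) + real (Suc (a - 1)))) = hypergeom a b (a - 1) * (real a - real (a - 1))\<^sup>2"
      using ab by (intro hyp_step) auto
    then have "hypergeom a b a * (real a * real b) = hypergeom a b (a - 1)" using ab by (simp add: of_nat_diff)
    moreover have "hypergeom a b a * 1 \<le> hypergeom a b a * (real a * real b)"
      using ab hyp_nonneg by (intro mult_left_mono) (auto simp: mult_ge1_I)
    ultimately have "hypergeom a b a \<le> hypergeom a b (a - 1)" by simp
    then have "hypergeom a b a * exp \<theta> \<le> hypergeom a b (a - 1) * 3" using ex hyp_nonneg by (intro mult_mono) auto
    then have le: "hypergeom a b a * exp \<theta> * exp (\<theta> * (real (a - 1) - m)) \<le> hypergeom a b (a - 1) * 3 * exp (\<theta> * (real (a - 1) - m))"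
      by (intro mult_right_mono) auto
    have "Suc (a - 1) = a" using ab by simp
    then have "w a = hypergeom a b a * (exp (\<theta> * (real (a - 1) - m)) * exp \<theta>)" using wS[of "a - 1"] by (simp only:)
    also have "\<dots> = hypergeom a b a * exp \<theta> * exp (\<theta> * (real (a - 1) - m))" by (simp only: mult_ac)
    also note le
    also have "hypergeom a b (a - 1) * 3 * exp (\<theta> * (real (a - 1) - m)) = 3 * w (a - 1)" by (simp only: w_def mult_ac)
    finally show ?thesis .
  qed
  have comp: "c / 2 * P r \<le> P (\<not> r)" for r
  proof -
    have "(\<Sum>k<a. if even k = r then c * w k else 0) \<le> (\<Sum>k<a. if even (Suc k) = (\<not> r) then w (Suc k) else 0)"
      using step by (intro sum_mono) auto
    also have "\<dots> \<le> P (\<not> r)" unfolding P_def by (subst sum.atMost_shift) (auto simp: w0)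
    finally have "c * (\<Sum>k<a. if even k = r then w k else 0) \<le> P (\<not> r)" by (simp add: sum_distrib_left if_distrib cong: if_cong)
    moreover have "P r = (\<Sum>k<a. if even k = r then w k else 0) + (if even a = r then w a else 0)"
      by (simp add: P_def lessThan_Suc_atMost[symmetric])
    moreover have "(if even a = r then w a else 0) \<le> 3 * P (\<not> r)"
    proof (cases "even a = r")
      case True
      have "w (a - 1) = (if even (a - 1) = (\<not> r) then w (a - 1) else 0)" using True ab by auto
      also have "\<dots> \<le> P (\<not> r)" unfolding P_def by (rule member_le_sum) (auto simp: w0)
      finally show ?thesis using True top by simp
    qed (use P0 in auto)
    then have "c * (if even a = r then w a else 0) \<le> (1/4) * (3 * P (\<not> r))"
      using c P0 w0 by (intro mult_mono) auto
    ultimately have "c * P r \<le> 2 * P (\<not> r)" using P0[of "\<not> r"] by (simp add: distrib_left)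
    then show ?thesis by simp
  qed
  have T: "(\<Sum>k\<le>a. w k) = P True + P False"
    unfolding P_def sum.distrib[symmetric] by (rule sum.cong) auto
  have D: "(\<Sum>k\<le>a. hypergeom a b k * ((-1) ^ k * exp (\<theta> * (real k - m)))) = P True - P False"
    unfolding P_def sum_subtractf[symmetric] by (rule sum.cong) (auto simp: w_def)
  have "c / 2 * P True \<le> P False" "c / 2 * P False \<le> P True" using comp[of True] comp[of False] by auto
  moreover have "c / 2 * P True \<le> P True" "c / 2 * P False \<le> P False" 
    using c P0[of True] P0[of False] mult_right_mono[of "c / 2" 1 "P True"] mult_right_mono[of "c / 2" 1 "P False"] by auto
  ultimately have "\<bar>P True - P False\<bar> \<le> (P True + P False) - c / 2 * (P True + P False)"
    unfolding distrib_left by (intro abs_leI) argo+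
  then show ?thesis unfolding D T[unfolded w_def] c_def by (simp add: algebra_simps)
qed

lemma hyp_mean_exp_sum:
  "hyp_mean n a b (\<lambda>k. \<Prod>v\<in>{1..n}. \<phi> (k v)) = (\<Sum>k\<le>a. hypergeom a b k * \<phi> k) ^ n"
  using hyp_mean_prod[of n a b "\<lambda>_. \<phi>"] by simp

text \<open>Both means factorise over the vertices. For the second, the indicator of an even total
  is \<open>(1 + (-1) ^ S) / 2\<close>: the unsigned part gives the factor one half and
  \<open>hyp_parity\<close> bounds the signed part.\<close>

lemma hyp_mean_mgf:
  assumes ab: "0 < a" "a \<le> b" and \<theta>: "\<bar>\<theta>\<bar> * real a \<le> 1"
  defines "m \<equiv> (real a)\<^sup>2 / real (a + b)" and "V \<equiv> (real a)\<^sup>2 * (real b)\<^sup>2 / ((real (a + b))\<^sup>2 * (real (a + b) - 1))"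
  shows "hyp_mean n a b (\<lambda>k. exp (\<theta> * (real (\<Sum>v\<in>{1..n}. k v) - real n * m))) \<le> exp (real n * (\<theta>\<^sup>2 * V / 2 + \<bar>\<theta>\<bar> ^ 3 * real a * V))"
    "hyp_mean n a b (\<lambda>k. if even (\<Sum>v\<in>{1..n}. k v) then exp (\<theta> * (real (\<Sum>v\<in>{1..n}. k v) - real n * m)) else 0) 
      \<le> (1 + exp (- real n / (2 * (real (a + b))\<^sup>2))) / 2 * exp (real n * (\<theta>\<^sup>2 * V / 2 + \<bar>\<theta>\<bar> ^ 3 * real a * V))"
proof -
  let ?S = "\<lambda>k. \<Sum>v\<in>{1..n}. k v :: nat"
  have pr: "exp (\<theta> * (real (?S k) - real n * m)) = (\<Prod>v\<in>{1..n}. exp (\<theta> * (real (k v) - m)))" for k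
    by (simp add: exp_sum[symmetric] sum_distrib_left[symmetric] sum_subtractf)
  define M where "M = (\<Sum>k\<le>a. hypergeom a b k * exp (\<theta> * (real k - m)))"
  define M' where "M' = (\<Sum>k\<le>a. hypergeom a b k * ((-1) ^ k * exp (\<theta> * (real k - m))))"
  define E where "E = exp (real n * (\<theta>\<^sup>2 * V / 2 + \<bar>\<theta>\<bar> ^ 3 * real a * V))"
  have M0: "0 \<le> M" by (auto simp: M_def hyp_nonneg intro!: sum_nonneg)
  have "M \<le> exp (\<theta>\<^sup>2 * V / 2 + \<bar>\<theta>\<bar> ^ 3 * real a * V)"
    using hyp_mgf[OF ab \<theta>] by (simp add: M_def m_def V_def)
  then have "M ^ n \<le> exp (\<theta>\<^sup>2 * V / 2 + \<bar>\<theta>\<bar> ^ 3 * real a * V) ^ n" using M0 by (intro power_mono)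
  then have ME: "M ^ n \<le> E" by (simp add: E_def exp_of_nat_mult)
  have H: "hyp_mean n a b (\<lambda>k. exp (\<theta> * (real (?S k) - real n * m))) = M ^ n"
    unfolding pr M_def by (rule hyp_mean_exp_sum)
  show "hyp_mean n a b (\<lambda>k. exp (\<theta> * (real (?S k) - real n * m))) \<le> exp (real n * (\<theta>\<^sup>2 * V / 2 + \<bar>\<theta>\<bar> ^ 3 * real a * V))"
    unfolding H using ME by (simp add: E_def)
  define D where "D = 1 / (2 * (real (a + b))\<^sup>2)"
  have "1 \<le> (real (a + b))\<^sup>2" using ab by (intro one_le_power) simp
  then have D: "D \<le> 1" by (simp add: D_def divide_le_eq del: of_nat_add)
  have "\<bar>M'\<bar> \<le> (1 - D) * M" using hyp_parity[OF ab \<theta>, of m] by (simp add: M'_def M_def D_def)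
  also have "\<dots> \<le> exp (- D) * M" using M0 exp_ge_add_one_self[of "- D"] by (intro mult_right_mono) auto
  finally have "\<bar>M'\<bar> ^ n \<le> (exp (- D) * M) ^ n" by (intro power_mono) auto
  also have "\<dots> = exp (- real n * D) * M ^ n" by (simp add: power_mult_distrib exp_of_nat_mult[symmetric])
  also have "\<dots> \<le> exp (- real n * D) * E" using ME by (intro mult_left_mono) auto
  finally have M'E: "M' ^ n \<le> exp (- real n * D) * E" by (simp add: power_abs[symmetric])
  have "(\<lambda>k. if even (?S k) then exp (\<theta> * (real (?S k) - real n * m)) else 0) =
     (\<lambda>k. (1/2) * (\<Prod>v\<in>{1..n}. exp (\<theta> * (real (k v) - m))) + (1/2) * (\<Prod>v\<in>{1..n}. (-1) ^ k v * exp (\<theta> * (real (k v) - m))))"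
  proof (rule ext)
    fix k
    have "(\<Prod>v\<in>{1..n}. (-1) ^ k v * exp (\<theta> * (real (k v) - m))) = (-1) ^ (?S k) * exp (\<theta> * (real (?S k) - real n * m))"
      unfolding prod.distrib pr by (simp add: power_sum)
    then show "(if even (?S k) then exp (\<theta> * (real (?S k) - real n * m)) else 0) = 
       (1/2) * (\<Prod>v\<in>{1..n}. exp (\<theta> * (real (k v) - m))) + (1/2) * (\<Prod>v\<in>{1..n}. (-1) ^ k v * exp (\<theta> * (real (k v) - m)))"
      unfolding pr[symmetric] by simp
  qed
  moreover have add: "hyp_mean n a b (\<lambda>k. F k + G k) = hyp_mean n a b F + hyp_mean n a b G" for F G
    by (simp add: hyp_mean_def distrib_left sum.distrib)
  ultimately have "hyp_mean n a b (\<lambda>k. if even (?S k) then exp (\<theta> * (real (?S k) - real n * m)) else 0) = (1/2) * M ^ n + (1/2) * M' ^ n"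
    using hyp_mean_exp_sum[of n a b "\<lambda>k. exp (\<theta> * (real k - m))", folded M_def]
      hyp_mean_exp_sum[of n a b "\<lambda>k. (-1) ^ k * exp (\<theta> * (real k - m))", folded M'_def]
    by (simp only: add hyp_mean_cmult)
  also have "\<dots> \<le> (1/2) * E + (1/2) * (exp (- real n * D) * E)" using ME M'E by simp
  also have "\<dots> = (1 + exp (- real n / (2 * (real (a + b))\<^sup>2))) / 2 * E" by (simp add: D_def algebra_simps)
  finally show "hyp_mean n a b (\<lambda>k. if even (?S k) then exp (\<theta> * (real (?S k) - real n * m)) else 0) 
      \<le> (1 + exp (- real n / (2 * (real (a + b))\<^sup>2))) / 2 * exp (real n * (\<theta>\<^sup>2 * V / 2 + \<bar>\<theta>\<bar> ^ 3 * real a * V))"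
    by (simp add: E_def)
qed

text \<open>Chernoff's method with the tilt \<open>\<gamma> / a ^ 4\<close> that minimises
  \<open>- \<theta> * \<gamma> + \<theta>\<^sup>2 * a ^ 4 / 2\<close>. For a lower tail the
  exponents are nonpositive, where the quadratic bound on \<open>exp\<close> holds for tilts of any
  size.\<close>

lemma hyp_mean_square_sum_lower_tail:
  assumes ab: "0 < a" "a \<le> b" and \<gamma>: "0 \<le> \<gamma>"
  defines "q \<equiv> (\<Sum>k\<le>a. hypergeom a b k * (real k)\<^sup>2)"
  shows "hyp_mean n a b (\<lambda>k. if real (\<Sum>v\<in>{1..n}. (k v)\<^sup>2) \<le> real n * (q - \<gamma>) then 1 else 0) \<le> exp (- (real n * \<gamma>\<^sup>2 / (2 * real a ^ 4)))"
proof -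
  define \<theta> where "\<theta> = \<gamma> / real a ^ 4"
  have \<theta>: "0 \<le> \<theta>" using \<gamma> by (simp add: \<theta>_def)
  have "hyp_mean n a b (\<lambda>k. if real (\<Sum>v\<in>{1..n}. (k v)\<^sup>2) \<le> real n * (q - \<gamma>) then 1 else 0) \<le>
     hyp_mean n a b (\<lambda>k. \<Prod>v\<in>{1..n}. exp (\<theta> * (q - \<gamma>) + - \<theta> * (real (k v))\<^sup>2))"
  proof (rule hyp_mean_mono)
    fix k :: "nat \<Rightarrow> nat"
    have "(\<Prod>v\<in>{1..n}. exp (\<theta> * (q - \<gamma>) + - \<theta> * (real (k v))\<^sup>2)) = exp (\<theta> * (real n * (q - \<gamma>) - real (\<Sum>v\<in>{1..n}. (k v)\<^sup>2)))"
    proof -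
      have "(\<Sum>v\<in>{1..n}. \<theta> * (q - \<gamma>) + - \<theta> * (real (k v))\<^sup>2) = real n * (\<theta> * (q - \<gamma>)) + - \<theta> * (\<Sum>v\<in>{1..n}. (real (k v))\<^sup>2)"
        unfolding sum.distrib sum_distrib_left[symmetric] by simp
      then show ?thesis by (simp add: exp_sum[symmetric] algebra_simps)
    qed
    then show "(if real (\<Sum>v\<in>{1..n}. (k v)\<^sup>2) \<le> real n * (q - \<gamma>) then 1 else 0) \<le> (\<Prod>v\<in>{1..n}. exp (\<theta> * (q - \<gamma>) + - \<theta> * (real (k v))\<^sup>2))"
      using \<theta> by auto
  qed
  also have "\<dots> = (\<Sum>k\<le>a. hypergeom a b k * exp (\<theta> * (q - \<gamma>) + - \<theta> * (real k)\<^sup>2)) ^ n" by (rule hyp_mean_exp_sum)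
  also have "\<dots> \<le> exp (- (\<gamma>\<^sup>2 / (2 * real a ^ 4))) ^ n"
  proof (rule power_mono)
    have "(\<Sum>k\<le>a. hypergeom a b k * exp (- \<theta> * (real k)\<^sup>2)) \<le> (\<Sum>k\<le>a. hypergeom a b k * (1 - \<theta> * (real k)\<^sup>2 + \<theta>\<^sup>2 * real a ^ 4 / 2))"
    proof (intro sum_mono mult_left_mono hyp_nonneg)
      fix k assume "k \<in> {..a}"
      then have "(real k) ^ 4 \<le> real a ^ 4" by (intro power_mono) auto
      then have "\<theta>\<^sup>2 * real k ^ 4 \<le> \<theta>\<^sup>2 * real a ^ 4" by (intro mult_left_mono) auto
      moreover have "exp (- \<theta> * (real k)\<^sup>2) \<le> 1 + (- \<theta> * (real k)\<^sup>2) + (- \<theta> * (real k)\<^sup>2)\<^sup>2 / 2"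
        using \<theta> by (intro exp_le_quadratic_neg) auto
      moreover have "(- \<theta> * (real k)\<^sup>2)\<^sup>2 = \<theta>\<^sup>2 * real k ^ 4" by (simp add: power_mult_distrib power_mult[symmetric])
      ultimately show "exp (- \<theta> * (real k)\<^sup>2) \<le> 1 - \<theta> * (real k)\<^sup>2 + \<theta>\<^sup>2 * real a ^ 4 / 2" by simp
    qed
    also have "\<dots> = (\<Sum>k\<le>a. hypergeom a b k * (1 + \<theta>\<^sup>2 * real a ^ 4 / 2) - \<theta> * (hypergeom a b k * (real k)\<^sup>2))"
      by (rule sum.cong[OF refl]) (simp add: algebra_simps)
    also have "\<dots> = 1 + (\<theta>\<^sup>2 * real a ^ 4 / 2 - \<theta> * q)"
      unfolding sum_subtractf sum_distrib_right[symmetric] sum_distrib_left[symmetric] sum_hyp[OF ab(2)] q_def by simp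
    also have "\<dots> \<le> exp (\<theta>\<^sup>2 * real a ^ 4 / 2 - \<theta> * q)" by (rule exp_ge_add_one_self)
    finally have "(\<Sum>k\<le>a. hypergeom a b k * exp (- \<theta> * (real k)\<^sup>2)) \<le> exp (\<theta>\<^sup>2 * real a ^ 4 / 2 - \<theta> * q)" .
    then have "exp (\<theta> * (q - \<gamma>)) * (\<Sum>k\<le>a. hypergeom a b k * exp (- \<theta> * (real k)\<^sup>2)) \<le> exp (\<theta> * (q - \<gamma>)) * exp (\<theta>\<^sup>2 * real a ^ 4 / 2 - \<theta> * q)"
      by (intro mult_left_mono) auto
    also have "\<dots> = exp (- \<theta> * \<gamma> + \<theta>\<^sup>2 * real a ^ 4 / 2)" by (simp add: exp_add[symmetric] algebra_simps)
    also have "- \<theta> * \<gamma> + \<theta>\<^sup>2 * real a ^ 4 / 2 = - (\<gamma>\<^sup>2 / (2 * real a ^ 4))"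
      using ab by (simp add: \<theta>_def field_simps power2_eq_square power4_eq_xxxx)
    also have "exp (\<theta> * (q - \<gamma>)) * (\<Sum>k\<le>a. hypergeom a b k * exp (- \<theta> * (real k)\<^sup>2)) = (\<Sum>k\<le>a. hypergeom a b k * exp (\<theta> * (q - \<gamma>) + - \<theta> * (real k)\<^sup>2))"
      unfolding sum_distrib_left by (rule sum.cong[OF refl]) (simp only: exp_add mult_ac)
    finally show "(\<Sum>k\<le>a. hypergeom a b k * exp (\<theta> * (q - \<gamma>) + - \<theta> * (real k)\<^sup>2)) \<le> exp (- (\<gamma>\<^sup>2 / (2 * real a ^ 4)))" .
  qed (auto simp: hyp_nonneg intro!: sum_nonneg)
  also have "\<dots> = exp (- (real n * \<gamma>\<^sup>2 / (2 * real a ^ 4)))" by (simp add: exp_of_nat_mult[symmetric])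
  finally show ?thesis .
qed

section \<open>Decay away from the mean overlap\<close>

text \<open>The mean is restricted to total overlap \<open>s\<close>, not conditioned on it; so
  slices add up over \<open>s\<close>.\<close>

definition slice :: "nat \<Rightarrow> nat \<Rightarrow> nat \<Rightarrow> nat \<Rightarrow> ((nat \<Rightarrow> nat) \<Rightarrow> real) \<Rightarrow> real" where
  "slice n a b s F = hyp_mean n a b (\<lambda>k. if (\<Sum>v\<in>{1..n}. k v) = s then F k else 0)"

lemma slice_mono:
  assumes "\<And>k. k \<in> PiE {1..n} (\<lambda>_. {..a}) \<Longrightarrow> (\<Sum>v\<in>{1..n}. k v) = s \<Longrightarrow> F k \<le> G k"
  shows "slice n a b s F \<le> slice n a b s G"
  unfolding slice_def by (rule hyp_mean_mono) (use assms in auto)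

lemma slice_cmult: "slice n a b s (\<lambda>k. c * F k) = c * slice n a b s F"
proof -
  have "(\<lambda>k. if (\<Sum>v\<in>{1..n}. k v) = s then c * F k else 0) = (\<lambda>k. c * (if (\<Sum>v\<in>{1..n}. k v) = s then F k else 0))" by auto
  then show ?thesis unfolding slice_def by (simp only: hyp_mean_cmult)
qed

lemma slice_nonneg: "(\<And>k. 0 \<le> F k) \<Longrightarrow> 0 \<le> slice n a b s F"
  unfolding slice_def hyp_mean_def by (intro sum_nonneg mult_nonneg_nonneg prod_nonneg) (auto simp: hyp_nonneg)

lemma slice_sum: "finite A \<Longrightarrow> slice n a b s (\<lambda>k. \<Sum>v\<in>A. F v k) = (\<Sum>v\<in>A. slice n a b s (F v))"
proof -
  have "(if (\<Sum>v\<in>{1..n}. k v) = s then \<Sum>v\<in>A. F v k else 0) = (\<Sum>v\<in>A. if (\<Sum>v\<in>{1..n}. k v) = s then F v k else 0)" for k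
    by simp
  then show ?thesis unfolding slice_def hyp_mean_def by (simp only: sum_distrib_left) (rule sum.swap)
qed

text \<open>Lowering the overlap at \<open>v\<close> by one matches the vectors with
  \<open>0 < k v\<close> and total \<open>Suc s\<close> to those with \<open>k v < a\<close> and
  total \<open>s\<close>. The vectors left out on either side have weight 0, by the factors
  \<open>k v\<close> and \<open>a - k v\<close>.\<close>

lemma slice_shift_vertex:
  assumes v: "v \<in> {1..n}" and ab: "a \<le> b"
  shows "slice n a b (Suc s) (\<lambda>k. real (k v) * (real (b - a) + real (k v))) = slice n a b s (\<lambda>k. (real a - real (k v))\<^sup>2)"
proof -
  let ?K = "PiE {1..n} (\<lambda>_. {..a})"
  have fK: "finite ?K" by (intro finite_PiE) auto
  define W where "W k = (\<Prod>u\<in>{1..n}. hypergeom a b (k u))" for k :: "nat \<Rightarrow> nat"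
  define g where "g k = W k * (if (\<Sum>u\<in>{1..n}. k u) = Suc s then real (k v) * (real (b - a) + real (k v)) else 0)" for k
  define h where "h k = W k * (if (\<Sum>u\<in>{1..n}. k u) = s then (real a - real (k v))\<^sup>2 else 0)" for k
  have Wv: "W k = hypergeom a b (k v) * (\<Prod>u\<in>{1..n} - {v}. hypergeom a b (k u))" for k
    unfolding W_def using v by (intro prod.remove) auto
  have Sv: "(\<Sum>u\<in>{1..n}. k u) = k v + (\<Sum>u\<in>{1..n} - {v}. k u)" for k :: "nat \<Rightarrow> nat"
    using v by (intro sum.remove) auto
  have "sum g ?K = sum g {k\<in>?K. 0 < k v}"
    by (rule sum.mono_neutral_right[OF fK]) (auto simp: g_def)
  also have "\<dots> = sum h {k\<in>?K. k v < a}"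
  proof (rule sum.reindex_bij_witness[of _ "\<lambda>k. k(v := Suc (k v))" "\<lambda>k. k(v := k v - 1)"])
    fix k assume k: "k \<in> {k\<in>?K. 0 < k v}"
    then have kv: "k v \<le> a" "0 < k v" using v by (auto simp: PiE_iff)
    have kk: "k v - Suc 0 \<le> a" "k v - Suc 0 < a" using kv by linarith+
    show "(k(v := k v - 1))(v := Suc ((k(v := k v - 1)) v)) = k" using kv by auto
    show "k(v := k v - 1) \<in> {k\<in>?K. k v < a}" using k kk v by (auto simp: PiE_iff extensional_def)
    have p: "(\<Prod>u\<in>{1..n} - {v}. hypergeom a b ((k(v := k v - 1)) u)) = (\<Prod>u\<in>{1..n} - {v}. hypergeom a b (k u))"
      by (rule prod.cong) auto
    have q: "(\<Sum>u\<in>{1..n} - {v}. (k(v := k v - 1)) u) = (\<Sum>u\<in>{1..n} - {v}. k u)" by (rule sum.cong) auto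
    have S: "(\<Sum>u\<in>{1..n}. (k(v := k v - 1)) u) = s \<longleftrightarrow> (\<Sum>u\<in>{1..n}. k u) = Suc s"
      unfolding Sv q using kv by auto
    have st: "hypergeom a b (k v) * (real (k v) * (real (b - a) + real (k v))) = hypergeom a b (k v - 1) * (real a - real (k v - 1))\<^sup>2"
      using hyp_step[of "k v - 1" a b] kv ab by simp
    define R where "R = (\<Prod>u\<in>{1..n} - {v}. hypergeom a b (k u))"
    have "W k * (real (k v) * (real (b - a) + real (k v))) = R * (hypergeom a b (k v) * (real (k v) * (real (b - a) + real (k v))))"
      unfolding Wv R_def by (simp only: mult_ac)
    also have "\<dots> = W (k(v := k v - 1)) * (real a - real (k v - 1))\<^sup>2"
      unfolding st Wv p R_def fun_upd_same by (simp only: mult_ac)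
    finally show "h (k(v := k v - 1)) = g k"
      unfolding h_def g_def S fun_upd_same by (cases "(\<Sum>u\<in>{1..n}. k u) = Suc s") simp_all
  next
    fix k assume k: "k \<in> {k\<in>?K. k v < a}"
    show "(k(v := Suc (k v)))(v := (k(v := Suc (k v))) v - 1) = k" by auto
    show "k(v := Suc (k v)) \<in> {k\<in>?K. 0 < k v}" using k v by (auto simp: PiE_iff extensional_def)
  qed
  also have "\<dots> = sum h ?K"
  proof (rule sum.mono_neutral_left[OF fK])
    show "\<forall>k\<in>?K - {k\<in>?K. k v < a}. h k = 0"
    proof
      fix k assume k: "k \<in> ?K - {k\<in>?K. k v < a}"
      then have "k v \<in> {..a}" using PiE_mem[of k "{1..n}" "\<lambda>_. {..a}" v] v by blast
      then have "k v = a" using k by simp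
      then show "h k = 0" by (simp add: h_def)
    qed
  qed blast
  finally have "(\<Sum>k\<in>?K. g k) = (\<Sum>k\<in>?K. h k)" .
  then show ?thesis unfolding slice_def hyp_mean_def g_def h_def W_def .
qed

text \<open>The recurrence of the hypergeometric weights, applied at one vertex, turns \<open>share_weight\<close> at total overlap
  \<open>s + 1\<close> into \<open>gap_weight\<close> at total overlap \<open>s\<close>.\<close>

definition share_weight :: "nat \<Rightarrow> nat \<Rightarrow> nat \<Rightarrow> (nat \<Rightarrow> nat) \<Rightarrow> real" where
  "share_weight n a b k = (\<Sum>v\<in>{1..n}. real (k v) * (real (b - a) + real (k v)))"

definition gap_weight :: "nat \<Rightarrow> nat \<Rightarrow> (nat \<Rightarrow> nat) \<Rightarrow> real" where
  "gap_weight n a k = (\<Sum>v\<in>{1..n}. (real a - real (k v))\<^sup>2)"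

lemma slice_shift: "a \<le> b \<Longrightarrow> slice n a b (Suc s) (share_weight n a b) = slice n a b s (gap_weight n a)"
  unfolding share_weight_def gap_weight_def
  by (simp only: slice_sum[OF finite_atLeastAtMost]) (intro sum.cong refl slice_shift_vertex)

lemma sum_squares_ge_mean_square:
  fixes x :: "'a \<Rightarrow> real"
  assumes "finite A"
  shows "(\<Sum>v\<in>A. x v)\<^sup>2 \<le> real (card A) * (\<Sum>v\<in>A. (x v)\<^sup>2)"
  using Cauchy_Schwarz_ineq_sum[of "\<lambda>_. 1" x A] by simp

text \<open>Given the total, both weights depend only on the sum \<open>Q\<close> of squares. The
  difference compared in the fifth and sixth claims factorises as
  \<open>(a * s - Q) * (s * (a + b) - a\<^sup>2 * n)\<close>: the first factor is nonnegative, and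
  the sign of the second tells whether \<open>s\<close> lies above or below the mean.\<close>

lemma share_gap_weight_bounds:
  assumes k: "k \<in> PiE {1..n} (\<lambda>_. {..a})" and s: "(\<Sum>v\<in>{1..n}. k v) = s" and ab: "a \<le> b"
  defines "X \<equiv> share_weight n a b k" and "Y \<equiv> gap_weight n a k" and "N \<equiv> real n * real a"
  shows "X \<le> real b * real s" "Y \<le> real a * (N - real s)" "(real s)\<^sup>2 \<le> real n * X" "(N - real s)\<^sup>2 \<le> real n * Y"
    "(real a)\<^sup>2 * real n \<le> real s * real (a + b) \<Longrightarrow> real s * real b * Y \<le> real a * (N - real s) * X"
    "real s * real (a + b) \<le> (real a)\<^sup>2 * real n \<Longrightarrow> real a * (N - real s) * X \<le> real s * real b * Y"
    "real s \<le> N"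
proof -
  define Q where "Q = (\<Sum>v\<in>{1..n}. (real (k v))\<^sup>2)"
  have ka: "k v \<le> a" if "v \<in> {1..n}" for v using k that by (auto simp: PiE_iff)
  have rs: "real s = (\<Sum>v\<in>{1..n}. real (k v))" using s by auto
  have X: "X = real (b - a) * real s + Q"
    unfolding X_def share_weight_def Q_def rs sum_distrib_left sum.distrib[symmetric]
    by (rule sum.cong) (auto simp: power2_eq_square algebra_simps)
  have "Y = (\<Sum>v\<in>{1..n}. (real a)\<^sup>2 - 2 * real a * real (k v) + (real (k v))\<^sup>2)"
    unfolding Y_def gap_weight_def by (rule sum.cong) (auto simp: power2_eq_square algebra_simps)
  also have "\<dots> = real n * (real a)\<^sup>2 - 2 * real a * real s + Q"
    by (simp add: sum.distrib sum_subtractf sum_distrib_left[symmetric] rs Q_def)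
  finally have Y: "Y = real n * (real a)\<^sup>2 - 2 * real a * real s + Q" .
  have Q: "Q \<le> real a * real s"
    unfolding Q_def rs sum_distrib_left using ka by (intro sum_mono) (auto simp: power2_eq_square mult_right_mono)
  have e: "real (b - a) = real b - real a" using ab by (simp add: of_nat_diff)
  show "X \<le> real b * real s" unfolding X e using Q by (simp add: algebra_simps)
  show "Y \<le> real a * (N - real s)" unfolding Y N_def using Q by (simp add: algebra_simps power2_eq_square)
  have "(real s)\<^sup>2 \<le> real n * Q"
    using sum_squares_ge_mean_square[of "{1..n}" "\<lambda>v. real (k v)"] by (simp add: rs Q_def)
  also have "\<dots> \<le> real n * X" unfolding X by (intro mult_left_mono) auto
  finally show "(real s)\<^sup>2 \<le> real n * X" .
  have "(\<Sum>v\<in>{1..n}. real a - real (k v)) = N - real s" by (simp add: sum_subtractf rs N_def)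
  then show "(N - real s)\<^sup>2 \<le> real n * Y"
    using sum_squares_ge_mean_square[of "{1..n}" "\<lambda>v. real a - real (k v)"] by (simp add: Y_def gap_weight_def)
  have id: "real a * (N - real s) * X - real s * real b * Y = (real a * real s - Q) * (real s * real (a + b) - (real a)\<^sup>2 * real n)"
    unfolding X Y e N_def by (simp add: algebra_simps power2_eq_square)
  show "real s * real b * Y \<le> real a * (N - real s) * X" if "(real a)\<^sup>2 * real n \<le> real s * real (a + b)"
  proof -
    have "0 \<le> (real a * real s - Q) * (real s * real (a + b) - (real a)\<^sup>2 * real n)" using Q that by (intro mult_nonneg_nonneg) auto
    then show ?thesis using id by linarith
  qed
  show "real a * (N - real s) * X \<le> real s * real b * Y" if "real s * real (a + b) \<le> (real a)\<^sup>2 * real n"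
  proof -
    have "(real a * real s - Q) * (real s * real (a + b) - (real a)\<^sup>2 * real n) \<le> 0" using Q that by (intro mult_nonneg_nonpos) auto
    then show ?thesis using id by linarith
  qed
  show "real s \<le> N" unfolding rs N_def using sum_mono[of "{1..n}" "\<lambda>v. real (k v)" "\<lambda>_. real a"] ka by simp
qed

section \<open>Comparison of neighbouring total overlaps\<close>

locale overlap_slices =
  fixes n a b :: nat
  assumes n: "0 < n" and a: "0 < a" and ab: "a \<le> b"
begin

text \<open>The recurrence at single vertices relates weighted probabilities rather than
  \<open>p\<close> itself, namely \<open>B (Suc s) = A s\<close>. Both \<open>A\<close> and
  \<open>B\<close> agree with \<open>p\<close> up to polynomial factors, so decay shown for them
  carries over.\<close>

definition p where "p s = slice n a b s (\<lambda>_. 1)"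
definition A where "A s = slice n a b s (gap_weight n a)"
definition B where "B s = slice n a b s (share_weight n a b)"
definition N where "N = real n * real a"
definition f where "f s = config_ratio n (a + b) a s"

lemma p_nonneg: "0 \<le> p s" unfolding p_def by (rule slice_nonneg) simp
lemma A_nonneg: "0 \<le> A s" unfolding A_def by (rule slice_nonneg) (auto simp: gap_weight_def intro: sum_nonneg)
lemma B_nonneg: "0 \<le> B s" unfolding B_def by (rule slice_nonneg) (auto simp: share_weight_def intro!: sum_nonneg)
lemma f_nonneg: "0 \<le> f s" by (simp add: f_def config_ratio_def)

lemma B_Suc: "B (Suc s) = A s" unfolding A_def B_def by (rule slice_shift[OF ab])

lemma p_le_B: "(real s)\<^sup>2 * p s \<le> real n * B s"
proof -
  have "slice n a b s (\<lambda>_. (real s)\<^sup>2 * 1) \<le> slice n a b s (\<lambda>k. real n * share_weight n a b k)"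
    by (rule slice_mono) (use share_gap_weight_bounds(3) ab in auto)
  then show ?thesis unfolding slice_cmult p_def B_def .
qed

lemma p_le_A: "(N - real s)\<^sup>2 * p s \<le> real n * A s"
proof -
  have "slice n a b s (\<lambda>_. (N - real s)\<^sup>2 * 1) \<le> slice n a b s (\<lambda>k. real n * gap_weight n a k)"
    by (rule slice_mono) (use share_gap_weight_bounds(4) ab in \<open>auto simp: N_def\<close>)
  then show ?thesis unfolding slice_cmult p_def A_def .
qed

lemma B_le_p: "B s \<le> real b * real s * p s"
proof -
  have "slice n a b s (share_weight n a b) \<le> slice n a b s (\<lambda>k. real b * real s * 1)"
    by (rule slice_mono) (use share_gap_weight_bounds(1) ab in auto)
  then show ?thesis unfolding slice_cmult p_def B_def .
qed

lemma A_le_p: "A s \<le> real a * (N - real s) * p s"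
proof -
  have "slice n a b s (gap_weight n a) \<le> slice n a b s (\<lambda>k. real a * (N - real s) * 1)"
    by (rule slice_mono) (use share_gap_weight_bounds(2) ab in \<open>auto simp: N_def\<close>)
  then show ?thesis unfolding slice_cmult p_def A_def .
qed

lemma A_le_B: "(real a)\<^sup>2 * real n \<le> real s * real (a + b) \<Longrightarrow> real s * real b * A s \<le> real a * (N - real s) * B s"
proof -
  assume s: "(real a)\<^sup>2 * real n \<le> real s * real (a + b)"
  have "slice n a b s (\<lambda>k. real s * real b * gap_weight n a k) \<le> slice n a b s (\<lambda>k. real a * (N - real s) * share_weight n a b k)"
    by (rule slice_mono) (use share_gap_weight_bounds(5) ab s in \<open>auto simp: N_def\<close>)
  then show ?thesis unfolding slice_cmult A_def B_def .
qed

lemma B_le_A: "real s * real (a + b) \<le> (real a)\<^sup>2 * real n \<Longrightarrow> real a * (N - real s) * B s \<le> real s * real b * A s"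
proof -
  assume s: "real s * real (a + b) \<le> (real a)\<^sup>2 * real n"
  have "slice n a b s (\<lambda>k. real a * (N - real s) * share_weight n a b k) \<le> slice n a b s (\<lambda>k. real s * real b * gap_weight n a k)"
    by (rule slice_mono) (use share_gap_weight_bounds(6) ab s in \<open>auto simp: N_def\<close>)
  then show ?thesis unfolding slice_cmult A_def B_def .
qed

lemma f_step:
  assumes "s + 2 \<le> n * a"
  shows "f (s + 2) * (N - real s - 1)\<^sup>2 = f s * ((real s + 1) * (real n * (real b - real a) + real s + 1))"
proof -
  have "real (n * (a + b - 2 * a)) = real n * (real b - real a)" using ab by (simp add: of_nat_diff)
  then show ?thesis using config_ratio_step[OF assms, of "a + b"] unfolding f_def N_def by (simp del: of_nat_diff)
qed

text \<open>\<open>B (Suc s) = A s\<close> and \<open>A_le_B\<close>, used at \<open>s\<close> and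
  at \<open>Suc s\<close>, bound the growth of \<open>B\<close> over two steps, and
  \<open>f_step\<close> gives that of \<open>f\<close>. Steps have length two because
  \<open>f\<close> vanishes at odd overlaps. The last factor on each side is
  \<open>(N - s + 1) / s\<close> at its own overlap, so the estimate telescopes.\<close>

lemma up_step:
  assumes s: "(real a)\<^sup>2 * real n \<le> real s * real (a + b)" "s + 2 \<le> n * a"
  shows "f (s + 2) * B (s + 2) * ((N - real s - 1) / (real s + 2)) \<le> f s * B s * ((N - real s + 1) / real s)"
proof -
  define S where "S = real s"
  have "0 < (real a)\<^sup>2 * real n" using a n by simp
  then have s0: "0 < S" using s(1) unfolding S_def by (cases "s = 0") simp_all
  have N: "S + 2 \<le> N" using s(2) unfolding S_def N_def by (metis of_nat_add of_nat_le_iff of_nat_mult of_nat_numeral)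
  have b0: "0 < real b" using a ab by simp
  define e where "e = real n * (real b - real a)"
  have e0: "0 \<le> e" using ab by (simp add: e_def)
  have 1: "S * real b * A s \<le> real a * (N - S) * B s" using A_le_B[OF s(1)] by (simp add: S_def)
  have s1: "(real a)\<^sup>2 * real n \<le> real (Suc s) * real (a + b)" using s(1) by (simp add: algebra_simps)
  have 2: "(S + 1) * real b * B (s + 2) \<le> real a * (N - S - 1) * A s"
    using A_le_B[OF s1] B_Suc[of "Suc s"] B_Suc[of s] by (simp add: S_def algebra_simps)
  have "S * real b * ((S + 1) * real b * B (s + 2)) \<le> S * real b * (real a * (N - S - 1) * A s)"
    using 2 s0 b0 by (intro mult_left_mono) auto
  also have "\<dots> = real a * (N - S - 1) * (S * real b * A s)" by (simp only: mult_ac)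
  also have "\<dots> \<le> real a * (N - S - 1) * (real a * (N - S) * B s)" using 1 N by (intro mult_left_mono) auto
  finally have 3: "S * real b * ((S + 1) * real b * B (s + 2)) \<le> real a * (N - S - 1) * (real a * (N - S) * B s)" .
  have fs: "f (s + 2) * (N - S - 1)\<^sup>2 = f s * ((S + 1) * (e + S + 1))" using f_step[OF s(2)] by (simp add: S_def e_def)
  \<comment> \<open>Position above the mean is used once more, now in the form
    \<open>a\<^sup>2 * n \<le> s * (a + b)\<close> multiplied by \<open>b - a\<close>: it makes the
    growth of \<open>f\<close> no larger than the decay of \<open>B\<close>.\<close>
  have k: "(real a)\<^sup>2 * (e + S + 1) \<le> (real b)\<^sup>2 * (S + 1)"
  proof -
    have "(real a)\<^sup>2 * e = ((real a)\<^sup>2 * real n) * (real b - real a)" by (simp add: e_def)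
    also have "\<dots> \<le> (S * real (a + b)) * (real b - real a)" using s(1) ab by (intro mult_right_mono) (auto simp: S_def)
    also have "\<dots> \<le> ((S + 1) * real (a + b)) * (real b - real a)" using ab by (intro mult_right_mono) auto
    finally show ?thesis by (simp add: algebra_simps power2_eq_square)
  qed
  have "(f (s + 2) * B (s + 2) * ((N - S - 1) * S)) * ((N - S - 1) * (S + 1) * (real b)\<^sup>2)
      = (f (s + 2) * (N - S - 1)\<^sup>2) * (S * real b * ((S + 1) * real b * B (s + 2)))"
    by (simp add: power2_eq_square mult_ac)
  also have "\<dots> = (f s * ((S + 1) * (e + S + 1))) * (S * real b * ((S + 1) * real b * B (s + 2)))" unfolding fs ..
  also have "\<dots> \<le> (f s * ((S + 1) * (e + S + 1))) * (real a * (N - S - 1) * (real a * (N - S) * B s))"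
    using 3 s0 e0 f_nonneg by (intro mult_left_mono) auto
  also have "\<dots> = (f s * B s * ((N - S) * (S + 1) * (N - S - 1))) * ((real a)\<^sup>2 * (e + S + 1))"
    by (simp add: power2_eq_square mult_ac)
  also have "\<dots> \<le> (f s * B s * ((N - S) * (S + 1) * (N - S - 1))) * ((real b)\<^sup>2 * (S + 1))"
    using k s0 N f_nonneg B_nonneg by (intro mult_left_mono) auto
  also have "\<dots> = (f s * B s * ((N - S) * (S + 1))) * ((N - S - 1) * (S + 1) * (real b)\<^sup>2)" by (simp only: mult_ac)
  finally have "f (s + 2) * B (s + 2) * ((N - S - 1) * S) \<le> f s * B s * ((N - S) * (S + 1))"
    by (rule mult_right_le_imp_le) (use N s0 b0 in simp)
  also have "\<dots> \<le> f s * B s * ((N - S + 1) * (S + 2))"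
    using N s0 f_nonneg B_nonneg by (intro mult_left_mono mult_mono) auto
  finally show ?thesis using s0 by (simp add: S_def[symmetric] field_simps)
qed

text \<open>The mirror image below the mean, with \<open>A\<close> in the role of \<open>B\<close>
  and the telescoping factor \<open>(e + s + 1) / (N - s)\<close>.\<close>

lemma down_step:
  assumes s: "real (s + 2) * real (a + b) \<le> (real a)\<^sup>2 * real n"
  defines "S \<equiv> real s" and "e \<equiv> real n * (real b - real a)"
  shows "f s * A s * ((e + S + 1) / (N - S)) \<le> f (s + 2) * A (s + 2) * ((e + S + 3) / (N - S - 2))" "0 < N - S - 2"
proof -
  have b0: "0 < real b" "0 < real a" using a ab by auto
  have e0: "0 \<le> e" using ab by (simp add: e_def)
  have S0: "0 \<le> S" by (simp add: S_def)
  have "(S + 2) * real (a + b) < N * real (a + b)"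
  proof -
    have "real (s + 2) = S + 2" by (simp add: S_def)
    then have "(S + 2) * real (a + b) \<le> N * real a" using s by (simp only: N_def power2_eq_square mult_ac)
    also have "\<dots> < N * real (a + b)" using n b0 by (intro mult_strict_left_mono) (auto simp: N_def)
    finally show ?thesis .
  qed
  then have N: "S + 2 < N" using a by (simp add: mult_less_cancel_right)
  then show "0 < N - S - 2" by simp
  have s2: "s + 2 \<le> n * a" using N unfolding S_def N_def by (metis less_eq_real_def of_nat_add of_nat_le_iff of_nat_mult of_nat_numeral)
  have 1: "real a * (N - S - 2) * A (s + 1) \<le> (S + 2) * real b * A (s + 2)"
    using B_le_A[OF s] B_Suc[of "s + 1"] by (simp add: S_def algebra_simps)
  have s1: "real (s + 1) * real (a + b) \<le> (real a)\<^sup>2 * real n" using s by (simp add: algebra_simps)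
  have 2: "real a * (N - S - 1) * A s \<le> (S + 1) * real b * A (s + 1)"
    using B_le_A[OF s1] B_Suc[of s] by (simp add: S_def algebra_simps)
  have "real a * (N - S - 2) * (real a * (N - S - 1) * A s) \<le> real a * (N - S - 2) * ((S + 1) * real b * A (s + 1))"
    using 2 b0 N by (intro mult_left_mono) auto
  also have "\<dots> = (S + 1) * real b * (real a * (N - S - 2) * A (s + 1))" by (simp only: mult_ac)
  also have "\<dots> \<le> (S + 1) * real b * ((S + 2) * real b * A (s + 2))" using 1 b0 S0 by (intro mult_left_mono) auto
  finally have 3: "real a * (N - S - 2) * (real a * (N - S - 1) * A s) \<le> (S + 1) * real b * ((S + 2) * real b * A (s + 2))" .
  have fs: "f (s + 2) * (N - S - 1)\<^sup>2 = f s * ((S + 1) * (e + S + 1))" using f_step[OF s2] by (simp add: S_def e_def)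
  have k: "(real b)\<^sup>2 * (S + 2) \<le> (real a)\<^sup>2 * (e + S + 2)"
  proof -
    have "((S + 2) * real (a + b)) * (real b - real a) \<le> ((real a)\<^sup>2 * real n) * (real b - real a)"
      using s ab by (intro mult_right_mono) (auto simp: S_def add.commute)
    then show ?thesis by (simp add: algebra_simps power2_eq_square e_def)
  qed
  have "(f s * A s * ((e + S + 1) * (N - S - 2))) * ((S + 1) * (N - S - 1) * (real a)\<^sup>2)
     = (f s * ((S + 1) * (e + S + 1))) * (real a * (N - S - 2) * (real a * (N - S - 1) * A s))"
    by (simp add: power2_eq_square mult_ac)
  also have "\<dots> \<le> (f s * ((S + 1) * (e + S + 1))) * ((S + 1) * real b * ((S + 2) * real b * A (s + 2)))"
    using 3 S0 e0 f_nonneg by (intro mult_left_mono) auto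
  also have "\<dots> = (f (s + 2) * (N - S - 1)\<^sup>2) * ((S + 1) * real b * ((S + 2) * real b * A (s + 2)))" unfolding fs ..
  also have "\<dots> = (f (s + 2) * A (s + 2) * ((N - S - 1)\<^sup>2 * (S + 1))) * ((real b)\<^sup>2 * (S + 2))"
    by (simp add: power2_eq_square mult_ac)
  also have "\<dots> \<le> (f (s + 2) * A (s + 2) * ((N - S - 1)\<^sup>2 * (S + 1))) * ((real a)\<^sup>2 * (e + S + 2))"
    using k S0 f_nonneg A_nonneg by (intro mult_left_mono) auto
  also have "\<dots> = (f (s + 2) * A (s + 2) * ((N - S - 1) * (e + S + 2))) * ((S + 1) * (N - S - 1) * (real a)\<^sup>2)"
    by (simp add: power2_eq_square mult_ac)
  finally have "f s * A s * ((e + S + 1) * (N - S - 2)) \<le> f (s + 2) * A (s + 2) * ((N - S - 1) * (e + S + 2))"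
    by (rule mult_right_le_imp_le) (use N S0 b0 in simp)
  also have "\<dots> \<le> f (s + 2) * A (s + 2) * ((N - S) * (e + S + 3))"
    using N S0 e0 f_nonneg A_nonneg by (intro mult_left_mono mult_mono) auto
  finally show "f s * A s * ((e + S + 1) / (N - S)) \<le> f (s + 2) * A (s + 2) * ((e + S + 3) / (N - S - 2))"
    using N by (simp add: field_simps)
qed

lemma up_chain:
  assumes s: "(real a)\<^sup>2 * real n \<le> real s * real (a + b)" "s + 2 * j \<le> n * a"
  shows "f (s + 2 * j) * B (s + 2 * j) * ((N - real (s + 2 * j) + 1) / real (s + 2 * j)) \<le> f s * B s * ((N - real s + 1) / real s)"
  using s(2)
proof (induction j)
  case (Suc j)
  have m: "(real a)\<^sup>2 * real n \<le> real (s + 2 * j) * real (a + b)"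
    by (rule order.trans[OF s(1)]) (intro mult_right_mono, auto)
  have e: "s + 2 * Suc j = (s + 2 * j) + 2" by simp
  have r: "N - real (s + 2 * j + 2) + 1 = N - real (s + 2 * j) - 1" "real (s + 2 * j + 2) = real (s + 2 * j) + 2" by simp_all
  show ?case unfolding e r(1)
    unfolding r(2) by (rule order.trans[OF up_step[OF m] Suc.IH]) (use Suc.prems in simp_all)
qed simp

lemma down_chain:
  assumes s: "real (s + 2 * j) * real (a + b) \<le> (real a)\<^sup>2 * real n"
  defines "e \<equiv> real n * (real b - real a)"
  shows "f s * A s * ((e + real s + 1) / (N - real s)) \<le> 
    f (s + 2 * j) * A (s + 2 * j) * ((e + real (s + 2 * j) + 1) / (N - real (s + 2 * j)))"
  using s
proof (induction j)
  case (Suc j)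
  have e: "s + 2 * Suc j = (s + 2 * j) + 2" by simp
  have m: "real (s + 2 * j + 2) * real (a + b) \<le> (real a)\<^sup>2 * real n" using Suc.prems unfolding e .
  have "real (s + 2 * j) * real (a + b) \<le> real (s + 2 * j + 2) * real (a + b)" by (intro mult_right_mono) auto
  then have m': "real (s + 2 * j) * real (a + b) \<le> (real a)\<^sup>2 * real n" using m by linarith
  have r: "e + real (s + 2 * j + 2) + 1 = e + real (s + 2 * j) + 3" "N - real (s + 2 * j + 2) = N - real (s + 2 * j) - 2" by simp_all
  show ?case unfolding e r 
    by (rule order.trans[OF Suc.IH[OF m'] down_step(1)[OF m, folded e_def]])
qed simp

text \<open>Translates the chain back to \<open>p\<close>: passing from \<open>p\<close> to
  \<open>B\<close> and back, and bounding the telescoping factors below by \<open>1 / N\<close> and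
  above by \<open>N + 1\<close>, costs four factors of at most \<open>n * (a + b)\<close>.\<close>

lemma up_bound:
  assumes s: "(real a)\<^sup>2 * real n \<le> real s * real (a + b)" "s + 2 * j \<le> n * a"
  shows "f (s + 2 * j) * p (s + 2 * j) \<le> (real n * real (a + b)) ^ 4 * (f s * p s)"
proof -
  define t where "t = s + 2 * j"
  have "0 < (real a)\<^sup>2 * real n" using a n by simp
  then have s0: "0 < s" using s(1) by (cases "s = 0") simp_all
  have N: "real t \<le> N" "real s \<le> N" using s(2) unfolding t_def N_def by (simp_all flip: of_nat_mult)
  have t1: "1 \<le> real t" using s0 by (simp add: t_def)
  have s1: "1 \<le> real s" using s0 by simp
  have ch: "f t * B t * ((N - real t + 1) / real t) \<le> f s * B s * ((N - real s + 1) / real s)"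
    using up_chain[OF s] by (simp add: t_def)
  have fB: "0 \<le> f t * B t" "0 \<le> f s * B s" using f_nonneg B_nonneg by simp_all
  have "p t * 1 \<le> p t * (real t)\<^sup>2" using p_nonneg t1 by (intro mult_left_mono) (auto intro: one_le_power)
  also have "\<dots> \<le> real n * B t" using p_le_B[of t] by (simp add: mult.commute)
  finally have "f t * p t \<le> f t * (real n * B t)" using f_nonneg by (intro mult_left_mono) auto
  also have "\<dots> = real n * (f t * B t)" by (simp only: mult_ac)
  also have "f t * B t \<le> N * (f t * B t * ((N - real t + 1) / real t))"
  proof -
    have "1 \<le> N * ((N - real t + 1) / real t)"
    proof -
      have "real t * 1 \<le> N * (N - real t + 1)" using N t1 by (intro mult_mono) auto
      then show ?thesis using t1 by (simp add: field_simps)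
    qed
    then have "f t * B t * 1 \<le> f t * B t * (N * ((N - real t + 1) / real t))" using fB by (intro mult_left_mono)
    then show ?thesis by (simp only: mult_ac mult_1_right)
  qed
  also have "f t * B t * ((N - real t + 1) / real t) \<le> f s * B s * ((N - real s + 1) / real s)" by (rule ch)
  also have "\<dots> \<le> f s * B s * (N + 1)"
  proof (intro mult_left_mono fB)
    have "N - real s + 1 \<le> (N + 1) * real s" 
    proof -
      have "(N + 1) * 1 \<le> (N + 1) * real s" using s1 N by (intro mult_left_mono) auto
      then show ?thesis using s1 by argo
    qed
    then show "(N - real s + 1) / real s \<le> N + 1" using s1 by (simp add: field_simps)
  qed
  also have "f s * B s \<le> f s * (real b * real s * p s)" using B_le_p f_nonneg by (intro mult_left_mono)
  also have "\<dots> \<le> f s * (real b * N * p s)" using N f_nonneg p_nonneg by (intro mult_left_mono mult_right_mono) auto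
  finally have "f t * p t \<le> real n * (N * (f s * (real b * N * p s) * (N + 1)))"
    using N t1 by (simp add: mult_left_mono mult_right_mono)
  also have "\<dots> = ((real n * real b) * N * N * (N + 1)) * (f s * p s)" by (simp only: mult_ac)
  also have "\<dots> \<le> (real n * real (a + b)) ^ 4 * (f s * p s)"
  proof (intro mult_right_mono mult_nonneg_nonneg f_nonneg p_nonneg)
    have "real a + 1 \<le> real a + real b" using a ab by simp
    then have "real n * (real a + 1) \<le> real n * real (a + b)" by (intro mult_left_mono) auto
    moreover have "N + 1 \<le> real n * (real a + 1)" using n by (simp add: N_def distrib_left)
    ultimately have N1: "N + 1 \<le> real n * real (a + b)" by linarith
    have "(real n * real b) * N * N * (N + 1) \<le> (real n * real (a + b)) * (real n * real (a + b)) * (real n * real (a + b)) * (real n * real (a + b))"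
      using N1 N t1 by (intro mult_mono) (auto simp: N_def)
    then show "(real n * real b) * N * N * (N + 1) \<le> (real n * real (a + b)) ^ 4" by (simp only: power4_eq_xxxx)
  qed
  finally show ?thesis by (simp add: t_def)
qed

lemma down_bound:
  assumes s: "real (s + 2 * j) * real (a + b) \<le> (real a)\<^sup>2 * real n"
  shows "f s * p s \<le> (real n * real (a + b)) ^ 4 * (f (s + 2 * j) * p (s + 2 * j))"
proof -
  define t where "t = s + 2 * j"
  define e where "e = real n * (real b - real a)"
  have e0: "0 \<le> e" using ab by (simp add: e_def)
  have b0: "0 < real b" "0 < real a" "1 \<le> real a" using a ab by auto
  have "real t * real (a + b) < N * real (a + b)"
  proof -
    have "real t * real (a + b) \<le> N * real a" using s by (simp add: N_def power2_eq_square mult_ac t_def)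
    also have "\<dots> < N * real (a + b)" using n b0 by (intro mult_strict_left_mono) (auto simp: N_def)
    finally show ?thesis .
  qed
  then have "real t < N" using a by (simp add: mult_less_cancel_right)
  then have "t < n * a" unfolding N_def by (simp flip: of_nat_mult)
  then have "t + 1 \<le> n * a" by simp
  then have "real (t + 1) \<le> real (n * a)" by (simp only: of_nat_le_iff)
  then have N: "real t + 1 \<le> N" by (simp add: N_def)
  have Ns: "real s \<le> real t" by (simp add: t_def)
  have ch: "f s * A s * ((e + real s + 1) / (N - real s)) \<le> f t * A t * ((e + real t + 1) / (N - real t))"
    using down_chain[OF s] by (simp add: t_def e_def)
  have fA: "0 \<le> f t * A t" "0 \<le> f s * A s" using f_nonneg A_nonneg by simp_all
  have "p s * 1 \<le> p s * (N - real s)\<^sup>2" using p_nonneg N Ns by (intro mult_left_mono) (auto intro: one_le_power)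
  also have "\<dots> \<le> real n * A s" using p_le_A[of s] by (simp add: mult.commute)
  finally have "f s * p s \<le> f s * (real n * A s)" using f_nonneg by (intro mult_left_mono) auto
  also have "\<dots> = real n * (f s * A s)" by (simp only: mult_ac)
  also have "f s * A s \<le> N * (f s * A s * ((e + real s + 1) / (N - real s)))"
  proof -
    have "1 \<le> N * ((e + real s + 1) / (N - real s))"
    proof -
      have "(N - real s) * 1 \<le> N * (e + real s + 1)" using N Ns e0 by (intro mult_mono) auto
      then show ?thesis using N Ns by (simp add: field_simps)
    qed
    then have "f s * A s * 1 \<le> f s * A s * (N * ((e + real s + 1) / (N - real s)))" using fA by (intro mult_left_mono)
    then show ?thesis by (simp only: mult_ac mult_1_right)
  qed
  also have "f s * A s * ((e + real s + 1) / (N - real s)) \<le> f t * A t * ((e + real t + 1) / (N - real t))" by (rule ch)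
  also have "\<dots> \<le> f t * (real a * (N - real t) * p t) * ((e + real t + 1) / (N - real t))"
    using A_le_p[of t] f_nonneg N e0 by (intro mult_right_mono mult_left_mono) auto
  also have "\<dots> = f t * (real a * p t) * (e + real t + 1)" using N by (simp add: field_simps)
  also have "\<dots> \<le> f t * (real a * p t) * (real n * real (a + b))"
    using N f_nonneg p_nonneg n b0 by (intro mult_left_mono) (auto simp: e_def N_def algebra_simps)
  finally have "f s * p s \<le> real n * (N * (f t * (real a * p t) * (real n * real (a + b))))"
    using N by (simp add: mult_left_mono mult_right_mono)
  also have "\<dots> = ((real n * real a) * N * 1 * (real n * real (a + b))) * (f t * p t)" by (simp only: mult_ac mult_1_right)
  also have "\<dots> \<le> (real n * real (a + b)) ^ 4 * (f t * p t)"
  proof (intro mult_right_mono mult_nonneg_nonneg f_nonneg p_nonneg)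
    have "1 * 1 \<le> real n * real (a + b)" using n b0 by (intro mult_mono) auto
    moreover have "real n * real a \<le> real n * real (a + b)" by (intro mult_left_mono) auto
    ultimately have "(real n * real a) * N * 1 * (real n * real (a + b)) \<le> (real n * real (a + b)) * (real n * real (a + b)) * (real n * real (a + b)) * (real n * real (a + b))"
      by (intro mult_mono) (auto simp: N_def)
    then show "(real n * real a) * N * 1 * (real n * real (a + b)) \<le> (real n * real (a + b)) ^ 4" by (simp only: power4_eq_xxxx)
  qed
  finally show ?thesis by (simp add: t_def)
qed

lemma hyp_mean_sum_slices: "hyp_mean n a b (\<lambda>k. F (\<Sum>v\<in>{1..n}. k v)) = (\<Sum>s\<le>n * a. F s * p s)"
proof -
  let ?K = "PiE {1..n} (\<lambda>_. {..a})" let ?W = "\<lambda>k. \<Prod>v\<in>{1..n}. hypergeom a b (k v)"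
  have le: "(\<Sum>v\<in>{1..n}. k v) \<le> n * a" if "k \<in> ?K" for k
    using sum_mono[of "{1..n}" k "\<lambda>_. a"] that by (auto simp: PiE_iff)
  have "(\<Sum>s\<le>n * a. F s * p s) = (\<Sum>s\<le>n * a. \<Sum>k\<in>?K. ?W k * (if (\<Sum>v\<in>{1..n}. k v) = s then F s else 0))"
    unfolding p_def slice_def hyp_mean_def sum_distrib_left by (intro sum.cong refl) auto
  also have "\<dots> = (\<Sum>k\<in>?K. \<Sum>s\<le>n * a. ?W k * (if (\<Sum>v\<in>{1..n}. k v) = s then F s else 0))" by (rule sum.swap)
  also have "\<dots> = (\<Sum>k\<in>?K. ?W k * F (\<Sum>v\<in>{1..n}. k v))"
  proof (intro sum.cong refl)
    fix k assume "k \<in> ?K"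
    from le[OF this] show "(\<Sum>s\<le>n * a. ?W k * (if (\<Sum>v\<in>{1..n}. k v) = s then F s else 0)) = ?W k * F (\<Sum>v\<in>{1..n}. k v)"
      unfolding sum_distrib_left[symmetric] by (simp only: sum.delta' finite_atMost atMost_iff if_True)
  qed
  finally show ?thesis by (simp add: hyp_mean_def)
qed

end

section \<open>The Gaussian window\<close>

text \<open>The variance is one half, because then the moment generating function at
  \<open>\<tau>\<close> is \<open>exp (\<tau>\<^sup>2 / 4)\<close>, the growth of
  \<open>config_ratio\<close>. A quadratic exponent is thus traded for an average of linear ones,
  which factorise over the vertices.\<close>

abbreviation half_normal :: "real \<Rightarrow> real" where "half_normal \<equiv> normal_density 0 (1 / sqrt 2)"

lemma half_normal_eq: "normal_density c (1 / sqrt 2) y = exp (- (y - c)\<^sup>2) / sqrt pi"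
  by (simp add: normal_density_def power_divide)

lemma half_normal_gaussian:
  assumes "\<kappa> < 2"
  shows "integrable lborel (\<lambda>y. half_normal y * exp (\<kappa> * y\<^sup>2 / 2))" 
    "(\<integral>y. half_normal y * exp (\<kappa> * y\<^sup>2 / 2) \<partial>lborel) = 1 / sqrt (1 - \<kappa> / 2)"
proof -
  define c where "c = 1 - \<kappa> / 2"
  have c: "0 < c" using assms by (simp add: c_def)
  define \<sigma> where "\<sigma> = 1 / sqrt (2 * c)"
  have \<sigma>: "0 < \<sigma>" using c by (simp add: \<sigma>_def)
  have \<sigma>2: "\<sigma>\<^sup>2 = 1 / (2 * c)" using c by (simp add: \<sigma>_def power_divide)
  have eq: "half_normal y * exp (\<kappa> * y\<^sup>2 / 2) = (1 / sqrt c) * normal_density 0 \<sigma> y" for y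
  proof -
    have "half_normal y * exp (\<kappa> * y\<^sup>2 / 2) = exp (- c * y\<^sup>2) / sqrt pi"
      by (simp add: half_normal_eq exp_add[symmetric] c_def algebra_simps)
    also have "\<dots> = (1 / sqrt c) * normal_density 0 \<sigma> y"
      using c by (simp add: normal_density_def \<sigma>2 real_sqrt_divide real_sqrt_mult mult.commute)
    finally show ?thesis .
  qed
  show "integrable lborel (\<lambda>y. half_normal y * exp (\<kappa> * y\<^sup>2 / 2))" unfolding eq using \<sigma> by simp
  show "(\<integral>y. half_normal y * exp (\<kappa> * y\<^sup>2 / 2) \<partial>lborel) = 1 / sqrt (1 - \<kappa> / 2)" unfolding eq using \<sigma> by (simp add: c_def)
qed

definition central_mass :: "real \<Rightarrow> real" where
  "central_mass Y = (\<integral>y. indicator {- Y / 2..Y / 2} y * half_normal y \<partial>lborel)"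

lemma integrable_indicator_half_normal: "integrable lborel (\<lambda>y. indicator {l..u} y * normal_density c (1 / sqrt 2) y)"
  using integrable_mult_indicator[of "{l..u}" lborel "normal_density c (1 / sqrt 2)"] by simp

text \<open>The weight \<open>exp (y\<^sup>2 / 2 - Y\<^sup>2 / 8)\<close> is at least 1 outside the
  interval, and its integral against \<open>half_normal\<close> is
  \<open>sqrt 2 * exp (- Y\<^sup>2 / 8)\<close>.\<close>

lemma central_mass_ge: 
  assumes "0 \<le> Y"
  shows "1 - sqrt 2 * exp (- Y\<^sup>2 / 8) \<le> central_mass Y"
proof -
  have "(\<integral>y. half_normal y - exp (- Y\<^sup>2 / 8) * (half_normal y * exp (1 * y\<^sup>2 / 2)) \<partial>lborel) \<le> central_mass Y"
    unfolding central_mass_def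
  proof (rule integral_mono)
    show "integrable lborel (\<lambda>y. half_normal y - exp (- Y\<^sup>2 / 8) * (half_normal y * exp (1 * y\<^sup>2 / 2)))"
      using half_normal_gaussian(1)[of 1] by (intro Bochner_Integration.integrable_diff integrable_mult_right) auto
    show "integrable lborel (\<lambda>y. indicator {- Y / 2..Y / 2} y * half_normal y)" by (rule integrable_indicator_half_normal)
    fix y
    show "half_normal y - exp (- Y\<^sup>2 / 8) * (half_normal y * exp (1 * y\<^sup>2 / 2)) \<le> indicator {- Y / 2..Y / 2} y * half_normal y"
    proof (cases "y \<in> {- Y / 2..Y / 2}")
      case True
      then show ?thesis by simp
    next
      case False
      then have "Y / 2 < \<bar>y\<bar>" by auto
      then have "(Y / 2)\<^sup>2 \<le> \<bar>y\<bar>\<^sup>2" using assms by (intro power_mono) auto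
      then have "1 \<le> exp (- Y\<^sup>2 / 8 + y\<^sup>2 / 2)" by (simp add: power_divide)
      then have "half_normal y * 1 \<le> half_normal y * (exp (- Y\<^sup>2 / 8) * exp (y\<^sup>2 / 2))"
        unfolding exp_add by (intro mult_left_mono) auto
      then show ?thesis using False by (simp add: mult_ac)
    qed
  qed
  moreover have 2: "(\<integral>y. half_normal y - exp (- Y\<^sup>2 / 8) * (half_normal y * exp (1 * y\<^sup>2 / 2)) \<partial>lborel) = 1 - exp (- Y\<^sup>2 / 8) * (1 / sqrt (1 - 1 / 2))"
    using half_normal_gaussian[of 1] by (subst Bochner_Integration.integral_diff) auto
  moreover have 3: "1 / sqrt (1 - 1 / 2 :: real) = sqrt 2" by (simp add: real_sqrt_divide)
  ultimately have "1 - exp (- Y\<^sup>2 / 8) * sqrt 2 \<le> central_mass Y" by (simp only:)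
  then show ?thesis by (simp only: mult.commute)
qed

text \<open>Completing the square moves the centre of the density to \<open>\<tau> / 2\<close>; the
  interval of radius \<open>Y / 2\<close> around that point still lies in
  \<open>{- Y..Y}\<close>.\<close>

lemma exp_quarter_square_le:
  assumes "\<bar>\<tau>\<bar> \<le> Y"
  shows "exp (\<tau>\<^sup>2 / 4) * central_mass Y \<le> (\<integral>y. indicator {- Y..Y} y * (half_normal y * exp (y * \<tau>)) \<partial>lborel)"
proof -
  have e: "half_normal y * exp (y * \<tau>) = exp (\<tau>\<^sup>2 / 4) * normal_density (\<tau> / 2) (1 / sqrt 2) y" for y
  proof -
    have "exp (- (y - 0)\<^sup>2) * exp (y * \<tau>) = exp (\<tau>\<^sup>2 / 4) * exp (- (y - \<tau> / 2)\<^sup>2)"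
      unfolding exp_add[symmetric] by (simp add: power2_eq_square field_simps)
    then show ?thesis unfolding half_normal_eq by simp
  qed
  have "central_mass Y = (\<integral>y. indicator {- Y / 2..Y / 2} (- \<tau> / 2 + 1 * y) * half_normal (- \<tau> / 2 + 1 * y) \<partial>lborel)"
    unfolding central_mass_def by (subst lborel_integral_real_affine[of 1 _ "- \<tau> / 2"]) auto
  also have "\<dots> = (\<integral>y. indicator {- Y / 2 + \<tau> / 2..Y / 2 + \<tau> / 2} y * normal_density (\<tau> / 2) (1 / sqrt 2) y \<partial>lborel)"
  proof (rule Bochner_Integration.integral_cong[OF refl])
    fix y
    have "(- \<tau> / 2 + 1 * y - 0)\<^sup>2 = (y - \<tau> / 2)\<^sup>2" by (simp add: algebra_simps)
    then show "indicator {- Y / 2..Y / 2} (- \<tau> / 2 + 1 * y) * half_normal (- \<tau> / 2 + 1 * y) =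
       indicator {- Y / 2 + \<tau> / 2..Y / 2 + \<tau> / 2} y * normal_density (\<tau> / 2) (1 / sqrt 2) y"
      unfolding half_normal_eq by (auto simp: indicator_def)
  qed
  also have "\<dots> \<le> (\<integral>y. indicator {- Y..Y} y * normal_density (\<tau> / 2) (1 / sqrt 2) y \<partial>lborel)"
  proof (rule integral_mono)
    fix y
    have "{- Y / 2 + \<tau> / 2..Y / 2 + \<tau> / 2} \<subseteq> {- Y..Y}" using assms by auto
    then show "indicator {- Y / 2 + \<tau> / 2..Y / 2 + \<tau> / 2} y * normal_density (\<tau> / 2) (1 / sqrt 2) y \<le> indicator {- Y..Y} y * normal_density (\<tau> / 2) (1 / sqrt 2) y"
      by (intro mult_right_mono) (auto simp: indicator_def)
  qed (rule integrable_indicator_half_normal)+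
  finally have "exp (\<tau>\<^sup>2 / 4) * central_mass Y \<le> exp (\<tau>\<^sup>2 / 4) * (\<integral>y. indicator {- Y..Y} y * normal_density (\<tau> / 2) (1 / sqrt 2) y \<partial>lborel)"
    by (intro mult_left_mono) auto
  also have "\<dots> = (\<integral>y. exp (\<tau>\<^sup>2 / 4) * (indicator {- Y..Y} y * normal_density (\<tau> / 2) (1 / sqrt 2) y) \<partial>lborel)"
    by simp
  also have "\<dots> = (\<integral>y. indicator {- Y..Y} y * (half_normal y * exp (y * \<tau>)) \<partial>lborel)"
    unfolding e by (intro Bochner_Integration.integral_cong refl) (simp add: mult_ac)
  finally show ?thesis .
qed

lemma integrable_indicator_half_normal_exp: "integrable lborel (\<lambda>y. indicator {- Y..Y} y * (half_normal y * exp (y * \<tau>)))"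
proof (rule Bochner_Integration.integrable_bound[of _ "\<lambda>y. exp (Y * \<bar>\<tau>\<bar>) * half_normal y"])
  show "AE y in lborel. norm (indicator {- Y..Y} y * (half_normal y * exp (y * \<tau>))) \<le> norm (exp (Y * \<bar>\<tau>\<bar>) * half_normal y)"
  proof (rule AE_I2)
    fix y :: real
    have "y * \<tau> \<le> Y * \<bar>\<tau>\<bar>" if "y \<in> {- Y..Y}"
    proof -
      have "y * \<tau> \<le> \<bar>y\<bar> * \<bar>\<tau>\<bar>" by (metis abs_ge_self abs_mult)
      also have "\<dots> \<le> Y * \<bar>\<tau>\<bar>" using that by (intro mult_right_mono) auto
      finally show ?thesis .
    qed
    then show "norm (indicator {- Y..Y} y * (half_normal y * exp (y * \<tau>))) \<le> norm (exp (Y * \<bar>\<tau>\<bar>) * half_normal y)"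
      by (auto simp: indicator_def abs_mult mult.commute intro!: mult_right_mono)
  qed
qed (auto intro: integrable_mult_right)

section \<open>Overlaps inside and outside the window\<close>

context overlap_slices
begin

definition \<mu> where "\<mu> = (real a)\<^sup>2 * real n / real (a + b)"
text \<open>The scale that governs the quadratic term of \<open>config_ratio_le\<close>. The exact
  variance of the total overlap is \<open>var * \<kappa>\<close>, where \<open>\<kappa>\<close> is
  the finite population correction.\<close>

definition var where "var = real n * (real a)\<^sup>2 * (real b)\<^sup>2 / real (a + b) ^ 3"
definition \<kappa> where "\<kappa> = real (a + b) / (real (a + b) - 1)"

lemma d_ge2: "2 \<le> real (a + b)" using a ab by simp

lemma var_pos: "0 < var" and mu_pos: "0 < \<mu>" and kappa: "1 \<le> \<kappa>" "\<kappa> \<le> 2"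
proof -
  show "0 < var" "0 < \<mu>" using n a ab by (auto simp: var_def \<mu>_def)
  show "1 \<le> \<kappa>" "\<kappa> \<le> 2" using d_ge2 by (auto simp: \<kappa>_def field_simps)
qed

lemma sqrt_var: "0 < sqrt var" "sqrt var * sqrt var = var" "(sqrt var)\<^sup>2 = var" using var_pos by auto

lemma nV: "real n * ((real a)\<^sup>2 * (real b)\<^sup>2 / ((real (a + b))\<^sup>2 * (real (a + b) - 1))) = var * \<kappa>"
proof -
  define D where "D = real (a + b)"
  have D: "D \<noteq> 0" "D - 1 \<noteq> 0" using d_ge2 by (auto simp: D_def)
  show ?thesis unfolding var_def \<kappa>_def D_def[symmetric] using D by (simp add: field_simps power2_eq_square power3_eq_cube)
qed

lemma mean_eq: "real n * ((real a)\<^sup>2 / real (a + b)) = \<mu>" by (simp add: \<mu>_def)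

lemma mgf_exponent:
  assumes y: "\<bar>y\<bar> \<le> Y"
  defines "V \<equiv> (real a)\<^sup>2 * (real b)\<^sup>2 / ((real (a + b))\<^sup>2 * (real (a + b) - 1))" and "\<theta> \<equiv> y / sqrt var"
  shows "real n * (\<theta>\<^sup>2 * V / 2 + \<bar>\<theta>\<bar> ^ 3 * real a * V) \<le> \<kappa> * y\<^sup>2 / 2 + 2 * real a * Y ^ 3 / sqrt var"
proof -
  have V: "real n * V = var * \<kappa>" unfolding V_def by (rule nV)
  have "real n * (\<theta>\<^sup>2 * V / 2 + \<bar>\<theta>\<bar> ^ 3 * real a * V) = (real n * V) * (\<theta>\<^sup>2 / 2 + \<bar>\<theta>\<bar> ^ 3 * real a)" by (simp add: algebra_simps)
  also have "\<dots> = \<kappa> * y\<^sup>2 / 2 + \<kappa> * real a * \<bar>y\<bar> ^ 3 / sqrt var"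
  proof -
    have "var * \<theta>\<^sup>2 = y\<^sup>2" using var_pos by (simp add: \<theta>_def power_divide)
    moreover have "var * \<bar>\<theta>\<bar> ^ 3 = \<bar>y\<bar> ^ 3 / sqrt var"
    proof -
      have "\<bar>\<theta>\<bar> ^ 3 = \<bar>y\<bar> ^ 3 / (sqrt var * (sqrt var * sqrt var))"
        using sqrt_var(1) by (simp add: \<theta>_def abs_divide power_divide power3_eq_cube)
      then show ?thesis unfolding sqrt_var(2) using var_pos by simp
    qed
    moreover have "var * \<kappa> * (\<theta>\<^sup>2 / 2 + \<bar>\<theta>\<bar> ^ 3 * real a) = \<kappa> * (var * \<theta>\<^sup>2) / 2 + \<kappa> * real a * (var * \<bar>\<theta>\<bar> ^ 3)" by (simp add: algebra_simps)
    ultimately show ?thesis unfolding V by simp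
  qed
  also have "\<kappa> * real a * \<bar>y\<bar> ^ 3 / sqrt var \<le> 2 * real a * Y ^ 3 / sqrt var"
    using kappa y sqrt_var by (intro divide_right_mono mult_mono power_mono) auto
  finally show ?thesis by simp
qed

definition stirling_err where "stirling_err Y = (Y * sqrt var) ^ 3 / \<mu>\<^sup>2 + 2 / (real n * real a)"

definition mgf_err where "mgf_err Y = 2 * real a * Y ^ 3 / sqrt var"

lemma f_near:
  assumes "even n" "Y * sqrt var < \<mu>" "\<bar>real s - \<mu>\<bar> \<le> Y * sqrt var"
  shows "f s \<le> sqrt 2 * exp (((real s - \<mu>) / sqrt var)\<^sup>2 / 4 + stirling_err Y)"
proof -
  have "f s \<le> sqrt 2 * exp ((real s - \<mu>)\<^sup>2 / (4 * var) + \<bar>real s - \<mu>\<bar> ^ 3 / \<mu>\<^sup>2 + 2 / (real n * real a))"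
    using config_ratio_le[of a "a + b" n s] a ab n assms unfolding f_def by (simp add: \<mu>_def var_def)
  also have "\<dots> \<le> sqrt 2 * exp (((real s - \<mu>) / sqrt var)\<^sup>2 / 4 + stirling_err Y)"
  proof (intro mult_left_mono iffD2[OF exp_le_cancel_iff])
    have "\<bar>real s - \<mu>\<bar> ^ 3 / \<mu>\<^sup>2 \<le> (Y * sqrt var) ^ 3 / \<mu>\<^sup>2" using assms by (intro divide_right_mono power_mono) auto
    moreover have "(real s - \<mu>)\<^sup>2 / (4 * var) = ((real s - \<mu>) / sqrt var)\<^sup>2 / 4" using var_pos by (simp add: power_divide)
    ultimately show "(real s - \<mu>)\<^sup>2 / (4 * var) + \<bar>real s - \<mu>\<bar> ^ 3 / \<mu>\<^sup>2 + 2 / (real n * real a) \<le> ((real s - \<mu>) / sqrt var)\<^sup>2 / 4 + stirling_err Y"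
      by (simp add: stirling_err_def)
  qed auto
  finally show ?thesis .
qed

lemma f_odd: "odd s \<Longrightarrow> f s = 0" by (simp add: f_def config_ratio_def pairings_odd)

text \<open>\<open>exp (\<tau>\<^sup>2 / 4)\<close> is the integral of \<open>exp (y * \<tau>)\<close> against \<open>half_normal\<close>. For \<open>\<bar>\<tau>\<bar> \<le> Y\<close> the part \<open>\<bar>y\<bar> \<le> Y\<close> carries
  at least the fraction \<open>central_mass Y\<close> of it, and only there the moment generating function is controlled.\<close>

lemma near_gaussian:
  assumes Y: "0 \<le> Y" "Y * real a \<le> sqrt var" and d: "2 < a + b"
  shows "central_mass Y * hyp_mean n a b (\<lambda>k. if even (\<Sum>v\<in>{1..n}. k v) \<and> \<bar>real (\<Sum>v\<in>{1..n}. k v) - \<mu>\<bar> \<le> Y * sqrt var 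
      then exp (((real (\<Sum>v\<in>{1..n}. k v) - \<mu>) / sqrt var)\<^sup>2 / 4) else 0)
    \<le> (1 + exp (- real n / (2 * (real (a + b))\<^sup>2))) / 2 * exp (mgf_err Y) / sqrt (1 - \<kappa> / 2)"
proof -
  let ?S = "\<lambda>k. \<Sum>v\<in>{1..n}. k v :: nat"
  let ?K = "PiE {1..n} (\<lambda>_. {..a})"
  define \<tau> where "\<tau> k = (real (?S k) - \<mu>) / sqrt var" for k
  define W where "W k = (\<Prod>v\<in>{1..n}. hypergeom a b (k v))" for k
  have W: "0 \<le> W k" for k by (auto simp: W_def hyp_nonneg intro: prod_nonneg)
  define I where "I \<tau> = (\<integral>y. indicator {- Y..Y} y * (half_normal y * exp (y * \<tau>)) \<partial>lborel)" for \<tau> :: real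
  have I0: "0 \<le> I \<tau>" for \<tau> unfolding I_def by (intro Bochner_Integration.integral_nonneg) auto
  define \<rho> where "\<rho> = (1 + exp (- real n / (2 * (real (a + b))\<^sup>2))) / 2 * exp (mgf_err Y)"
  have \<kappa>2: "\<kappa> < 2"
  proof -
    have "3 \<le> real (a + b)" using d by simp
    then show ?thesis by (simp add: \<kappa>_def field_simps del: of_nat_add)
  qed
  have "central_mass Y * hyp_mean n a b (\<lambda>k. if even (?S k) \<and> \<bar>real (?S k) - \<mu>\<bar> \<le> Y * sqrt var then exp ((\<tau> k)\<^sup>2 / 4) else 0)
     = hyp_mean n a b (\<lambda>k. central_mass Y * (if even (?S k) \<and> \<bar>real (?S k) - \<mu>\<bar> \<le> Y * sqrt var then exp ((\<tau> k)\<^sup>2 / 4) else 0))"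
    by (simp only: hyp_mean_cmult)
  also have "\<dots> \<le> hyp_mean n a b (\<lambda>k. if even (?S k) then I (\<tau> k) else 0)"
  proof (rule hyp_mean_mono)
    fix k
    have "\<bar>\<tau> k\<bar> \<le> Y" if "\<bar>real (?S k) - \<mu>\<bar> \<le> Y * sqrt var"
      using that sqrt_var(1) by (simp add: \<tau>_def abs_divide field_simps)
    then show "central_mass Y * (if even (?S k) \<and> \<bar>real (?S k) - \<mu>\<bar> \<le> Y * sqrt var then exp ((\<tau> k)\<^sup>2 / 4) else 0) \<le> (if even (?S k) then I (\<tau> k) else 0)"
      using exp_quarter_square_le[of "\<tau> k" Y] I0[of "\<tau> k"] by (auto simp: I_def mult.commute)
  qed
  also have "\<dots> = (\<Sum>k\<in>?K. \<integral>y. indicator {- Y..Y} y * (half_normal y * (W k * (if even (?S k) then exp (y * \<tau> k) else 0))) \<partial>lborel)"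
    unfolding hyp_mean_def W_def[symmetric]
  proof (rule sum.cong[OF refl])
    fix k assume "k \<in> ?K"
    show "W k * (if even (?S k) then I (\<tau> k) else 0) = (\<integral>y. indicator {- Y..Y} y * (half_normal y * (W k * (if even (?S k) then exp (y * \<tau> k) else 0))) \<partial>lborel)"
    proof (cases "even (?S k)")
      case True
      have "W k * I (\<tau> k) = (\<integral>y. W k * (indicator {- Y..Y} y * (half_normal y * exp (y * \<tau> k))) \<partial>lborel)"
        unfolding I_def by simp
      also have "\<dots> = (\<integral>y. indicator {- Y..Y} y * (half_normal y * (W k * exp (y * \<tau> k))) \<partial>lborel)"
        by (intro Bochner_Integration.integral_cong refl) (simp only: mult_ac)
      finally show ?thesis using True by simp
    qed simp
  qed
  \<comment> \<open>The mean over overlaps is a finite sum, so it can be moved inside the integral,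
    where for fixed \<open>y\<close> it becomes a moment generating function.\<close>
  also have "\<dots> = (\<integral>y. (\<Sum>k\<in>?K. indicator {- Y..Y} y * (half_normal y * (W k * (if even (?S k) then exp (y * \<tau> k) else 0)))) \<partial>lborel)"
  proof (rule Bochner_Integration.integral_sum[symmetric])
    fix k
    show "integrable lborel (\<lambda>y. indicator {- Y..Y} y * (half_normal y * (W k * (if even (?S k) then exp (y * \<tau> k) else 0))))"
      using integrable_mult_right[OF integrable_indicator_half_normal_exp[of Y "\<tau> k"], of "W k"]
      by (cases "even (?S k)") (simp_all add: mult_ac)
  qed
  also have "\<dots> = (\<integral>y. indicator {- Y..Y} y * (half_normal y * hyp_mean n a b (\<lambda>k. if even (?S k) then exp (y * \<tau> k) else 0)) \<partial>lborel)"
    unfolding hyp_mean_def W_def[symmetric] by (simp only: sum_distrib_left)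
  also have "\<dots> \<le> (\<integral>y. \<rho> * (half_normal y * exp (\<kappa> * y\<^sup>2 / 2)) \<partial>lborel)"
  proof (rule integral_mono')
    show "integrable lborel (\<lambda>y. \<rho> * (half_normal y * exp (\<kappa> * y\<^sup>2 / 2)))"
      using half_normal_gaussian(1)[OF \<kappa>2] by (rule integrable_mult_right)
    fix y
    have \<rho>: "0 \<le> \<rho>" by (simp add: \<rho>_def add_nonneg_nonneg)
    then show "0 \<le> \<rho> * (half_normal y * exp (\<kappa> * y\<^sup>2 / 2))" by simp
    show "indicator {- Y..Y} y * (half_normal y * hyp_mean n a b (\<lambda>k. if even (?S k) then exp (y * \<tau> k) else 0)) \<le> \<rho> * (half_normal y * exp (\<kappa> * y\<^sup>2 / 2))"
    proof (cases "y \<in> {- Y..Y}")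
      case False
      then show ?thesis using \<rho> by simp
    next
      case True
      then have y: "\<bar>y\<bar> \<le> Y" by auto
      \<comment> \<open>The condition \<open>\<bar>\<theta>\<bar> * a \<le> 1\<close> of
        \<open>hyp_mgf\<close> is what confines \<open>y\<close> to \<open>{- Y..Y}\<close>.\<close>
      define \<theta> where "\<theta> = y / sqrt var"
      have \<theta>: "\<bar>\<theta>\<bar> * real a \<le> 1"
      proof -
        have "\<bar>y\<bar> * real a \<le> Y * real a" using y by (intro mult_right_mono) auto
        then show ?thesis using Y(2) sqrt_var(1) by (simp add: \<theta>_def abs_divide field_simps)
      qed
      have "hyp_mean n a b (\<lambda>k. if even (?S k) then exp (y * \<tau> k) else 0) = hyp_mean n a b (\<lambda>k. if even (?S k) then exp (\<theta> * (real (?S k) - \<mu>)) else 0)"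
      proof -
        have "y * \<tau> k = \<theta> * (real (?S k) - \<mu>)" for k by (simp add: \<tau>_def \<theta>_def)
        then show ?thesis by (simp only:)
      qed
      also have "\<dots> \<le> (1 + exp (- real n / (2 * (real (a + b))\<^sup>2))) / 2 * exp (\<kappa> * y\<^sup>2 / 2 + mgf_err Y)"
        by (rule order.trans[OF hyp_mean_mgf(2)[OF a ab \<theta>, of n, unfolded mean_eq] mult_left_mono])
           (use mgf_exponent[OF y] in \<open>auto simp: \<theta>_def mgf_err_def add_nonneg_nonneg\<close>)
      also have "\<dots> = \<rho> * exp (\<kappa> * y\<^sup>2 / 2)" by (simp add: \<rho>_def exp_add)
      finally have "half_normal y * hyp_mean n a b (\<lambda>k. if even (?S k) then exp (y * \<tau> k) else 0) \<le> half_normal y * (\<rho> * exp (\<kappa> * y\<^sup>2 / 2))"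
        by (intro mult_left_mono) auto
      then show ?thesis using True by (simp add: mult_ac)
    qed
  qed
  also have "\<dots> = \<rho> * (1 / sqrt (1 - \<kappa> / 2))"
    using half_normal_gaussian(2)[OF \<kappa>2] by simp
  finally show ?thesis unfolding \<tau>_def \<rho>_def by (simp only: times_divide_eq_right mult_1_right)
qed

text \<open>Chernoff's bound with tilt \<open>Y / sqrt var\<close> towards the side of
  \<open>s\<close>. The slack of 2 is the step length of the walk in \<open>far_sum\<close>; it
  costs the term \<open>2 * Y / sqrt var\<close>.\<close>

lemma p_tail:
  assumes Y: "0 \<le> Y" "Y * real a \<le> sqrt var" and s: "Y * sqrt var - 2 \<le> \<bar>real s - \<mu>\<bar>"
  shows "p s \<le> exp (- Y\<^sup>2 + 2 * Y / sqrt var + \<kappa> * Y\<^sup>2 / 2 + mgf_err Y)"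
proof -
  let ?S = "\<lambda>k. \<Sum>v\<in>{1..n}. k v :: nat"
  define y where "y = (if \<mu> \<le> real s then Y else - Y)"
  have y: "\<bar>y\<bar> \<le> Y" "y\<^sup>2 = Y\<^sup>2" using Y by (auto simp: y_def)
  define \<theta> where "\<theta> = y / sqrt var"
  have \<theta>: "\<bar>\<theta>\<bar> * real a \<le> 1"
  proof -
    have "\<bar>y\<bar> * real a \<le> Y * real a" using y by (intro mult_right_mono) auto
    then show ?thesis using Y(2) sqrt_var(1) by (simp add: \<theta>_def abs_divide field_simps)
  qed
  have \<theta>s: "Y\<^sup>2 - 2 * Y / sqrt var \<le> \<theta> * (real s - \<mu>)"
  proof -
    have "Y / sqrt var * (Y * sqrt var - 2) \<le> Y / sqrt var * \<bar>real s - \<mu>\<bar>" using s Y sqrt_var by (intro mult_left_mono) auto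
    moreover have "Y / sqrt var * \<bar>real s - \<mu>\<bar> = \<theta> * (real s - \<mu>)"
    proof (cases "\<mu> \<le> real s")
      case False
      then have "\<bar>real s - \<mu>\<bar> = - (real s - \<mu>)" by simp
      then show ?thesis using False by (simp only: \<theta>_def y_def if_False mult_minus_right mult_minus_left minus_divide_left[symmetric])
    qed (simp add: \<theta>_def y_def)
    moreover have "Y / sqrt var * (Y * sqrt var - 2) = Y\<^sup>2 - 2 * Y / sqrt var"
      using sqrt_var(1) by (simp add: field_simps power2_eq_square)
    ultimately show ?thesis by simp
  qed
  have "p s \<le> hyp_mean n a b (\<lambda>k. exp (- (Y\<^sup>2 - 2 * Y / sqrt var)) * exp (\<theta> * (real (?S k) - \<mu>)))"
    unfolding p_def slice_def
  proof (rule hyp_mean_mono)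
    fix k
    show "(if ?S k = s then 1 else 0) \<le> exp (- (Y\<^sup>2 - 2 * Y / sqrt var)) * exp (\<theta> * (real (?S k) - \<mu>))"
      using \<theta>s by (auto simp: exp_add[symmetric])
  qed
  also have "\<dots> = exp (- (Y\<^sup>2 - 2 * Y / sqrt var)) * hyp_mean n a b (\<lambda>k. exp (\<theta> * (real (?S k) - \<mu>)))" by (rule hyp_mean_cmult)
  also have "\<dots> \<le> exp (- (Y\<^sup>2 - 2 * Y / sqrt var)) * exp (\<kappa> * y\<^sup>2 / 2 + mgf_err Y)"
  proof (rule mult_left_mono)
    show "hyp_mean n a b (\<lambda>k. exp (\<theta> * (real (?S k) - \<mu>))) \<le> exp (\<kappa> * y\<^sup>2 / 2 + mgf_err Y)"
      by (rule order.trans[OF hyp_mean_mgf(1)[OF a ab \<theta>, of n, unfolded mean_eq]])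
         (use mgf_exponent[OF y(1)] in \<open>auto simp: \<theta>_def mgf_err_def\<close>)
  qed simp
  also have "\<dots> = exp (- Y\<^sup>2 + 2 * Y / sqrt var + \<kappa> * Y\<^sup>2 / 2 + mgf_err Y)" by (simp add: exp_add[symmetric] y(2))
  finally show ?thesis .
qed

text \<open>From a far overlap, steps of two lead to one inside the window and within 2 of its edge.
  There the Stirling factor \<open>exp (Y\<^sup>2 / 4)\<close> meets the tail
  \<open>exp (- Y\<^sup>2 + \<kappa> * Y\<^sup>2 / 2)\<close>. Of the five polynomial factors, four
  pay for the walk and one for the number of overlaps.\<close>

lemma far_sum:
  assumes n: "even n" and Y: "0 \<le> Y" "Y * real a \<le> sqrt var" "Y * sqrt var < \<mu>" "2 \<le> Y * sqrt var"
  shows "hyp_mean n a b (\<lambda>k. if Y * sqrt var < \<bar>real (\<Sum>v\<in>{1..n}. k v) - \<mu>\<bar> then f (\<Sum>v\<in>{1..n}. k v) else 0)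
    \<le> (real n * real (a + b)) ^ 5 * (sqrt 2 * exp (- 3 * Y\<^sup>2 / 4 + \<kappa> * Y\<^sup>2 / 2 + 2 * Y / sqrt var + mgf_err Y + stirling_err Y))"
proof -
  define R where "R = Y * sqrt var"
  define C where "C = sqrt 2 * exp (- 3 * Y\<^sup>2 / 4 + \<kappa> * Y\<^sup>2 / 2 + 2 * Y / sqrt var + mgf_err Y + stirling_err Y)"
  have C0: "0 \<le> C" by (simp add: C_def)
  have bd: "f s * p s \<le> C" if s: "R - 2 \<le> \<bar>real s - \<mu>\<bar>" "\<bar>real s - \<mu>\<bar> \<le> R" for s
  proof -
    have "f s \<le> sqrt 2 * exp (((real s - \<mu>) / sqrt var)\<^sup>2 / 4 + stirling_err Y)"
      using f_near[OF n Y(3)] s by (simp add: R_def)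
    also have "\<dots> \<le> sqrt 2 * exp (Y\<^sup>2 / 4 + stirling_err Y)"
    proof -
      have "\<bar>(real s - \<mu>) / sqrt var\<bar> \<le> Y" using s(2) sqrt_var(1) by (simp add: R_def abs_divide field_simps)
      then have "\<bar>(real s - \<mu>) / sqrt var\<bar>\<^sup>2 \<le> Y\<^sup>2" by (intro power_mono) auto
      then have "((real s - \<mu>) / sqrt var)\<^sup>2 \<le> Y\<^sup>2" by (simp only: power2_abs)
      then show ?thesis by (intro mult_left_mono iffD2[OF exp_le_cancel_iff]) auto
    qed
    finally have "f s * p s \<le> (sqrt 2 * exp (Y\<^sup>2 / 4 + stirling_err Y)) * exp (- Y\<^sup>2 + 2 * Y / sqrt var + \<kappa> * Y\<^sup>2 / 2 + mgf_err Y)"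
      using p_tail[OF Y(1,2)] s p_nonneg by (intro mult_mono) (auto simp: R_def)
    also have "\<dots> = C" by (simp add: C_def exp_add[symmetric] mult.assoc)
    finally show ?thesis .
  qed
  define G where "G = (real n * real (a + b)) ^ 4"
  have G1: "1 \<le> G"
  proof -
    have "1 * 1 \<le> real n * real (a + b)" using d_ge2 overlap_slices.n[OF overlap_slices_axioms] by (intro mult_mono) auto
    then show ?thesis unfolding G_def by (intro one_le_power) simp
  qed
  have dd: "0 < real (a + b)" using d_ge2 by simp
  have far: "f s * p s \<le> G * C" if s: "R < \<bar>real s - \<mu>\<bar>" "s \<le> n * a" for s
  proof (cases "\<mu> \<le> real s")
    case True
    \<comment> \<open>The least number of steps that enters the window; minimality places the end
      point within 2 of the edge.\<close>
    define j where "j = (LEAST j. real s - 2 * real j \<le> \<mu> + R)"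
    have "real s - 2 * real s \<le> \<mu> + R" using mu_pos Y by (auto simp: R_def intro: add_nonneg_nonneg order.trans[of _ 0])
    then have j1: "real s - 2 * real j \<le> \<mu> + R" unfolding j_def by (rule LeastI)
    have j0: "j \<noteq> 0" using j1 s True by (intro notI) auto
    then obtain i where i: "j = Suc i" by (cases j) auto
    have "\<not> real s - 2 * real i \<le> \<mu> + R" using not_less_Least[of i "\<lambda>j. real s - 2 * real j \<le> \<mu> + R"] i unfolding j_def by auto
    then have j2: "\<mu> + R - 2 < real s - 2 * real j" by (simp add: i)
    then have "0 < real s - 2 * real j" using mu_pos Y(4) by (simp add: R_def)
    then have le: "2 * j \<le> s" by linarith
    define s0 where "s0 = s - 2 * j"
    have s0: "s = s0 + 2 * j" "real s0 = real s - 2 * real j" using le by (auto simp: s0_def of_nat_diff)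
    have m: "(real a)\<^sup>2 * real n \<le> real s0 * real (a + b)"
    proof -
      have "\<mu> \<le> real s0" using j2 Y(4) unfolding s0(2) R_def by linarith
      then have "\<mu> * real (a + b) \<le> real s0 * real (a + b)" by (intro mult_right_mono) auto
      then show ?thesis using dd by (simp add: \<mu>_def)
    qed
    have "f s * p s \<le> G * (f s0 * p s0)" using up_bound[OF m, of j] s(2) s0(1) by (simp add: G_def)
    also have "\<dots> \<le> G * C"
    proof (intro mult_left_mono bd)
      show "R - 2 \<le> \<bar>real s0 - \<mu>\<bar>" "\<bar>real s0 - \<mu>\<bar> \<le> R" using j1 j2 s0(2) Y(4) by (auto simp: R_def)
    qed (use G1 in simp)
    finally show ?thesis .
  next
    case False
    define j where "j = (LEAST j. \<mu> - R \<le> real s + 2 * real j)"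
    obtain N where N: "\<mu> - R \<le> real N" using real_arch_simple by blast
    then have "\<mu> - R \<le> real s + 2 * real N" by simp
    then have j1: "\<mu> - R \<le> real s + 2 * real j" unfolding j_def by (rule LeastI)
    have j0: "j \<noteq> 0" using j1 s False by (intro notI) auto
    then obtain i where i: "j = Suc i" by (cases j) auto
    have "\<not> \<mu> - R \<le> real s + 2 * real i" using not_less_Least[of i "\<lambda>j. \<mu> - R \<le> real s + 2 * real j"] i unfolding j_def by auto
    then have j2: "real s + 2 * real j < \<mu> - R + 2" by (simp add: i)
    define s0 where "s0 = s + 2 * j"
    have s0: "real s0 = real s + 2 * real j" by (simp add: s0_def)
    have m: "real (s + 2 * j) * real (a + b) \<le> (real a)\<^sup>2 * real n"
    proof -
      have "real s0 \<le> \<mu>" using j2 Y(4) s0 by (simp add: R_def)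
      then have "real s0 * real (a + b) \<le> \<mu> * real (a + b)" by (intro mult_right_mono) auto
      then show ?thesis using dd by (simp add: \<mu>_def s0_def)
    qed
    have "f s * p s \<le> G * (f s0 * p s0)" using down_bound[OF m] by (simp add: G_def s0_def)
    also have "\<dots> \<le> G * C"
    proof (intro mult_left_mono bd)
      show "R - 2 \<le> \<bar>real s0 - \<mu>\<bar>" "\<bar>real s0 - \<mu>\<bar> \<le> R" using j1 j2 s0 Y(4) by (auto simp: R_def)
    qed (use G1 in simp)
    finally show ?thesis .
  qed
  have "hyp_mean n a b (\<lambda>k. (\<lambda>s. if Y * sqrt var < \<bar>real s - \<mu>\<bar> then f s else 0) (\<Sum>v\<in>{1..n}. k v))
     = (\<Sum>s\<le>n * a. (if Y * sqrt var < \<bar>real s - \<mu>\<bar> then f s else 0) * p s)"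
    by (rule hyp_mean_sum_slices)
  also have "\<dots> \<le> (\<Sum>s\<le>n * a. G * C)"
    using far C0 G1 by (intro sum_mono) (auto simp: R_def)
  also have "\<dots> = (real n * real a + 1) * (G * C)" by simp
  also have "\<dots> \<le> (real n * real (a + b)) * (G * C)"
  proof (intro mult_right_mono)
    have n1: "1 \<le> real n" using overlap_slices.n[OF overlap_slices_axioms] by simp
    have "1 * 1 \<le> real n * real b" using n1 a ab by (intro mult_mono) auto
    then show "real n * real a + 1 \<le> real n * real (a + b)" by (simp add: distrib_left)
  qed (use C0 G1 in simp)
  also have "\<dots> = (real n * real (a + b)) ^ 5 * C"
    by (simp add: G_def eval_nat_numeral)
  finally show ?thesis by (simp add: C_def)
qed

end

section \<open>Three contributions to the second moment\<close>

context overlap_slices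
begin

lemma hyp_mean_add: "hyp_mean n a b (\<lambda>k. F k + G k) = hyp_mean n a b F + hyp_mean n a b G"
  by (simp add: hyp_mean_def distrib_left sum.distrib)

lemma class_means:
  defines "\<mu>2 \<equiv> real n * real a - \<mu>" and "\<mu>4 \<equiv> real n * (real b - real a) + \<mu>"
  shows "\<mu> \<le> \<mu>2" "\<mu> \<le> \<mu>4" "1 / \<mu> + 2 / \<mu>2 + 1 / \<mu>4 = 1 / var"
proof -
  define A B D N where "A = real a" and "B = real b" and "D = A + B" and "N = real n"
  have pos: "0 < A" "A \<le> B" "0 < B" "0 < D" "0 < N" using a ab n by (auto simp: A_def B_def D_def N_def)
  have m: "\<mu> = A\<^sup>2 * N / D" by (simp add: \<mu>_def A_def B_def D_def N_def)
  have m2: "\<mu>2 = A * B * N / D"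
    unfolding \<mu>2_def m using pos by (simp add: A_def[symmetric] N_def[symmetric] field_simps) (simp add: D_def power2_eq_square algebra_simps)
  have m4: "\<mu>4 = B\<^sup>2 * N / D"
    unfolding \<mu>4_def m using pos by (simp add: A_def[symmetric] B_def[symmetric] N_def[symmetric] field_simps) (simp add: D_def power2_eq_square algebra_simps)
  show "\<mu> \<le> \<mu>2" "\<mu> \<le> \<mu>4" unfolding m m2 m4 using pos
    by (auto simp: power2_eq_square intro!: divide_right_mono mult_right_mono mult_mono)
  have "1 / \<mu> + 2 / \<mu>2 + 1 / \<mu>4 = D * (B\<^sup>2 + 2 * A * B + A\<^sup>2) / (N * A\<^sup>2 * B\<^sup>2)"
    unfolding m m2 m4 using pos by (simp add: field_simps power2_eq_square)
  also have "B\<^sup>2 + 2 * A * B + A\<^sup>2 = D\<^sup>2" by (simp add: D_def power2_eq_square algebra_simps)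
  also have "D * D\<^sup>2 / (N * A\<^sup>2 * B\<^sup>2) = 1 / var"
    by (simp add: var_def A_def B_def D_def N_def power2_eq_square power3_eq_cube mult_ac)
  finally show "1 / \<mu> + 2 / \<mu>2 + 1 / \<mu>4 = 1 / var" .
qed

lemma sizes_near:
  fixes s :: nat
  assumes s: "\<bar>real s - \<mu>\<bar> \<le> R" and R: "2 * R \<le> \<mu>"
  shows "\<mu> / 2 \<le> real s" "\<mu> / 2 \<le> real n * real a - real s" "0 < real n * (real b - real a) + real s" "s < n * a"
proof -
  show 1: "\<mu> / 2 \<le> real s" using s R by linarith
  show 2: "\<mu> / 2 \<le> real n * real a - real s" using s R class_means(1) by linarith
  show "0 < real n * (real b - real a) + real s" using 1 mu_pos ab by (intro add_nonneg_pos) auto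
  have "real s < real (n * a)" using 2 mu_pos by simp
  then show "s < n * a" by (simp only: of_nat_less_iff)
qed

text \<open>When the square sum is not too small, \<open>n\<close> times the empirical variance of
  the overlaps is at least nearly \<open>var\<close>; near the mean, the reciprocal class sizes add
  up to nearly \<open>1 / var\<close>. Their product is thus at least nearly 1, which is the final
  \<open>+ 1\<close> in the exponent \<open>d\<^sup>2 - 4 + 1\<close>.\<close>

lemma overlap_defect_ge:
  assumes \<epsilon>: "0 < \<epsilon>" "\<epsilon> \<le> 1" and R: "2 * R \<le> \<epsilon> * \<mu>" "12 * \<mu> * R \<le> \<epsilon> * real n * var"
    and S: "\<bar>real (\<Sum>v\<in>{1..n}. k v) - \<mu>\<bar> \<le> R"
    and Q: "real n * ((\<Sum>j\<le>a. hypergeom a b j * (real j)\<^sup>2) - \<epsilon> / 4 * var / real n) < real (\<Sum>v\<in>{1..n}. (k v)\<^sup>2)"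
  shows "1 - \<epsilon> \<le> overlap_defect n (a + b) a k"
proof -
  define s where "s = (\<Sum>v\<in>{1..n}. k v)"
  define q where "q = real (\<Sum>v\<in>{1..n}. (k v)\<^sup>2)"
  define t where "t = real s - \<mu>"
  have t: "\<bar>t\<bar> \<le> R" using S by (simp add: t_def s_def)
  then have R0: "0 \<le> R" by linarith
  have "\<epsilon> * \<mu> \<le> 1 * \<mu>" using \<epsilon> mu_pos by (intro mult_right_mono) auto
  then have R2: "2 * R \<le> \<mu>" using R by simp
  have n0: "0 < real n" using n by simp
  note sz = sizes_near[OF S[folded s_def] R2]
  define m V where "m = (real a)\<^sup>2 / real (a + b)" and "V = (real a)\<^sup>2 * (real b)\<^sup>2 / ((real (a + b))\<^sup>2 * (real (a + b) - 1))"
  have M2: "(\<Sum>j\<le>a. hypergeom a b j * (real j)\<^sup>2) = m\<^sup>2 + V" using hyp_second_moment[OF a ab] by (simp add: m_def V_def)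
  have nm: "real n * m = \<mu>" unfolding m_def by (rule mean_eq)
  have nV': "real n * V = var * \<kappa>" unfolding V_def by (rule nV)
  have "var * 1 \<le> var * \<kappa>" using kappa var_pos by (intro mult_left_mono) auto
  then have vk: "var \<le> real n * V" unfolding nV' by simp
  have "real n * (m\<^sup>2 + V - \<epsilon> / 4 * var / real n) = \<mu> * m + real n * V - \<epsilon> / 4 * var"
    using n0 nm by (simp add: algebra_simps power2_eq_square)
  then have Q': "\<mu> * m + var - \<epsilon> / 4 * var < q" using Q vk unfolding M2 q_def by linarith
  have mm: "m = \<mu> / real n" using nm n0 by (simp add: field_simps)
  have sq: "(real s)\<^sup>2 / real n = \<mu> * m + (2 * \<mu> * t + t\<^sup>2) / real n"
    using n0 unfolding mm t_def by (simp add: field_simps power2_eq_square)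
  have "2 * \<mu> * t + t\<^sup>2 \<le> 2 * \<mu> * R + \<mu> * R"
  proof (rule add_mono)
    show "2 * \<mu> * t \<le> 2 * \<mu> * R" using t mu_pos by (intro mult_left_mono) auto
    have "\<bar>t\<bar> * \<bar>t\<bar> \<le> \<mu> * R" using t R2 R0 by (intro mult_mono) auto
    then show "t\<^sup>2 \<le> \<mu> * R" by (simp add: power2_eq_square)
  qed
  then have "2 * \<mu> * t + t\<^sup>2 \<le> \<epsilon> / 4 * var * real n" using R(2) by argo
  then have "(2 * \<mu> * t + t\<^sup>2) / real n \<le> \<epsilon> / 4 * var" using n0 by (simp add: pos_divide_le_eq)
  then have W: "(1 - \<epsilon> / 2) * var \<le> q - (real s)\<^sup>2 / real n" using Q' unfolding sq by argo
  \<comment> \<open>Half of \<open>\<epsilon>\<close> is spent on the empirical variance and half on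
    the class sizes, as \<open>(1 - \<epsilon>) * (1 + \<epsilon> / 2) \<le> 1 - \<epsilon> /
    2\<close>.\<close>
  define \<delta> where "\<delta> = \<epsilon> / 2"
  have \<delta>: "0 < \<delta>" "R \<le> \<delta> * \<mu>" using \<epsilon> R by (auto simp: \<delta>_def)
  define \<mu>2 \<mu>4 where "\<mu>2 = real n * real a - \<mu>" and "\<mu>4 = real n * (real b - real a) + \<mu>"
  note cm = class_means[folded \<mu>2_def \<mu>4_def]
  have inv: "1 / (c * (1 + \<delta>)) \<le> 1 / u" if "u \<le> c + R" "0 < u" "\<mu> \<le> c" for c u
  proof -
    have "R \<le> \<delta> * c" using \<delta> that(3) by (meson mult_left_mono order.trans less_imp_le)
    then have "u \<le> c * (1 + \<delta>)" using that by (simp add: algebra_simps)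
    then show ?thesis using that by (intro divide_left_mono) auto
  qed
  have s1: "1 / (\<mu> * (1 + \<delta>)) \<le> 1 / real s" using t sz mu_pos by (intro inv) (auto simp: t_def)
  have s2: "1 / (\<mu>2 * (1 + \<delta>)) \<le> 1 / (real n * real a - real s)" using t sz mu_pos cm by (intro inv) (auto simp: t_def \<mu>2_def)
  have s4: "1 / (\<mu>4 * (1 + \<delta>)) \<le> 1 / (real n * (real b - real a) + real s)" using t sz mu_pos cm by (intro inv) (auto simp: t_def \<mu>4_def)
  define Bb where "Bb = 1 / real s + 2 / (real n * real a - real s) + 1 / (real n * (real b - real a) + real s)"
  have "1 / (var * (1 + \<delta>)) = 1 / (\<mu> * (1 + \<delta>)) + 2 * (1 / (\<mu>2 * (1 + \<delta>))) + 1 / (\<mu>4 * (1 + \<delta>))"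
    using arg_cong[OF cm(3), of "\<lambda>x. x / (1 + \<delta>)"] by (simp add: add_divide_distrib)
  also have "\<dots> \<le> 1 / real s + 2 * (1 / (real n * real a - real s)) + 1 / (real n * (real b - real a) + real s)"
    using s1 s2 s4 by (intro add_mono mult_left_mono) auto
  finally have BB: "1 / (var * (1 + \<delta>)) \<le> Bb" by (simp add: Bb_def)
  have "real (n * (a + b - 2 * a)) = real n * (real b - real a)" using ab by (simp add: of_nat_diff)
  then have od: "overlap_defect n (a + b) a k = (q - (real s)\<^sup>2 / real n) * Bb"
    unfolding overlap_defect_def Let_def s_def[symmetric] q_def[symmetric] Bb_def by simp
  have "1 - \<epsilon> \<le> ((1 - \<epsilon> / 2) * var) * (1 / (var * (1 + \<delta>)))"
  proof -
    have "(1 - \<epsilon>) * (1 + \<delta>) \<le> 1 - \<epsilon> / 2" using \<epsilon> by (simp add: \<delta>_def algebra_simps)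
    then have "1 - \<epsilon> \<le> (1 - \<epsilon> / 2) / (1 + \<delta>)" using \<delta> by (simp add: pos_le_divide_eq)
    also have "\<dots> = ((1 - \<epsilon> / 2) * var) * (1 / (var * (1 + \<delta>)))" using var_pos by simp
    finally show ?thesis .
  qed
  also have "\<dots> \<le> (q - (real s)\<^sup>2 / real n) * Bb"
  proof (rule mult_mono[OF W BB])
    have "0 \<le> (1 - \<epsilon> / 2) * var" using \<epsilon> var_pos by (intro mult_nonneg_nonneg) auto
    then show "0 \<le> q - (real s)\<^sup>2 / real n" using W by linarith
    show "0 \<le> 1 / (var * (1 + \<delta>))" using var_pos \<delta> by simp
  qed
  finally show ?thesis unfolding od .
qed

text \<open>Meant for \<open>x = 1 - \<epsilon>\<close> at typical overlap vectors and for
  \<open>x = 0\<close> when nothing is known about the defect. The smallest class has at least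
  \<open>\<mu> / 2\<close> points, which turns 33 into 66.\<close>

lemma simple_bound_near:
  assumes S: "\<bar>real (\<Sum>v\<in>{1..n}. k v) - \<mu>\<bar> \<le> R" and R: "2 * R \<le> \<mu>" and d: "256 * real (a + b) ^ 2 \<le> \<mu>"
    and x: "0 \<le> x" "x \<le> 1" "x \<le> overlap_defect n (a + b) a k \<or> x = 0"
  shows "simple_bound n (a + b) a k \<le> exp (- (real (a + b) ^ 2 - 4 + x\<^sup>2) / 4 + 66 * real (a + b) ^ 4 / \<mu>)"
proof -
  define s where "s = (\<Sum>v\<in>{1..n}. k v)"
  define m where "m = min s (n * a - s)"
  note sz = sizes_near[OF S[folded s_def] R]
  have "real (n * a - s) = real n * real a - real s" using sz(4) by (simp add: of_nat_diff)
  then have m: "\<mu> / 2 \<le> real m" using sz(1,2) by (auto simp: m_def min_def)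
  then have "real (128 * (a + b)\<^sup>2) \<le> real m" using d by simp
  then have c: "128 * (a + b)\<^sup>2 \<le> m" by (simp only: of_nat_le_iff)
  have x2: "x\<^sup>2 \<le> min 1 ((overlap_defect n (a + b) a k)\<^sup>2)"
  proof -
    have "x\<^sup>2 \<le> 1" using x by (simp add: power_le_one)
    moreover have "x\<^sup>2 \<le> (overlap_defect n (a + b) a k)\<^sup>2" using x by (auto intro: power_mono)
    ultimately show ?thesis by simp
  qed
  have "66 * real (a + b) ^ 4 / \<mu> = 33 * real (a + b) ^ 4 / (\<mu> / 2)" by simp
  moreover have "33 * real (a + b) ^ 4 / real m \<le> 33 * real (a + b) ^ 4 / (\<mu> / 2)"
    using m mu_pos by (intro divide_left_mono) auto
  ultimately have e: "33 * real (a + b) ^ 4 / real m \<le> 66 * real (a + b) ^ 4 / \<mu>" by simp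
  have "simple_bound n (a + b) a k = exp (- (real (a + b) ^ 2 - 4 + min 1 ((overlap_defect n (a + b) a k)\<^sup>2)) / 4 + 33 * real (a + b) ^ 4 / real m)"
    unfolding simple_bound_def Let_def s_def[symmetric] m_def[symmetric] using c by (simp only: if_True)
  also have "\<dots> \<le> exp (- (real (a + b) ^ 2 - 4 + x\<^sup>2) / 4 + 66 * real (a + b) ^ 4 / \<mu>)"
    by (intro iffD2[OF exp_le_cancel_iff] add_mono e divide_right_mono) (use x2 in auto)
  finally show ?thesis .
qed

text \<open>Where the switching estimate is in force, \<open>128 * d\<^sup>2 \<le> m\<close> keeps
  its error \<open>33 * d ^ 4 / m\<close> below \<open>d\<^sup>2\<close>. This crude bound suffices
  outside the window.\<close>

lemma simple_bound_le: "simple_bound n (a + b) a k \<le> exp (1 + real (a + b) ^ 2)"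
proof -
  define m where "m = min (\<Sum>v\<in>{1..n}. k v) (n * a - (\<Sum>v\<in>{1..n}. k v))"
  define D where "D = real (a + b)"
  have D0: "0 < D" using a by (simp add: D_def)
  show ?thesis
  proof (cases "128 * (a + b)\<^sup>2 \<le> m")
    case True
    then have "real (128 * (a + b)\<^sup>2) \<le> real m" by (simp only: of_nat_le_iff)
    then have m: "128 * D ^ 2 \<le> real m" by (simp add: D_def)
    then have m0: "0 < real m" using D0 by (smt (verit) zero_less_power mult_pos_pos)
    have "33 * D ^ 4 / real m \<le> 33 * D ^ 4 / (128 * D ^ 2)" using m m0 D0 by (intro divide_left_mono) auto
    also have "\<dots> = 33 / 128 * D ^ 2" using D0 by (simp add: field_simps power4_eq_xxxx power2_eq_square)
    also have "\<dots> \<le> D ^ 2" using D0 by simp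
    finally have "33 * D ^ 4 / real m \<le> D ^ 2" .
    moreover have "- (D ^ 2 - 4 + min 1 ((overlap_defect n (a + b) a k)\<^sup>2)) / 4 \<le> 1"
    proof -
      have "0 \<le> min 1 ((overlap_defect n (a + b) a k)\<^sup>2)" by simp
      then show ?thesis using zero_le_power2[of D] by argo
    qed
    ultimately have "- (D ^ 2 - 4 + min 1 ((overlap_defect n (a + b) a k)\<^sup>2)) / 4 + 33 * D ^ 4 / real m \<le> 1 + D ^ 2" by linarith
    then show ?thesis using True unfolding simple_bound_def Let_def m_def[symmetric] D_def[symmetric] by simp
  next
    case False
    then show ?thesis unfolding simple_bound_def Let_def m_def[symmetric] by (simp add: add_nonneg_nonneg)
  qed
qed

text \<open>An upper bound for \<open>E X\<^sup>2 / (E X)\<^sup>2\<close>, that is, for one plus the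
  chi-square divergence of the law of the union from the uniform law.\<close>

definition chi_square_bound :: real where
  "chi_square_bound = exp ((real (a + b) ^ 2 - 3) / 4 + 97 * real (a + b) ^ 4 / real n) *
     hyp_mean n a b (\<lambda>k. f (\<Sum>v\<in>{1..n}. k v) * simple_bound n (a + b) a k)"

text \<open>The three summands belong to the window with typical square sum, to the window with too
  small a square sum, which has exponentially small probability, and to the outside of the window,
  where simplicity is bounded crudely.\<close>

lemma chi_square_bound_le:
  assumes ev: "even n" and \<epsilon>: "0 < \<epsilon>" "\<epsilon> \<le> 1" and Y: "0 \<le> Y" "Y * real a \<le> sqrt var" "2 \<le> Y * sqrt var"
    and d: "256 * real (a + b) ^ 2 \<le> \<mu>" "2 < a + b"
    and R: "2 * (Y * sqrt var) \<le> \<epsilon> * \<mu>" "12 * \<mu> * (Y * sqrt var) \<le> \<epsilon> * real n * var"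
    and cm: "0 < central_mass Y"
  defines "E0 \<equiv> 66 * real (a + b) ^ 4 / \<mu> + 97 * real (a + b) ^ 4 / real n" and "D \<equiv> real (a + b)"
    and "se \<equiv> stirling_err Y" and "me \<equiv> mgf_err Y"
  shows "chi_square_bound \<le> exp (\<epsilon> / 2 + E0 + se + me) * (1 + exp (- real n / (2 * D\<^sup>2))) / (sqrt (2 - \<kappa>) * central_mass Y)
    + sqrt 2 * exp (1 / 4 + E0 + se + Y\<^sup>2 / 4 - (\<epsilon> / 4 * var)\<^sup>2 / (2 * real n * real a ^ 4))
    + sqrt 2 * (real n * D) ^ 5 * exp (2 * D\<^sup>2 + 1 + E0 - 3 * Y\<^sup>2 / 4 + \<kappa> * Y\<^sup>2 / 2 + 2 * Y / sqrt var + me + se)"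
proof -
  let ?S = "\<lambda>k. \<Sum>v\<in>{1..n}. k v :: nat"
  define rr where "rr = Y * sqrt var"
  have n0: "0 < real n" using n by simp
  have "\<epsilon> * \<mu> \<le> 1 * \<mu>" using \<epsilon> mu_pos by (intro mult_right_mono) auto
  then have R2: "2 * rr \<le> \<mu>" and Rlt: "rr < \<mu>" using R(1) mu_pos unfolding rr_def by linarith+
  define q \<gamma> where "q = (\<Sum>j\<le>a. hypergeom a b j * (real j)\<^sup>2)" and "\<gamma> = \<epsilon> / 4 * var / real n"
  have \<gamma>: "0 \<le> \<gamma>" using \<epsilon> var_pos by (simp add: \<gamma>_def)
  define c1 c2 c3 where "c1 = sqrt 2 * exp (se - (D ^ 2 - 4 + (1 - \<epsilon>)\<^sup>2) / 4 + 66 * D ^ 4 / \<mu>)"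
    and "c2 = sqrt 2 * exp (Y\<^sup>2 / 4 + se - (D ^ 2 - 4) / 4 + 66 * D ^ 4 / \<mu>)" and "c3 = exp (1 + D ^ 2)"
  define F1 where "F1 = (\<lambda>k. if even (?S k) \<and> \<bar>real (?S k) - \<mu>\<bar> \<le> rr then exp (((real (?S k) - \<mu>) / sqrt var)\<^sup>2 / 4) else 0)"
  define F2 where "F2 = (\<lambda>k. if real (\<Sum>v\<in>{1..n}. (k v)\<^sup>2) \<le> real n * (q - \<gamma>) then 1 else 0 :: real)"
  define F3 where "F3 = (\<lambda>k. if rr < \<bar>real (?S k) - \<mu>\<bar> then f (?S k) else 0)"
  have c: "0 \<le> c1" "0 \<le> c2" "0 \<le> c3" by (auto simp: c1_def c2_def c3_def)
  have F: "0 \<le> F1 k" "0 \<le> F2 k" "0 \<le> F3 k" for k using f_nonneg by (auto simp: F1_def F2_def F3_def)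
  have pt: "f (?S k) * simple_bound n (a + b) a k \<le> c1 * F1 k + (c2 * F2 k + c3 * F3 k)" for k
  proof -
    have sb0: "0 \<le> simple_bound n (a + b) a k" by (simp add: simple_bound_def Let_def)
    consider "odd (?S k)" | "rr < \<bar>real (?S k) - \<mu>\<bar>" | "even (?S k)" "\<bar>real (?S k) - \<mu>\<bar> \<le> rr" by linarith
    then show ?thesis
    proof cases
      case 1
      then show ?thesis using f_odd[OF 1] c F by (simp add: add_nonneg_nonneg)
    next
      case 2
      have "f (?S k) * simple_bound n (a + b) a k \<le> f (?S k) * c3"
        using simple_bound_le[of k] f_nonneg by (intro mult_left_mono) (auto simp: c3_def D_def)
      also have "\<dots> = c3 * F3 k" using 2 by (simp add: F3_def)
      also have "\<dots> \<le> c1 * F1 k + (c2 * F2 k + c3 * F3 k)" using c F by (simp add: add_nonneg_nonneg)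
      finally show ?thesis .
    next
      case 3
      define \<tau> where "\<tau> = (real (?S k) - \<mu>) / sqrt var"
      have fk: "f (?S k) \<le> sqrt 2 * exp (\<tau>\<^sup>2 / 4 + se)"
        using f_near[OF ev Rlt[unfolded rr_def] 3(2)[unfolded rr_def]] by (simp add: \<tau>_def se_def)
      have "\<bar>\<tau>\<bar> \<le> Y" using 3(2) sqrt_var(1) by (simp add: \<tau>_def rr_def abs_divide field_simps)
      then have "\<bar>\<tau>\<bar>\<^sup>2 \<le> Y\<^sup>2" by (intro power_mono) auto
      then have \<tau>Y: "\<tau>\<^sup>2 \<le> Y\<^sup>2" by (simp only: power2_abs)
      show ?thesis
      proof (cases "real (\<Sum>v\<in>{1..n}. (k v)\<^sup>2) \<le> real n * (q - \<gamma>)")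
        case False
        then have "1 - \<epsilon> \<le> overlap_defect n (a + b) a k"
          by (intro overlap_defect_ge[OF \<epsilon> R(1,2)]) (use 3(2) in \<open>auto simp: rr_def q_def \<gamma>_def\<close>)
        then have "simple_bound n (a + b) a k \<le> exp (- (D ^ 2 - 4 + (1 - \<epsilon>)\<^sup>2) / 4 + 66 * D ^ 4 / \<mu>)"
          unfolding D_def using \<epsilon> by (intro simple_bound_near[OF 3(2) R2 d(1)]) auto
        then have "f (?S k) * simple_bound n (a + b) a k \<le> (sqrt 2 * exp (\<tau>\<^sup>2 / 4 + se)) * exp (- (D ^ 2 - 4 + (1 - \<epsilon>)\<^sup>2) / 4 + 66 * D ^ 4 / \<mu>)"
          using fk sb0 by (intro mult_mono) auto
        also have "\<dots> = c1 * exp (\<tau>\<^sup>2 / 4)"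
          by (simp add: c1_def exp_add[symmetric] mult.assoc) (simp add: field_simps)
        also have "\<dots> = c1 * F1 k" using 3 by (simp add: F1_def \<tau>_def)
        also have "\<dots> \<le> c1 * F1 k + (c2 * F2 k + c3 * F3 k)" using c F by (simp add: add_nonneg_nonneg)
        finally show ?thesis .
      next
        case True
        have "simple_bound n (a + b) a k \<le> exp (- (D ^ 2 - 4 + 0\<^sup>2) / 4 + 66 * D ^ 4 / \<mu>)"
          unfolding D_def by (intro simple_bound_near[OF 3(2) R2 d(1)]) auto
        moreover have "f (?S k) \<le> sqrt 2 * exp (Y\<^sup>2 / 4 + se)"
          using fk \<tau>Y by (elim order.trans) simp
        ultimately have "f (?S k) * simple_bound n (a + b) a k \<le> (sqrt 2 * exp (Y\<^sup>2 / 4 + se)) * exp (- (D ^ 2 - 4 + 0\<^sup>2) / 4 + 66 * D ^ 4 / \<mu>)"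
          using sb0 by (intro mult_mono) auto
        also have "\<dots> = c2 * F2 k" using True by (simp add: c2_def F2_def exp_add[symmetric] mult.assoc) (simp add: field_simps)
        also have "\<dots> \<le> c1 * F1 k + (c2 * F2 k + c3 * F3 k)" using c F by (simp add: add_nonneg_nonneg)
        finally show ?thesis .
      qed
    qed
  qed
  have "hyp_mean n a b (\<lambda>k. f (?S k) * simple_bound n (a + b) a k) \<le> hyp_mean n a b (\<lambda>k. c1 * F1 k + (c2 * F2 k + c3 * F3 k))"
    by (rule hyp_mean_mono) (rule pt)
  also have "\<dots> = c1 * hyp_mean n a b F1 + (c2 * hyp_mean n a b F2 + c3 * hyp_mean n a b F3)"
    by (simp only: hyp_mean_add hyp_mean_cmult)
  finally have H: "hyp_mean n a b (\<lambda>k. f (?S k) * simple_bound n (a + b) a k) \<le> \<dots>" .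
  define \<rho> where "\<rho> = exp (- real n / (2 * D\<^sup>2))"
  have \<kappa>2: "\<kappa> < 2"
  proof -
    have "3 \<le> real (a + b)" using d by simp
    then show ?thesis by (simp add: \<kappa>_def field_simps del: of_nat_add)
  qed
  have h1: "hyp_mean n a b F1 \<le> (1 + \<rho>) / 2 * exp me / sqrt (1 - \<kappa> / 2) / central_mass Y"
    using near_gaussian[OF Y(1,2) d(2)] cm unfolding F1_def rr_def \<rho>_def D_def me_def by (subst pos_le_divide_eq) (simp_all only: mult.commute)
  have h2: "hyp_mean n a b F2 \<le> exp (- ((\<epsilon> / 4 * var)\<^sup>2 / (2 * real n * real a ^ 4)))"
  proof -
    have "hyp_mean n a b F2 \<le> exp (- (real n * \<gamma>\<^sup>2 / (2 * real a ^ 4)))"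
      using hyp_mean_square_sum_lower_tail[OF a ab \<gamma>, of n] by (simp only: F2_def q_def)
    also have "real n * \<gamma>\<^sup>2 / (2 * real a ^ 4) = (\<epsilon> / 4 * var)\<^sup>2 / (2 * real n * real a ^ 4)"
      using n0 by (simp add: \<gamma>_def field_simps power2_eq_square)
    finally show ?thesis .
  qed
  have h3: "hyp_mean n a b F3 \<le> (real n * D) ^ 5 * (sqrt 2 * exp (- 3 * Y\<^sup>2 / 4 + \<kappa> * Y\<^sup>2 / 2 + 2 * Y / sqrt var + me + se))"
    using far_sum[OF ev Y(1,2) Rlt[unfolded rr_def] Y(3)] by (simp only: F3_def rr_def D_def me_def se_def)
  define pf where "pf = exp ((D ^ 2 - 3) / 4 + 97 * D ^ 4 / real n)"
  have "chi_square_bound \<le> pf * (c1 * ((1 + \<rho>) / 2 * exp me / sqrt (1 - \<kappa> / 2) / central_mass Y) + (c2 * exp (- ((\<epsilon> / 4 * var)\<^sup>2 / (2 * real n * real a ^ 4)))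
      + c3 * ((real n * D) ^ 5 * (sqrt 2 * exp (- 3 * Y\<^sup>2 / 4 + \<kappa> * Y\<^sup>2 / 2 + 2 * Y / sqrt var + me + se)))))"
    unfolding chi_square_bound_def pf_def D_def[symmetric]
    by (intro mult_left_mono order.trans[OF H] add_mono h1 h2 h3 c) auto
  also have "\<dots> = pf * c1 * ((1 + \<rho>) / 2 * exp me / sqrt (1 - \<kappa> / 2) / central_mass Y) + pf * c2 * exp (- ((\<epsilon> / 4 * var)\<^sup>2 / (2 * real n * real a ^ 4)))
      + pf * c3 * ((real n * D) ^ 5 * (sqrt 2 * exp (- 3 * Y\<^sup>2 / 4 + \<kappa> * Y\<^sup>2 / 2 + 2 * Y / sqrt var + me + se)))"
    by (simp only: distrib_left mult.assoc add.assoc)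
  also have "\<dots> \<le> exp (\<epsilon> / 2 + E0 + se + me) * (1 + \<rho>) / (sqrt (2 - \<kappa>) * central_mass Y)
    + sqrt 2 * exp (1 / 4 + E0 + se + Y\<^sup>2 / 4 - (\<epsilon> / 4 * var)\<^sup>2 / (2 * real n * real a ^ 4))
    + sqrt 2 * (real n * D) ^ 5 * exp (2 * D\<^sup>2 + 1 + E0 - 3 * Y\<^sup>2 / 4 + \<kappa> * Y\<^sup>2 / 2 + 2 * Y / sqrt var + me + se)"
  proof (intro add_mono)
    \<comment> \<open>Here the exponents of the one-, two- and four-coloured counts cancel, except
      for \<open>(1 - (1 - \<epsilon>)\<^sup>2) / 4\<close> and vanishing errors.\<close>
    have "pf * c1 = sqrt 2 * exp ((1 - (1 - \<epsilon>)\<^sup>2) / 4 + E0 + se)"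
      unfolding pf_def c1_def E0_def D_def[symmetric] by (simp add: exp_add[symmetric] diff_divide_distrib add_divide_distrib algebra_simps)
    also have "\<dots> \<le> sqrt 2 * exp (\<epsilon> / 2 + E0 + se)"
    proof -
      have "(1 - (1 - \<epsilon>)\<^sup>2) / 4 \<le> \<epsilon> / 2" by (simp add: power2_eq_square algebra_simps)
      then show ?thesis by simp
    qed
    finally have pc: "pf * c1 \<le> sqrt 2 * exp (\<epsilon> / 2 + E0 + se)" .
    define X where "X = (1 + \<rho>) / 2 * exp me / sqrt (1 - \<kappa> / 2) / central_mass Y"
    have "0 \<le> X" using cm \<kappa>2 by (auto simp: X_def \<rho>_def add_nonneg_nonneg intro!: divide_nonneg_pos)
    then have "pf * c1 * X \<le> sqrt 2 * exp (\<epsilon> / 2 + E0 + se) * X" using pc by (intro mult_right_mono)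
    also have "\<dots> = exp (\<epsilon> / 2 + E0 + se + me) * (1 + \<rho>) / (sqrt (2 - \<kappa>) * central_mass Y)"
    proof -
      have s: "sqrt (1 - \<kappa> / 2) = sqrt (2 - \<kappa>) / sqrt 2" by (simp add: real_sqrt_divide[symmetric] diff_divide_distrib)
      have gen: "r * E * (x / 2 * M / (q / r) / P) = E * M * x / (q * P)" if "r * r = 2" for r E x M q P :: real
      proof -
        have "r * E * (x / 2 * M / (q / r) / P) = ((r * r) / 2) * (E * M * x / (q * P))" by (simp add: mult_ac)
        then show ?thesis using that by simp
      qed
      have "sqrt 2 * exp (\<epsilon> / 2 + E0 + se) * X = exp (\<epsilon> / 2 + E0 + se) * exp me * (1 + \<rho>) / (sqrt (2 - \<kappa>) * central_mass Y)"
        unfolding X_def s by (rule gen) simp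
      then show ?thesis by (simp only: exp_add)
    qed
    finally show "pf * c1 * ((1 + \<rho>) / 2 * exp me / sqrt (1 - \<kappa> / 2) / central_mass Y) \<le> exp (\<epsilon> / 2 + E0 + se + me) * (1 + \<rho>) / (sqrt (2 - \<kappa>) * central_mass Y)"
      unfolding X_def .
    have "pf * c2 = sqrt 2 * exp (1 / 4 + E0 + se + Y\<^sup>2 / 4)"
      unfolding pf_def c2_def E0_def D_def[symmetric] by (simp add: exp_add[symmetric] diff_divide_distrib add_divide_distrib algebra_simps)
    then have "pf * c2 * exp (- w) = sqrt 2 * exp (1 / 4 + E0 + se + Y\<^sup>2 / 4 - w)" for w
      by (simp only: mult.assoc exp_add[symmetric] add_uminus_conv_diff)
    then show "pf * c2 * exp (- ((\<epsilon> / 4 * var)\<^sup>2 / (2 * real n * real a ^ 4))) \<le> sqrt 2 * exp (1 / 4 + E0 + se + Y\<^sup>2 / 4 - (\<epsilon> / 4 * var)\<^sup>2 / (2 * real n * real a ^ 4))"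
      by (simp only: order.refl)
    have "pf * c3 \<le> exp (2 * D\<^sup>2 + 1 + E0)"
      unfolding pf_def c3_def E0_def D_def[symmetric] exp_add[symmetric]
    proof (rule iffD2[OF exp_le_cancel_iff])
      have "0 \<le> 66 * D ^ 4 / \<mu>" using mu_pos by (simp add: D_def)
      then show "(D\<^sup>2 - 3) / 4 + 97 * D ^ 4 / real n + (1 + D\<^sup>2) \<le> 2 * D\<^sup>2 + 1 + (66 * D ^ 4 / \<mu> + 97 * D ^ 4 / real n)"
        using zero_le_power2[of D] by argo
    qed
    then have "pf * c3 * ((real n * D) ^ 5 * (sqrt 2 * exp (- 3 * Y\<^sup>2 / 4 + \<kappa> * Y\<^sup>2 / 2 + 2 * Y / sqrt var + me + se)))
      \<le> exp (2 * D\<^sup>2 + 1 + E0) * ((real n * D) ^ 5 * (sqrt 2 * exp (- 3 * Y\<^sup>2 / 4 + \<kappa> * Y\<^sup>2 / 2 + 2 * Y / sqrt var + me + se)))"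
      by (intro mult_right_mono) (auto simp: D_def)
    also have "\<dots> = sqrt 2 * (real n * D) ^ 5 * (exp (2 * D\<^sup>2 + 1 + E0) * exp (- 3 * Y\<^sup>2 / 4 + \<kappa> * Y\<^sup>2 / 2 + 2 * Y / sqrt var + me + se))"
      by (simp only: mult_ac)
    also have "exp (2 * D\<^sup>2 + 1 + E0) * exp (- 3 * Y\<^sup>2 / 4 + \<kappa> * Y\<^sup>2 / 2 + 2 * Y / sqrt var + me + se) = 
      exp (2 * D\<^sup>2 + 1 + E0 - 3 * Y\<^sup>2 / 4 + \<kappa> * Y\<^sup>2 / 2 + 2 * Y / sqrt var + me + se)"
      unfolding exp_add[symmetric] by (rule arg_cong[of _ _ exp]) simp
    finally show "pf * c3 * ((real n * D) ^ 5 * (sqrt 2 * exp (- 3 * Y\<^sup>2 / 4 + \<kappa> * Y\<^sup>2 / 2 + 2 * Y / sqrt var + me + se)))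
      \<le> sqrt 2 * (real n * D) ^ 5 * exp (2 * D\<^sup>2 + 1 + E0 - 3 * Y\<^sup>2 / 4 + \<kappa> * Y\<^sup>2 / 2 + 2 * Y / sqrt var + me + se)" .
  qed
  finally show ?thesis unfolding \<rho>_def .
qed

end

section \<open>Choice of the window and asymptotics\<close>

context overlap_slices begin

text \<open>The window is \<open>Y = x powr (1/8)\<close>. The exponent has to exceed 1/10, so that
  \<open>Y\<^sup>2\<close> dominates \<open>D\<^sup>2\<close> and the far part vanishes, and to stay
  below 3/20, so that \<open>Y ^ 3 * sqrt (D / x)\<close> tends to 0. With 1/8 the latter is of
  order \<open>x powr (-3/40)\<close>, which is the quantity \<open>u\<close>.\<close>

lemma chi_square_bound_le_powr:
  fixes C \<epsilon> q :: real
  defines "x \<equiv> real n" and "D \<equiv> real (a + b)"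
  defines "u \<equiv> C * x powr (-3/40)"
  defines "E \<equiv> 163 * C ^ 5 * x powr (-1/2)"
  assumes "even n" and \<epsilon>: "0 < \<epsilon>" "\<epsilon> \<le> 1" and C: "1 \<le> C" and D: "D \<le> C * x powr (1/10)" and D5: "5 \<le> D"
    and u: "24 * u \<le> \<epsilon>" and x: "256 * C ^ 3 * x powr (3/10) \<le> x"
    and cm: "0 < 1 - sqrt 2 * exp (- (x powr (1/4)) / 8)"
    and q: "0 < q" "q \<le> sqrt (2 - \<kappa>)"
  shows "chi_square_bound \<le>
      exp (\<epsilon> / 2 + E + 5 * u + 2 / x) * (1 + exp (- (x powr (4/5)) / (2 * C\<^sup>2)))
        / (q * (1 - sqrt 2 * exp (- (x powr (1/4)) / 8)))
      + sqrt 2 * exp (1 / 4 + E + u + 2 / x + x powr (1/4) / 4 - \<epsilon>\<^sup>2 * x powr (4/5) / (512 * C\<^sup>2))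
      + sqrt 2 * (C ^ 5 * x ^ 6) * exp (2 * C\<^sup>2 * x powr (1/5) + 1 + E - x powr (1/4) / 8 + 9 * u + 2 / x)"
proof -
  define A where "A = real a"
  define Y where "Y = x powr (1/8)"
  \<comment> \<open>All scales are expressed through this ratio: \<open>\<mu>\<close> is the square
    of \<open>A / \<eta>\<close>, and the standard deviation \<open>sv\<close> lies between
    \<open>A / (2 * \<eta>)\<close> and \<open>A / \<eta>\<close>.\<close>
  define \<eta> where "\<eta> = sqrt (D / x)"
  have x1: "1 \<le> x" using n by (simp add: x_def)
  then have x0: "0 < x" by simp
  have A1: "1 \<le> A" using a by (simp add: A_def)
  have D0: "0 < D" using D5 by simp
  have AD: "2 * A \<le> D" using ab by (simp add: A_def D_def)
  have \<eta>0: "0 < \<eta>" using x0 D0 by (simp add: \<eta>_def)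
  have \<eta>2: "\<eta>\<^sup>2 = D / x" using x0 D0 by (simp add: \<eta>_def)
  have Y1: "1 \<le> Y" using x1 by (simp add: Y_def ge_one_powr_ge_zero)
  have Ysq: "Y\<^sup>2 = x powr (1/4)" using x0 by (simp add: Y_def power2_eq_square powr_add[symmetric])
  have Ycu: "Y ^ 3 = x powr (3/8)" using x0 by (simp add: Y_def power3_eq_cube powr_add[symmetric])
  have Dp: "D ^ k \<le> C ^ k * x powr (real k / 10)" for k
  proof -
    have "D ^ k \<le> (C * x powr (1/10)) ^ k" using D D0 by (intro power_mono) auto
    also have "\<dots> = C ^ k * x powr (real k / 10)" using x0 by (simp add: power_mult_distrib powr_powr powr_realpow[symmetric] powr_gt_zero)
    finally show ?thesis .
  qed
  have u3: "Y ^ 3 * \<eta> \<le> u"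
  proof (rule power2_le_imp_le)
    show "0 \<le> u" using C by (simp add: u_def)
    have "(Y ^ 3 * \<eta>)\<^sup>2 = (x powr (3/8))\<^sup>2 * (D / x)" by (simp add: power_mult_distrib \<eta>2 Ycu)
    also have "\<dots> \<le> (x powr (3/8))\<^sup>2 * (C * x powr (1/10) / x)" using D x0 by (intro mult_left_mono divide_right_mono) auto
    also have "\<dots> = C * x powr (-6/40)"
    proof -
      have "x powr (1/10) / x = x powr (1/10) / x powr 1" using x0 by simp
      then have "(x powr (3/8))\<^sup>2 * (x powr (1/10) / x) = x powr (-6/40)"
        unfolding powr_diff[symmetric] power2_eq_square by (simp add: powr_add[symmetric])
      moreover have "(x powr (3/8))\<^sup>2 * (C * x powr (1/10) / x) = C * ((x powr (3/8))\<^sup>2 * (x powr (1/10) / x))"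
        by simp
      ultimately show ?thesis by (simp only:)
    qed
    also have "\<dots> \<le> C * C * x powr (-6/40)" using C by (intro mult_right_mono) auto
    also have "\<dots> = u\<^sup>2" using x0 by (simp add: u_def power2_eq_square powr_add[symmetric])
    finally show "(Y ^ 3 * \<eta>)\<^sup>2 \<le> u\<^sup>2" .
  qed
  have u0: "0 \<le> u" using C by (simp add: u_def)
  have "Y \<le> Y ^ 3" using Y1 power_increasing[of 1 3 Y] by simp
  then have u1: "Y * \<eta> \<le> u" using u3 \<eta>0 by (meson mult_right_mono less_imp_le order_trans)
  have \<eta>u: "\<eta> \<le> u" using u1 mult_right_mono[OF Y1 less_imp_le[OF \<eta>0]] by simp
  have u24: "24 * u \<le> 1" using u \<epsilon> by simp
  have mu: "\<mu> = A\<^sup>2 / \<eta>\<^sup>2" unfolding \<eta>2 by (simp add: \<mu>_def A_def D_def x_def)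
  define sv where "sv = sqrt var"
  have sv2: "sv\<^sup>2 = var" using var_pos by (simp add: sv_def)
  have vareq: "var = (A * (D - A) / (\<eta> * D))\<^sup>2"
  proof -
    have "var = x * A\<^sup>2 * (D - A)\<^sup>2 / D ^ 3" by (simp add: var_def A_def D_def x_def)
    also have "\<dots> = A\<^sup>2 * (D - A)\<^sup>2 / (D / x * D\<^sup>2)" using x0 D0 by (simp add: power2_eq_square power3_eq_cube mult_ac)
    finally show ?thesis by (simp only: power_divide power_mult_distrib \<eta>2)
  qed
  have sveq: "sv = A * (D - A) / (\<eta> * D)" unfolding sv_def vareq using A1 AD \<eta>0 D0 by simp
  have sv_le: "sv \<le> A / \<eta>" unfolding sveq using A1 AD \<eta>0 D0 by (simp add: field_simps)
  have sv_ge: "A / (2 * \<eta>) \<le> sv" unfolding sveq using A1 AD \<eta>0 D0 by (simp add: field_simps)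
  have svp: "0 < sv" using var_pos by (simp add: sv_def)
  have isv: "1 / sv \<le> 2 * \<eta> / A"
  proof -
    have "1 / sv \<le> 1 / (A / (2 * \<eta>))" using sv_ge A1 \<eta>0 svp by (intro divide_left_mono mult_pos_pos divide_pos_pos) auto
    then show ?thesis by simp
  qed
  have Ysv: "Y * sv \<le> Y * A / \<eta>" using sv_le Y1 by (metis mult_left_mono order.trans times_divide_eq_right zero_le_one)
  have h1: "Y * real a \<le> sqrt var"
  proof -
    have "Y * \<eta> * 2 \<le> 1" using u1 u24 u0 by linarith
    then have "Y * A \<le> A / (2 * \<eta>)" using \<eta>0 A1 by (simp add: field_simps)
    then show ?thesis using sv_ge by (simp add: sv_def A_def)
  qed
  have h2: "2 \<le> Y * sqrt var"
  proof -
    have "4 * \<eta> \<le> A" using \<eta>u u24 A1 u0 by linarith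
    then have "2 \<le> A / (2 * \<eta>)" using \<eta>0 by (simp add: field_simps)
    then have "2 \<le> sv" using sv_ge by linarith
    then show ?thesis using mult_right_mono[OF Y1 less_imp_le[OF svp]] by (simp add: sv_def)
  qed
  have A21: "1 \<le> A\<^sup>2" using A1 by simp
  have h3: "256 * real (a + b) ^ 2 \<le> \<mu>"
  proof -
    have "256 * D ^ 3 \<le> 256 * (C ^ 3 * x powr (3/10))" using Dp[of 3] by simp
    then have "256 * D ^ 3 \<le> x" using x by simp
    then have "256 * D\<^sup>2 \<le> x / D" using D0 by (simp add: field_simps power2_eq_square power3_eq_cube)
    also have "\<dots> \<le> A\<^sup>2 * x / D" using A21 x0 D0 by (simp add: divide_right_mono)
    finally show ?thesis by (simp add: \<mu>_def A_def D_def x_def)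
  qed
  have h4: "2 * (Y * sqrt var) \<le> \<epsilon> * \<mu>"
  proof -
    have "2 * (Y * \<eta>) \<le> \<epsilon> * A"
    proof -
      have "2 * (Y * \<eta>) \<le> \<epsilon>" using u1 u u0 by linarith
      also have "\<dots> \<le> \<epsilon> * A" using \<epsilon> A1 by simp
      finally show ?thesis .
    qed
    then have "2 * (Y * \<eta>) * (A / \<eta>\<^sup>2) \<le> \<epsilon> * A * (A / \<eta>\<^sup>2)" using A1 by (intro mult_right_mono) auto
    then have "2 * (Y * A / \<eta>) \<le> \<epsilon> * \<mu>" using \<eta>0 by (simp add: mu power2_eq_square mult_ac)
    then show ?thesis using Ysv by (simp add: sv_def)
  qed
  have h5: "12 * \<mu> * (Y * sqrt var) \<le> \<epsilon> * real n * var"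
  proof -
    have "24 * (Y * \<eta>) * A \<le> \<epsilon> * D"
    proof (rule mult_mono)
      show "24 * (Y * \<eta>) \<le> \<epsilon>" using u1 u by linarith
    qed (use \<epsilon> AD A1 in auto)
    then have "24 * (Y * \<eta>) * A * (A / (2 * \<eta> ^ 3)) \<le> \<epsilon> * D * (A / (2 * \<eta> ^ 3))" using A1 \<eta>0 by (intro mult_right_mono) auto
    moreover have "24 * (Y * \<eta>) * A * (A / (2 * \<eta> ^ 3)) = 12 * \<mu> * Y" using \<eta>0 by (simp add: mu power2_eq_square power3_eq_cube)
    moreover have "\<epsilon> * D * (A / (2 * \<eta> ^ 3)) = \<epsilon> * x * (A / (2 * \<eta>))"
    proof -
      have "D = x * \<eta>\<^sup>2" using \<eta>2 x0 by simp
      then show ?thesis using \<eta>0 by (simp add: power2_eq_square power3_eq_cube)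
    qed
    ultimately have "12 * \<mu> * Y \<le> \<epsilon> * x * (A / (2 * \<eta>))" by simp
    also have "\<dots> \<le> \<epsilon> * x * sv" using sv_ge \<epsilon> x0 by (intro mult_left_mono) auto
    finally have "12 * \<mu> * Y * sv \<le> \<epsilon> * x * sv * sv" using svp by (intro mult_right_mono) auto
    then show ?thesis unfolding x_def[symmetric] sv_def[symmetric] by (simp only: sv2[symmetric] power2_eq_square mult_ac)
  qed
  have cmY: "1 - sqrt 2 * exp (- (x powr (1/4)) / 8) \<le> central_mass Y"
    using central_mass_ge[of Y] Y1 by (simp add: Ysq)
  define E0 where "E0 = 66 * real (a + b) ^ 4 / \<mu> + 97 * real (a + b) ^ 4 / real n"
  have E0: "E0 \<le> E"
  proof -
    have "66 * D ^ 4 / \<mu> = 66 * D ^ 5 / x / A\<^sup>2" unfolding mu \<eta>2 using x0 D0 A1 by (simp add: field_simps power_numeral_reduce)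
    also have "\<dots> \<le> 66 * D ^ 5 / x" using A21 x0 D0 by (simp add: divide_le_eq mult_left_le_one_le le_divide_eq)
    finally have 1: "66 * D ^ 4 / \<mu> \<le> 66 * D ^ 5 / x" .
    have "97 * D ^ 4 / x \<le> 97 * D ^ 5 / x" using x0 D5 power_increasing[of 4 5 D] by (intro divide_right_mono) auto
    then have "E0 \<le> 66 * D ^ 5 / x + 97 * D ^ 5 / x" using 1 unfolding E0_def D_def[symmetric] x_def[symmetric] by (intro add_mono)
    also have "\<dots> = 163 * D ^ 5 / x" by (simp add: add_divide_distrib[symmetric])
    also have "\<dots> \<le> 163 * (C ^ 5 * x powr (1/2)) / x" using Dp[of 5] x0 by (intro divide_right_mono mult_left_mono) auto
    also have "\<dots> = 163 * C ^ 5 * (x powr (1/2) / x powr 1)" using x0 by simp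
    also have "\<dots> = E" unfolding powr_diff[symmetric] by (simp add: E_def)
    finally show ?thesis .
  qed
  have se: "stirling_err Y \<le> u + 2 / x"
  proof -
    have "(Y * sqrt var) ^ 3 \<le> (Y * A / \<eta>) ^ 3" using Ysv Y1 svp by (intro power_mono) (auto simp: sv_def)
    then have "(Y * sqrt var) ^ 3 / \<mu>\<^sup>2 \<le> (Y * A / \<eta>) ^ 3 / \<mu>\<^sup>2" by (intro divide_right_mono) auto
    also have "\<dots> = Y ^ 3 * \<eta> / A" using \<eta>0 A1 by (simp add: mu field_simps power_numeral_reduce)
    also have "\<dots> \<le> Y ^ 3 * \<eta>" using A1 Y1 \<eta>0 by (simp add: divide_le_eq mult_left_le le_divide_eq)
    also note u3
    finally have 1: "(Y * sqrt var) ^ 3 / \<mu>\<^sup>2 \<le> u" .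
    have "2 / (x * A) \<le> 2 / (x * 1)" using A1 x0 by (intro divide_left_mono mult_left_mono mult_pos_pos) auto
    then show ?thesis using 1 by (simp add: stirling_err_def A_def x_def)
  qed
  have me: "mgf_err Y \<le> 4 * u"
  proof -
    have "mgf_err Y = 2 * A * Y ^ 3 * (1 / sv)" by (simp add: mgf_err_def A_def sv_def)
    also have "\<dots> \<le> 2 * A * Y ^ 3 * (2 * \<eta> / A)" using isv A1 Y1 by (intro mult_left_mono) auto
    also have "\<dots> = 4 * (Y ^ 3 * \<eta>)" using A1 by simp
    finally show ?thesis using u3 by simp
  qed
  have yv: "2 * Y / sqrt var \<le> 4 * u"
  proof -
    have "2 * Y / sv = 2 * Y * (1 / sv)" by simp
    also have "\<dots> \<le> 2 * Y * (2 * \<eta> / A)" using isv Y1 by (intro mult_left_mono) auto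
    also have "\<dots> = 4 * (Y * \<eta>) / A" by simp
    also have "\<dots> \<le> 4 * (Y * \<eta>)" using A1 Y1 \<eta>0 by (simp add: divide_le_eq mult_left_le le_divide_eq)
    finally show ?thesis using u1 by (simp add: sv_def)
  qed
  have xD: "x powr (4/5) / C\<^sup>2 \<le> x / D\<^sup>2"
  proof -
    have "x powr (4/5) * D\<^sup>2 \<le> x powr (4/5) * (C\<^sup>2 * x powr (1/5))" using Dp[of 2] by (intro mult_left_mono) auto
    also have "\<dots> = C\<^sup>2 * (x powr (4/5) * x powr (1/5))" by simp
    also have "x powr (4/5) * x powr (1/5) = x" using x0 by (simp add: powr_add[symmetric])
    finally show ?thesis using C D0 by (simp add: field_simps)
  qed
  have w: "\<epsilon>\<^sup>2 * x powr (4/5) / (512 * C\<^sup>2) \<le> (\<epsilon> / 4 * var)\<^sup>2 / (2 * real n * real a ^ 4)"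
  proof -
    have "\<epsilon>\<^sup>2 * x powr (4/5) / (512 * C\<^sup>2) = \<epsilon>\<^sup>2 / 512 * (x powr (4/5) / C\<^sup>2)" by simp
    also have "\<dots> \<le> \<epsilon>\<^sup>2 / 512 * (x / D\<^sup>2)" using xD by (intro mult_left_mono) auto
    also have "\<dots> = (\<epsilon> / 4 * (A / (2 * \<eta>))\<^sup>2)\<^sup>2 / (2 * x * A ^ 4)"
      unfolding power_divide power_mult_distrib \<eta>2 using x0 D0 A1 by (simp add: field_simps power_numeral_reduce)
    also have "\<dots> \<le> (\<epsilon> / 4 * sv\<^sup>2)\<^sup>2 / (2 * x * A ^ 4)" using sv_ge \<epsilon> A1 \<eta>0 x0
      by (intro divide_right_mono power_mono mult_left_mono) auto
    finally show ?thesis by (simp add: sv2 x_def A_def)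
  qed
  have D2: "D\<^sup>2 \<le> C\<^sup>2 * x powr (1/5)" using Dp[of 2] by simp
  have nD: "(x * D) ^ 5 \<le> C ^ 5 * x ^ 6"
  proof -
    have "(x * D) ^ 5 \<le> x ^ 5 * (C ^ 5 * x powr (1/2))" using Dp[of 5] x0 by (simp add: power_mult_distrib)
    also have "\<dots> \<le> x ^ 5 * (C ^ 5 * x)" using x1 C powr_mono[of "1/2" 1 x] by (intro mult_left_mono) auto
    finally show ?thesis by (simp add: power_numeral_reduce mult_ac)
  qed
  \<comment> \<open>This makes the coefficient of \<open>Y\<^sup>2\<close> in the far part at most
    \<open>- 3/4 + 5/8 = - 1/8\<close>.\<close>
  have \<kappa>54: "\<kappa> \<le> 5 / 4" using D5 unfolding \<kappa>_def D_def[symmetric] by (simp add: divide_le_eq)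
  have \<rho>: "exp (- real n / (2 * real (a + b) ^ 2)) \<le> exp (- (x powr (4/5)) / (2 * C\<^sup>2))"
    unfolding x_def[symmetric] D_def[symmetric] using xD by simp
  have "chi_square_bound \<le> exp (\<epsilon> / 2 + E0 + stirling_err Y + mgf_err Y) * (1 + exp (- real n / (2 * D\<^sup>2))) / (sqrt (2 - \<kappa>) * central_mass Y)
    + sqrt 2 * exp (1 / 4 + E0 + stirling_err Y + Y\<^sup>2 / 4 - (\<epsilon> / 4 * var)\<^sup>2 / (2 * real n * real a ^ 4))
    + sqrt 2 * (real n * D) ^ 5 * exp (2 * D\<^sup>2 + 1 + E0 - 3 * Y\<^sup>2 / 4 + \<kappa> * Y\<^sup>2 / 2 + 2 * Y / sqrt var + mgf_err Y + stirling_err Y)"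
    unfolding E0_def D_def
    by (rule chi_square_bound_le) (use \<open>even n\<close> \<epsilon> Y1 h1 h2 h3 h4 h5 cm cmY D5 in \<open>auto simp: D_def\<close>)
  also have "\<dots> \<le> exp (\<epsilon> / 2 + E + 5 * u + 2 / x) * (1 + exp (- (x powr (4/5)) / (2 * C\<^sup>2)))
        / (q * (1 - sqrt 2 * exp (- (x powr (1/4)) / 8)))
      + sqrt 2 * exp (1 / 4 + E + u + 2 / x + x powr (1/4) / 4 - \<epsilon>\<^sup>2 * x powr (4/5) / (512 * C\<^sup>2))
      + sqrt 2 * (C ^ 5 * x ^ 6) * exp (2 * C\<^sup>2 * x powr (1/5) + 1 + E - x powr (1/4) / 8 + 9 * u + 2 / x)"
  proof (intro add_mono)
    show "exp (\<epsilon> / 2 + E0 + stirling_err Y + mgf_err Y) * (1 + exp (- real n / (2 * D\<^sup>2))) / (sqrt (2 - \<kappa>) * central_mass Y)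
      \<le> exp (\<epsilon> / 2 + E + 5 * u + 2 / x) * (1 + exp (- (x powr (4/5)) / (2 * C\<^sup>2))) / (q * (1 - sqrt 2 * exp (- (x powr (1/4)) / 8)))"
    proof (intro frac_le mult_mono)
      show "exp (\<epsilon> / 2 + E0 + stirling_err Y + mgf_err Y) \<le> exp (\<epsilon> / 2 + E + 5 * u + 2 / x)"
        using E0 se me by simp
      show "1 + exp (- real n / (2 * D\<^sup>2)) \<le> 1 + exp (- (x powr (4/5)) / (2 * C\<^sup>2))"
        using \<rho> by (simp add: D_def)
    qed (use q cm cmY \<kappa>54 in \<open>auto simp: add_nonneg_nonneg\<close>)
    have "1 / 4 + E0 + stirling_err Y + Y\<^sup>2 / 4 - (\<epsilon> / 4 * var)\<^sup>2 / (2 * real n * real a ^ 4)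
       \<le> 1 / 4 + E + u + 2 / x + x powr (1/4) / 4 - \<epsilon>\<^sup>2 * x powr (4/5) / (512 * C\<^sup>2)"
      using E0 se w Ysq by argo
    then show "sqrt 2 * exp (1 / 4 + E0 + stirling_err Y + Y\<^sup>2 / 4 - (\<epsilon> / 4 * var)\<^sup>2 / (2 * real n * real a ^ 4))
       \<le> sqrt 2 * exp (1 / 4 + E + u + 2 / x + x powr (1/4) / 4 - \<epsilon>\<^sup>2 * x powr (4/5) / (512 * C\<^sup>2))"
      by simp
    show "sqrt 2 * (real n * D) ^ 5 * exp (2 * D\<^sup>2 + 1 + E0 - 3 * Y\<^sup>2 / 4 + \<kappa> * Y\<^sup>2 / 2 + 2 * Y / sqrt var + mgf_err Y + stirling_err Y)
      \<le> sqrt 2 * (C ^ 5 * x ^ 6) * exp (2 * C\<^sup>2 * x powr (1/5) + 1 + E - x powr (1/4) / 8 + 9 * u + 2 / x)"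
    proof (intro mult_mono)
      have "\<kappa> * Y\<^sup>2 \<le> 5 / 4 * Y\<^sup>2" using \<kappa>54 by (intro mult_right_mono) auto
      then have "2 * D\<^sup>2 + 1 + E0 - 3 * Y\<^sup>2 / 4 + \<kappa> * Y\<^sup>2 / 2 + 2 * Y / sqrt var + mgf_err Y + stirling_err Y
         \<le> 2 * C\<^sup>2 * x powr (1/5) + 1 + E - x powr (1/4) / 8 + 9 * u + 2 / x"
        using D2 E0 yv me se Ysq by argo
      then show "exp (2 * D\<^sup>2 + 1 + E0 - 3 * Y\<^sup>2 / 4 + \<kappa> * Y\<^sup>2 / 2 + 2 * Y / sqrt var + mgf_err Y + stirling_err Y)
        \<le> exp (2 * C\<^sup>2 * x powr (1/5) + 1 + E - x powr (1/4) / 8 + 9 * u + 2 / x)" by simp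
    qed (use nD x0 C D0 in \<open>auto simp: x_def\<close>)
  qed
  finally show ?thesis .
qed

end

text \<open>The thresholds depend on \<open>C\<close> and \<open>\<epsilon>\<close> only. Uniformity
  in \<open>a\<close> is essential, because the split of the degree may vary with \<open>n\<close>
  in any manner.\<close>

lemma chi_square_bound_le_exp:
  fixes C \<epsilon> :: real
  assumes \<epsilon>: "0 < \<epsilon>" "\<epsilon> \<le> 1" and C: "1 \<le> C"
  shows "\<exists>D0 N0. \<forall>n a b. even n \<longrightarrow> N0 \<le> n \<longrightarrow> 0 < a \<longrightarrow> a \<le> b \<longrightarrow> D0 \<le> a + b \<longrightarrow>
           real (a + b) \<le> C * real n powr (1/10) \<longrightarrow> overlap_slices.chi_square_bound n a b \<le> exp \<epsilon>"
proof -
  \<comment> \<open>A constant in place of \<open>sqrt (2 - \<kappa>)\<close>, so that the bound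
    depends on \<open>x\<close> alone. Its limit is
    \<open>exp (\<epsilon> / 2) / q = exp (3 * \<epsilon> / 4)\<close>, below the target.\<close>
  define q where "q = exp (- (\<epsilon> / 4))"
  have q: "0 < q" "q < 1" using \<epsilon> by (auto simp: q_def)
  have q2: "q\<^sup>2 < 1" using q by (simp add: power_less_one_iff)
  define bound where "bound = (\<lambda>x::real.
      exp (\<epsilon> / 2 + 163 * C ^ 5 * x powr (-1/2) + 5 * (C * x powr (-3/40)) + 2 / x) * (1 + exp (- (x powr (4/5)) / (2 * C\<^sup>2)))
        / (q * (1 - sqrt 2 * exp (- (x powr (1/4)) / 8)))
      + sqrt 2 * exp (1 / 4 + 163 * C ^ 5 * x powr (-1/2) + C * x powr (-3/40) + 2 / x + x powr (1/4) / 4 - \<epsilon>\<^sup>2 * x powr (4/5) / (512 * C\<^sup>2))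
      + sqrt 2 * (C ^ 5 * x ^ 6) * exp (2 * C\<^sup>2 * x powr (1/5) + 1 + 163 * C ^ 5 * x powr (-1/2) - x powr (1/4) / 8 + 9 * (C * x powr (-3/40)) + 2 / x))"
  have C0: "0 < C" using C by simp
  have "((\<lambda>x. exp (\<epsilon> / 2 + 163 * C ^ 5 * x powr (-1/2) + 5 * (C * x powr (-3/40)) + 2 / x) * (1 + exp (- (x powr (4/5)) / (2 * C\<^sup>2)))
     / (q * (1 - sqrt 2 * exp (- (x powr (1/4)) / 8)))) \<longlongrightarrow> exp (\<epsilon> / 2) * inverse q) at_top"
    using \<epsilon>(1) C0 q(1) by real_asymp
  moreover have "((\<lambda>x. sqrt 2 * exp (1 / 4 + 163 * C ^ 5 * x powr (-1/2) + C * x powr (-3/40) + 2 / x + x powr (1/4) / 4 - \<epsilon>\<^sup>2 * x powr (4/5) / (512 * C\<^sup>2))) \<longlongrightarrow> 0) at_top"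
    using \<epsilon>(1) C0 by real_asymp
  moreover have "((\<lambda>x. sqrt 2 * (C ^ 5 * x ^ 6) * exp (2 * C\<^sup>2 * x powr (1/5) + 1 + 163 * C ^ 5 * x powr (-1/2) - x powr (1/4) / 8 + 9 * (C * x powr (-3/40)) + 2 / x)) \<longlongrightarrow> 0) at_top"
    using \<epsilon>(1) C0 by real_asymp
  ultimately have "(bound \<longlongrightarrow> exp (\<epsilon> / 2) * inverse q + 0 + 0) at_top"
    unfolding bound_def by (intro tendsto_add)
  moreover have "exp (\<epsilon> / 2) * inverse q + 0 + 0 < exp \<epsilon>"
    using \<epsilon> by (simp add: q_def exp_minus[symmetric] exp_add[symmetric])
  ultimately have b: "eventually (\<lambda>x. bound x < exp \<epsilon>) at_top" by (rule order_tendstoD)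
  have cm: "eventually (\<lambda>x::real. 0 < 1 - sqrt 2 * exp (- (x powr (1/4)) / 8)) at_top" by real_asymp
  have u: "eventually (\<lambda>x::real. 24 * (C * x powr (-3/40)) \<le> \<epsilon>) at_top" using \<epsilon>(1) C0 by real_asymp
  have x: "eventually (\<lambda>x::real. 256 * C ^ 3 * x powr (3/10) \<le> x) at_top" using C0 by real_asymp
  obtain X where X: "\<And>x. X \<le> x \<Longrightarrow> bound x < exp \<epsilon> \<and> 0 < 1 - sqrt 2 * exp (- (x powr (1/4)) / 8) \<and>
      24 * (C * x powr (-3/40)) \<le> \<epsilon> \<and> 256 * C ^ 3 * x powr (3/10) \<le> x"
    using eventually_conj[OF b eventually_conj[OF cm eventually_conj[OF u x]]] by (auto simp: eventually_at_top_linorder)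
  \<comment> \<open>The second term ensures \<open>\<kappa> \<le> 2 - q\<^sup>2\<close>, since
    \<open>\<kappa> - 1\<close> is the inverse of \<open>a + b - 1\<close>; this is where a large
    degree is required.\<close>
  define D0 where "D0 = max 5 (nat \<lceil>1 + 1 / (1 - q\<^sup>2)\<rceil>)"
  define N0 where "N0 = max 1 (nat \<lceil>X\<rceil>)"
  show ?thesis
  proof (rule exI[of _ D0], rule exI[of _ N0], intro allI impI)
    fix n a b :: nat
    assume A: "even n" "N0 \<le> n" "0 < a" "a \<le> b" "D0 \<le> a + b" "real (a + b) \<le> C * real n powr (1/10)"
    interpret overlap_slices n a b using A by unfold_locales (auto simp: N0_def)
    have nX: "X \<le> real n" using A(2) unfolding N0_def by linarith
    have D5: "5 \<le> real (a + b)" using A(5) unfolding D0_def by linarith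
    have Dq: "1 + 1 / (1 - q\<^sup>2) \<le> real (a + b)" using A(5) unfolding D0_def by linarith
    have "q\<^sup>2 \<le> 2 - \<kappa>"
    proof -
      have "1 \<le> (real (a + b) - 1) * (1 - q\<^sup>2)" using Dq q2 by (simp add: field_simps)
      then have "1 / (real (a + b) - 1) \<le> 1 - q\<^sup>2" using D5 by (simp add: divide_le_eq mult.commute)
      moreover have "\<kappa> = 1 + 1 / (real (a + b) - 1)" using D5 by (simp add: \<kappa>_def field_simps)
      ultimately show ?thesis by simp
    qed
    then have qs: "q \<le> sqrt (2 - \<kappa>)" by (rule real_le_rsqrt)
    have "chi_square_bound \<le> bound (real n)"
      unfolding bound_def using X[OF nX] A D5 q qs \<epsilon> C by (intro chi_square_bound_le_powr) auto
    then show "chi_square_bound \<le> exp \<epsilon>" using X[OF nX] by simp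
  qed
qed

section \<open>Total variation distance and coupling\<close>

text \<open>A factor and its complement determine each other, so the smaller degree may always be
  taken as \<open>a\<close>, as the second moment estimate requires.\<close>

lemma factor_count_commute: "factor_count n a b H = factor_count n b a H"
proof -
  have "bij_betw prod.swap (factor_pairs n a b H) (factor_pairs n b a H)"
    by (rule bij_betw_byWitness[where f' = prod.swap]) (auto simp: factor_pairs_def)
  then show ?thesis by (simp add: factor_count_def bij_betw_same_card)
qed

lemma factor_count_second_moment:
  fixes C \<epsilon> :: real
  assumes \<epsilon>: "0 < \<epsilon>" "\<epsilon> \<le> 1" and C: "1 \<le> C"
  shows "\<exists>D0 N0. \<forall>n a b. even n \<longrightarrow> N0 \<le> n \<longrightarrow> 0 < a \<longrightarrow> 0 < b \<longrightarrow> D0 \<le> a + b \<longrightarrow>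
           real (a + b) \<le> C * real n powr (1/10) \<longrightarrow>
           0 < real (\<Sum>H\<in>regular_graphs n (a + b). factor_count n a b H) \<and>
           real (\<Sum>H\<in>regular_graphs n (a + b). (factor_count n a b H)\<^sup>2) * real (card (regular_graphs n (a + b)))
             \<le> (real (\<Sum>H\<in>regular_graphs n (a + b). factor_count n a b H))\<^sup>2 * exp \<epsilon>"
proof -
  obtain D0 N0 where chi_square_bound: "\<And>n a b. \<lbrakk>even n; N0 \<le> n; 0 < a; a \<le> b; D0 \<le> a + b; real (a + b) \<le> C * real n powr (1/10)\<rbrakk>
      \<Longrightarrow> overlap_slices.chi_square_bound n a b \<le> exp \<epsilon>"
    using chi_square_bound_le_exp[OF assms] by meson
  have C0: "0 < C" using C by simp
  have "eventually (\<lambda>x::real. 32 * (C * x powr (1/10)) \<le> x) at_top" "eventually (\<lambda>x::real. 32 * (C\<^sup>2 * x powr (1/5)) \<le> x) at_top"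
    using C0 by real_asymp+
  then have "eventually (\<lambda>x::real. 32 * (C * x powr (1/10)) \<le> x \<and> 32 * (C\<^sup>2 * x powr (1/5)) \<le> x) at_top"
    by (rule eventually_conj)
  then obtain X where X: "\<And>x. X \<le> x \<Longrightarrow> 32 * (C * x powr (1/10)) \<le> x \<and> 32 * (C\<^sup>2 * x powr (1/5)) \<le> x"
    by (auto simp: eventually_at_top_linorder)
  define N1 where "N1 = max (max N0 1) (nat \<lceil>X\<rceil>)"
  have main: "0 < real (\<Sum>H\<in>regular_graphs n (a + b). factor_count n a b H) \<and>
           real (\<Sum>H\<in>regular_graphs n (a + b). (factor_count n a b H)\<^sup>2) * real (card (regular_graphs n (a + b)))
             \<le> (real (\<Sum>H\<in>regular_graphs n (a + b). factor_count n a b H))\<^sup>2 * exp \<epsilon>"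
    if A: "even n" "N1 \<le> n" "0 < a" "a \<le> b" "D0 \<le> a + b" "real (a + b) \<le> C * real n powr (1/10)" for n a b
  proof -
    have nN: "N0 \<le> n" "0 < n" "X \<le> real n" using A(2) unfolding N1_def by linarith+
    interpret overlap_slices n a b using A nN by unfold_locales
    have t: "chi_square_bound \<le> exp \<epsilon>" using A nN by (intro chi_square_bound)
    have "32 * real (a + b) \<le> real n" using A(6) conjunct1[OF X[OF nN(3)]] by argo
    then have n32: "32 * (a + b) \<le> n" by linarith
    have "(real (a + b))\<^sup>2 \<le> (C * real n powr (1/10))\<^sup>2" using A(6) by (intro power_mono) auto
    also have "\<dots> = C\<^sup>2 * real n powr (1/5)" using nN by (simp add: power_mult_distrib powr_powr powr_realpow[symmetric])
    finally have "32 * (real (a + b))\<^sup>2 \<le> real n" using conjunct2[OF X[OF nN(3)]] by argo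
    then have "real (32 * (a + b)\<^sup>2) \<le> real n" by simp
    then have "32 * (a + b)\<^sup>2 \<le> n" by (simp only: of_nat_le_iff)
    also have "n \<le> n * a" using A by simp
    finally have n2: "32 * (a + b)\<^sup>2 \<le> n * a" .
    have a2: "2 * a \<le> a + b" using A by simp
    have ab: "a + b - a = b" by simp
    note S = second_moment_bound[OF A(3) a2 A(1) n32 n2, unfolded ab]
    have tt: "exp ((real (a + b) ^ 2 - 3) / 4 + 97 * real (a + b) ^ 4 / real n) *
      hyp_mean n a b (\<lambda>k. config_ratio n (a + b) a (\<Sum>v\<in>{1..n}. k v) * simple_bound n (a + b) a k) = chi_square_bound"
      by (simp only: chi_square_bound_def f_def)
    show ?thesis using S(2) order_trans[OF S(1)[unfolded tt] mult_left_mono[OF t]] by simp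
  qed
  show ?thesis
  proof (rule exI[of _ D0], rule exI[of _ N1], intro allI impI)
    fix n a b :: nat
    assume A: "even n" "N1 \<le> n" "0 < a" "0 < b" "D0 \<le> a + b" "real (a + b) \<le> C * real n powr (1/10)"
    show "0 < real (\<Sum>H\<in>regular_graphs n (a + b). factor_count n a b H) \<and>
           real (\<Sum>H\<in>regular_graphs n (a + b). (factor_count n a b H)\<^sup>2) * real (card (regular_graphs n (a + b)))
             \<le> (real (\<Sum>H\<in>regular_graphs n (a + b). factor_count n a b H))\<^sup>2 * exp \<epsilon>"
    proof (cases "a \<le> b")
      case True
      then show ?thesis using A by (intro main)
    next
      case False
      have "0 < real (\<Sum>H\<in>regular_graphs n (b + a). factor_count n b a H) \<and>
           real (\<Sum>H\<in>regular_graphs n (b + a). (factor_count n b a H)\<^sup>2) * real (card (regular_graphs n (b + a)))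
             \<le> (real (\<Sum>H\<in>regular_graphs n (b + a). factor_count n b a H))\<^sup>2 * exp \<epsilon>"
        using A False by (intro main) (auto simp: add.commute)
      then show ?thesis by (simp only: add.commute[of b a] factor_count_commute[of n b a])
    qed
  qed
qed

section \<open>From second moments to couplings\<close>

lemma regular_graphs_union:
  assumes "G \<in> regular_graphs n a" "G' \<in> regular_graphs n b" "G \<inter> G' = {}"
  shows "G \<union> G' \<in> regular_graphs n (a + b)"
proof -
  have fin: "finite G" "finite G'"
    using assms finite_subset[OF _ finite_complete_edges] by (auto simp: regular_graphs_def)
  have "degree (G \<union> G') v = degree G v + degree G' v" for v
  proof -
    have "{e \<in> G \<union> G'. v \<in> e} = {e \<in> G. v \<in> e} \<union> {e \<in> G'. v \<in> e}" by auto
    then show ?thesis using fin assms(3) by (auto simp: degree_def intro!: card_Un_disjoint)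
  qed
  then show ?thesis using assms by (auto simp: regular_graphs_def)
qed

lemma pair_pmf_of_set:
  assumes "finite A" "A \<noteq> {}" "finite B" "B \<noteq> {}"
  shows "pair_pmf (pmf_of_set A) (pmf_of_set B) = pmf_of_set (A \<times> B)"
proof (rule pmf_eqI)
  fix z
  show "pmf (pair_pmf (pmf_of_set A) (pmf_of_set B)) z = pmf (pmf_of_set (A \<times> B)) z"
    using assms by (cases z) (simp add: pmf_pair card_cartesian_product indicator_def)
qed

lemma cond_pmf_of_set:
  assumes "finite A" "A \<inter> B \<noteq> {}"
  shows "cond_pmf (pmf_of_set A) B = pmf_of_set (A \<inter> B)"
proof (rule pmf_eqI)
  fix z
  have A: "A \<noteq> {}" using assms by auto
  show "pmf (cond_pmf (pmf_of_set A) B) z = pmf (pmf_of_set (A \<inter> B)) z"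
    using assms A by (simp add: pmf_cond measure_pmf_of_set indicator_def card_gt_0_iff)
qed

text \<open>Positivity of the total count makes all sets involved nonempty, so the conditioned
  product is the uniform law on edge-disjoint pairs, and the preimage of \<open>H\<close> under the
  union map is \<open>factor_pairs n a b H\<close>.\<close>

lemma pmf_random_regular_sum:
  assumes pos: "0 < real (\<Sum>H\<in>regular_graphs n (a + b). factor_count n a b H)"
  shows "pmf (random_regular_sum n a b) H =
     real (factor_count n a b H) / real (\<Sum>H\<in>regular_graphs n (a + b). factor_count n a b H)"
proof -
  define S where "S = (regular_graphs n a \<times> regular_graphs n b) \<inter> {(G1, G2). G1 \<inter> G2 = {}}"
  have SH: "S \<inter> (\<lambda>(G1, G2). G1 \<union> G2) -` {H} = factor_pairs n a b H" for H
    by (auto simp: S_def factor_pairs_def)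
  have finS: "finite S" by (auto simp: S_def finite_regular_graphs)
  have "S = (\<Union>H\<in>regular_graphs n (a + b). factor_pairs n a b H)"
    by (auto simp: S_def factor_pairs_def regular_graphs_union)
  moreover have "card (\<Union>H\<in>regular_graphs n (a + b). factor_pairs n a b H) =
      (\<Sum>H\<in>regular_graphs n (a + b). card (factor_pairs n a b H))"
  proof (rule card_UN_disjoint)
    show "\<forall>H\<in>regular_graphs n (a + b). finite (factor_pairs n a b H)"
      using finS by (auto simp flip: SH)
  qed (auto simp: finite_regular_graphs factor_pairs_def)
  ultimately have cS: "card S = (\<Sum>H\<in>regular_graphs n (a + b). factor_count n a b H)"
    by (simp add: factor_count_def)
  have "S \<noteq> {}" using pos unfolding cS[symmetric] by auto
  then have ne: "regular_graphs n a \<noteq> {}" "regular_graphs n b \<noteq> {}" by (auto simp: S_def)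
  have "random_regular_sum n a b = map_pmf (\<lambda>(G1, G2). G1 \<union> G2) (pmf_of_set S)"
    unfolding random_regular_sum_def random_regular_def S_def
    using ne \<open>S \<noteq> {}\<close> by (simp add: pair_pmf_of_set cond_pmf_of_set finite_regular_graphs S_def)
  then have "pmf (random_regular_sum n a b) H = measure (pmf_of_set S) ((\<lambda>(G1, G2). G1 \<union> G2) -` {H})"
    by (simp add: pmf_map)
  also have "\<dots> = real (card (factor_pairs n a b H)) / real (card S)"
    using measure_pmf_of_set[OF \<open>S \<noteq> {}\<close> finS] SH by simp
  finally show ?thesis by (simp only: cS factor_count_def)
qed

text \<open>By Cauchy--Schwarz against the constant 1, the squared sum is at most
  \<open>card R\<close> times the sum of squared deviations, and this product is the second moment
  over the squared first moment, minus 1.\<close>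

lemma sum_abs_deviation_le:
  fixes X :: "'a \<Rightarrow> real"
  assumes R: "finite R" and s: "0 < sum X R" and v: "(\<Sum>H\<in>R. (X H)\<^sup>2) * real (card R) \<le> (sum X R)\<^sup>2 * (1 + \<delta>)"
  shows "(\<Sum>H\<in>R. \<bar>X H / sum X R - 1 / real (card R)\<bar>) \<le> sqrt \<delta>"
proof -
  define s where "s = sum X R"
  define N where "N = real (card R)"
  have "R \<noteq> {}" using s by auto
  then have N: "0 < N" using R by (simp add: N_def card_gt_0_iff)
  have s0: "0 < s" using s by (simp add: s_def)
  have "(\<Sum>H\<in>R. \<bar>X H / s - 1 / N\<bar> * 1)\<^sup>2 \<le> (\<Sum>H\<in>R. \<bar>X H / s - 1 / N\<bar>\<^sup>2) * (\<Sum>H\<in>R. 1\<^sup>2)"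
    by (rule Cauchy_Schwarz_ineq_sum)
  also have "(\<Sum>H\<in>R. \<bar>X H / s - 1 / N\<bar>\<^sup>2) = (\<Sum>H\<in>R. (X H)\<^sup>2 / s\<^sup>2 - 2 / (s * N) * X H + 1 / N\<^sup>2)"
    by (intro sum.cong refl) (simp add: power2_diff power_divide)
  also have "\<dots> = (\<Sum>H\<in>R. (X H)\<^sup>2) / s\<^sup>2 - 2 / (s * N) * s + N / N\<^sup>2"
    by (simp add: sum.distrib sum_subtractf sum_divide_distrib[symmetric] sum_distrib_left[symmetric] s_def[symmetric] N_def)
  also have "\<dots> = (\<Sum>H\<in>R. (X H)\<^sup>2) / s\<^sup>2 - 1 / N" using s0 N by (simp add: power2_eq_square field_simps)
  also have "((\<Sum>H\<in>R. (X H)\<^sup>2) / s\<^sup>2 - 1 / N) * (\<Sum>H\<in>R. 1\<^sup>2) = (\<Sum>H\<in>R. (X H)\<^sup>2) * N / s\<^sup>2 - 1"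
    using N by (simp add: N_def[symmetric] left_diff_distrib)
  also have "\<dots> \<le> (1 + \<delta>) - 1"
    using v s0 by (intro diff_right_mono) (simp add: divide_le_eq s_def[symmetric] N_def[symmetric] mult.commute)
  finally have "(\<Sum>H\<in>R. \<bar>X H / s - 1 / N\<bar>)\<^sup>2 \<le> \<delta>" by simp
  then show ?thesis unfolding s_def N_def by (rule real_le_rsqrt)
qed

text \<open>The common mass of the two laws is placed on the diagonal, and the two excesses, which
  have the same total \<open>\<tau>\<close>, are coupled independently.\<close>

lemma exists_maximal_coupling:
  fixes p q :: "'a pmf"
  assumes R: "finite R" "set_pmf p \<subseteq> R" "set_pmf q \<subseteq> R"
  shows "\<exists>c. is_coupling c p q \<and> 1 - (\<Sum>x\<in>R. \<bar>pmf p x - pmf q x\<bar>) / 2 \<le> measure_pmf.prob c {(x, y). x = y}"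
proof -
  define m where "m x = min (pmf p x) (pmf q x)" for x
  define \<tau> where "\<tau> = 1 - sum m R"
  \<comment> \<open>If \<open>\<tau> = 0\<close> the quotient is 0, which is the right value because
    both excesses then vanish.\<close>
  define f where "f = (\<lambda>(x, y). (if x = y then m x else 0) + (pmf p x - m x) * (pmf q y - m y) / \<tau>)"
  have sp: "sum (pmf p) R = 1" and sq: "sum (pmf q) R = 1" using R by (auto intro: sum_pmf_eq_1)
  have out: "pmf p x = 0" "pmf q x = 0" if "x \<notin> R" for x using that R by (auto simp: pmf_eq_0_set_pmf)
  have m: "0 \<le> m x" "m x \<le> pmf p x" "m x \<le> pmf q x" for x by (auto simp: m_def)
  have tp: "(\<Sum>x\<in>R. pmf p x - m x) = \<tau>" and tq: "(\<Sum>x\<in>R. pmf q x - m x) = \<tau>"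
    by (simp_all add: sum_subtractf sp sq \<tau>_def)
  have \<tau>0: "0 \<le> \<tau>" unfolding tp[symmetric] using m by (intro sum_nonneg) auto
  have zero: "pmf p x = m x \<and> pmf q x = m x" if "\<tau> = 0" "x \<in> R" for x
    using sum_nonneg_eq_0_iff[of R "\<lambda>x. pmf p x - m x"] sum_nonneg_eq_0_iff[of R "\<lambda>x. pmf q x - m x"] tp tq that R m by auto
  have f0: "0 \<le> f z" for z using m \<tau>0 by (auto simp: f_def split: prod.split intro!: add_nonneg_nonneg divide_nonneg_nonneg mult_nonneg_nonneg)
  have row: "(\<Sum>y\<in>R. f (x, y)) = pmf p x" if "x \<in> R" for x
  proof -
    have "(\<Sum>y\<in>R. f (x, y)) = m x + (pmf p x - m x) * \<tau> / \<tau>"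
      using that R by (simp add: f_def sum.distrib sum_divide_distrib[symmetric] sum_distrib_left[symmetric] tq)
    then show ?thesis using zero[OF _ that] by (cases "\<tau> = 0") auto
  qed
  have col: "(\<Sum>x\<in>R. f (x, y)) = pmf q y" if "y \<in> R" for y
  proof -
    have "(\<Sum>x\<in>R. f (x, y)) = m y + \<tau> * (pmf q y - m y) / \<tau>"
      using that R by (simp add: f_def sum.distrib sum_divide_distrib[symmetric] sum_distrib_right[symmetric] tp)
    then show ?thesis using zero[OF _ that] by (cases "\<tau> = 0") auto
  qed
  have fout: "f z = 0" if that': "z \<notin> R \<times> R" for z
  proof -
    have mz: "m x = 0" if "x \<notin> R" for x using out[OF that] by (simp add: m_def)
    obtain x y where z: "z = (x, y)" by fastforce
    show ?thesis
    proof (cases "x \<in> R")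
      case True
      then have "y \<notin> R" using that' z by auto
      then show ?thesis using True by (auto simp: z f_def out mz)
    qed (auto simp: z f_def out mz)
  qed
  define c where "c = embed_pmf f"
  have "(\<integral>\<^sup>+ z. ennreal (f z) \<partial>count_space UNIV) = (\<Sum>z\<in>R \<times> R. ennreal (f z))"
    using R fout by (intro nn_integral_count_space') (auto simp: f0)
  also have "\<dots> = ennreal (\<Sum>z\<in>R \<times> R. f z)" using f0 by (simp add: sum_ennreal)
  also have "(\<Sum>z\<in>R \<times> R. f z) = (\<Sum>x\<in>R. \<Sum>y\<in>R. f (x, y))" by (simp add: sum.cartesian_product)
  also have "\<dots> = 1" by (simp add: row sp)
  finally have fsum: "(\<integral>\<^sup>+ z. ennreal (f z) \<partial>count_space UNIV) = 1" by simp
  have pc: "pmf c z = f z" for z unfolding c_def using f0 fsum by (rule pmf_embed_pmf)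
  have prob: "measure c A = sum f (A \<inter> R \<times> R)" for A
  proof -
    have "measure c A = measure c (A \<inter> R \<times> R)"
    proof (rule measure_pmf.finite_measure_eq_AE)
      have "z \<in> R \<times> R" if "z \<in> set_pmf c" for z using that fout[of z] by (auto simp: set_pmf_iff pc)
      then show "AE z in measure_pmf c. (z \<in> A) = (z \<in> A \<inter> R \<times> R)" by (auto simp: AE_measure_pmf_iff)
    qed auto
    also have "\<dots> = sum f (A \<inter> R \<times> R)" using R by (simp add: measure_measure_pmf_finite pc)
    finally show ?thesis .
  qed
  have "map_pmf fst c = p"
  proof (rule pmf_eqI)
    fix x
    have "pmf (map_pmf fst c) x = sum f (fst -` {x} \<inter> R \<times> R)" by (simp add: pmf_map prob)
    also have "\<dots> = pmf p x"
    proof (cases "x \<in> R")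
      case True
      then have "fst -` {x} \<inter> R \<times> R = Pair x ` R" by auto
      then show ?thesis using row[OF True] by (simp add: sum.reindex inj_on_def)
    next
      case False
      then have "fst -` {x} \<inter> R \<times> R = {}" by auto
      then show ?thesis using out[OF False] by (simp only: sum.empty)
    qed
    finally show "pmf (map_pmf fst c) x = pmf p x" .
  qed
  moreover have "map_pmf snd c = q"
  proof (rule pmf_eqI)
    fix y
    have "pmf (map_pmf snd c) y = sum f (snd -` {y} \<inter> R \<times> R)" by (simp add: pmf_map prob)
    also have "\<dots> = pmf q y"
    proof (cases "y \<in> R")
      case True
      then have "snd -` {y} \<inter> R \<times> R = (\<lambda>x. (x, y)) ` R" by auto
      then show ?thesis using col[OF True] by (simp add: sum.reindex inj_on_def)
    next
      case False
      then have "snd -` {y} \<inter> R \<times> R = {}" by auto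
      then show ?thesis using out[OF False] by (simp only: sum.empty)
    qed
    finally show "pmf (map_pmf snd c) y = pmf q y" .
  qed
  moreover have "1 - (\<Sum>x\<in>R. \<bar>pmf p x - pmf q x\<bar>) / 2 \<le> measure c {(x, y). x = y}"
  proof -
    have "m x = (pmf p x + pmf q x - \<bar>pmf p x - pmf q x\<bar>) / 2" for x by (auto simp: m_def min_def)
    then have "1 - (\<Sum>x\<in>R. \<bar>pmf p x - pmf q x\<bar>) / 2 = sum m R"
      by (simp add: sum_divide_distrib[symmetric] sum_subtractf sum.distrib sp sq diff_divide_distrib)
    also have "sum m R \<le> (\<Sum>x\<in>R. f (x, x))"
      using m \<tau>0 by (intro sum_mono) (auto simp: f_def)
    also have "\<dots> = sum f ((\<lambda>x. (x, x)) ` R)" by (simp add: sum.reindex inj_on_def)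
    also have "(\<lambda>x. (x, x)) ` R = {(x, y). x = y} \<inter> R \<times> R" by auto
    finally show ?thesis by (simp add: prob)
  qed
  ultimately show ?thesis by (auto simp: is_coupling_def)
qed

text \<open>The uniform law is the common reference point: it depends on \<open>a + b\<close> only,
  so two different splits of one degree are compared through it.\<close>

lemma random_regular_sum_near_uniform:
  fixes C \<epsilon> :: real
  assumes \<epsilon>: "0 < \<epsilon>" "\<epsilon> \<le> 1" and C: "1 \<le> C"
  shows "\<exists>D0 N0. \<forall>n a b. even n \<longrightarrow> N0 \<le> n \<longrightarrow> 0 < a \<longrightarrow> 0 < b \<longrightarrow> D0 \<le> a + b \<longrightarrow>
           real (a + b) \<le> C * real n powr (1/10) \<longrightarrow>
           set_pmf (random_regular_sum n a b) \<subseteq> regular_graphs n (a + b) \<and>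
           (\<Sum>H\<in>regular_graphs n (a + b). \<bar>pmf (random_regular_sum n a b) H - 1 / real (card (regular_graphs n (a + b)))\<bar>)
             \<le> sqrt (exp \<epsilon> - 1)"
proof -
  obtain D0 N0 where F: "\<And>n a b. \<lbrakk>even n; N0 \<le> n; 0 < a; 0 < b; D0 \<le> a + b; real (a + b) \<le> C * real n powr (1/10)\<rbrakk> \<Longrightarrow>
           0 < real (\<Sum>H\<in>regular_graphs n (a + b). factor_count n a b H) \<and>
           real (\<Sum>H\<in>regular_graphs n (a + b). (factor_count n a b H)\<^sup>2) * real (card (regular_graphs n (a + b)))
             \<le> (real (\<Sum>H\<in>regular_graphs n (a + b). factor_count n a b H))\<^sup>2 * exp \<epsilon>"
    using factor_count_second_moment[OF assms] by meson
  show ?thesis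
  proof (rule exI[of _ D0], rule exI[of _ N0], intro allI impI)
    fix n a b :: nat
    assume A: "even n" "N0 \<le> n" "0 < a" "0 < b" "D0 \<le> a + b" "real (a + b) \<le> C * real n powr (1/10)"
    note pos = conjunct1[OF F[OF A]] and second = conjunct2[OF F[OF A]]
    define R where "R = regular_graphs n (a + b)"
    have R: "finite R" by (simp add: R_def finite_regular_graphs)
    define X where "X = (\<lambda>H. real (factor_count n a b H))"
    have pmf: "pmf (random_regular_sum n a b) H = X H / sum X R" for H
      unfolding pmf_random_regular_sum[OF pos] by (simp add: X_def R_def)
    have "set_pmf (random_regular_sum n a b) \<subseteq> R"
    proof
      fix H assume "H \<in> set_pmf (random_regular_sum n a b)"
      then have "factor_count n a b H \<noteq> 0" by (auto simp: set_pmf_iff pmf X_def)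
      then have "factor_pairs n a b H \<noteq> {}" by (auto simp: factor_count_def)
      then show "H \<in> R" by (auto simp: factor_pairs_def R_def regular_graphs_union)
    qed
    moreover have "(\<Sum>H\<in>R. \<bar>X H / sum X R - 1 / real (card R)\<bar>) \<le> sqrt (exp \<epsilon> - 1)"
      using pos second by (intro sum_abs_deviation_le R) (simp_all add: X_def R_def)
    ultimately show "set_pmf (random_regular_sum n a b) \<subseteq> regular_graphs n (a + b) \<and>
       (\<Sum>H\<in>regular_graphs n (a + b). \<bar>pmf (random_regular_sum n a b) H - 1 / real (card (regular_graphs n (a + b)))\<bar>)
         \<le> sqrt (exp \<epsilon> - 1)"
      by (simp only: pmf R_def)
  qed
qed

lemma is_coupling_pair_pmf: "is_coupling (pair_pmf p q) p q"
  by (simp add: is_coupling_def map_fst_pair_pmf map_snd_pair_pmf)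

theorem theorem1p4:
  fixes d1 d1' d2 :: "nat \<Rightarrow> nat"
  assumes "filterlim d2 at_top even_at_top"
    and "(\<lambda>n. real (d2 n)) \<in> O[even_at_top](\<lambda>n. real n powr (1/10))"
    and "filterlim (\<lambda>n. Min {int (d1 n), int (d1' n), int (d2 n) - int (d1 n), int (d2 n) - int (d1' n)})
           at_top even_at_top"
  shows "\<exists>C :: nat \<Rightarrow> (nat set set \<times> nat set set) pmf.
           (\<forall>n. even n \<and> n > 0 \<longrightarrow>
              is_coupling (C n) (random_regular_sum n (d1 n) (d2 n - d1 n))
                                (random_regular_sum n (d1' n) (d2 n - d1' n))) \<and>
           ((\<lambda>n. measure_pmf.prob (C n) {(G, G'). G = G'}) \<longlongrightarrow> 1) even_at_top"
proof -
  define P where "P = (\<lambda>n. random_regular_sum n (d1 n) (d2 n - d1 n))"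
  define Q where "Q = (\<lambda>n. random_regular_sum n (d1' n) (d2 n - d1' n))"
  define R where "R = (\<lambda>n. regular_graphs n (d2 n))"
  \<comment> \<open>A coupling is demanded at every even \<open>n\<close>, including small ones
    about which nothing is estimated; there the product coupling fills in when the laws are not
    supported on \<open>R n\<close>.\<close>
  have "\<exists>c. is_coupling c (P n) (Q n) \<and> (set_pmf (P n) \<subseteq> R n \<and> set_pmf (Q n) \<subseteq> R n \<longrightarrow>
      1 - (\<Sum>x\<in>R n. \<bar>pmf (P n) x - pmf (Q n) x\<bar>) / 2 \<le> measure_pmf.prob c {(x, y). x = y})" for n
  proof (cases "set_pmf (P n) \<subseteq> R n \<and> set_pmf (Q n) \<subseteq> R n")
    case True
    moreover have "finite (R n)" by (simp add: R_def finite_regular_graphs)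
    ultimately show ?thesis using exists_maximal_coupling[of "R n" "P n" "Q n"] by blast
  next
    case False
    then show ?thesis by (intro exI[of _ "pair_pmf (P n) (Q n)"]) (blast intro: is_coupling_pair_pmf)
  qed
  then obtain C where "\<forall>n. is_coupling (C n) (P n) (Q n) \<and> (set_pmf (P n) \<subseteq> R n \<and> set_pmf (Q n) \<subseteq> R n \<longrightarrow>
      1 - (\<Sum>x\<in>R n. \<bar>pmf (P n) x - pmf (Q n) x\<bar>) / 2 \<le> measure_pmf.prob (C n) {(x, y). x = y})"
    by (rule choice[OF allI, THEN exE])
  then have C: "\<And>n. is_coupling (C n) (P n) (Q n)"
    and prob: "\<And>n. \<lbrakk>set_pmf (P n) \<subseteq> R n; set_pmf (Q n) \<subseteq> R n\<rbrakk> \<Longrightarrow>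
      1 - (\<Sum>x\<in>R n. \<bar>pmf (P n) x - pmf (Q n) x\<bar>) / 2 \<le> measure_pmf.prob (C n) {(x, y). x = y}"
    by blast+
  obtain K0 where "eventually (\<lambda>n. norm (real (d2 n)) \<le> K0 * norm (real n powr (1/10))) even_at_top"
    using assms(2) by (elim landau_o.bigE)
  then have K: "eventually (\<lambda>n. real (d2 n) \<le> max 1 K0 * real n powr (1/10)) even_at_top"
  proof eventually_elim
    case (elim n)
    have "K0 * real n powr (1/10) \<le> max 1 K0 * real n powr (1/10)" by (intro mult_right_mono) auto
    then show ?case using elim by simp
  qed
  have ev: "eventually (\<lambda>n. N \<le> n \<and> even n) even_at_top" for N
    unfolding even_at_top_def eventually_inf_principal using eventually_ge_at_top[of N] by eventually_elim auto
  have Min: "eventually (\<lambda>n. 1 \<le> Min {int (d1 n), int (d1' n), int (d2 n) - int (d1 n), int (d2 n) - int (d1' n)}) even_at_top"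
    using assms(3) unfolding filterlim_at_top by (rule spec)
  have "((\<lambda>n. measure_pmf.prob (C n) {(G, G'). G = G'}) \<longlongrightarrow> 1) even_at_top"
  proof (rule tendstoI)
    fix e :: real assume e: "0 < e"
    \<comment> \<open>Then \<open>exp \<epsilon> - 1 \<le> e\<^sup>2 / 2\<close>, so each law has
      \<open>L\<^sup>1\<close> distance less than \<open>e\<close> from uniform; the cap at 1 serves
      the hypothesis of the estimate.\<close>
    define \<epsilon> where "\<epsilon> = min 1 (ln (1 + e\<^sup>2 / 2))"
    have \<epsilon>: "0 < \<epsilon>" "\<epsilon> \<le> 1" using e by (auto simp: \<epsilon>_def add_pos_nonneg)
    have "exp \<epsilon> \<le> exp (ln (1 + e\<^sup>2 / 2))" by (simp add: \<epsilon>_def)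
    also have "\<dots> = 1 + e\<^sup>2 / 2" using e by (intro exp_ln) (simp add: add_pos_nonneg)
    finally have "exp \<epsilon> - 1 < e\<^sup>2" using zero_less_power[OF e, of 2] by linarith
    then have se: "sqrt (exp \<epsilon> - 1) < e" using e by (intro real_less_lsqrt) auto
    obtain D0 N0 where near: "\<And>n a b. \<lbrakk>even n; N0 \<le> n; 0 < a; 0 < b; D0 \<le> a + b; real (a + b) \<le> max 1 K0 * real n powr (1/10)\<rbrakk> \<Longrightarrow>
           set_pmf (random_regular_sum n a b) \<subseteq> regular_graphs n (a + b) \<and>
           (\<Sum>H\<in>regular_graphs n (a + b). \<bar>pmf (random_regular_sum n a b) H - 1 / real (card (regular_graphs n (a + b)))\<bar>)
             \<le> sqrt (exp \<epsilon> - 1)"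
      using random_regular_sum_near_uniform[OF \<epsilon> max.cobounded1[of 1 K0]] by meson
    have "eventually (\<lambda>n. D0 \<le> d2 n) even_at_top" using assms(1) by (simp add: filterlim_at_top)
    then show "eventually (\<lambda>n. dist (measure_pmf.prob (C n) {(G, G'). G = G'}) 1 < e) even_at_top"
      using K Min ev[of N0]
    proof eventually_elim
      case (elim n)
      have d: "0 < d1 n" "0 < d1' n" "d1 n < d2 n" "d1' n < d2 n" using elim(3) by auto
      then have sums: "d1 n + (d2 n - d1 n) = d2 n" "d1' n + (d2 n - d1' n) = d2 n" by auto
      have P: "set_pmf (P n) \<subseteq> R n \<and> (\<Sum>H\<in>R n. \<bar>pmf (P n) H - 1 / real (card (R n))\<bar>) \<le> sqrt (exp \<epsilon> - 1)"
        using near[of n "d1 n" "d2 n - d1 n"] elim d unfolding sums P_def R_def by simp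
      have Q: "set_pmf (Q n) \<subseteq> R n \<and> (\<Sum>H\<in>R n. \<bar>pmf (Q n) H - 1 / real (card (R n))\<bar>) \<le> sqrt (exp \<epsilon> - 1)"
        using near[of n "d1' n" "d2 n - d1' n"] elim d unfolding sums Q_def R_def by simp
      \<comment> \<open>Through the uniform law the two distances add up to less than
        \<open>2 * e\<close>, of which the maximal coupling loses half.\<close>
      have "(\<Sum>H\<in>R n. \<bar>pmf (P n) H - pmf (Q n) H\<bar>)
          \<le> (\<Sum>H\<in>R n. \<bar>pmf (P n) H - 1 / real (card (R n))\<bar> + \<bar>pmf (Q n) H - 1 / real (card (R n))\<bar>)"
        by (intro sum_mono) linarith
      then have "(\<Sum>H\<in>R n. \<bar>pmf (P n) H - pmf (Q n) H\<bar>) < 2 * e" using P Q se unfolding sum.distrib by linarith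
      then have "1 - e < measure_pmf.prob (C n) {(G, G'). G = G'}" using prob[of n] P Q by linarith
      moreover have "measure_pmf.prob (C n) {(G, G'). G = G'} \<le> 1" by (rule measure_pmf.prob_le_1)
      ultimately show ?case by (simp add: dist_real_def)
    qed
  qed
  then show ?thesis using C by (intro exI[of _ C]) (simp add: P_def Q_def)
qed

end
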